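(* Let $(I,\cdot)$ be a Cartan datum, $\ell$ a positive integer coprime to every $d_i=\tfrac12(i\cdot i)$ ($i\in I$), $p$ a prime not dividing $\ell$, $q$ a power of $p$, and $\varepsilon$ a square root of $q$. Then, over the ring $\mathscr A_\ell=\mathbb Z[\varepsilon,\varepsilon^{-1}]/(\Phi_{2\ell}(\varepsilon))$, the map $Q$ (restriction of functions along $\iota_\ell$) maps the twisted composition algebra $\mathcal F$ into $\mathcal F^\sharp$, and $Q\colon\mathcal F\to\mathcal F^\sharp$ is an algebra homomorphism with respect to the twisted multiplications $\circ$.
   Context: A Cartan datum $(I,\cdot)$ is a finite set $I$ with a $\mathbb Z$-valued symmetric bilinear pairing on $\mathbb Z[I]$ with $i\cdot i\in\{2,4,6,\dots\}$ and $2\frac{i\cdot j}{i\cdot i}\in\{0,-1,-2,\dots\}$ for $i\neq j$. Put $d_i=\frac12(i\cdot i)$. Oriented quiver data (the set of automorphism-orbits of arrows of the oriented quiver with automorphism attached to $(I,\cdot)$): a finite set $\mathcal K$ with maps $s,t\colon\mathcal K\to I$, $s(k)\ne t(k)$, such that for $i\ne j$ there are exactly $(-i\cdot j)/\mathrm{lcm}(d_i,d_j)$ elements $k$ with $\{s(k),t(k)\}=\{i,j\}$. Put $d_k=\mathrm{lcm}(d_{s(k)},d_{t(k)})$. All finite fields are subfields of a fixed algebraic closure of $\mathbb F_p$. Representations over $\mathbb F_{Q_0}$, where $Q_0$ is $q$ or $q^\ell$: objects of $\mathcal C_{Q_0}$ are families $V=\bigoplus_{i\in I}V_i$ with $V_i$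 a finite-dimensional $\mathbb F_{Q_0^{d_i}}$-vector space; $|V|=\sum_i\dim_{\mathbb F_{Q_0^{d_i}}}(V_i)\,i\in\mathbb NI$. $G_V=\prod_iGL_{\mathbb F_{Q_0^{d_i}}}(V_i)$, and $E_V$ is the set of families $x=(x_k)_{k\in\mathcal K}$ of $\mathbb F_{Q_0^{d_{t(k)}}}$-linear maps $x_k\colon\mathbb F_{Q_0^{d_k}}\otimes_{\mathbb F_{Q_0^{d_{s(k)}}}}V_{s(k)}\to V_{t(k)}$. $G_V$ acts on $E_V$ by conjugation. A graded subspace $U=\bigoplus U_i$ ($U_i\subset V_i$ an $\mathbb F_{Q_0^{d_i}}$-subspace) is $x$-stable if $x_k(\mathbb F_{Q_0^{d_k}}\otimes U_{s(k)})\subset U_{t(k)}$ for all $k$; then $x$ induces elements $x|_U\in E_U$, $x_{V/U}\in E_{V/U}$. Write $\mathcal C=\mathcal C_q$, $\mathcal C^\ell=\mathcal C_{q^\ell}$. Hall algebra over a commutative ring $A$: $\mathscr H=\bigoplus_{\nu\in\mathbb NI}\mathscr H_\nu$, where $\mathscr H_\nu$ is the $A$-module of $G_V$-invariant functions $E_V\to A$ for any $V$ with $|V|=\nu$ (canonically independent of $V$). For $f_1\in\mathscr H_{\nu_1}$, $f_2\in\mathscr H_{\nu_2}$, $|V|=\nu_1+\nu_2$, $$(f_1\star f_2)(x)=\sum_{W}f_1(x_{V/W})f_2(x|_W),$$ the sum over $x$-stable graded subspaces $W\subset V$ with $|W|=\nu_2$. Composition algebra: $\mathcal X$ is the set of pairs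 $(\underline i,\underline c)$ with $\underline i=(i_1,\dots,i_m)$ a sequence in $I$, $\underline c=(c_1,\dots,c_m)$ a sequence in $\mathbb N$. If $|V|=\sum_kc_ki_k$, a flag of type $(\underline i,\underline c)$ is a chain of graded subspaces $V=V^0\supseteq V^1\supseteq\dots\supseteq V^m=0$ with $|V^{k-1}/V^k|=c_ki_k$, and $\mathbf 1_{(\underline i,\underline c)}(x)$ is the number of flags of type $(\underline i,\underline c)$ in $V$ all of whose terms are $x$-stable, for $x\in E_V$. The $A$-span of the functions $\mathbf 1_{(\underline i,\underline c)}$ in $\mathscr H$ is a subalgebra for $\star$, the composition algebra. Twist: for $\nu,\mu\in\mathbb Z[I]$ let $m(\nu,\mu)=\sum_{i\in I}d_i\nu_i\mu_i+\sum_{k\in\mathcal K}d_k\nu_{s(k)}\mu_{t(k)}$. Let $\mathscr A_\ell=\mathbb Z[\varepsilon,\varepsilon^{-1}]/(\Phi_{2\ell}(\varepsilon))$ ($\mathbb Z[\varepsilon,\varepsilon^{-1}]\subset\mathbb C$ generated by the number $\varepsilon$ with $\varepsilon^2=q$; $\Phi_k$ the $k$-th cyclotomic polynomial), and $\varepsilon_\ell=(-1)^{\ell+1}\varepsilon^\ell$, a square root of $q^\ell$. Take $A=\mathscr A_\ell$. $\mathcal F$ is the composition algebra for $\mathcal C$ (inside its Hall algebra $\mathscr H$) with product $f_1\circ f_2=\varepsilon^{-m(\nu_1,\nu_2)}f_1\star f_2$; $\mathcal F^\sharp$ is the composition algebra for $\mathcal C^\ell$ (inside its Hall algebra $\mathscr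 H^\sharp$) with product $f_1\circ f_2=\varepsilon_\ell^{-m(\nu_1,\nu_2)}f_1\star f_2$ ($f_a$ homogeneous of degree $\nu_a$). The map $Q$: for $V\in\mathcal C^\ell$ let $R_\ell(V)\in\mathcal C$ be obtained by regarding each $\mathbb F_{q^{\ell d_i}}$-space $V_i$ as an $\mathbb F_{q^{d_i}}$-space, so $|R_\ell(V)|=\ell|V|$. Let $\iota_\ell\colon E_V\to E_{R_\ell(V)}$ send $x$ to the family of composites $\mathbb F_{q^{d_k}}\otimes_{\mathbb F_{q^{d_{s(k)}}}}V_{s(k)}\to\mathbb F_{q^{\ell d_k}}\otimes_{\mathbb F_{q^{\ell d_{s(k)}}}}V_{s(k)}\xrightarrow{x_k}V_{t(k)}$, the first map being the natural one. Define the $\mathscr A_\ell$-linear map $Q\colon\mathscr H\to\mathscr H^\sharp$ on $f\in\mathscr H_\nu$ by $Q(f)=0$ if $\nu\notin\ell\mathbb NI$, and otherwise $Q(f)=f\circ\iota_\ell$ for any $V\in\mathcal C^\ell$ with $|R_\ell(V)|=\nu$. *)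

theory Defs
  imports
    "HOL-Algebra.Algebraic_Closure_Type"
    "HOL-Algebra.Free_Abelian_Groups"
    "HOL-Algebra.Generated_Rings"
    "HOL-Algebra.QuotRing"
    "Jordan_Normal_Form.Missing_VectorSpace"
begin

section \<open>Cartan data and oriented quiver data\<close>

text \<open>A symmetric bilinear pairing on \<open>\<int>[I]\<close> is recorded by its values on the basis \<open>I\<close>.\<close>

record 'i cartan =
  vertices :: "'i set"
  pairing :: "'i \<Rightarrow> 'i \<Rightarrow> int"

record ('i, 'a) quiver = "'i cartan" +
  arrows :: "'a set"
  src :: "'a \<Rightarrow> 'i"
  tgt :: "'a \<Rightarrow> 'i"

definition cartan_datum :: "('i, 'z) cartan_scheme \<Rightarrow> bool" where
  "cartan_datum D \<longleftrightarrow>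
     finite (vertices D) \<and>
     (\<forall>i\<in>vertices D. \<forall>j\<in>vertices D. pairing D i j = pairing D j i) \<and>
     (\<forall>i\<in>vertices D. pairing D i i > 0 \<and> even (pairing D i i)) \<and>
     (\<forall>i\<in>vertices D. \<forall>j\<in>vertices D. i \<noteq> j \<longrightarrow>
        pairing D i i dvd 2 * pairing D i j \<and> 2 * pairing D i j div pairing D i i \<le> 0)"

definition vdeg :: "('i, 'z) cartan_scheme \<Rightarrow> 'i \<Rightarrow> nat" where
  "vdeg D i = nat (pairing D i i div 2)"

definition adeg :: "('i, 'a) quiver \<Rightarrow> 'a \<Rightarrow> nat" where
  "adeg D k = lcm (vdeg D (src D k)) (vdeg D (tgt D k))"

definition quiver_datum :: "('i, 'a) quiver \<Rightarrow> bool" where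
  "quiver_datum D \<longleftrightarrow>
     cartan_datum D \<and> finite (arrows D) \<and>
     (\<forall>k\<in>arrows D. src D k \<in> vertices D \<and> tgt D k \<in> vertices D \<and> src D k \<noteq> tgt D k) \<and>
     (\<forall>i\<in>vertices D. \<forall>j\<in>vertices D. i \<noteq> j \<longrightarrow>
        int (card {k \<in> arrows D. {src D k, tgt D k} = {i, j}}) * int (lcm (vdeg D i) (vdeg D j))
          = - pairing D i j)"

definition NI :: "('i, 'z) cartan_scheme \<Rightarrow> ('i \<Rightarrow> nat) set" where
  "NI D = {\<nu>. \<forall>i. i \<notin> vertices D \<longrightarrow> \<nu> i = 0}"

definition twist_form :: "('i, 'a) quiver \<Rightarrow> ('i \<Rightarrow> int) \<Rightarrow> ('i \<Rightarrow> int) \<Rightarrow> int" where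
  "twist_form D \<nu> \<mu> = (\<Sum>i\<in>vertices D. int (vdeg D i) * \<nu> i * \<mu> i)
     + (\<Sum>k\<in>arrows D. int (adeg D k) * \<nu> (src D k) * \<mu> (tgt D k))"


section \<open>Finite fields inside a fixed algebraic closure\<close>

text \<open>The type \<open>'k\<close> is an algebraic closure of the field with \<open>p\<close> elements.\<close>

definition is_closure_of_prime_field :: "'k::alg_closed_field itself \<Rightarrow> nat \<Rightarrow> bool" where
  "is_closure_of_prime_field T p \<longleftrightarrow> prime p \<and> CHAR('k) = p \<and>
     (\<forall>x::'k. \<exists>f. f \<noteq> 0 \<and> (\<forall>n. poly.coeff f n \<in> range of_int) \<and> poly f x = 0)"

text \<open>For a power \<open>Q\<close> of the characteristic, the unique subfield with \<open>Q\<close> elements consists of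
  the roots of \<open>X^Q - X\<close>.\<close>

definition GF :: "nat \<Rightarrow> 'k::alg_closed_field ring" where
  "GF Q = ring_of_type_algebra\<lparr>carrier := {x. x ^ Q = x}\<rparr>"


section \<open>Tensor products and quotients of modules\<close>

text \<open>For \<open>K \<subseteq> L\<close> and a \<open>K\<close>-module \<open>V\<close>, the tensor product of \<open>L\<close> and \<open>V\<close> over \<open>K\<close> is the
  quotient of the free abelian group on \<open>L \<times> V\<close> by the usual relations, with \<open>L\<close> acting on the
  left factor. The fields \<open>mult\<close> and \<open>one\<close> of a module record carry no information. As module
  records do not mention the scalars, restricting scalars to a subfield leaves them unchanged.\<close>

type_synonym ('k, 'v) tens = "('k \<times> 'v \<Rightarrow>\<^sub>0 int) set"

definition tensor_free :: "'k ring \<Rightarrow> ('k, 'v) module \<Rightarrow> ('k \<times> 'v \<Rightarrow>\<^sub>0 int) monoid" where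
  "tensor_free L V = free_Abelian_group (carrier L \<times> carrier V)"

definition tensor_relators :: "'k ring \<Rightarrow> 'k ring \<Rightarrow> ('k, 'v) module \<Rightarrow> ('k \<times> 'v \<Rightarrow>\<^sub>0 int) set" where
  "tensor_relators L K V =
     {frag_of (a \<oplus>\<^bsub>L\<^esub> b, v) - frag_of (a, v) - frag_of (b, v) | a b v.
        a \<in> carrier L \<and> b \<in> carrier L \<and> v \<in> carrier V} \<union>
     {frag_of (a, v \<oplus>\<^bsub>V\<^esub> w) - frag_of (a, v) - frag_of (a, w) | a v w.
        a \<in> carrier L \<and> v \<in> carrier V \<and> w \<in> carrier V} \<union>
     {frag_of (a \<otimes>\<^bsub>L\<^esub> c, v) - frag_of (a, c \<odot>\<^bsub>V\<^esub> v) | a c v.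
        a \<in> carrier L \<and> c \<in> carrier K \<and> v \<in> carrier V}"

definition tensor_null :: "'k ring \<Rightarrow> 'k ring \<Rightarrow> ('k, 'v) module \<Rightarrow> ('k, 'v) tens" where
  "tensor_null L K V = generate (tensor_free L V) (tensor_relators L K V)"

definition tensor_class ::
  "'k ring \<Rightarrow> 'k ring \<Rightarrow> ('k, 'v) module \<Rightarrow> ('k \<times> 'v \<Rightarrow>\<^sub>0 int) \<Rightarrow> ('k, 'v) tens" where
  "tensor_class L K V z = tensor_null L K V #>\<^bsub>tensor_free L V\<^esub> z"

text \<open>The unions over \<open>z \<in> Z\<close> below are unions of one and the same class: they evaluate a map
  between quotients on representatives.\<close>

definition tensor :: "'k ring \<Rightarrow> 'k ring \<Rightarrow> ('k, 'v) module \<Rightarrow> ('k, ('k, 'v) tens) module" where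
  "tensor L K V = (let T = tensor_free L V Mod tensor_null L K V in
     \<lparr>carrier = carrier T, monoid.mult = (\<lambda>_ _. \<one>\<^bsub>T\<^esub>), monoid.one = \<one>\<^bsub>T\<^esub>,
      ring.zero = \<one>\<^bsub>T\<^esub>, ring.add = (\<lambda>Y Y'. Y \<otimes>\<^bsub>T\<^esub> Y'),
      module.smult = (\<lambda>a Z. \<Union>z\<in>Z. tensor_class L K V
                 (frag_extend (\<lambda>(b, v). frag_of (a \<otimes>\<^bsub>L\<^esub> b, v)) z))\<rparr>)"

text \<open>The map to the tensor product of \<open>L\<close> and \<open>V\<close> over \<open>K\<close> sending each pure tensor of \<open>b\<close> and
  \<open>v\<close> to that of \<open>b\<close> and \<open>h v\<close>; its source may be a tensor product over smaller fields.\<close>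

definition tensor_map ::
  "'k ring \<Rightarrow> 'k ring \<Rightarrow> ('k, 'v) module \<Rightarrow> ('u \<Rightarrow> 'v) \<Rightarrow> ('k, 'u) tens \<Rightarrow> ('k, 'v) tens" where
  "tensor_map L K V h Z =
     (\<Union>z\<in>Z. tensor_class L K V (frag_extend (\<lambda>(b, v). frag_of (b, h v)) z))"

definition quot_module :: "('k, 'v) module \<Rightarrow> 'v set \<Rightarrow> ('k, 'v set) module" where
  "quot_module V U =
     \<lparr>carrier = a_rcosets\<^bsub>V\<^esub> U, monoid.mult = (\<lambda>_ _. U), monoid.one = U,
      ring.zero = U, ring.add = set_add V,
      module.smult = (\<lambda>a Y. \<Union>x\<in>Y. U +>\<^bsub>V\<^esub> (a \<odot>\<^bsub>V\<^esub> x))\<rparr>"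


section \<open>Representations\<close>

text \<open>Throughout, the argument \<open>Q\<close> is the cardinality of the base field, written \<open>Q_0\<close> in the
  usual notation (\<open>Q_0\<close> being \<open>q\<close> or \<open>q^l\<close>); a graded space is a family of module records, and a
  graded subspace is a family of subsets, with value \<open>undefined\<close> outside \<open>I\<close>.\<close>

type_synonym ('i, 'k, 'v) gspace = "'i \<Rightarrow> ('k, 'v) module"
type_synonym ('a, 'k, 'v) rep = "'a \<Rightarrow> ('k, 'v) tens \<Rightarrow> 'v"

definition vfield :: "('i, 'a) quiver \<Rightarrow> nat \<Rightarrow> 'i \<Rightarrow> 'k::alg_closed_field ring" where
  "vfield D Q i = GF (Q ^ vdeg D i)"

definition afield :: "('i, 'a) quiver \<Rightarrow> nat \<Rightarrow> 'a \<Rightarrow> 'k::alg_closed_field ring" where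
  "afield D Q k = GF (Q ^ adeg D k)"

definition gdim ::
  "('i, 'a) quiver \<Rightarrow> nat \<Rightarrow> ('i, 'k::alg_closed_field, 'v) gspace \<Rightarrow> 'i \<Rightarrow> nat" where
  "gdim D Q V = (\<lambda>i. if i \<in> vertices D then vectorspace.dim (vfield D Q i) (V i) else 0)"

definition std_space ::
  "('i, 'a) quiver \<Rightarrow> nat \<Rightarrow> ('i \<Rightarrow> nat) \<Rightarrow> ('i, 'k::alg_closed_field, nat \<Rightarrow> 'k) gspace" where
  "std_space D Q \<nu> = (\<lambda>i. ring.func_space (vfield D Q i) {..<\<nu> i})"

definition arrow_space ::
  "('i, 'a) quiver \<Rightarrow> nat \<Rightarrow> ('i, 'k::alg_closed_field, 'v) gspace \<Rightarrow> 'a \<Rightarrow> ('k, ('k, 'v) tens) module"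
  where
  "arrow_space D Q V k = tensor (afield D Q k) (vfield D Q (src D k)) (V (src D k))"

definition arrow_map ::
  "('i, 'a) quiver \<Rightarrow> nat \<Rightarrow> ('i, 'k::alg_closed_field, 'v) gspace \<Rightarrow> 'a \<Rightarrow> ('u \<Rightarrow> 'v)
     \<Rightarrow> ('k, 'u) tens \<Rightarrow> ('k, 'v) tens" where
  "arrow_map D Q V k h = tensor_map (afield D Q k) (vfield D Q (src D k)) (V (src D k)) h"

text \<open>\<open>reps D Q V\<close> is the set \<open>E_V\<close>. Its elements are extensional, so that equality of
  representations is equality of the families of linear maps.\<close>

definition reps ::
  "('i, 'a) quiver \<Rightarrow> nat \<Rightarrow> ('i, 'k::alg_closed_field, 'v) gspace \<Rightarrow> ('a, 'k, 'v) rep set" where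
  "reps D Q V = (\<Pi>\<^sub>E k\<in>arrows D.
     module_hom (vfield D Q (tgt D k)) (arrow_space D Q V k) (V (tgt D k))
       \<inter> extensional (carrier (arrow_space D Q V k)))"

text \<open>Graded isomorphisms and transport of structure along them; \<open>G_V\<close> is \<open>graded_isos D Q V V\<close>, and
  \<open>transport D Q V V g\<close> is its action on \<open>E_V\<close> by conjugation.\<close>

definition graded_isos ::
  "('i, 'a) quiver \<Rightarrow> nat \<Rightarrow> ('i, 'k::alg_closed_field, 'u) gspace \<Rightarrow> ('i, 'k, 'v) gspace
     \<Rightarrow> ('i \<Rightarrow> 'u \<Rightarrow> 'v) set" where
  "graded_isos D Q V V' = {g. \<forall>i\<in>vertices D.
     g i \<in> module_hom (vfield D Q i) (V i) (V' i) \<and> bij_betw (g i) (carrier (V i)) (carrier (V' i))}"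

definition transport ::
  "('i, 'a) quiver \<Rightarrow> nat \<Rightarrow> ('i, 'k::alg_closed_field, 'u) gspace \<Rightarrow> ('i, 'k, 'v) gspace
     \<Rightarrow> ('i \<Rightarrow> 'u \<Rightarrow> 'v) \<Rightarrow> ('a, 'k, 'u) rep \<Rightarrow> ('a, 'k, 'v) rep" where
  "transport D Q V V' g x = (\<lambda>k\<in>arrows D. \<lambda>Y\<in>carrier (arrow_space D Q V' k).
     g (tgt D k) (x k (arrow_map D Q V k (inv_into (carrier (V (src D k))) (g (src D k))) Y)))"

definition graded_subspaces ::
  "('i, 'a) quiver \<Rightarrow> nat \<Rightarrow> ('i, 'k::alg_closed_field, 'v) gspace \<Rightarrow> ('i \<Rightarrow> 'v set) set" where
  "graded_subspaces D Q V = (\<Pi>\<^sub>E i\<in>vertices D. {U. VectorSpace.subspace (vfield D Q i) U (V i)})"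

definition sub_space :: "('i, 'k, 'v) gspace \<Rightarrow> ('i \<Rightarrow> 'v set) \<Rightarrow> ('i, 'k, 'v) gspace" where
  "sub_space V U = (\<lambda>i. (V i)\<lparr>carrier := U i\<rparr>)"

definition quot_space :: "('i, 'k, 'v) gspace \<Rightarrow> ('i \<Rightarrow> 'v set) \<Rightarrow> ('i, 'k, 'v set) gspace" where
  "quot_space V U = (\<lambda>i. quot_module (V i) (U i))"

definition stable ::
  "('i, 'a) quiver \<Rightarrow> nat \<Rightarrow> ('i, 'k::alg_closed_field, 'v) gspace \<Rightarrow> ('a, 'k, 'v) rep
     \<Rightarrow> ('i \<Rightarrow> 'v set) \<Rightarrow> bool" where
  "stable D Q V x U \<longleftrightarrow> (\<forall>k\<in>arrows D. \<forall>Y\<in>carrier (arrow_space D Q (sub_space V U) k).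
     x k (arrow_map D Q V k id Y) \<in> U (tgt D k))"

definition sub_rep ::
  "('i, 'a) quiver \<Rightarrow> nat \<Rightarrow> ('i, 'k::alg_closed_field, 'v) gspace \<Rightarrow> ('i \<Rightarrow> 'v set)
     \<Rightarrow> ('a, 'k, 'v) rep \<Rightarrow> ('a, 'k, 'v) rep" where
  "sub_rep D Q V U x = (\<lambda>k\<in>arrows D. \<lambda>Y\<in>carrier (arrow_space D Q (sub_space V U) k).
     x k (arrow_map D Q V k id Y))"

text \<open>The value on \<open>Y\<close> of the representation induced on \<open>V/U\<close> is the class of \<open>x_k(Z)\<close> for any lift \<open>Z\<close>
  of \<open>Y\<close>; when \<open>U\<close> is stable all sets in the union coincide.\<close>

definition quot_rep ::
  "('i, 'a) quiver \<Rightarrow> nat \<Rightarrow> ('i, 'k::alg_closed_field, 'v) gspace \<Rightarrow> ('i \<Rightarrow> 'v set)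
     \<Rightarrow> ('a, 'k, 'v) rep \<Rightarrow> ('a, 'k, 'v set) rep" where
  "quot_rep D Q V U x = (\<lambda>k\<in>arrows D. \<lambda>Y\<in>carrier (arrow_space D Q (quot_space V U) k).
     \<Union>Z\<in>{Z \<in> carrier (arrow_space D Q V k).
           arrow_map D Q (quot_space V U) k (\<lambda>v. U (src D k) +>\<^bsub>V (src D k)\<^esub> v) Z = Y}.
       U (tgt D k) +>\<^bsub>V (tgt D k)\<^esub> x k Z)"


section \<open>Hall algebras and composition algebras\<close>

text \<open>Elements of \<open>H_\<nu>\<close> are invariant functions on \<open>E_V\<close> for the standard space \<open>V\<close> of dimension
  vector \<open>\<nu>\<close>, and \<open>hall_value\<close> evaluates them on a representation on any space \<open>V\<close> with
  \<open>|V| = \<nu>\<close>, by transport along a graded isomorphism; by invariance the choice is immaterial.\<close>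

type_synonym ('i, 'a, 'k, 'r) hall = "('i \<Rightarrow> nat) \<Rightarrow> ('a, 'k, nat \<Rightarrow> 'k) rep \<Rightarrow> 'r"

definition hall_component ::
  "('i, 'a) quiver \<Rightarrow> nat \<Rightarrow> 'r ring \<Rightarrow> ('i \<Rightarrow> nat)
     \<Rightarrow> (('a, 'k::alg_closed_field, nat \<Rightarrow> 'k) rep \<Rightarrow> 'r) set" where
  "hall_component D Q A \<nu> = (let V = std_space D Q \<nu> in
     {f \<in> reps D Q V \<rightarrow>\<^sub>E carrier A.
        \<forall>g\<in>graded_isos D Q V V. \<forall>x\<in>reps D Q V. f (transport D Q V V g x) = f x})"

definition hall_value ::
  "('i, 'a) quiver \<Rightarrow> nat \<Rightarrow> ('i \<Rightarrow> nat) \<Rightarrow> (('a, 'k::alg_closed_field, nat \<Rightarrow> 'k) rep \<Rightarrow> 'r)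
     \<Rightarrow> ('i, 'k, 'v) gspace \<Rightarrow> ('a, 'k, 'v) rep \<Rightarrow> 'r" where
  "hall_value D Q \<nu> f V x = f (transport D Q V (std_space D Q \<nu>)
     (SOME g. g \<in> graded_isos D Q V (std_space D Q \<nu>)) x)"

definition hall_star ::
  "('i, 'a) quiver \<Rightarrow> nat \<Rightarrow> 'r ring \<Rightarrow> ('i \<Rightarrow> nat) \<Rightarrow> ('i \<Rightarrow> nat)
     \<Rightarrow> (('a, 'k::alg_closed_field, nat \<Rightarrow> 'k) rep \<Rightarrow> 'r) \<Rightarrow> (('a, 'k, nat \<Rightarrow> 'k) rep \<Rightarrow> 'r)
     \<Rightarrow> ('a, 'k, nat \<Rightarrow> 'k) rep \<Rightarrow> 'r" where
  "hall_star D Q A \<nu>1 \<nu>2 f1 f2 = (let V = std_space D Q (\<lambda>i. \<nu>1 i + \<nu>2 i) in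
     (\<lambda>x\<in>reps D Q V.
       \<Oplus>\<^bsub>A\<^esub> W\<in>{W \<in> graded_subspaces D Q V. stable D Q V x W \<and> gdim D Q (sub_space V W) = \<nu>2}.
         hall_value D Q \<nu>1 f1 (quot_space V W) (quot_rep D Q V W x)
         \<otimes>\<^bsub>A\<^esub> hall_value D Q \<nu>2 f2 (sub_space V W) (sub_rep D Q V W x)))"

text \<open>The bilinear extension of \<open>f1 \<circ> f2 = e^{-m(\<nu>1,\<nu>2)} f1 \<star> f2\<close> (\<open>f1\<close>, \<open>f2\<close> homogeneous of degrees
  \<open>\<nu>1\<close>, \<open>\<nu>2\<close>).\<close>

definition twisted_mult ::
  "('i, 'a) quiver \<Rightarrow> nat \<Rightarrow> 'r ring \<Rightarrow> 'r \<Rightarrow> ('i, 'a, 'k::alg_closed_field, 'r) hall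
     \<Rightarrow> ('i, 'a, 'k, 'r) hall \<Rightarrow> ('i, 'a, 'k, 'r) hall" where
  "twisted_mult D Q A e f1 f2 = (\<lambda>\<nu>\<in>NI D. \<lambda>x\<in>reps D Q (std_space D Q \<nu>).
     finsum A
       (\<lambda>(\<nu>1, \<nu>2). (e [^]\<^bsub>A\<^esub> (- twist_form D (\<lambda>i. int (\<nu>1 i)) (\<lambda>i. int (\<nu>2 i))))
                   \<otimes>\<^bsub>A\<^esub> hall_star D Q A \<nu>1 \<nu>2 (f1 \<nu>1) (f2 \<nu>2) x)
       {(\<nu>1, \<nu>2). \<nu>1 \<in> NI D \<and> \<nu>2 \<in> NI D \<and> (\<lambda>i. \<nu>1 i + \<nu>2 i) = \<nu>})"

text \<open>A homogeneous component is zero when it vanishes on all representations; elements of the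
  direct sum over \<open>\<nat>I\<close> are the families with finitely many nonzero components.\<close>

definition hall_algebra ::
  "('i, 'a) quiver \<Rightarrow> nat \<Rightarrow> 'r ring \<Rightarrow> 'r \<Rightarrow> ('r, ('i, 'a, 'k::alg_closed_field, 'r) hall) module"
  where
  "hall_algebra D Q A e = (let E = (\<lambda>\<nu>. reps D Q (std_space D Q \<nu>)) in
     \<lparr>carrier = {f \<in> (\<Pi>\<^sub>E \<nu>\<in>NI D. hall_component D Q A \<nu>).
                  finite {\<nu> \<in> NI D. \<exists>x\<in>E \<nu>. f \<nu> x \<noteq> \<zero>\<^bsub>A\<^esub>}},
      monoid.mult = twisted_mult D Q A e,
      monoid.one = (\<lambda>\<nu>\<in>NI D. \<lambda>x\<in>E \<nu>. if \<nu> = (\<lambda>_. 0) then \<one>\<^bsub>A\<^esub> else \<zero>\<^bsub>A\<^esub>),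
      ring.zero = (\<lambda>\<nu>\<in>NI D. \<lambda>x\<in>E \<nu>. \<zero>\<^bsub>A\<^esub>),
      ring.add = (\<lambda>f g. \<lambda>\<nu>\<in>NI D. \<lambda>x\<in>E \<nu>. f \<nu> x \<oplus>\<^bsub>A\<^esub> g \<nu> x),
      module.smult = (\<lambda>a f. \<lambda>\<nu>\<in>NI D. \<lambda>x\<in>E \<nu>. a \<otimes>\<^bsub>A\<^esub> f \<nu> x)\<rparr>)"

definition simple_weight :: "'i \<Rightarrow> nat \<Rightarrow> 'i \<Rightarrow> nat" where
  "simple_weight i c = (\<lambda>j. if j = i then c else 0)"

definition flag_weight :: "'i list \<Rightarrow> nat list \<Rightarrow> 'i \<Rightarrow> nat" where
  "flag_weight js cs = (\<lambda>i. \<Sum>n<length js. simple_weight (js ! n) (cs ! n) i)"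

text \<open>A flag \<open>V = V^0 \<supseteq> \<dots> \<supseteq> V^m = 0\<close> is the list of its \<open>m + 1\<close> terms.\<close>

definition flags ::
  "('i, 'a) quiver \<Rightarrow> nat \<Rightarrow> ('i, 'k::alg_closed_field, 'v) gspace \<Rightarrow> 'i list \<Rightarrow> nat list
     \<Rightarrow> ('i \<Rightarrow> 'v set) list set" where
  "flags D Q V js cs = {Us. length Us = Suc (length js) \<and> set Us \<subseteq> graded_subspaces D Q V \<and>
     hd Us = (\<lambda>i\<in>vertices D. carrier (V i)) \<and> last Us = (\<lambda>i\<in>vertices D. {\<zero>\<^bsub>V i\<^esub>}) \<and>
     (\<forall>n<length js. (\<forall>i\<in>vertices D. (Us ! Suc n) i \<subseteq> (Us ! n) i) \<and>
        gdim D Q (quot_space (sub_space V (Us ! n)) (Us ! Suc n)) = simple_weight (js ! n) (cs ! n))}"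

definition flag_function ::
  "('i, 'a) quiver \<Rightarrow> nat \<Rightarrow> 'r ring \<Rightarrow> 'i list \<Rightarrow> nat list
     \<Rightarrow> ('i, 'a, 'k::alg_closed_field, 'r) hall" where
  "flag_function D Q A js cs = (\<lambda>\<nu>\<in>NI D. let V = std_space D Q \<nu> in (\<lambda>x\<in>reps D Q V.
     if \<nu> = flag_weight js cs
     then [card {Us \<in> flags D Q V js cs. \<forall>U\<in>set Us. stable D Q V x U}] \<cdot>\<^bsub>A\<^esub> \<one>\<^bsub>A\<^esub>
     else \<zero>\<^bsub>A\<^esub>))"

definition composition_algebra ::
  "('i, 'a) quiver \<Rightarrow> nat \<Rightarrow> 'r ring \<Rightarrow> 'r \<Rightarrow> ('r, ('i, 'a, 'k::alg_closed_field, 'r) hall) module"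
  where
  "composition_algebra D Q A e = (let H = hall_algebra D Q A e in
     H\<lparr>carrier := module.span A H
         {flag_function D Q A js cs | js cs. length js = length cs \<and> set js \<subseteq> vertices D}\<rparr>)"


section \<open>The ring of coefficients\<close>

definition cyclotomic_poly :: "nat \<Rightarrow> complex poly" where
  "cyclotomic_poly n = (\<Prod>z\<in>{z. z ^ n = 1 \<and> (\<forall>m. 0 < m \<and> m < n \<longrightarrow> z ^ m \<noteq> 1)}. [:- z, 1:])"

definition laurent_ring :: "complex \<Rightarrow> complex ring" where
  "laurent_ring \<epsilon> =
     ring_of_type_algebra\<lparr>carrier := generate_ring ring_of_type_algebra {\<epsilon>, inverse \<epsilon>}\<rparr>"

definition coeff_ideal :: "nat \<Rightarrow> complex \<Rightarrow> complex set" where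
  "coeff_ideal l \<epsilon> = PIdl\<^bsub>laurent_ring \<epsilon>\<^esub> (poly (cyclotomic_poly (2 * l)) \<epsilon>)"

definition coeff_ring :: "nat \<Rightarrow> complex \<Rightarrow> complex set ring" where
  "coeff_ring l \<epsilon> = laurent_ring \<epsilon> Quot coeff_ideal l \<epsilon>"

definition coeff_class :: "nat \<Rightarrow> complex \<Rightarrow> complex \<Rightarrow> complex set" where
  "coeff_class l \<epsilon> a = coeff_ideal l \<epsilon> +>\<^bsub>laurent_ring \<epsilon>\<^esub> a"


section \<open>Restriction of functions along the forgetful maps\<close>

text \<open>The map \<open>\<iota>\<close> from \<open>E_V\<close> over the field with \<open>q^l\<close> elements to \<open>E_{R(V)}\<close> over the field with \<open>q\<close>
  elements. The underlying family of module records of \<open>R(V)\<close> is that of \<open>V\<close>.\<close>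

definition iota ::
  "('i, 'a) quiver \<Rightarrow> nat \<Rightarrow> nat \<Rightarrow> ('i, 'k::alg_closed_field, 'v) gspace
     \<Rightarrow> ('a, 'k, 'v) rep \<Rightarrow> ('a, 'k, 'v) rep" where
  "iota D q l V x = (\<lambda>k\<in>arrows D. \<lambda>Y\<in>carrier (arrow_space D q V k).
     x k (arrow_map D (q ^ l) V k id Y))"

text \<open>The component of \<open>Q(f)\<close> of degree \<open>\<mu>\<close> comes from the component of \<open>f\<close> of degree \<open>l\<mu>\<close>; the
  components of \<open>f\<close> of degrees not divisible by \<open>l\<close> are annihilated.\<close>

definition Q_map ::
  "('i, 'a) quiver \<Rightarrow> nat \<Rightarrow> nat \<Rightarrow> ('i, 'a, 'k::alg_closed_field, 'r) hall
     \<Rightarrow> ('i, 'a, 'k, 'r) hall" where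
  "Q_map D q l f = (\<lambda>\<mu>\<in>NI D. let V = std_space D (q ^ l) \<mu> in (\<lambda>x\<in>reps D (q ^ l) V.
     hall_value D q (\<lambda>i. l * \<mu> i) (f (\<lambda>i. l * \<mu> i)) V (iota D q l V x)))"

end

theory Submission
  imports Defs
begin

text \<open>The algebra \<open>\<F>\<close> is spanned by the functions counting stable flags, and the product of two of them is
  a power of \<open>\<epsilon>\<close> times the function of the concatenated type. For \<open>x\<close> in \<open>E_V\<close>, the group \<open>F_{q^l}^*\<close> acts
  by scalars on the \<open>F_q\<close>-flags stable under \<open>\<iota>(x)\<close>. As \<open>l\<close> is prime to all \<open>d_i\<close>, the fixed flags are
  the \<open>F_{q^l}\<close>-flags stable under \<open>x\<close>, and every other orbit has \<open>(q^l - 1)/(q^f - 1)\<close> elements with \<open>f\<close> a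
  proper divisor of \<open>l\<close>, which is a multiple of \<open>\<Phi>_{2l}(\<epsilon>)\<close>. So \<open>Q\<close> sends the function of type \<open>(i, c)\<close> to that
  of type \<open>(i, c/l)\<close>, or to \<open>0\<close> if some \<open>c_k\<close> is not divisible by \<open>l\<close>. The twists agree since
  \<open>m(l\<nu>, l\<mu>) = l^2 m(\<nu>, \<mu>)\<close> and \<open>\<epsilon>^l = -1\<close> gives \<open>\<epsilon>^{l^2} = (-1)^{l+1} \<epsilon>^l\<close>.\<close>

section \<open>Cyclotomic polynomials\<close>

text \<open>Three obstacles shape the argument. A representation lives on tensor products over
  fields that change with the base field, so it is replaced by the maps u -> x_k(1 \<otimes> u),
  which are compatible with subspaces, quotients, isomorphisms and \<open>iota\<close>; in these
  terms stability under the arrows is literally the same condition over F_q and over F_{q^l}.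
  Dimensions are taken over different fields, so they are expressed by cardinalities. Finally,
  scaling is applied to one term of a flag at a time: once the terms above are subspaces over the
  large fields, scaling fixes them, permutes the candidates for the next term and preserves the
  number of ways to continue down to zero, so an induction on the length of the flag suffices.
  Divisibility by Phi_{2l}(\<epsilon>) must hold in Z[\<epsilon>, 1/\<epsilon>] and not merely among
  complex numbers. As the cyclotomic polynomial is given by its complex roots, integrality of the
  cofactors of X^{2l} - 1 has to be established as well.\<close>

definition int_coeffs :: "complex poly \<Rightarrow> bool" where
  "int_coeffs f \<longleftrightarrow> (\<forall>n. poly.coeff f n \<in> \<int>)"

lemma int_coeffs_mult: "int_coeffs f \<Longrightarrow> int_coeffs g \<Longrightarrow> int_coeffs (f * g)"
  unfolding int_coeffs_def coeff_mult by (auto intro!: Ints_sum Ints_mult)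

lemma int_coeffs_prod: "(\<And>x. x \<in> A \<Longrightarrow> int_coeffs (f x)) \<Longrightarrow> int_coeffs (\<Prod>x\<in>A. f x)"
proof (induction A rule: infinite_finite_induct)
  case (insert x A)
  then show ?case by (simp add: int_coeffs_mult)
qed (auto simp: int_coeffs_def)

lemma int_coeffs_monom_minus_1: "int_coeffs (Polynomial.monom 1 n - 1)"
  unfolding int_coeffs_def by (auto simp: coeff_1)

text \<open>Division by a monic polynomial stays integral. As \<open>g\<close> is monic,
  \<open>g * h\<close> and \<open>h\<close> share the leading coefficient, which is therefore an
  integer; its monomial is split off from \<open>h\<close>, and the rest is zero or of smaller
  degree.\<close>

lemma int_coeffs_quotient:
  assumes "lead_coeff g = 1" "int_coeffs g" "int_coeffs (g * h)"
  shows "int_coeffs h"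
  using assms(3)
proof (induction "degree h" arbitrary: h rule: less_induct)
  case less
  show ?case
  proof (cases "h = 0")
    case True
    then show ?thesis by (simp add: int_coeffs_def)
  next
    case False
    define m where "m = Polynomial.monom (lead_coeff h) (degree h)"
    have "lead_coeff (g * h) = lead_coeff h"
      using assms(1) by (simp add: lead_coeff_mult)
    then have "lead_coeff h \<in> \<int>"
      using less.prems unfolding int_coeffs_def by metis
    then have m: "int_coeffs m"
      by (auto simp: int_coeffs_def m_def)
    have "int_coeffs (g * (h - m))"
      using int_coeffs_mult[OF assms(2) m] less.prems
      by (auto simp: right_diff_distrib int_coeffs_def)
    moreover have "h - m = 0 \<or> degree (h - m) < degree h"
    proof (cases "degree h = 0")
      case True
      then show ?thesis by (metis m_def monom_0 degree_eq_zeroE coeff_pCons_0 diff_self)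
    next
      case False
      have "degree (h - m) \<le> degree h"
        by (simp add: m_def degree_diff_le degree_monom_le)
      moreover have "degree (h - m) \<noteq> degree h"
      proof
        assume eq: "degree (h - m) = degree h"
        have "lead_coeff (h - m) = 0"
          unfolding eq by (simp add: m_def)
        then have "h - m = 0" by (simp only: leading_coeff_0_iff)
        then show False using eq False by simp
      qed
      ultimately show ?thesis by simp
    qed
    ultimately have "int_coeffs (h - m)"
      using less.hyps[of "h - m"] by (auto simp: int_coeffs_def)
    then have "int_coeffs (h - m + m)"
      using m unfolding int_coeffs_def by auto
    then show ?thesis by simp
  qed
qed

definition unity_roots :: "nat \<Rightarrow> complex set" where
  "unity_roots n = {z. z ^ n = 1}"

definition primitive_roots :: "nat \<Rightarrow> complex set" where
  "primitive_roots n = {z. z ^ n = 1 \<and> (\<forall>m. 0 < m \<and> m < n \<longrightarrow> z ^ m \<noteq> 1)}"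

lemma cyclotomic_poly_eq: "cyclotomic_poly n = (\<Prod>z\<in>primitive_roots n. [:- z, 1:])"
  by (simp add: cyclotomic_poly_def primitive_roots_def)

lemma finite_unity_roots: "n > 0 \<Longrightarrow> finite (unity_roots n)"
  unfolding unity_roots_def using finite_roots_unity[of n] by simp

lemma finite_primitive_roots: "n > 0 \<Longrightarrow> finite (primitive_roots n)"
  by (rule finite_subset[OF _ finite_unity_roots[of n]]) (auto simp: primitive_roots_def unity_roots_def)

lemma primitive_roots_disjoint: "m > 0 \<Longrightarrow> n > 0 \<Longrightarrow> m \<noteq> n \<Longrightarrow> primitive_roots m \<inter> primitive_roots n = {}"
  unfolding primitive_roots_def by (cases "m < n") (auto simp: set_eq_iff)

lemma monic_prod_linear: "lead_coeff (\<Prod>z\<in>A. [:- z, 1:] :: complex poly) = 1"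
  unfolding lead_coeff_prod by simp

lemma degree_prod_linear: "degree (\<Prod>z\<in>A. [:- z, 1:] :: complex poly) = card A"
  by (subst degree_prod_eq_sum_degree) auto

text \<open>Both sides are monic of degree \<open>n\<close>, so their difference has degree below
  \<open>n\<close>; it vanishes at all \<open>n\<close> roots of unity and hence is zero.\<close>

lemma prod_unity_roots:
  assumes "n > 0"
  shows "(\<Prod>z\<in>unity_roots n. [:- z, 1:]) = Polynomial.monom 1 n - 1"
proof -
  define d where "d = (\<Prod>z\<in>unity_roots n. [:- z, 1:]) - (Polynomial.monom 1 n - 1)"
  have card: "card (unity_roots n) = n"
    using card_roots_unity_eq[OF assms] by (simp add: unity_roots_def)
  have fin: "finite (unity_roots n)" by (rule finite_unity_roots[OF assms])
  have deg: "degree (Polynomial.monom 1 n - 1 :: complex poly) = n"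
    using assms degree_add_eq_left[of "- 1" "Polynomial.monom 1 n :: complex poly"]
    by (simp add: degree_monom_eq)
  have "d = 0"
  proof (rule ccontr)
    assume "d \<noteq> 0"
    have "degree d \<le> n"
      unfolding d_def by (rule degree_diff_le) (simp_all only: degree_prod_linear card deg order.refl)
    moreover have "poly.coeff d n = 0"
      using monic_prod_linear[of "unity_roots n"] assms
      by (simp add: d_def degree_prod_linear card coeff_1)
    ultimately have "degree d < n"
      using \<open>d \<noteq> 0\<close> by (metis le_neq_implies_less leading_coeff_0_iff)
    moreover have "unity_roots n \<subseteq> {z. poly d z = 0}"
      using fin by (auto simp: d_def poly_prod poly_monom unity_roots_def)
    then have "n \<le> card {z. poly d z = 0}"
      using card_mono[OF poly_roots_finite[OF \<open>d \<noteq> 0\<close>]] card by metis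
    moreover have "card {z. poly d z = 0} \<le> degree d"
      by (rule card_poly_roots_bound) (fact \<open>d \<noteq> 0\<close>)
    ultimately show False by simp
  qed
  then show ?thesis by (simp add: d_def)
qed

lemma unity_roots_UN:
  assumes "n > 0"
  shows "unity_roots n = (\<Union>d\<in>{d. d dvd n}. primitive_roots d)"
proof (intro equalityI subsetI)
  fix z assume "z \<in> unity_roots n"
  then have z: "z ^ n = 1" by (simp add: unity_roots_def)
  \<comment> \<open>The multiplicative order of \<open>z\<close>; its minimality makes
    \<open>z\<close> a primitive root of that order.\<close>
  define d where "d = (LEAST d. d > 0 \<and> z ^ d = 1)"
  have d: "d > 0 \<and> z ^ d = 1"
    unfolding d_def by (rule LeastI[of _ n]) (use z assms in simp)
  have least: "z ^ m \<noteq> 1" if "0 < m" "m < d" for m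
    using that not_less_Least unfolding d_def by blast
  have "z ^ n = z ^ (n mod d)"
    by (metis d mult_div_mod_eq power_add power_mult power_one mult_1)
  then have "n mod d = 0"
    using least[of "n mod d"] d z by (metis mod_less_divisor neq0_conv)
  then have "d dvd n" by auto
  moreover have "z \<in> primitive_roots d"
    using d least by (auto simp: primitive_roots_def)
  ultimately show "z \<in> (\<Union>d\<in>{d. d dvd n}. primitive_roots d)" by auto
next
  fix z assume "z \<in> (\<Union>d\<in>{d. d dvd n}. primitive_roots d)"
  then show "z \<in> unity_roots n"
    by (auto simp: primitive_roots_def unity_roots_def power_mult elim!: dvdE)
qed

text \<open>X^n - 1 is the product of the cyclotomic polynomials of all divisors of
  \<open>n\<close>. By induction the factors for proper divisors are integral, and their product is
  monic, so the last factor is an integral quotient.\<close>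

lemma int_coeffs_cyclotomic: "n > 0 \<Longrightarrow> int_coeffs (cyclotomic_poly n)"
proof (induction n rule: less_induct)
  case (less n)
  let ?P = "{d. d dvd n \<and> d < n}"
  have fin: "finite ?P" by simp
  have pos: "d > 0" if "d dvd n" for d using that less.prems by (auto intro: Nat.gr0I)
  have "{d. d dvd n} = insert n ?P"
    using less.prems by (auto dest: dvd_imp_le)
  then have U: "unity_roots n = (\<Union>d\<in>?P. primitive_roots d) \<union> primitive_roots n"
    using unity_roots_UN[OF less.prems] by auto
  have "Polynomial.monom 1 n - 1 = (\<Prod>z\<in>(\<Union>d\<in>?P. primitive_roots d) \<union> primitive_roots n. [:- z, 1:])"
    by (simp only: prod_unity_roots[OF less.prems, symmetric] U)
  also have "\<dots> = (\<Prod>z\<in>(\<Union>d\<in>?P. primitive_roots d). [:- z, 1:]) * cyclotomic_poly n"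
    unfolding cyclotomic_poly_eq
  proof (rule prod.union_disjoint)
    show "finite (\<Union> (primitive_roots ` ?P))"
      using fin pos finite_primitive_roots by auto
    show "finite (primitive_roots n)" by (rule finite_primitive_roots[OF less.prems])
    show "\<Union> (primitive_roots ` ?P) \<inter> primitive_roots n = {}"
      using primitive_roots_disjoint pos less.prems by blast
  qed
  also have "(\<Prod>z\<in>(\<Union>d\<in>?P. primitive_roots d). [:- z, 1:]) = (\<Prod>d\<in>?P. cyclotomic_poly d)"
    unfolding cyclotomic_poly_eq
  proof (rule prod.UNION_disjoint)
    show "\<forall>i\<in>?P. finite (primitive_roots i)"
      using pos finite_primitive_roots by auto
    show "\<forall>i\<in>?P. \<forall>j\<in>?P. i \<noteq> j \<longrightarrow> primitive_roots i \<inter> primitive_roots j = {}"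
      using primitive_roots_disjoint pos by blast
  qed (rule fin)
  finally have *: "Polynomial.monom 1 n - 1 = (\<Prod>d\<in>?P. cyclotomic_poly d) * cyclotomic_poly n" .
  show ?case
  proof (rule int_coeffs_quotient)
    show "lead_coeff (\<Prod>d\<in>?P. cyclotomic_poly d) = 1"
      unfolding lead_coeff_prod cyclotomic_poly_eq monic_prod_linear by simp
    show "int_coeffs (\<Prod>d\<in>?P. cyclotomic_poly d)"
      using less.IH pos by (intro int_coeffs_prod) auto
    show "int_coeffs ((\<Prod>d\<in>?P. cyclotomic_poly d) * cyclotomic_poly n)"
      unfolding *[symmetric] by (rule int_coeffs_monom_minus_1)
  qed
qed

text \<open>No \<open>a\<close>-th root of unity is a primitive \<open>n\<close>-th one, so both
  factors fit into X^n - 1 together. Integrality of the cofactor \<open>h\<close> is the point: it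
  puts the value of \<open>h\<close> at \<epsilon> into the ring generated by \<epsilon> and its
  inverse.\<close>

lemma cyclotomic_factor:
  assumes "a dvd n" "0 < a" "a < n"
  obtains h where "int_coeffs h"
    "Polynomial.monom 1 n - 1 = (Polynomial.monom 1 a - 1) * (cyclotomic_poly n * h)"
proof -
  \<comment> \<open>The roots of X^n - 1 that belong to neither factor; they make up
    \<open>h\<close>.\<close>
  define R where "R = unity_roots n - unity_roots a - primitive_roots n"
  define h where "h = (\<Prod>z\<in>R. [:- z, 1:] :: complex poly)"
  have n: "n > 0" using assms by simp
  have fin: "finite R" using finite_unity_roots[OF n] by (simp add: R_def)
  have U: "unity_roots n = unity_roots a \<union> (primitive_roots n \<union> R)"
    using assms(1) by (auto simp: R_def unity_roots_def primitive_roots_def power_mult elim!: dvdE)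
  have D: "unity_roots a \<inter> (primitive_roots n \<union> R) = {}" "primitive_roots n \<inter> R = {}"
    using assms(2,3) by (auto simp: R_def unity_roots_def primitive_roots_def)
  have "Polynomial.monom 1 n - 1 = (\<Prod>z\<in>unity_roots a \<union> (primitive_roots n \<union> R). [:- z, 1:])"
    by (simp only: prod_unity_roots[OF n, symmetric] U[symmetric])
  also have "\<dots> = (Polynomial.monom 1 a - 1) * (cyclotomic_poly n * h)"
    using finite_unity_roots[OF assms(2)] finite_primitive_roots[OF n] fin D
    by (simp add: prod.union_disjoint prod_unity_roots[OF assms(2)] cyclotomic_poly_eq h_def)
  finally have *: "Polynomial.monom 1 n - 1 = (Polynomial.monom 1 a - 1) * (cyclotomic_poly n * h)" .
  have "int_coeffs (cyclotomic_poly n * h)"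
  proof (rule int_coeffs_quotient)
    show "lead_coeff (Polynomial.monom 1 a - 1 :: complex poly) = 1"
      using monic_prod_linear[of "unity_roots a"] prod_unity_roots[OF assms(2)] by simp
  qed (simp_all only: int_coeffs_monom_minus_1 *[symmetric])
  then have "int_coeffs h"
    using int_coeffs_quotient[of "cyclotomic_poly n"] int_coeffs_cyclotomic[OF n]
    unfolding cyclotomic_poly_eq monic_prod_linear by blast
  then show ?thesis using * that by blast
qed

section \<open>The ring Z[\<epsilon>, 1/\<epsilon>] inside the complex numbers\<close>

definition laurent :: "complex \<Rightarrow> complex set" where
  "laurent \<epsilon> = generate_ring ring_of_type_algebra {\<epsilon>, inverse \<epsilon>}"

lemma laurent_1: "1 \<in> laurent \<epsilon>"
  using generate_ring.one[of ring_of_type_algebra] by (simp add: laurent_def ring_of_type_algebra_def)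

lemma laurent_add: "a \<in> laurent \<epsilon> \<Longrightarrow> b \<in> laurent \<epsilon> \<Longrightarrow> a + b \<in> laurent \<epsilon>"
  using generate_ring.eng_add[of a ring_of_type_algebra _ b]
  by (simp add: laurent_def ring_of_type_algebra_def)

lemma laurent_mult: "a \<in> laurent \<epsilon> \<Longrightarrow> b \<in> laurent \<epsilon> \<Longrightarrow> a * b \<in> laurent \<epsilon>"
  using generate_ring.eng_mult[of a ring_of_type_algebra _ b]
  by (simp add: laurent_def ring_of_type_algebra_def)

lemma laurent_uminus:
  assumes "a \<in> laurent \<epsilon>" shows "- a \<in> laurent \<epsilon>"
proof -
  interpret R: ring "ring_of_type_algebra :: complex ring" by (rule ring_from_type_algebra)
  have "- a = \<ominus>\<^bsub>ring_of_type_algebra\<^esub> a"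
    by (rule R.minus_equality[symmetric]) (auto simp: ring_of_type_algebra_def)
  then show ?thesis
    using generate_ring.a_inv[of a ring_of_type_algebra] assms by (simp add: laurent_def)
qed

lemma laurent_gen: "\<epsilon> \<in> laurent \<epsilon>" "inverse \<epsilon> \<in> laurent \<epsilon>"
  unfolding laurent_def by (auto intro: generate_ring.incl)

lemma laurent_0: "0 \<in> laurent \<epsilon>"
  using laurent_add[OF laurent_1 laurent_uminus[OF laurent_1]] by simp

lemma laurent_of_nat: "of_nat n \<in> laurent \<epsilon>"
  by (induction n) (auto intro: laurent_0 laurent_1 laurent_add)

lemma laurent_of_int: "z \<in> \<int> \<Longrightarrow> z \<in> laurent \<epsilon>"
proof -
  assume "z \<in> \<int>"
  then obtain k where z: "z = of_int k" by (rule Ints_cases)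
  show ?thesis
    unfolding z by (cases k rule: int_cases2) (simp_all add: laurent_of_nat laurent_uminus)
qed

lemma laurent_power: "a \<in> laurent \<epsilon> \<Longrightarrow> a ^ n \<in> laurent \<epsilon>"
  by (induction n) (auto intro: laurent_1 laurent_mult)

lemma laurent_sum: "(\<And>x. x \<in> A \<Longrightarrow> f x \<in> laurent \<epsilon>) \<Longrightarrow> (\<Sum>x\<in>A. f x) \<in> laurent \<epsilon>"
  by (induction A rule: infinite_finite_induct) (auto intro: laurent_0 laurent_add)

lemma laurent_poly: "int_coeffs h \<Longrightarrow> poly h \<epsilon> \<in> laurent \<epsilon>"
  unfolding poly_altdef int_coeffs_def
  by (intro laurent_sum laurent_mult laurent_power laurent_gen laurent_of_int) auto

text \<open>With q = \<epsilon>^2 the quotient (q^l - 1)/(q^e - 1) is the value at \<epsilon> of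
  (X^{2l} - 1)/(X^{2e} - 1), and 2e is a proper divisor of 2l. The number \<open>m\<close> will be
  the size of an orbit whose stabilizer is the multiplicative group of a field with q^e
  elements.\<close>

lemma orbit_size_cyclotomic:
  assumes "e dvd l" "0 < e" "e < l" "\<epsilon> ^ 2 = of_nat q" "q > 1" "m * (q ^ e - 1) = q ^ l - 1"
  obtains r where "r \<in> laurent \<epsilon>" "of_nat m = poly (cyclotomic_poly (2 * l)) \<epsilon> * r"
proof -
  obtain h where h: "int_coeffs h" and
    eq: "Polynomial.monom 1 (2*l) - 1 = (Polynomial.monom 1 (2*e) - 1) * (cyclotomic_poly (2 * l) * h)"
    by (rule cyclotomic_factor[of "2*e" "2*l"]) (use assms in auto)
  have "\<epsilon> ^ (2*l) - 1 = (\<epsilon> ^ (2*e) - 1) * (poly (cyclotomic_poly (2 * l)) \<epsilon> * poly h \<epsilon>)"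
    using arg_cong[OF eq, of "\<lambda>f. poly f \<epsilon>"] by (simp add: poly_monom)
  moreover have pw: "\<epsilon> ^ (2*k) = of_nat (q ^ k)" for k
    by (simp add: power_mult assms(4))
  moreover have sb: "complex_of_nat (q ^ k) - 1 = of_nat (q ^ k - 1)" for k
    using assms(5) by (simp add: of_nat_diff)
  ultimately have "complex_of_nat (q ^ l - 1)
      = of_nat (q ^ e - 1) * (poly (cyclotomic_poly (2 * l)) \<epsilon> * poly h \<epsilon>)"
    by simp
  also have "complex_of_nat (q ^ l - 1) = of_nat (q ^ e - 1) * of_nat m"
    using assms(6) by (metis mult.commute of_nat_mult)
  finally have "of_nat (q ^ e - 1) * of_nat m
      = complex_of_nat (q ^ e - 1) * (poly (cyclotomic_poly (2 * l)) \<epsilon> * poly h \<epsilon>)" .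
  moreover have "q ^ e > 1"
    using one_less_power[OF assms(5,2)] .
  then have "complex_of_nat (q ^ e - 1) \<noteq> 0"
    by (metis of_nat_eq_0_iff not_one_less_zero zero_less_diff not_gr_zero)
  ultimately have "of_nat m = poly (cyclotomic_poly (2 * l)) \<epsilon> * poly h \<epsilon>"
    by (simp only: mult_cancel_left) blast
  then show ?thesis using that laurent_poly[OF h] by blast
qed

text \<open>X^l + 1 is the full cofactor of X^l - 1 in X^{2l} - 1, and \<open>l\<close> is a proper
  divisor of \<open>2 * l\<close>. This is the source of the relation \<epsilon>^l = -1 in the
  coefficient ring.\<close>

lemma power_plus_1_cyclotomic:
  assumes "l > 0"
  obtains r where "r \<in> laurent \<epsilon>" "\<epsilon> ^ l + 1 = poly (cyclotomic_poly (2 * l)) \<epsilon> * r"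
proof -
  let ?X = "Polynomial.monom 1 l :: complex poly"
  obtain h where h: "int_coeffs h" and
    eq: "Polynomial.monom 1 (2*l) - 1 = (?X - 1) * (cyclotomic_poly (2 * l) * h)"
    by (rule cyclotomic_factor[of l "2*l"]) (use assms in auto)
  have "Polynomial.monom 1 (2*l) - 1 = (?X - 1) * (?X + 1)"
    by (simp add: algebra_simps mult_monom flip: mult_2_right)
  moreover have "?X - 1 \<noteq> 0"
    using monic_prod_linear[of "unity_roots l"] prod_unity_roots[OF assms]
    by (metis leading_coeff_0_iff zero_neq_one)
  ultimately have "?X + 1 = cyclotomic_poly (2 * l) * h"
    using eq by (metis mult_cancel_left)
  from arg_cong[OF this, of "\<lambda>f. poly f \<epsilon>"]
  have "\<epsilon> ^ l + 1 = poly (cyclotomic_poly (2 * l)) \<epsilon> * poly h \<epsilon>"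
    by (simp add: poly_monom)
  then show ?thesis using that laurent_poly[OF h] by blast
qed

section \<open>Finite fields and cardinalities of vector spaces\<close>

abbreviation subring_of :: "'k::field set \<Rightarrow> 'k ring" where
  "subring_of S \<equiv> ring_of_type_algebra\<lparr>carrier := S\<rparr>"

lemma ring_of_type_algebra_simps [simp]:
  "carrier ring_of_type_algebra = UNIV" "\<zero>\<^bsub>ring_of_type_algebra\<^esub> = 0" "\<one>\<^bsub>ring_of_type_algebra\<^esub> = 1"
  "a \<oplus>\<^bsub>ring_of_type_algebra\<^esub> b = a + b" "a \<otimes>\<^bsub>ring_of_type_algebra\<^esub> b = a * b"
  by (simp_all add: ring_of_type_algebra_def)

text \<open>Fields occur as subsets of one closure, so inclusions between them are inclusions of
  sets. Since \<open>inverse 0 = 0\<close>, inverses need no exception at zero, and zero itself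
  arises as \<open>1 + - 1\<close>.\<close>

definition is_subfield :: "'k::field set \<Rightarrow> bool" where
  "is_subfield S \<longleftrightarrow> 1 \<in> S \<and> (\<forall>a\<in>S. \<forall>b\<in>S. a + b \<in> S \<and> a * b \<in> S) \<and> (\<forall>a\<in>S. - a \<in> S \<and> inverse a \<in> S)"

lemma is_subfieldD:
  assumes "is_subfield S"
  shows "1 \<in> S" "0 \<in> S" "a \<in> S \<Longrightarrow> b \<in> S \<Longrightarrow> a + b \<in> S" "a \<in> S \<Longrightarrow> b \<in> S \<Longrightarrow> a * b \<in> S"
    "a \<in> S \<Longrightarrow> - a \<in> S" "a \<in> S \<Longrightarrow> inverse a \<in> S"
proof -
  show "0 \<in> S" using assms unfolding is_subfield_def by (metis add.right_inverse)
qed (use assms in \<open>auto simp: is_subfield_def\<close>)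

lemma field_subring_of:
  assumes "is_subfield S"
  shows "field (subring_of S)"
proof -
  note S = is_subfieldD[OF assms]
  have "cring (subring_of S)"
  proof (intro cringI abelian_groupI comm_monoidI)
    fix x assume "x \<in> carrier (subring_of S)"
    then show "\<exists>y\<in>carrier (subring_of S). y \<oplus>\<^bsub>subring_of S\<^esub> x = \<zero>\<^bsub>subring_of S\<^esub>"
      using S(5)[of x] by (simp add: bexI[of _ "- x"])
  qed (use S in \<open>simp_all add: algebra_simps\<close>)
  then show ?thesis
  proof (rule cring.cring_fieldI)
    show "Units (subring_of S) = carrier (subring_of S) - {\<zero>\<^bsub>subring_of S\<^esub>}"
    proof (intro equalityI subsetI)
      fix a assume "a \<in> Units (subring_of S)"
      then show "a \<in> carrier (subring_of S) - {\<zero>\<^bsub>subring_of S\<^esub>}"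
        by (clarsimp simp: Units_def)
    next
      fix a assume "a \<in> carrier (subring_of S) - {\<zero>\<^bsub>subring_of S\<^esub>}"
      then have "a \<in> S" "a \<noteq> 0" by auto
      then show "a \<in> Units (subring_of S)"
        using S(6)[of a] by (auto simp: Units_def intro!: bexI[of _ "inverse a"])
    qed
  qed
qed

text \<open>The numbers \<open>Q\<close> for which x -> x^Q is a power of Frobenius; the positive
  exponent keeps \<open>Q\<close> above 1.\<close>

definition char_power :: "'k::alg_closed_field itself \<Rightarrow> nat \<Rightarrow> bool" where
  "char_power T Q \<longleftrightarrow> prime CHAR('k) \<and> (\<exists>n>0. Q = CHAR('k) ^ n)"

lemma char_power_gt_1: "char_power TYPE('k::alg_closed_field) Q \<Longrightarrow> Q > 1"
  unfolding char_power_def by (metis one_less_power prime_gt_1_nat)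

lemma char_power_power: "char_power TYPE('k::alg_closed_field) Q \<Longrightarrow> d > 0 \<Longrightarrow> char_power TYPE('k) (Q ^ d)"
  unfolding char_power_def by (metis nat_0_less_mult_iff power_mult)

abbreviation GFset :: "nat \<Rightarrow> 'k::alg_closed_field set" where
  "GFset Q \<equiv> {x. x ^ Q = x}"

lemma GF_eq: "GF Q = subring_of (GFset Q)"
  by (simp add: GF_def)

lemma GF_simps [simp]:
  "\<one>\<^bsub>GF Q\<^esub> = 1" "a \<oplus>\<^bsub>GF Q\<^esub> b = a + b" "a \<otimes>\<^bsub>GF Q\<^esub> b = a * b"
  unfolding GF_eq by simp_all

lemma is_subfield_GFset:
  assumes "char_power TYPE('k::alg_closed_field) Q"
  shows "is_subfield (GFset Q :: 'k set)"
proof -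
  have add: "(x + y :: 'k) ^ Q = x ^ Q + y ^ Q" for x y
    using assms unfolding char_power_def by (auto intro: freshmans_dream')
  have "(- x :: 'k) ^ Q = - (x ^ Q)" for x
    using add[of x "- x"] char_power_gt_1[OF assms]
    by (simp add: eq_neg_iff_add_eq_0 add.commute power_0_left)
  then show ?thesis
    unfolding is_subfield_def by (auto simp: add power_mult_distrib power_inverse)
qed

lemma GFset_mono: "GFset Q \<subseteq> (GFset (Q ^ d) :: 'k::alg_closed_field set)"
proof -
  have "x ^ (Q ^ d) = x" if "x ^ Q = x" for x :: 'k
    using that by (induction d) (simp_all add: power_mult)
  then show ?thesis by auto
qed

lemma GFset_dvd_mono: "d dvd e \<Longrightarrow> GFset (Q ^ d) \<subseteq> (GFset (Q ^ e) :: 'k::alg_closed_field set)"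
proof -
  assume "d dvd e"
  then obtain c where "e = d * c" ..
  then show ?thesis using GFset_mono[of "Q ^ d" c] by (simp only: power_mult)
qed

text \<open>X^Q - X has derivative -1, because \<open>Q\<close> vanishes in the field, so it has no
  multiple root; over an algebraically closed field it splits and thus has exactly \<open>Q\<close>
  distinct roots.\<close>

lemma card_GFset:
  assumes "char_power TYPE('k::alg_closed_field) Q"
  shows "finite (GFset Q :: 'k set)" "card (GFset Q :: 'k set) = Q"
proof -
  define f where "f = Polynomial.monom 1 Q - ([:0, 1:] :: 'k poly)"
  have Q: "Q > 1" by (rule char_power_gt_1[OF assms])
  have roots: "poly f x = 0 \<longleftrightarrow> x \<in> GFset Q" for x
    by (simp add: f_def poly_monom)
  have deg: "degree f = Q"
    using Q degree_add_eq_left[of "- [:0, 1:]" "Polynomial.monom 1 Q :: 'k poly"]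
    by (simp only: f_def degree_monom_eq flip: diff_conv_add_uminus) (simp add: degree_monom_eq)
  have "(of_nat Q :: 'k) = 0"
    using assms unfolding char_power_def by (auto simp: of_nat_CHAR)
  then have der: "poly (pderiv f) x = -1" for x
    by (simp add: f_def pderiv_diff pderiv_monom pderiv_pCons poly_monom)
  have f0: "f \<noteq> 0" using deg Q by auto
  obtain A where A: "size A = degree f" "f = smult (lead_coeff f) (\<Prod>x\<in>#A. [:-x, 1:])"
    using alg_closed_imp_factorization[OF f0] by blast
  have count: "count A x = 1" if "x \<in># A" for x
  proof (rule ccontr)
    assume "count A x \<noteq> 1"
    have "count A x \<ge> 2"
      using \<open>count A x \<noteq> 1\<close> that by (metis count_greater_eq_one_iff le_neq_implies_less Suc_1 Suc_leI)
    then have "{#x, x#} \<subseteq># A"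
      by (auto simp: subseteq_mset_def)
    then obtain B where B: "A = {#x, x#} + B"
      by (metis subset_mset.le_iff_add)
    define g where "g = smult (lead_coeff f) (\<Prod>x\<in>#B. [:-x, 1:])"
    have "f = [:-x, 1:] * ([:-x, 1:] * g)"
      by (subst A(2)) (simp only: g_def B image_mset_union prod_mset.union mult_smult_right
            image_mset_add_mset prod_mset.add_mset image_mset_empty prod_mset.empty mult_1_right mult.assoc)
    then have "poly (pderiv f) x = 0"
      by (simp only: pderiv_mult poly_add poly_mult) simp
    then show False using der by simp
  qed
  have "poly f x = 0 \<longleftrightarrow> x \<in># A" for x
    by (subst A(2)) (use f0 in \<open>auto simp: poly_prod_mset prod_mset_zero_iff image_iff\<close>)
  then have eq: "GFset Q = set_mset A" using roots by blast
  show "finite (GFset Q :: 'k set)" unfolding eq by simp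
  have "size A = card (set_mset A)"
    unfolding size_multiset_overloaded_eq using count by simp
  then show "card (GFset Q :: 'k set) = Q" unfolding eq using A(1) deg by simp
qed

text \<open>Renumbers coordinates: a basis is indexed by its own vectors, whereas
  \<open>std_space\<close> uses initial segments of the natural numbers.\<close>

lemma (in cring) func_space_reindex:
  assumes c: "bij_betw c B S"
  defines "r \<equiv> \<lambda>a. \<lambda>v\<in>B. a (c v)"
  shows "r \<in> module_hom R (func_space S) (func_space B)"
    "bij_betw r (carrier (func_space S)) (carrier (func_space B))"
proof -
  have cS: "c v \<in> S" if "v \<in> B" for v using c that by (auto simp: bij_betw_def)
  show "r \<in> module_hom R (func_space S) (func_space B)"
    using cS by (auto simp: module_hom_def func_space_def r_def PiE_mem intro!: restrict_ext)
  show "bij_betw r (carrier (func_space S)) (carrier (func_space B))"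
  proof (rule bij_betw_imageI)
    show "inj_on r (carrier (func_space S))"
    proof (rule inj_onI)
      fix a a' assume a: "a \<in> carrier (func_space S)" "a' \<in> carrier (func_space S)" and eq: "r a = r a'"
      show "a = a'"
      proof (rule extensionalityI[of _ S])
        fix m assume "m \<in> S"
        then obtain v where v: "v \<in> B" "m = c v" using c by (auto simp: bij_betw_def)
        then show "a m = a' m" using fun_cong[OF eq, of v] by (simp add: r_def)
      qed (use a in \<open>auto simp: func_space_def PiE_def\<close>)
    qed
    show "r ` carrier (func_space S) = carrier (func_space B)"
    proof (intro equalityI subsetI)
      fix a assume a: "a \<in> carrier (func_space B)"
      define a' where "a' = (\<lambda>m\<in>S. a (inv_into B c m))"
      have "r a' = a"
      proof (rule extensionalityI[of _ B])
        fix v assume "v \<in> B"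
        then show "r a' v = a v"
          using cS c by (simp add: r_def a'_def bij_betw_inv_into_left)
      qed (use a in \<open>auto simp: func_space_def PiE_def r_def\<close>)
      moreover have "inv_into B c m \<in> B" if "m \<in> S" for m
        using c that by (simp add: bij_betw_def inv_into_into)
      then have "a' \<in> carrier (func_space S)"
        using a by (auto simp: func_space_def a'_def)
      ultimately show "a \<in> r ` carrier (func_space S)" by blast
    qed (use cS in \<open>auto simp: func_space_def r_def\<close>)
  qed
qed

lemma module_hom_comp:
  "f \<in> module_hom R M N \<Longrightarrow> g \<in> module_hom R N P \<Longrightarrow> (\<lambda>x. g (f x)) \<in> module_hom R M P"
  unfolding module_hom_def by (auto simp: Pi_iff)

lemma vectorspace_basis_iso:
  assumes V: "vectorspace K V" and fin: "finite (carrier V)"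
  obtains g where "g \<in> module_hom K (ring.func_space K {..<vectorspace.dim K V}) V"
    "bij_betw g (carrier (ring.func_space K {..<vectorspace.dim K V})) (carrier V)"
proof -
  interpret V: vectorspace K V by fact
  \<comment> \<open>The finite carrier is itself a spanning set.\<close>
  have "V.fin_dim"
    unfolding V.fin_dim_def using fin V.in_own_span[of "carrier V"] V.span_is_subset2[of "carrier V"]
    by (intro exI[of _ "carrier V"]) auto
  then obtain B where B: "finite B" "V.basis B" using V.finite_basis_exists by blast
  have BV: "B \<subseteq> carrier V" using B(2) by (simp add: V.basis_def)
  obtain b where b: "bij_betw b B {..<V.dim}"
    using ex_bij_betw_finite_nat[OF B(1)] V.dim_basis[OF B] by (auto simp: atLeast0LessThan)
  interpret L: mod_hom K "V.func_space B" V "\<lambda>a. V.lincomb a B"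
    by (rule V.lincomb_is_mod_hom[OF B(1) BV])
  have lin: "bij_betw (\<lambda>a. V.lincomb a B) (carrier (V.func_space B)) (carrier V)"
  proof -
    have uniq: "\<exists>!a. a \<in> B \<rightarrow>\<^sub>E carrier K \<and> V.lincomb a B = v" if "v \<in> carrier V" for v
      using B(2) that unfolding V.basis_criterion[OF B(1) BV] by blast
    have car: "carrier (V.func_space B) = B \<rightarrow>\<^sub>E carrier K"
      by (simp add: V.func_space_def)
    have im: "V.lincomb a B \<in> carrier V" if "a \<in> B \<rightarrow>\<^sub>E carrier K" for a
      using L.f_im[of a] that car by simp
    show ?thesis
      unfolding bij_betw_def inj_on_def car
    proof (intro conjI ballI impI equalityI subsetI)
      fix a a' assume "a \<in> B \<rightarrow>\<^sub>E carrier K" "a' \<in> B \<rightarrow>\<^sub>E carrier K" "V.lincomb a B = V.lincomb a' B"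
      then show "a = a'" using uniq[OF im[of a]] by metis
    next
      fix v assume "v \<in> (\<lambda>a. V.lincomb a B) ` (B \<rightarrow>\<^sub>E carrier K)"
      then show "v \<in> carrier V" using im by blast
    next
      fix v assume "v \<in> carrier V"
      from uniq[OF this] show "v \<in> (\<lambda>a. V.lincomb a B) ` (B \<rightarrow>\<^sub>E carrier K)"
        by blast
    qed
  qed
  note r = V.func_space_reindex[OF b]
  show ?thesis
  proof (rule that)
    show "bij_betw (\<lambda>a. V.lincomb (\<lambda>v\<in>B. a (b v)) B) (carrier (V.func_space {..<V.dim})) (carrier V)"
      using bij_betw_trans[OF r(2) lin] by (simp add: o_def)
  qed (rule module_hom_comp[OF r(1) L.f_hom])
qed

text \<open>Dimension is read off from the cardinality, which does not depend on the field of
  scalars and so is the common measure for dimensions over F_q and F_{q^l}.\<close>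

lemma vectorspace_card:
  assumes "vectorspace K V" "finite (carrier V)"
  shows "card (carrier V) = card (carrier K) ^ vectorspace.dim K V"
proof -
  interpret V: vectorspace K V by fact
  obtain g where "bij_betw g (carrier (V.func_space {..<V.dim})) (carrier V)"
    using vectorspace_basis_iso[OF assms] by blast
  from bij_betw_same_card[OF this] show ?thesis
    by (simp add: V.func_space_def card_PiE)
qed

section \<open>Subspaces of a field over its subfields\<close>

definition K_closed :: "'k::field set \<Rightarrow> 'k set \<Rightarrow> bool" where
  "K_closed K M \<longleftrightarrow> 0 \<in> M \<and> (\<forall>a\<in>M. \<forall>b\<in>M. a + b \<in> M) \<and> (\<forall>c\<in>K. \<forall>a\<in>M. c * a \<in> M)"

lemma card_K_closed:
  assumes K: "is_subfield (K :: 'k::field set)" and M: "K_closed K M" "finite M"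
  obtains d where "card M = card K ^ d"
proof -
  define V :: "('k, 'k) module" where "V = \<lparr>carrier = M, monoid.mult = (*), monoid.one = 1, ring.zero = 0,
    ring.add = (+), module.smult = (*)\<rparr>"
  note KD = is_subfieldD[OF K]
  have "module (subring_of K) V"
  proof (rule module_criteria)
    show "cring (subring_of K)" using field_subring_of[OF K] fieldE(1) by blast
    have "- v \<in> M" if "v \<in> M" for v
      using M(1) KD(1,5) that unfolding K_closed_def by (metis mult_minus1)
    then show "\<forall>v\<in>carrier V. \<exists>neg_v\<in>carrier V. v \<oplus>\<^bsub>V\<^esub> neg_v = \<zero>\<^bsub>V\<^esub>"
      by (auto simp: V_def intro!: bexI[of _ "- _"])
  qed (use M(1) in \<open>auto simp: V_def K_closed_def algebra_simps\<close>)
  then have "vectorspace (subring_of K) V"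
    using field_subring_of[OF K] by (simp add: vectorspace_def)
  then have "card M = card K ^ vectorspace.dim (subring_of K) V"
    using vectorspace_card[of "subring_of K" V] M(2) by (simp add: V_def)
  then show ?thesis by (rule that)
qed

text \<open>A vector space over both fields has a cardinality that is a power of Q^a and of Q^b, so
  its exponent over \<open>Q\<close> is a common multiple of \<open>a\<close> and \<open>b\<close>.
  It is positive because \<open>M\<close> contains 0 and 1, hence it is at least the
  \<open>lcm\<close>, and \<open>M\<close> fills the field. Closure under sums and scalars fits sets
  of scalars defined by a linear condition; the lemma serves for the field of an arrow and for the
  fixed points of scaling.\<close>

lemma GFset_compositum:
  assumes Q: "char_power TYPE('k::alg_closed_field) Q" and "a > 0" "b > 0"
    and M: "M \<subseteq> (GFset (Q ^ lcm a b) :: 'k set)" "1 \<in> M"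
      "K_closed (GFset (Q ^ a)) M" "K_closed (GFset (Q ^ b)) M"
  shows "M = GFset (Q ^ lcm a b)"
proof -
  have pos: "lcm a b > 0" using assms by (simp add: lcm_pos_nat)
  note C = card_GFset[OF char_power_power[OF Q]]
  have fin: "finite M" by (rule finite_subset[OF M(1) C(1)[OF pos]])
  obtain x where x: "card M = card (GFset (Q ^ a) :: 'k set) ^ x"
    by (rule card_K_closed[OF is_subfield_GFset[OF char_power_power[OF Q]] M(3) fin]) (use assms in auto)
  obtain y where y: "card M = card (GFset (Q ^ b) :: 'k set) ^ y"
    by (rule card_K_closed[OF is_subfield_GFset[OF char_power_power[OF Q]] M(4) fin]) (use assms in auto)
  have x: "card M = Q ^ (a * x)" and y: "card M = Q ^ (b * y)"
    using x y C(2) assms(2,3) by (simp_all add: power_mult)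
  have Q1: "Q > 1" by (rule char_power_gt_1[OF Q])
  have "a * x = b * y" using x y Q1 by (metis power_inject_exp)
  then have "lcm a b dvd a * x" by (metis dvd_triv_left lcm_least)
  moreover have "a * x \<noteq> 0"
  proof
    assume "a * x = 0"
    then have "card M = 1" using x by simp
    moreover have "{0, 1} \<subseteq> M" using M by (auto simp: K_closed_def)
    ultimately show False using card_mono[OF fin, of "{0, 1}"] by simp
  qed
  ultimately have "lcm a b \<le> a * x" by (intro dvd_imp_le) simp_all
  then have "card (GFset (Q ^ lcm a b) :: 'k set) \<le> card M"
    using Q1 x C(2)[OF pos] by simp
  then show ?thesis
    using M(1) C(1)[OF pos] by (metis card_seteq)
qed

section \<open>Tensor products\<close>

text \<open>Fields are passed as sets, so one locale covers every arrow over both base fields.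
  Tensors are cosets, and equality of tensors is membership of a difference of representatives in
  \<open>null\<close>.\<close>

locale scalar_extension =
  fixes L K :: "'k::field set" and V :: "('k, 'v) module"
  assumes L: "is_subfield L" and K: "is_subfield K" and KL: "K \<subseteq> L"
    and V: "module (subring_of K) V"
begin

sublocale V: module "subring_of K" V by (rule V)

abbreviation S :: "('k \<times> 'v) set" where "S \<equiv> L \<times> carrier V"
abbreviation null :: "('k, 'v) tens" where "null \<equiv> tensor_null (subring_of L) (subring_of K) V"
abbreviation cls :: "('k \<times> 'v \<Rightarrow>\<^sub>0 int) \<Rightarrow> ('k, 'v) tens" where
  "cls \<equiv> tensor_class (subring_of L) (subring_of K) V"
abbreviation T :: "('k, ('k, 'v) tens) module" where "T \<equiv> tensor (subring_of L) (subring_of K) V"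

lemmas LD = is_subfieldD[OF L] and KD = is_subfieldD[OF K]

lemma tensor_free_eq: "tensor_free (subring_of L) V = free_Abelian_group S"
  by (simp add: tensor_free_def)

lemma keys_diffI: "Poly_Mapping.keys x \<subseteq> A \<Longrightarrow> Poly_Mapping.keys y \<subseteq> A \<Longrightarrow> Poly_Mapping.keys (x - y :: 'c \<Rightarrow>\<^sub>0 int) \<subseteq> A"
  using keys_diff[of x y] by blast

lemma keys_addI: "Poly_Mapping.keys x \<subseteq> A \<Longrightarrow> Poly_Mapping.keys y \<subseteq> A \<Longrightarrow> Poly_Mapping.keys (x + y :: 'c \<Rightarrow>\<^sub>0 int) \<subseteq> A"
  using keys_add[of x y] by blast

lemma relators_keys: "r \<in> tensor_relators (subring_of L) (subring_of K) V \<Longrightarrow> Poly_Mapping.keys r \<subseteq> S"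
proof -
  assume "r \<in> tensor_relators (subring_of L) (subring_of K) V"
  then consider
      c b v where "c \<in> L" "b \<in> L" "v \<in> carrier V" "r = frag_of (c + b, v) - frag_of (c, v) - frag_of (b, v)"
    | c v w where "c \<in> L" "v \<in> carrier V" "w \<in> carrier V" "r = frag_of (c, v \<oplus>\<^bsub>V\<^esub> w) - frag_of (c, v) - frag_of (c, w)"
    | b c v where "b \<in> L" "c \<in> K" "v \<in> carrier V" "r = frag_of (b * c, v) - frag_of (b, c \<odot>\<^bsub>V\<^esub> v)"
    unfolding tensor_relators_def by auto
  then show ?thesis
  proof cases
    case 1
    show ?thesis unfolding 1(4) by (intro keys_diffI) (use 1 LD(3) in auto)
  next
    case 2
    show ?thesis unfolding 2(4) by (intro keys_diffI) (use 2 in auto)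
  next
    case 3
    then have "c \<in> L" using KL by auto
    show ?thesis unfolding 3(4) by (intro keys_diffI) (use 3 \<open>c \<in> L\<close> LD(4) in auto)
  qed
qed

lemma null_subgroup: "subgroup null (free_Abelian_group S)"
  unfolding tensor_null_def tensor_free_eq
  by (rule group.generate_is_subgroup) (use relators_keys in auto)

lemma null_normal: "null \<lhd> free_Abelian_group S"
  using comm_group.normal_iff_subgroup[OF abelian_free_Abelian_group] null_subgroup by blast

lemma null_keys: "z \<in> null \<Longrightarrow> Poly_Mapping.keys z \<subseteq> S"
  using subgroup.mem_carrier[OF null_subgroup] by simp

lemma null_zero: "0 \<in> null"
  using subgroup.one_closed[OF null_subgroup] by simp

lemma null_add: "z \<in> null \<Longrightarrow> w \<in> null \<Longrightarrow> z + w \<in> null"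
  using subgroup.m_closed[OF null_subgroup] by simp

lemma null_minus: "z \<in> null \<Longrightarrow> - z \<in> null"
  using subgroup.m_inv_closed[OF null_subgroup, of z] null_keys by simp

lemma null_diff: "z \<in> null \<Longrightarrow> w \<in> null \<Longrightarrow> z - w \<in> null"
  using null_add[OF _ null_minus, of z w] by simp

text \<open>\<open>generate\<close> is phrased with the operations of the group
  \<open>tensor_free\<close>; here they are turned into \<open>+\<close> and \<open>-\<close> of
  finitely supported integer functions.\<close>

lemma null_induct [consumes 1, case_names rel minus add zero]:
  assumes "z \<in> null"
    and "\<And>r. r \<in> tensor_relators (subring_of L) (subring_of K) V \<Longrightarrow> P r"
    and "\<And>z. z \<in> null \<Longrightarrow> P z \<Longrightarrow> P (- z)"
    and "\<And>z w. z \<in> null \<Longrightarrow> w \<in> null \<Longrightarrow> P z \<Longrightarrow> P w \<Longrightarrow> P (z + w)" and "P 0"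
  shows "P z"
  using assms(1) unfolding tensor_null_def
proof (induction rule: generate.induct)
  case (inv h)
  then have "h \<in> null" unfolding tensor_null_def by (rule generate.incl)
  moreover have "inv\<^bsub>tensor_free (subring_of L) V\<^esub> h = - h"
    unfolding tensor_free_eq by (rule inv_free_Abelian_group) (rule relators_keys[OF inv])
  ultimately show ?case using assms(2,3) inv by simp
next
  case (eng h1 h2)
  then show ?case using assms(4)[of h1 h2] by (simp add: tensor_null_def tensor_free_eq)
qed (use assms in \<open>auto simp: tensor_free_eq\<close>)

lemma relators_null: "r \<in> tensor_relators (subring_of L) (subring_of K) V \<Longrightarrow> r \<in> null"
  unfolding tensor_null_def by (rule generate.incl)

lemma cls_eq: "cls z = (\<lambda>n. n + z) ` null"
  unfolding tensor_class_def tensor_free_eq r_coset_def by (auto simp: image_iff)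

lemma cls_memI: "z \<in> cls z"
  unfolding cls_eq using null_zero by (metis add_0 image_eqI)

lemma cls_eq_iff: "cls z = cls w \<longleftrightarrow> z - w \<in> null"
proof
  assume "cls z = cls w"
  then have "z \<in> cls w" using cls_memI by blast
  then show "z - w \<in> null" unfolding cls_eq by auto
next
  assume *: "z - w \<in> null"
  show "cls z = cls w"
  proof (intro equalityI subsetI)
    fix x assume "x \<in> cls z"
    then have "x - z \<in> null" unfolding cls_eq by auto
    then have "x - w \<in> null" using null_add[OF _ *, of "x - z"] by simp
    then show "x \<in> cls w" unfolding cls_eq by (metis diff_add_cancel image_eqI)
  next
    fix x assume "x \<in> cls w"
    then have "x - w \<in> null" unfolding cls_eq by auto
    then have "x - z \<in> null" using null_diff[OF _ *, of "x - w"] by simp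
    then show "x \<in> cls z" unfolding cls_eq by (metis diff_add_cancel image_eqI)
  qed
qed

lemma cls_mem_iff: "z' \<in> cls z \<longleftrightarrow> z' - z \<in> null"
  unfolding cls_eq by (auto simp: image_iff intro: bexI[of _ "z' - z"])

lemma carrier_T: "carrier T = cls ` {z. Poly_Mapping.keys z \<subseteq> S}"
proof -
  have "carrier T = rcosets\<^bsub>free_Abelian_group S\<^esub> null"
    by (simp add: tensor_def Let_def tensor_free_eq FactGroup_def)
  also have "\<dots> = (\<Union>z\<in>{z. Poly_Mapping.keys z \<subseteq> S}. {cls z})"
    unfolding RCOSETS_def tensor_class_def tensor_free_eq by (intro SUP_cong) auto
  also have "\<dots> = cls ` {z. Poly_Mapping.keys z \<subseteq> S}" by blast
  finally show ?thesis .
qed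

lemma carrier_T_E:
  assumes "Z \<in> carrier T" obtains z where "Poly_Mapping.keys z \<subseteq> S" "Z = cls z"
  using assms unfolding carrier_T by blast

lemma cls_carrier: "Poly_Mapping.keys z \<subseteq> S \<Longrightarrow> cls z \<in> carrier T"
  unfolding carrier_T by blast

lemma add_T: "Poly_Mapping.keys z \<subseteq> S \<Longrightarrow> Poly_Mapping.keys w \<subseteq> S \<Longrightarrow> cls z \<oplus>\<^bsub>T\<^esub> cls w = cls (z + w)"
  unfolding tensor_def Let_def tensor_class_def tensor_free_eq
  using normal.rcos_sum[OF null_normal, of z w] by (simp add: FactGroup_def)

lemma smult_T_def: "a \<odot>\<^bsub>T\<^esub> Z = (\<Union>z\<in>Z. cls (frag_extend (\<lambda>(b, v). frag_of (a * b, v)) z))"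
  unfolding tensor_def Let_def by simp

lemma pure_add_left: "a \<in> L \<Longrightarrow> b \<in> L \<Longrightarrow> v \<in> carrier V \<Longrightarrow>
    cls (frag_of (a + b, v)) = cls (frag_of (a, v) + frag_of (b, v))"
  unfolding cls_eq_iff diff_diff_eq[symmetric]
  by (rule relators_null, unfold tensor_relators_def, rule UnI1, rule UnI1, rule CollectI,
      rule exI[of _ a], rule exI[of _ b], rule exI[of _ v]) simp

lemma pure_add_right: "a \<in> L \<Longrightarrow> v \<in> carrier V \<Longrightarrow> w \<in> carrier V \<Longrightarrow>
    cls (frag_of (a, v \<oplus>\<^bsub>V\<^esub> w)) = cls (frag_of (a, v) + frag_of (a, w))"
  unfolding cls_eq_iff diff_diff_eq[symmetric]
  by (rule relators_null, unfold tensor_relators_def, rule UnI1, rule UnI2, rule CollectI,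
      rule exI[of _ a], rule exI[of _ v], rule exI[of _ w]) simp

lemma pure_balanced: "a \<in> L \<Longrightarrow> c \<in> K \<Longrightarrow> v \<in> carrier V \<Longrightarrow>
    cls (frag_of (a * c, v)) = cls (frag_of (a, c \<odot>\<^bsub>V\<^esub> v))"
  unfolding cls_eq_iff
  by (rule relators_null, unfold tensor_relators_def, rule UnI2, rule CollectI,
      rule exI[of _ a], rule exI[of _ c], rule exI[of _ v]) simp

text \<open>The map \<beta> extends additively from the free abelian group, kills every relator and
  so is constant on cosets. It is stated for additive maps into any abelian group: its purpose is to
  show that a map defined through lifts does not depend on the lift.\<close>

lemma tensor_universal:
  assumes N: "abelian_group N"
    and cl: "\<And>a v. a \<in> L \<Longrightarrow> v \<in> carrier V \<Longrightarrow> \<beta> a v \<in> carrier N"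
    and al: "\<And>a b v. a \<in> L \<Longrightarrow> b \<in> L \<Longrightarrow> v \<in> carrier V \<Longrightarrow> \<beta> (a + b) v = \<beta> a v \<oplus>\<^bsub>N\<^esub> \<beta> b v"
    and ar: "\<And>a v w. a \<in> L \<Longrightarrow> v \<in> carrier V \<Longrightarrow> w \<in> carrier V \<Longrightarrow> \<beta> a (v \<oplus>\<^bsub>V\<^esub> w) = \<beta> a v \<oplus>\<^bsub>N\<^esub> \<beta> a w"
    and ba: "\<And>a c v. a \<in> L \<Longrightarrow> c \<in> K \<Longrightarrow> v \<in> carrier V \<Longrightarrow> \<beta> (a * c) v = \<beta> a (c \<odot>\<^bsub>V\<^esub> v)"
  obtains F where "F \<in> carrier T \<rightarrow> carrier N"
    "\<And>Z W. Z \<in> carrier T \<Longrightarrow> W \<in> carrier T \<Longrightarrow> F (Z \<oplus>\<^bsub>T\<^esub> W) = F Z \<oplus>\<^bsub>N\<^esub> F W"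
    "\<And>a v. a \<in> L \<Longrightarrow> v \<in> carrier V \<Longrightarrow> F (cls (frag_of (a, v))) = \<beta> a v"
proof -
  interpret N: abelian_group N by fact
  obtain h where h: "h \<in> hom (free_Abelian_group S) (add_monoid N)"
    and hf: "\<And>x. x \<in> S \<Longrightarrow> h (frag_of x) = (\<lambda>(a, v). \<beta> a v) x"
  proof (rule comm_group.free_Abelian_group_universal[OF N.a_comm_group])
    show "(\<lambda>(a, v). \<beta> a v) ` S \<subseteq> carrier (add_monoid N)" using cl by auto
  qed blast
  have hc: "h z \<in> carrier N" if "Poly_Mapping.keys z \<subseteq> S" for z
    using hom_in_carrier[OF h, of z] that by simp
  have ha: "h (z + w) = h z \<oplus>\<^bsub>N\<^esub> h w" if "Poly_Mapping.keys z \<subseteq> S" "Poly_Mapping.keys w \<subseteq> S" for z w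
    using hom_mult[OF h, of z w] that by simp
  have h0: "h 0 = \<zero>\<^bsub>N\<^esub>"
  proof -
    have "h 0 \<oplus>\<^bsub>N\<^esub> h 0 = h 0" using ha[of 0 0, symmetric] by simp
    then show ?thesis using N.add.l_cancel_one[of "h 0" "h 0"] hc[of 0] by simp
  qed
  have hm: "h (- z) = \<ominus>\<^bsub>N\<^esub> h z" if "Poly_Mapping.keys z \<subseteq> S" for z
    using ha[of "- z" z] h0 hc[of z] hc[of "- z"] that by (simp add: N.minus_equality)
  have hd: "h (z - w) = h z \<ominus>\<^bsub>N\<^esub> h w" if "Poly_Mapping.keys z \<subseteq> S" "Poly_Mapping.keys w \<subseteq> S" for z w
    using ha[of z "- w"] hm[of w] that by (simp add: N.minus_eq)
  have hn: "h z = \<zero>\<^bsub>N\<^esub>" if "z \<in> null" for z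
    using that
  proof (induction rule: null_induct)
    case (rel r)
    have sub: "h (frag_of x - frag_of y - frag_of z) = \<zero>\<^bsub>N\<^esub>"
      if "x \<in> S" "y \<in> S" "z \<in> S" "h (frag_of x) = h (frag_of y) \<oplus>\<^bsub>N\<^esub> h (frag_of z)" for x y z
    proof -
      have c: "h (frag_of y) \<in> carrier N" "h (frag_of z) \<in> carrier N"
        using that by (auto intro!: hc)
      have "h (frag_of x - frag_of y - frag_of z) = h (frag_of x) \<ominus>\<^bsub>N\<^esub> h (frag_of y) \<ominus>\<^bsub>N\<^esub> h (frag_of z)"
        using that(1-3) by (simp add: hd keys_diffI)
      also have "\<dots> = \<zero>\<^bsub>N\<^esub>"
      proof -
        have "h (frag_of y) \<oplus>\<^bsub>N\<^esub> h (frag_of z) \<oplus>\<^bsub>N\<^esub> \<ominus>\<^bsub>N\<^esub> h (frag_of y) = h (frag_of z)"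
          using c N.a_comm[of "h (frag_of y)" "h (frag_of z)"] by (simp add: N.a_assoc N.r_neg)
        then show ?thesis unfolding that(4) N.minus_eq using c by (simp add: N.r_neg)
      qed
      finally show ?thesis .
    qed
    from rel consider
      a b v where "a \<in> L" "b \<in> L" "v \<in> carrier V" "r = frag_of (a + b, v) - frag_of (a, v) - frag_of (b, v)"
    | a v w where "a \<in> L" "v \<in> carrier V" "w \<in> carrier V" "r = frag_of (a, v \<oplus>\<^bsub>V\<^esub> w) - frag_of (a, v) - frag_of (a, w)"
    | a c v where "a \<in> L" "c \<in> K" "v \<in> carrier V" "r = frag_of (a * c, v) - frag_of (a, c \<odot>\<^bsub>V\<^esub> v)"
      unfolding tensor_relators_def by auto
    then show ?case
    proof cases
      case 1
      then have "a + b \<in> L" using LD(3) by blast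
      then show ?thesis unfolding 1(4) using 1(1-3) by (intro sub) (simp_all add: hf al)
    next
      case 2
      then have "v \<oplus>\<^bsub>V\<^esub> w \<in> carrier V" by blast
      then show ?thesis unfolding 2(4) using 2(1-3) by (intro sub) (simp_all add: hf ar)
    next
      case 3
      have "a * c \<in> L" using 3 LD(4) KL by blast
      moreover have "c \<odot>\<^bsub>V\<^esub> v \<in> carrier V" using 3 V.smult_closed[of c v] by simp
      ultimately show ?thesis
        unfolding 3(4) using 3(1-3) cl[of a "c \<odot>\<^bsub>V\<^esub> v"] by (subst hd) (simp_all add: hf ba N.minus_eq N.r_neg)
    qed
  next
    case (minus z)
    then show ?case using hm[OF null_keys] by simp
  next
    case (add z w)
    then show ?case using ha[OF null_keys null_keys] by simp
  qed (rule h0)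
  have hcls: "h z = h w" if "cls z = cls w" "Poly_Mapping.keys w \<subseteq> S" for z w
  proof -
    have *: "z - w \<in> null" using that(1) by (simp add: cls_eq_iff)
    have "h (z - w + w) = h (z - w) \<oplus>\<^bsub>N\<^esub> h w" by (rule ha[OF null_keys[OF *] that(2)])
    then show ?thesis using hn[OF *] hc[OF that(2)] by simp
  qed
  \<comment> \<open>Any representative may be chosen, by \<open>hcls\<close>.\<close>
  define F where "F Z = h (SOME z. Poly_Mapping.keys z \<subseteq> S \<and> Z = cls z)" for Z
  have F: "F (cls z) = h z" if "Poly_Mapping.keys z \<subseteq> S" for z
  proof -
    have "Poly_Mapping.keys (SOME w. Poly_Mapping.keys w \<subseteq> S \<and> cls z = cls w) \<subseteq> S
      \<and> cls z = cls (SOME w. Poly_Mapping.keys w \<subseteq> S \<and> cls z = cls w)"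
      by (rule someI[of _ z]) (use that in simp)
    from hcls[OF conjunct2[OF this, symmetric] that] show ?thesis unfolding F_def .
  qed
  show ?thesis
  proof (rule that[of F])
    show "F \<in> carrier T \<rightarrow> carrier N"
    proof
      fix Z assume "Z \<in> carrier T"
      then obtain z where "Poly_Mapping.keys z \<subseteq> S" "Z = cls z" by (rule carrier_T_E)
      then show "F Z \<in> carrier N" using F hc by simp
    qed
    show "F (Z \<oplus>\<^bsub>T\<^esub> W) = F Z \<oplus>\<^bsub>N\<^esub> F W" if Z: "Z \<in> carrier T" and W: "W \<in> carrier T" for Z W
    proof -
      obtain z where z: "Poly_Mapping.keys z \<subseteq> S" "Z = cls z" by (rule carrier_T_E[OF Z])
      obtain w where w: "Poly_Mapping.keys w \<subseteq> S" "W = cls w" by (rule carrier_T_E[OF W])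
      show ?thesis
        unfolding z(2) w(2) add_T[OF z(1) w(1)] F[OF z(1)] F[OF w(1)] F[OF keys_addI[OF z(1) w(1)]]
        by (rule ha[OF z(1) w(1)])
    qed
    show "F (cls (frag_of (a, v))) = \<beta> a v" if "a \<in> L" "v \<in> carrier V" for a v
      using that by (simp add: F hf)
  qed
qed

end

text \<open>Evaluating on representatives is legitimate as soon as relators go to null elements.\<close>

lemma (in scalar_extension) UN_class:
  assumes rel: "\<And>r. r \<in> tensor_relators (subring_of L) (subring_of K) V \<Longrightarrow> frag_extend \<phi> r \<in> N"
    and N: "\<And>z w. z \<in> N \<Longrightarrow> w \<in> N \<Longrightarrow> z - w \<in> N"
    and C: "\<And>z w. C z = C w \<longleftrightarrow> z - w \<in> N"
  shows "(\<Union>z\<in>cls z0. C (frag_extend \<phi> z)) = C (frag_extend \<phi> z0)"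
proof -
  have N0: "0 \<in> N" using C[of 0 0] by simp
  have nn: "frag_extend \<phi> z \<in> N" if "z \<in> null" for z
    using that
  proof (induction rule: null_induct)
    case (minus z)
    then show ?case using N[OF N0] by (simp add: frag_extend_minus)
  next
    case (add z w)
    then show ?case using N[OF _ N[OF N0]] by (simp add: frag_extend_add)
  qed (auto simp: rel N0)
  have "C (frag_extend \<phi> z) = C (frag_extend \<phi> z0)" if "z \<in> cls z0" for z
    using nn[of "z - z0"] that unfolding C cls_mem_iff by (simp add: frag_extend_diff)
  then show ?thesis using cls_memI by blast
qed

text \<open>Multiplying the left factor by \<open>a\<close> turns each relator into one of the same
  kind, so the union in the definition of the scalar action consists of a single class.\<close>

lemma (in scalar_extension) smult_T:
  assumes "a \<in> L"
  shows "a \<odot>\<^bsub>T\<^esub> cls z = cls (frag_extend (\<lambda>(b, v). frag_of (a * b, v)) z)"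
  unfolding smult_T_def
proof (rule UN_class[where N = null])
  fix r assume "r \<in> tensor_relators (subring_of L) (subring_of K) V"
  then consider
      c b v where "c \<in> L" "b \<in> L" "v \<in> carrier V" "r = frag_of (c + b, v) - frag_of (c, v) - frag_of (b, v)"
    | c v w where "c \<in> L" "v \<in> carrier V" "w \<in> carrier V" "r = frag_of (c, v \<oplus>\<^bsub>V\<^esub> w) - frag_of (c, v) - frag_of (c, w)"
    | b c v where "b \<in> L" "c \<in> K" "v \<in> carrier V" "r = frag_of (b * c, v) - frag_of (b, c \<odot>\<^bsub>V\<^esub> v)"
    unfolding tensor_relators_def by auto
  then show "frag_extend (\<lambda>(b, v). frag_of (a * b, v)) r \<in> null"
  proof cases
    case 1
    then show ?thesis using pure_add_left[of "a * c" "a * b" v] assms LD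
      by (simp add: frag_extend_diff frag_extend_add cls_eq_iff diff_diff_eq distrib_left)
  next
    case 2
    then show ?thesis using pure_add_right[of "a * c" v w] assms LD(4)
      by (simp add: frag_extend_diff frag_extend_add cls_eq_iff diff_diff_eq)
  next
    case 3
    then show ?thesis using pure_balanced[of "a * b" c v] assms LD
      by (simp add: frag_extend_diff cls_eq_iff mult.assoc)
  qed
qed (auto simp: null_diff cls_eq_iff)

text \<open>Four maps between tensor products have this shape: the inclusion of a subspace, the
  projection to a quotient, the inverse of a graded isomorphism, and the natural map in
  \<open>iota\<close>. The last one enlarges the fields, which is why source and target carry
  separate pairs \<open>L'\<close>, \<open>K'\<close> and \<open>L\<close>,
  \<open>K\<close>.\<close>

locale scalar_extension_map =
  A: scalar_extension L' K' U + B: scalar_extension L K V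
  for L' K' :: "'k::field set" and U :: "('k, 'u) module"
    and L K :: "'k set" and V :: "('k, 'v) module" +
  fixes h :: "'u \<Rightarrow> 'v"
  assumes LL: "L' \<subseteq> L" and KK: "K' \<subseteq> K"
    and h_closed: "u \<in> carrier U \<Longrightarrow> h u \<in> carrier V"
    and h_add: "u \<in> carrier U \<Longrightarrow> u' \<in> carrier U \<Longrightarrow> h (u \<oplus>\<^bsub>U\<^esub> u') = h u \<oplus>\<^bsub>V\<^esub> h u'"
    and h_smult: "c \<in> K' \<Longrightarrow> u \<in> carrier U \<Longrightarrow> h (c \<odot>\<^bsub>U\<^esub> u) = c \<odot>\<^bsub>V\<^esub> h u"
begin

abbreviation tmap :: "('k, 'u) tens \<Rightarrow> ('k, 'v) tens" where
  "tmap \<equiv> tensor_map (subring_of L) (subring_of K) V h"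

abbreviation fmap :: "('k \<times> 'u \<Rightarrow>\<^sub>0 int) \<Rightarrow> ('k \<times> 'v \<Rightarrow>\<^sub>0 int)" where
  "fmap \<equiv> frag_extend (\<lambda>(b, v). frag_of (b, h v))"

lemma tmap_cls: "tmap (A.cls z) = B.cls (fmap z)"
  unfolding tensor_map_def
proof (rule A.UN_class[where N = B.null])
  fix r assume "r \<in> tensor_relators (subring_of L') (subring_of K') U"
  then consider
      c b v where "c \<in> L'" "b \<in> L'" "v \<in> carrier U" "r = frag_of (c + b, v) - frag_of (c, v) - frag_of (b, v)"
    | c v w where "c \<in> L'" "v \<in> carrier U" "w \<in> carrier U" "r = frag_of (c, v \<oplus>\<^bsub>U\<^esub> w) - frag_of (c, v) - frag_of (c, w)"
    | b c v where "b \<in> L'" "c \<in> K'" "v \<in> carrier U" "r = frag_of (b * c, v) - frag_of (b, c \<odot>\<^bsub>U\<^esub> v)"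
    unfolding tensor_relators_def by auto
  then show "fmap r \<in> B.null"
  proof cases
    case 1
    then have "c \<in> L" "b \<in> L" using LL by auto
    then show ?thesis using 1 B.pure_add_left[of c b "h v"] h_closed
      by (simp add: frag_extend_diff frag_extend_add B.cls_eq_iff diff_diff_eq)
  next
    case 2
    then have "c \<in> L" using LL by auto
    then show ?thesis using 2 B.pure_add_right[of c "h v" "h w"] h_closed h_add
      by (simp add: frag_extend_diff frag_extend_add B.cls_eq_iff diff_diff_eq)
  next
    case 3
    then have "b \<in> L" "c \<in> K" using LL KK by auto
    then show ?thesis using 3 B.pure_balanced[of b c "h v"] h_closed h_smult
      by (simp add: frag_extend_diff B.cls_eq_iff)
  qed
qed (auto simp: B.null_diff B.cls_eq_iff)

lemma fmap_keys: "Poly_Mapping.keys z \<subseteq> A.S \<Longrightarrow> Poly_Mapping.keys (fmap z) \<subseteq> B.S"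
proof -
  assume z: "Poly_Mapping.keys z \<subseteq> A.S"
  have "(\<Union>x\<in>Poly_Mapping.keys z. Poly_Mapping.keys ((\<lambda>(b, v). frag_of (b, h v)) x)) \<subseteq> B.S"
  proof (rule UN_least)
    fix x assume "x \<in> Poly_Mapping.keys z"
    then have "x \<in> A.S" using z by blast
    then obtain b v where "x = (b, v)" "b \<in> L" "v \<in> carrier U" using LL by blast
    then show "Poly_Mapping.keys ((\<lambda>(b, v). frag_of (b, h v)) x) \<subseteq> B.S"
      using h_closed by simp
  qed
  then show ?thesis by (rule order_trans[OF keys_frag_extend])
qed

lemma tmap_pure: "tmap (A.cls (frag_of (a, v))) = B.cls (frag_of (a, h v))"
  by (simp add: tmap_cls)

lemma tmap_closed:
  assumes "Z \<in> carrier A.T"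
  shows "tmap Z \<in> carrier B.T"
proof -
  obtain z where z: "Poly_Mapping.keys z \<subseteq> A.S" "Z = A.cls z" by (rule A.carrier_T_E[OF assms])
  show ?thesis unfolding z(2) tmap_cls by (rule B.cls_carrier[OF fmap_keys[OF z(1)]])
qed

lemma tmap_add:
  assumes Z: "Z \<in> carrier A.T" and W: "W \<in> carrier A.T"
  shows "tmap (Z \<oplus>\<^bsub>A.T\<^esub> W) = tmap Z \<oplus>\<^bsub>B.T\<^esub> tmap W"
proof -
  obtain z where z: "Poly_Mapping.keys z \<subseteq> A.S" "Z = A.cls z" by (rule A.carrier_T_E[OF Z])
  obtain w where w: "Poly_Mapping.keys w \<subseteq> A.S" "W = A.cls w" by (rule A.carrier_T_E[OF W])
  show ?thesis
    unfolding z(2) w(2) A.add_T[OF z(1) w(1)] tmap_cls B.add_T[OF fmap_keys[OF z(1)] fmap_keys[OF w(1)]]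
    by (simp add: frag_extend_add)
qed

lemma tmap_smult:
  assumes "a \<in> L'" "Z \<in> carrier A.T"
  shows "tmap (a \<odot>\<^bsub>A.T\<^esub> Z) = a \<odot>\<^bsub>B.T\<^esub> tmap Z"
proof -
  have "a \<in> L" using assms LL by auto
  obtain z where z: "Poly_Mapping.keys z \<subseteq> A.S" "Z = A.cls z" by (rule A.carrier_T_E[OF assms(2)])
  have "fmap (frag_extend (\<lambda>(b, v). frag_of (a * b, v)) z)
      = frag_extend (\<lambda>(b, v). frag_of (a * b, v)) (fmap z)"
    by (induction rule: frag_induction[OF order.refl, of _ z]) (auto simp: frag_extend_diff)
  then show ?thesis unfolding z(2) using assms \<open>a \<in> L\<close> by (simp add: A.smult_T B.smult_T tmap_cls)
qed

end

lemma (in scalar_extension) T_add_closed: "Z \<in> carrier T \<Longrightarrow> W \<in> carrier T \<Longrightarrow> Z \<oplus>\<^bsub>T\<^esub> W \<in> carrier T"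
  by (metis add_T carrier_T_E cls_carrier keys_addI)

lemma (in scalar_extension) T_smult_closed:
  assumes "a \<in> L" "Z \<in> carrier T"
  shows "a \<odot>\<^bsub>T\<^esub> Z \<in> carrier T"
proof -
  obtain z where z: "Poly_Mapping.keys z \<subseteq> S" "Z = cls z" by (rule carrier_T_E[OF assms(2)])
  have "(\<Union>x\<in>Poly_Mapping.keys z. Poly_Mapping.keys ((\<lambda>(b, v). frag_of (a * b, v)) x)) \<subseteq> S"
  proof (rule UN_least)
    fix x assume "x \<in> Poly_Mapping.keys z"
    then have "x \<in> S" using z by blast
    then show "Poly_Mapping.keys ((\<lambda>(b, v). frag_of (a * b, v)) x) \<subseteq> S"
      using LD(4)[OF assms(1)] by auto
  qed
  then show ?thesis
    unfolding z(2) smult_T[OF assms(1)] by (intro cls_carrier order_trans[OF keys_frag_extend])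
qed

lemma (in scalar_extension) pure_closed: "a \<in> L \<Longrightarrow> v \<in> carrier V \<Longrightarrow> cls (frag_of (a, v)) \<in> carrier T"
  by (rule cls_carrier) simp

lemma (in scalar_extension) smult_pure:
  "c \<in> L \<Longrightarrow> c \<odot>\<^bsub>T\<^esub> cls (frag_of (a, v)) = cls (frag_of (c * a, v))"
  by (simp add: smult_T)

text \<open>Induction over the free abelian group proceeds by differences, so additive maps on
  tensors are used in this form.\<close>

lemma (in scalar_extension) T_hom_diff:
  assumes N: "abelian_group N" and f: "f \<in> carrier T \<rightarrow> carrier N"
    and fa: "\<And>Z W. Z \<in> carrier T \<Longrightarrow> W \<in> carrier T \<Longrightarrow> f (Z \<oplus>\<^bsub>T\<^esub> W) = f Z \<oplus>\<^bsub>N\<^esub> f W"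
    and z: "Poly_Mapping.keys z \<subseteq> S" and w: "Poly_Mapping.keys w \<subseteq> S"
  shows "f (cls (z - w)) = f (cls z) \<ominus>\<^bsub>N\<^esub> f (cls w)"
proof -
  interpret N: abelian_group N by fact
  have c: "f (cls z) \<in> carrier N" "f (cls w) \<in> carrier N" "f (cls (z - w)) \<in> carrier N"
    using f cls_carrier[OF z] cls_carrier[OF w] cls_carrier[OF keys_diffI[OF z w]]
    by auto
  have "cls z = cls (z - w) \<oplus>\<^bsub>T\<^esub> cls w"
    by (simp add: add_T[OF keys_diffI[OF z w] w])
  then have "f (cls z) = f (cls (z - w)) \<oplus>\<^bsub>N\<^esub> f (cls w)"
    using fa[OF cls_carrier[OF keys_diffI[OF z w]] cls_carrier[OF w]] by simp
  then show ?thesis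
    using c by (simp add: N.minus_eq N.a_assoc N.r_neg)
qed

text \<open>The pattern behind \<open>sub_rep\<close>, \<open>transport\<close> and
  \<open>iota\<close>: \<open>tmap\<close> before \<open>f\<close>, and \<open>g\<close> after it.
  The set \<open>C\<close> records where the values of \<open>f\<close> lie, since for a stable
  subspace they lie in a smaller set than the carrier of \<open>N\<close>; the scalars shrink from
  \<open>R\<close> to \<open>R'\<close> when the base field does.\<close>

lemma (in scalar_extension_map) tmap_hom:
  assumes f: "f \<in> module_hom (subring_of R) B.T N" and R: "R' \<subseteq> R" "R' \<subseteq> L'"
    and C: "\<And>Y. Y \<in> carrier A.T \<Longrightarrow> f (tmap Y) \<in> C"
    and gc: "\<And>n. n \<in> C \<Longrightarrow> g n \<in> carrier N'"
    and ga: "\<And>n m. n \<in> C \<Longrightarrow> m \<in> C \<Longrightarrow> g (n \<oplus>\<^bsub>N\<^esub> m) = g n \<oplus>\<^bsub>N'\<^esub> g m"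
    and gs: "\<And>c n. c \<in> R' \<Longrightarrow> n \<in> C \<Longrightarrow> g (c \<odot>\<^bsub>N\<^esub> n) = c \<odot>\<^bsub>N'\<^esub> g n"
  shows "(\<lambda>Y\<in>carrier A.T. g (f (tmap Y))) \<in> module_hom (subring_of R') A.T N'"
  unfolding module_hom_def
proof (intro CollectI conjI allI impI; (elim conjE)?)
  show "(\<lambda>Y\<in>carrier A.T. g (f (tmap Y))) \<in> carrier A.T \<rightarrow> carrier N'"
    using gc C by auto
next
  fix Y Z assume YZ: "Y \<in> carrier A.T" "Z \<in> carrier A.T"
  show "(\<lambda>Y\<in>carrier A.T. g (f (tmap Y))) (Y \<oplus>\<^bsub>A.T\<^esub> Z)
      = (\<lambda>Y\<in>carrier A.T. g (f (tmap Y))) Y \<oplus>\<^bsub>N'\<^esub> (\<lambda>Y\<in>carrier A.T. g (f (tmap Y))) Z"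
    by (simp only: restrict_apply YZ A.T_add_closed[OF YZ] tmap_add[OF YZ]
        module_hom_add[OF f tmap_closed[OF YZ(1)] tmap_closed[OF YZ(2)]] ga[OF C[OF YZ(1)] C[OF YZ(2)]] if_True)
next
  fix c Y assume c: "c \<in> carrier (subring_of R')" and Y: "Y \<in> carrier A.T"
  have c': "c \<in> R'" "c \<in> L'" "c \<in> carrier (subring_of R)" using c R by auto
  show "(\<lambda>Y\<in>carrier A.T. g (f (tmap Y))) (c \<odot>\<^bsub>A.T\<^esub> Y) = c \<odot>\<^bsub>N'\<^esub> (\<lambda>Y\<in>carrier A.T. g (f (tmap Y))) Y"
    by (simp only: restrict_apply Y A.T_smult_closed[OF c'(2) Y] tmap_smult[OF c'(2) Y]
        module_hom_smult[OF f c'(3) tmap_closed[OF Y]] gs[OF c'(1) C[OF Y]] if_True)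
qed

section \<open>Subspaces and quotients\<close>

text \<open>Subspaces as plain sets with an explicit set of scalars, so that one and the same set
  can be examined over two different fields.\<close>

definition lin_closed :: "'k::field set \<Rightarrow> ('k, 'v) module \<Rightarrow> 'v set \<Rightarrow> bool" where
  "lin_closed K V U \<longleftrightarrow> U \<subseteq> carrier V \<and> \<zero>\<^bsub>V\<^esub> \<in> U \<and> (\<forall>u\<in>U. \<forall>w\<in>U. u \<oplus>\<^bsub>V\<^esub> w \<in> U)
     \<and> (\<forall>c\<in>K. \<forall>u\<in>U. c \<odot>\<^bsub>V\<^esub> u \<in> U)"

lemma subspace_iff:
  assumes "vectorspace (subring_of K) V"
  shows "VectorSpace.subspace (subring_of K) U V \<longleftrightarrow> lin_closed K V U"
proof -
  interpret vectorspace "subring_of K" V by fact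
  have "module (subring_of K) V" ..
  then show ?thesis
    using assms by (auto simp: VectorSpace.subspace_def LinearCombinations.submodule_def lin_closed_def)
qed

lemma lin_closed_diff:
  assumes V: "vectorspace (subring_of K) V" and K: "is_subfield K" and U: "lin_closed K V U"
    and u: "u \<in> U" "w \<in> U"
  shows "\<ominus>\<^bsub>V\<^esub> u \<in> U" "u \<ominus>\<^bsub>V\<^esub> w \<in> U"
proof -
  interpret vectorspace "subring_of K" V by fact
  have neg: "\<ominus>\<^bsub>V\<^esub> v \<in> U" if "v \<in> U" for v
  proof -
    have "\<ominus>\<^bsub>V\<^esub> v = (- 1) \<odot>\<^bsub>V\<^esub> v"
    proof (rule M.minus_equality)
      have v: "v \<in> carrier V" using that U by (auto simp: lin_closed_def)
      have "(- 1) \<odot>\<^bsub>V\<^esub> v \<oplus>\<^bsub>V\<^esub> 1 \<odot>\<^bsub>V\<^esub> v = ((- 1) + 1) \<odot>\<^bsub>V\<^esub> v"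
        using smult_l_distr[of "- 1" 1 v] is_subfieldD(1,5)[OF K] v by simp
      then show "(- 1) \<odot>\<^bsub>V\<^esub> v \<oplus>\<^bsub>V\<^esub> v = \<zero>\<^bsub>V\<^esub>"
        using smult_one[OF v] lmult_0[OF v] by simp
      show "v \<in> carrier V" "(- 1) \<odot>\<^bsub>V\<^esub> v \<in> carrier V"
        using v is_subfieldD(1,5)[OF K] smult_closed[of "- 1" v] by auto
    qed
    then show ?thesis using U that is_subfieldD(1,5)[OF K] by (auto simp: lin_closed_def)
  qed
  show "\<ominus>\<^bsub>V\<^esub> u \<in> U" by (rule neg[OF u(1)])
  show "u \<ominus>\<^bsub>V\<^esub> w \<in> U"
    using U u(1) neg[OF u(2)] by (auto simp: lin_closed_def M.minus_eq)
qed

lemma vectorspace_sub: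
  assumes V: "vectorspace (subring_of K) V" and U: "lin_closed K V U"
  shows "vectorspace (subring_of K) (V\<lparr>carrier := U\<rparr>)"
proof -
  interpret vectorspace "subring_of K" V by fact
  show ?thesis using subspace_is_vs subspace_iff[OF V] U by blast
qed

locale quotient_space =
  fixes K :: "'k::field set" and V :: "('k, 'v) module" and W :: "'v set"
  assumes K: "is_subfield K" and V: "vectorspace (subring_of K) V" and W: "lin_closed K V W"
begin

sublocale V: vectorspace "subring_of K" V by (rule V)

lemma WV: "W \<subseteq> carrier V" using W by (simp add: lin_closed_def)

lemma a_subgroup: "abelian_subgroup W V"
proof (rule abelian_subgroupI3)
  show "abelian_group V" ..
  have "subgroup W (add_monoid V)"
  proof (rule group.subgroupI)
    show "Group.group (add_monoid V)" by (rule V.M.a_group)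
    show "inv\<^bsub>add_monoid V\<^esub> a \<in> W" if "a \<in> W" for a
      using lin_closed_diff(1)[OF V K W that that] by (simp add: a_inv_def)
  qed (use W in \<open>auto simp: lin_closed_def\<close>)
  then show "additive_subgroup W V" by (simp add: additive_subgroup_def)
qed

sublocale W: abelian_subgroup W V by (rule a_subgroup)

abbreviation \<pi> :: "'v \<Rightarrow> 'v set" where "\<pi> v \<equiv> W +>\<^bsub>V\<^esub> v"
abbreviation VW :: "('k, 'v set) module" where "VW \<equiv> quot_module V W"

lemma carrier_VW: "carrier VW = \<pi> ` carrier V"
  by (auto simp: quot_module_def A_RCOSETS_def')

lemma \<pi>_closed: "v \<in> carrier V \<Longrightarrow> \<pi> v \<in> carrier VW"
  unfolding carrier_VW by blast

lemma \<pi>_eq_iff: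
  assumes "v \<in> carrier V" "w \<in> carrier V"
  shows "\<pi> v = \<pi> w \<longleftrightarrow> v \<ominus>\<^bsub>V\<^esub> w \<in> W"
proof
  assume "\<pi> v = \<pi> w"
  then have "v \<in> \<pi> w" using W.a_rcos_self[OF assms(1)] by simp
  then show "v \<ominus>\<^bsub>V\<^esub> w \<in> W" using W.a_rcos_module_imp[OF assms(2)] by (simp add: V.M.minus_eq)
next
  assume "v \<ominus>\<^bsub>V\<^esub> w \<in> W"
  then have "v \<in> \<pi> w" using W.a_rcos_module_rev[OF assms(2,1)] by (simp add: V.M.minus_eq)
  then show "\<pi> v = \<pi> w" using W.a_repr_independence'[OF _ assms(2)] by simp
qed

lemma \<pi>_zero: "\<pi> \<zero>\<^bsub>V\<^esub> = W" using WV by simp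

lemma zero_VW: "\<zero>\<^bsub>VW\<^esub> = \<pi> \<zero>\<^bsub>V\<^esub>"
  using \<pi>_zero by (simp add: quot_module_def)

lemma \<pi>_eq_zero_iff: "v \<in> carrier V \<Longrightarrow> \<pi> v = \<zero>\<^bsub>VW\<^esub> \<longleftrightarrow> v \<in> W"
proof -
  assume v: "v \<in> carrier V"
  have m0: "\<ominus>\<^bsub>V\<^esub> \<zero>\<^bsub>V\<^esub> = \<zero>\<^bsub>V\<^esub>" by (rule V.M.minus_equality) simp_all
  show ?thesis
    using \<pi>_eq_iff[OF v V.M.zero_closed] unfolding zero_VW V.M.minus_eq m0 V.M.r_zero[OF v] .
qed

lemma \<pi>_add: "v \<in> carrier V \<Longrightarrow> w \<in> carrier V \<Longrightarrow> \<pi> v \<oplus>\<^bsub>VW\<^esub> \<pi> w = \<pi> (v \<oplus>\<^bsub>V\<^esub> w)"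
  using W.a_rcos_sum[of v w] by (simp add: quot_module_def)

text \<open>\<open>W\<close> is stable under scalars, so all cosets in the union that defines the
  scalar action on the quotient agree.\<close>

lemma \<pi>_smult:
  assumes "c \<in> K" "v \<in> carrier V"
  shows "c \<odot>\<^bsub>VW\<^esub> \<pi> v = \<pi> (c \<odot>\<^bsub>V\<^esub> v)"
proof -
  have c: "c \<odot>\<^bsub>V\<^esub> w \<in> carrier V" if "w \<in> carrier V" for w
    using that assms(1) V.smult_closed[of c w] by simp
  have "\<pi> (c \<odot>\<^bsub>V\<^esub> w) = \<pi> (c \<odot>\<^bsub>V\<^esub> v)" if w: "w \<in> \<pi> v" for w
  proof -
    have wV: "w \<in> carrier V" using w V.M.a_r_coset_subset_G[OF WV assms(2)] by blast
    have "w \<ominus>\<^bsub>V\<^esub> v \<in> W" using W.a_rcos_module_imp[OF assms(2) w] by (simp add: V.M.minus_eq)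
    then have "c \<odot>\<^bsub>V\<^esub> (w \<ominus>\<^bsub>V\<^esub> v) \<in> W" using W assms(1) by (simp add: lin_closed_def)
    moreover have "c \<odot>\<^bsub>V\<^esub> (w \<ominus>\<^bsub>V\<^esub> v) = c \<odot>\<^bsub>V\<^esub> w \<ominus>\<^bsub>V\<^esub> c \<odot>\<^bsub>V\<^esub> v"
      using assms wV V.smult_r_distr[of c w "\<ominus>\<^bsub>V\<^esub> v"] V.smult_r_minus[of c v] by (simp add: V.M.minus_eq)
    ultimately show ?thesis using \<pi>_eq_iff[OF c[OF wV] c[OF assms(2)]] by simp
  qed
  moreover have "v \<in> \<pi> v" by (rule W.a_rcos_self[OF assms(2)])
  ultimately have "(\<Union>w\<in>\<pi> v. \<pi> (c \<odot>\<^bsub>V\<^esub> w)) = \<pi> (c \<odot>\<^bsub>V\<^esub> v)" by blast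
  then show ?thesis by (simp add: quot_module_def)
qed

lemma vectorspace_VW: "vectorspace (subring_of K) VW"
proof -
  note KD = is_subfieldD[OF K]
  have sc: "c \<odot>\<^bsub>V\<^esub> v \<in> carrier V" if "c \<in> K" "v \<in> carrier V" for c v
    using that V.smult_closed[of c v] by simp
  have ex: "(\<forall>Y\<in>carrier VW. P Y) \<longleftrightarrow> (\<forall>v\<in>carrier V. P (\<pi> v))" for P
    unfolding carrier_VW by blast
  have "module (subring_of K) VW"
  proof (rule module_criteria)
    show "cring (subring_of K)" ..
    show "\<forall>v\<in>carrier VW. \<exists>neg_v\<in>carrier VW. v \<oplus>\<^bsub>VW\<^esub> neg_v = \<zero>\<^bsub>VW\<^esub>"
      unfolding ex
    proof
      fix v assume "v \<in> carrier V"
      then show "\<exists>neg_v\<in>carrier VW. \<pi> v \<oplus>\<^bsub>VW\<^esub> neg_v = \<zero>\<^bsub>VW\<^esub>"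
        by (intro bexI[of _ "\<pi> (\<ominus>\<^bsub>V\<^esub> v)"]) (simp_all add: \<pi>_add V.M.r_neg zero_VW \<pi>_closed)
    qed
    show "\<forall>v\<in>carrier VW. v \<oplus>\<^bsub>VW\<^esub> \<zero>\<^bsub>VW\<^esub> = v"
      unfolding ex zero_VW by (simp add: \<pi>_add)
    show "\<forall>v\<in>carrier VW. \<one>\<^bsub>subring_of K\<^esub> \<odot>\<^bsub>VW\<^esub> v = v"
      unfolding ex using KD(1) V.smult_one by (simp add: \<pi>_smult)
    show "\<zero>\<^bsub>VW\<^esub> \<in> carrier VW" unfolding zero_VW by (simp add: \<pi>_closed)
    show "\<forall>v w. v \<in> carrier VW \<and> w \<in> carrier VW \<longrightarrow> v \<oplus>\<^bsub>VW\<^esub> w \<in> carrier VW"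
      unfolding carrier_VW by (auto simp: \<pi>_add)
    show "\<forall>c v. c \<in> carrier (subring_of K) \<and> v \<in> carrier VW \<longrightarrow> c \<odot>\<^bsub>VW\<^esub> v \<in> carrier VW"
      unfolding carrier_VW by (auto simp: \<pi>_smult sc)
    show "\<forall>v w. v \<in> carrier VW \<and> w \<in> carrier VW \<longrightarrow> v \<oplus>\<^bsub>VW\<^esub> w = w \<oplus>\<^bsub>VW\<^esub> v"
      unfolding carrier_VW by (auto simp: \<pi>_add V.M.a_comm)
    show "\<forall>v w x. v \<in> carrier VW \<and> w \<in> carrier VW \<and> x \<in> carrier VW \<longrightarrow>
        v \<oplus>\<^bsub>VW\<^esub> w \<oplus>\<^bsub>VW\<^esub> x = v \<oplus>\<^bsub>VW\<^esub> (w \<oplus>\<^bsub>VW\<^esub> x)"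
      unfolding carrier_VW by (auto simp: \<pi>_add V.M.a_assoc)
    show "\<forall>a b v. a \<in> carrier (subring_of K) \<and> b \<in> carrier (subring_of K) \<and> v \<in> carrier VW \<longrightarrow>
        (a \<otimes>\<^bsub>subring_of K\<^esub> b) \<odot>\<^bsub>VW\<^esub> v = a \<odot>\<^bsub>VW\<^esub> (b \<odot>\<^bsub>VW\<^esub> v)"
      unfolding carrier_VW using V.smult_assoc1 KD(4) by (auto simp: \<pi>_smult sc)
    show "\<forall>a b v. a \<in> carrier (subring_of K) \<and> b \<in> carrier (subring_of K) \<and> v \<in> carrier VW \<longrightarrow>
        (a \<oplus>\<^bsub>subring_of K\<^esub> b) \<odot>\<^bsub>VW\<^esub> v = a \<odot>\<^bsub>VW\<^esub> v \<oplus>\<^bsub>VW\<^esub> b \<odot>\<^bsub>VW\<^esub> v"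
      unfolding carrier_VW using V.smult_l_distr KD(3) by (auto simp: \<pi>_smult \<pi>_add sc)
    show "\<forall>a v w. a \<in> carrier (subring_of K) \<and> v \<in> carrier VW \<and> w \<in> carrier VW \<longrightarrow>
        a \<odot>\<^bsub>VW\<^esub> (v \<oplus>\<^bsub>VW\<^esub> w) = a \<odot>\<^bsub>VW\<^esub> v \<oplus>\<^bsub>VW\<^esub> a \<odot>\<^bsub>VW\<^esub> w"
      unfolding carrier_VW using V.smult_r_distr by (auto simp: \<pi>_smult \<pi>_add sc)
  qed
  then show ?thesis using field_subring_of[OF K] by (simp add: vectorspace_def)
qed

lemma card_VW: "finite (carrier V) \<Longrightarrow> card (carrier V) = card (carrier VW) * card W"
  using group.lagrange_finite[OF V.M.a_group, of W] W.a_subgroup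
  by (simp add: Coset.order_def quot_module_def A_RCOSETS_def)

lemma finite_VW: "finite (carrier V) \<Longrightarrow> finite (carrier VW)"
  unfolding carrier_VW by simp

end

section \<open>Representations through their semilinear parts\<close>

text \<open>The record of the space stays the same; this is how the restricted space R_l(V)
  arises.\<close>

lemma vectorspace_restrict_scalars:
  assumes V: "vectorspace (subring_of K) V" and K': "is_subfield K'" "K' \<subseteq> K"
  shows "vectorspace (subring_of K') V"
proof -
  interpret V: vectorspace "subring_of K" V by fact
  have sub: "c \<in> carrier (subring_of K)" if "c \<in> K'" for c using that K' by auto
  have "module (subring_of K') V"
  proof (rule moduleI)
    show "cring (subring_of K')" using field_subring_of[OF K'(1)] fieldE(1) by blast
    show "abelian_group V" ..
  qed (use sub V.smult_closed V.smult_l_distr V.smult_r_distr V.smult_assoc1 V.smult_one in simp_all)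
  then show ?thesis using field_subring_of[OF K'(1)] by (simp add: vectorspace_def)
qed

locale quiver_rep =
  fixes D :: "('i, 'a) quiver" and Q :: nat and kt :: "'k::alg_closed_field itself"
  assumes D: "quiver_datum D" and charQ: "char_power kt Q"
begin

lemma Q: "char_power TYPE('k) Q" using charQ by (simp add: char_power_def)

abbreviation Kv :: "'i \<Rightarrow> 'k set" where "Kv i \<equiv> GFset (Q ^ vdeg D i)"
abbreviation Ka :: "'a \<Rightarrow> 'k set" where "Ka k \<equiv> GFset (Q ^ adeg D k)"

lemma finite_vertices: "finite (vertices D)"
  using D by (simp add: quiver_datum_def cartan_datum_def)

lemma vdeg_pos: "i \<in> vertices D \<Longrightarrow> vdeg D i > 0"
proof -
  assume "i \<in> vertices D"
  then have "pairing D i i > 0" "even (pairing D i i)"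
    using D by (simp_all add: quiver_datum_def cartan_datum_def)
  then obtain m where "pairing D i i = 2 * m" "m > 0" by (auto elim!: evenE)
  then show ?thesis by (simp add: vdeg_def)
qed

lemma arrows_D: "k \<in> arrows D \<Longrightarrow> src D k \<in> vertices D" "k \<in> arrows D \<Longrightarrow> tgt D k \<in> vertices D"
  using D by (simp_all add: quiver_datum_def)

lemma adeg_pos: "k \<in> arrows D \<Longrightarrow> adeg D k > 0"
  using vdeg_pos arrows_D by (simp add: adeg_def lcm_pos_nat)

lemma Kv_subfield: "i \<in> vertices D \<Longrightarrow> is_subfield (Kv i)"
  by (intro is_subfield_GFset char_power_power[OF Q] vdeg_pos)

lemma Ka_subfield: "k \<in> arrows D \<Longrightarrow> is_subfield (Ka k)"
  by (intro is_subfield_GFset char_power_power[OF Q] adeg_pos)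

lemma Kv_Ka: "Kv (src D k) \<subseteq> Ka k" "Kv (tgt D k) \<subseteq> Ka k"
  by (intro GFset_dvd_mono, simp add: adeg_def)+

lemma card_Kv: "i \<in> vertices D \<Longrightarrow> card (Kv i) = Q ^ vdeg D i"
  by (intro card_GFset char_power_power[OF Q] vdeg_pos)

lemma vfield_eq: "vfield D Q i = subring_of (Kv i)"
  by (simp add: vfield_def GF_eq)

lemma afield_eq: "afield D Q k = subring_of (Ka k)"
  by (simp add: afield_def GF_eq)

lemmas field_eqs = vfield_eq afield_eq

text \<open>Finite carriers express finite dimension, as the fields are finite. The property holds
  for standard spaces and passes to subspaces, quotients and restrictions of scalars.\<close>

definition good :: "('i, 'k, 'v) gspace \<Rightarrow> bool" where
  "good V \<longleftrightarrow> (\<forall>i\<in>vertices D. vectorspace (subring_of (Kv i)) (V i) \<and> finite (carrier (V i)))"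

lemma goodD: "good V \<Longrightarrow> i \<in> vertices D \<Longrightarrow> vectorspace (subring_of (Kv i)) (V i)"
  "good V \<Longrightarrow> i \<in> vertices D \<Longrightarrow> finite (carrier (V i))"
  by (simp_all add: good_def)

lemma good_abelian: "good V \<Longrightarrow> i \<in> vertices D \<Longrightarrow> abelian_group (V i)"
  by (meson goodD(1) vectorspace.axioms(1) Module.module.axioms(2))

definition pure :: "('i, 'k, 'v) gspace \<Rightarrow> 'a \<Rightarrow> 'k \<Rightarrow> 'v \<Rightarrow> ('k, 'v) tens" where
  "pure V k a u = tensor_class (subring_of (Ka k)) (subring_of (Kv (src D k))) (V (src D k)) (frag_of (a, u))"

text \<open>Since \<open>F_{d_k}\<close> is the compositum of \<open>F_{d_s}\<close> and \<open>F_{d_t}\<close>, the restriction of \<open>x_k\<close> to the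
  tensors \<open>1 \<otimes> u\<close> already determines which graded subspaces are stable.\<close>

definition xi :: "('i, 'k, 'v) gspace \<Rightarrow> ('a, 'k, 'v) rep \<Rightarrow> 'a \<Rightarrow> 'v \<Rightarrow> 'v" where
  "xi V x k u = x k (pure V k 1 u)"

text \<open>No field appears here, so the condition reads the same over F_q and over F_{q^l}; this
  makes the two flag counts comparable.\<close>

definition xi_stable :: "('a \<Rightarrow> 'v \<Rightarrow> 'v) \<Rightarrow> ('i \<Rightarrow> 'v set) \<Rightarrow> bool" where
  "xi_stable \<xi> U \<longleftrightarrow> (\<forall>k\<in>arrows D. \<forall>u\<in>U (src D k). \<xi> k u \<in> U (tgt D k))"

lemma arrow_space_eq:
  "arrow_space D Q V k = tensor (subring_of (Ka k)) (subring_of (Kv (src D k))) (V (src D k))"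
  by (simp add: arrow_space_def field_eqs)

lemma arrow_map_eq:
  "arrow_map D Q V k h = tensor_map (subring_of (Ka k)) (subring_of (Kv (src D k))) (V (src D k)) h"
  by (simp add: arrow_map_def field_eqs fun_eq_iff)

lemma scalar_extension: "good V \<Longrightarrow> k \<in> arrows D \<Longrightarrow> scalar_extension (Ka k) (Kv (src D k)) (V (src D k))"
  using goodD(1) Kv_Ka(1) arrows_D(1) Ka_subfield Kv_subfield vectorspace.axioms(1)
  by (fastforce simp: scalar_extension_def)

lemma reps_hom: "x \<in> reps D Q V \<Longrightarrow> k \<in> arrows D \<Longrightarrow>
    x k \<in> module_hom (subring_of (Kv (tgt D k))) (arrow_space D Q V k) (V (tgt D k))"
  unfolding reps_def vfield_eq by (drule PiE_mem) auto

lemma repsI: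
  assumes "\<And>k. k \<in> arrows D \<Longrightarrow> (\<lambda>Y\<in>carrier (arrow_space D Q V k). f k Y)
      \<in> module_hom (subring_of (Kv (tgt D k))) (arrow_space D Q V k) (V (tgt D k))"
  shows "(\<lambda>k\<in>arrows D. \<lambda>Y\<in>carrier (arrow_space D Q V k). f k Y) \<in> reps D Q V"
  unfolding reps_def vfield_eq by (intro restrict_PiE_iff[THEN iffD2] ballI IntI assms) auto

lemma graded_subspaces_iff:
  assumes "good V"
  shows "U \<in> graded_subspaces D Q V \<longleftrightarrow>
    U \<in> extensional (vertices D) \<and> (\<forall>i\<in>vertices D. lin_closed (Kv i) (V i) (U i))"
  unfolding graded_subspaces_def PiE_def vfield_eq
  using subspace_iff[OF goodD(1)[OF assms]] by (auto simp: Pi_iff)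

lemma good_sub:
  assumes "good V" "U \<in> graded_subspaces D Q V"
  shows "good (sub_space V U)"
  unfolding good_def
proof (intro ballI conjI)
  fix i assume i: "i \<in> vertices D"
  have U: "lin_closed (Kv i) (V i) (U i)" using assms i by (simp add: graded_subspaces_iff)
  show "vectorspace (subring_of (Kv i)) (sub_space V U i)"
    unfolding sub_space_def by (rule vectorspace_sub[OF goodD(1)[OF assms(1) i] U])
  show "finite (carrier (sub_space V U i))"
    using U goodD(2)[OF assms(1) i] by (auto simp: sub_space_def lin_closed_def intro: finite_subset)
qed

lemma quotient_space:
  assumes "good V" "U \<in> graded_subspaces D Q V" "i \<in> vertices D"
  shows "quotient_space (Kv i) (V i) (U i)"
  using assms by (simp add: quotient_space_def graded_subspaces_iff goodD(1) Kv_subfield)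

lemma good_quot:
  assumes "good V" "U \<in> graded_subspaces D Q V"
  shows "good (quot_space V U)"
  unfolding good_def quot_space_def
  using quotient_space.vectorspace_VW[OF quotient_space[OF assms]]
    quotient_space.finite_VW[OF quotient_space[OF assms]] goodD(2)[OF assms(1)] by blast

lemma sub_map:
  assumes V: "good V" and U: "U \<in> graded_subspaces D Q V" and k: "k \<in> arrows D"
  shows "scalar_extension_map (Ka k) (Kv (src D k)) (sub_space V U (src D k)) (Ka k) (Kv (src D k)) (V (src D k)) id"
proof -
  have "lin_closed (Kv (src D k)) (V (src D k)) (U (src D k))"
    using U arrows_D(1)[OF k] by (simp add: graded_subspaces_iff[OF V])
  then have "U (src D k) \<subseteq> carrier (V (src D k))" by (simp add: lin_closed_def)
  then show ?thesis
    using scalar_extension[OF V k] scalar_extension[OF good_sub[OF V U] k]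
    by (auto simp: scalar_extension_map_def scalar_extension_map_axioms_def sub_space_def)
qed

lemma stable_pure:
  assumes V: "good V" and U: "U \<in> graded_subspaces D Q V" and st: "stable D Q V x U"
    and k: "k \<in> arrows D" and a: "a \<in> Ka k" and u: "u \<in> U (src D k)"
  shows "x k (pure V k a u) \<in> U (tgt D k)"
proof -
  interpret T: scalar_extension_map "Ka k" "Kv (src D k)" "sub_space V U (src D k)"
    "Ka k" "Kv (src D k)" "V (src D k)" id
    by (rule sub_map[OF V U k])
  have "T.A.cls (frag_of (a, u)) \<in> carrier T.A.T"
    by (rule T.A.pure_closed[OF a]) (simp add: sub_space_def u)
  then have "x k (T.tmap (T.A.cls (frag_of (a, u)))) \<in> U (tgt D k)"
    using st k by (simp add: stable_def arrow_space_eq arrow_map_eq)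
  then show ?thesis by (simp add: T.tmap_pure pure_def)
qed

text \<open>For one arrow, take the scalars \<open>a\<close> such that u -> x_k(a \<otimes> u) maps
  \<open>U\<close> at the source into \<open>U\<close> at the target. Linearity of x_k makes this
  set a space over the field of the target, moving scalars across the tensor sign makes it one over
  the field of the source, and it contains 1 by assumption; so it is all of \<open>Ka k\<close> by
  \<open>GFset_compositum\<close>. Additivity extends the result from pure tensors to all
  tensors.\<close>

lemma stable_iff:
  assumes V: "good V" and x: "x \<in> reps D Q V" and U: "U \<in> graded_subspaces D Q V"
  shows "stable D Q V x U \<longleftrightarrow> xi_stable (xi V x) U"
proof
  assume st: "stable D Q V x U"
  show "xi_stable (xi V x) U"
    unfolding xi_stable_def xi_def
    using stable_pure[OF V U st] is_subfieldD(1)[OF Ka_subfield] by blast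
next
  assume st: "xi_stable (xi V x) U"
  show "stable D Q V x U"
    unfolding stable_def
  proof (intro ballI)
    fix k Y assume k: "k \<in> arrows D" and Y: "Y \<in> carrier (arrow_space D Q (sub_space V U) k)"
    let ?s = "src D k" and ?t = "tgt D k"
    interpret T: scalar_extension_map "Ka k" "Kv ?s" "sub_space V U ?s" "Ka k" "Kv ?s" "V ?s" id
      by (rule sub_map[OF V U k])
    have xk: "x k \<in> module_hom (subring_of (Kv ?t)) T.B.T (V ?t)"
      using reps_hom[OF x k] by (simp add: arrow_space_eq)
    have Us: "lin_closed (Kv ?s) (V ?s) (U ?s)" and Ut: "lin_closed (Kv ?t) (V ?t) (U ?t)"
      using U arrows_D[OF k] by (simp_all add: graded_subspaces_iff[OF V])
    have uV: "u \<in> carrier (V ?s)" if "u \<in> U ?s" for u using Us that by (auto simp: lin_closed_def)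
    note LD = T.B.LD
    define M where "M = {a \<in> Ka k. \<forall>u\<in>U ?s. x k (T.B.cls (frag_of (a, u))) \<in> U ?t}"
    have t_closed: "c * a \<in> M" if "c \<in> Kv ?t" "a \<in> M" for c a
    proof -
      have c: "c \<in> Ka k" using that(1) Kv_Ka(2) by blast
      have a: "a \<in> Ka k" using that(2) by (simp add: M_def)
      have "x k (T.B.cls (frag_of (c * a, u))) \<in> U ?t" if u: "u \<in> U ?s" for u
      proof -
        have "x k (c \<odot>\<^bsub>T.B.T\<^esub> T.B.cls (frag_of (a, u))) = c \<odot>\<^bsub>V ?t\<^esub> x k (T.B.cls (frag_of (a, u)))"
          using \<open>c \<in> Kv ?t\<close> by (intro module_hom_smult[OF xk] T.B.pure_closed a uV u) simp
        then show ?thesis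
          using \<open>a \<in> M\<close> u \<open>c \<in> Kv ?t\<close> Ut by (simp add: T.B.smult_pure[OF c] M_def lin_closed_def)
      qed
      then show ?thesis using LD(4)[OF c a] by (simp add: M_def)
    qed
    have s_closed: "c * a \<in> M" if "c \<in> Kv ?s" "a \<in> M" for c a
    proof -
      have c: "c \<in> Ka k" using that(1) Kv_Ka(1) by blast
      have a: "a \<in> Ka k" using that(2) by (simp add: M_def)
      have "x k (T.B.cls (frag_of (c * a, u))) \<in> U ?t" if u: "u \<in> U ?s" for u
        using T.B.pure_balanced[OF a \<open>c \<in> Kv ?s\<close> uV[OF u]] \<open>a \<in> M\<close> u \<open>c \<in> Kv ?s\<close> Us
        by (simp add: mult.commute[of c a] M_def lin_closed_def)
      then show ?thesis using LD(4)[OF c a] by (simp add: M_def)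
    qed
    have M_add: "a + b \<in> M" if "a \<in> M" "b \<in> M" for a b
    proof -
      have a: "a \<in> Ka k" and b: "b \<in> Ka k" using that by (simp_all add: M_def)
      have "x k (T.B.cls (frag_of (a + b, u))) \<in> U ?t" if u: "u \<in> U ?s" for u
      proof -
        have "T.B.cls (frag_of (a + b, u)) = T.B.cls (frag_of (a, u)) \<oplus>\<^bsub>T.B.T\<^esub> T.B.cls (frag_of (b, u))"
          unfolding T.B.pure_add_left[OF a b uV[OF u]]
          using a b uV[OF u] by (intro T.B.add_T[symmetric]) simp_all
        then have "x k (T.B.cls (frag_of (a + b, u)))
            = x k (T.B.cls (frag_of (a, u))) \<oplus>\<^bsub>V ?t\<^esub> x k (T.B.cls (frag_of (b, u)))"
          using module_hom_add[OF xk T.B.pure_closed[OF a uV[OF u]] T.B.pure_closed[OF b uV[OF u]]] by simp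
        then show ?thesis using \<open>a \<in> M\<close> \<open>b \<in> M\<close> u Ut by (simp add: M_def lin_closed_def)
      qed
      then show ?thesis using LD(3)[OF a b] by (simp add: M_def)
    qed
    have one: "1 \<in> M"
      using st k LD(1) by (simp add: M_def xi_stable_def xi_def pure_def)
    have zero: "0 \<in> M"
      using s_closed[of 0 1] one is_subfieldD(2)[OF Kv_subfield[OF arrows_D(1)[OF k]]] by simp
    have "M = GFset (Q ^ lcm (vdeg D ?s) (vdeg D ?t))"
      by (rule GFset_compositum[OF Q]) (use M_add one zero s_closed t_closed vdeg_pos arrows_D[OF k] in
          \<open>auto simp: K_closed_def M_def adeg_def\<close>)
    then have all: "x k (T.B.cls (frag_of (a, u))) \<in> U ?t" if "a \<in> Ka k" "u \<in> U ?s" for a u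
      using that by (auto simp: M_def adeg_def)
    obtain z where z: "Poly_Mapping.keys z \<subseteq> T.A.S" "Y = T.A.cls z"
      using Y T.A.carrier_T_E unfolding arrow_space_eq by blast
    have cls_diff: "x k (T.B.cls (z - w)) = x k (T.B.cls z) \<ominus>\<^bsub>V ?t\<^esub> x k (T.B.cls w)"
      if "Poly_Mapping.keys z \<subseteq> T.B.S" "Poly_Mapping.keys w \<subseteq> T.B.S" for z w
      by (rule T.B.T_hom_diff[OF good_abelian[OF V arrows_D(2)[OF k]] module_hom_closed[OF xk]
            module_hom_add[OF xk] that])
    note ld = lin_closed_diff(2)[OF goodD(1)[OF V arrows_D(2)[OF k]] Kv_subfield[OF arrows_D(2)[OF k]] Ut]
    have "x k (T.B.cls (T.fmap z)) \<in> U ?t"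
      using z(1)
    proof (induction z rule: free_Abelian_group_induct[consumes 1, case_names zero diff of])
      case zero
      \<comment> \<open>Zero is written as a difference so that \<open>cls_diff\<close> gives a
        vector minus itself.\<close>
      have "x k (T.B.cls (0 - 0)) \<in> U ?t"
      proof -
        have "x k (T.B.cls 0) \<in> carrier (V ?t)"
          using module_hom_closed[OF xk] T.B.cls_carrier[of 0] by auto
        then have "x k (T.B.cls 0) \<ominus>\<^bsub>V ?t\<^esub> x k (T.B.cls 0) = \<zero>\<^bsub>V ?t\<^esub>"
          using abelian_group.r_neg[OF good_abelian[OF V arrows_D(2)[OF k]]] by (simp add: a_minus_def)
        then show ?thesis
          using cls_diff[of 0 0] Ut by (simp add: lin_closed_def)
      qed
      then show ?case by simp
    next
      case (diff z w)
      show ?case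
        unfolding frag_extend_diff cls_diff[OF T.fmap_keys[OF diff(1)] T.fmap_keys[OF diff(2)]]
        by (rule ld[OF diff(3,4)])
    next
      case (of au)
      then show ?case using all by (cases au) (auto simp: sub_space_def)
    qed
    then show "x k (arrow_map D Q V k id Y) \<in> U (tgt D k)"
      by (simp add: arrow_map_eq z(2) T.tmap_cls)
  qed
qed

lemma sub_rep_reps:
  assumes V: "good V" and x: "x \<in> reps D Q V" and U: "U \<in> graded_subspaces D Q V"
    and st: "stable D Q V x U"
  shows "sub_rep D Q V U x \<in> reps D Q (sub_space V U)"
  unfolding sub_rep_def
proof (rule repsI)
  fix k assume k: "k \<in> arrows D"
  interpret T: scalar_extension_map "Ka k" "Kv (src D k)" "sub_space V U (src D k)"
    "Ka k" "Kv (src D k)" "V (src D k)" id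
    by (rule sub_map[OF V U k])
  have "(\<lambda>Y\<in>carrier T.A.T. id (x k (T.tmap Y))) \<in> module_hom (subring_of (Kv (tgt D k))) T.A.T (sub_space V U (tgt D k))"
  proof (rule T.tmap_hom[where f = "x k" and g = id and C = "U (tgt D k)"])
    show "x k \<in> module_hom (subring_of (Kv (tgt D k))) T.B.T (V (tgt D k))"
      using reps_hom[OF x k] by (simp add: arrow_space_eq)
    show "x k (T.tmap Y) \<in> U (tgt D k)" if "Y \<in> carrier T.A.T" for Y
      using st k that by (simp add: stable_def arrow_space_eq arrow_map_eq)
  qed (simp_all add: sub_space_def Kv_Ka(2))
  then show "(\<lambda>Y\<in>carrier (arrow_space D Q (sub_space V U) k). x k (arrow_map D Q V k id Y))
    \<in> module_hom (subring_of (Kv (tgt D k))) (arrow_space D Q (sub_space V U) k) (sub_space V U (tgt D k))"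
    by (simp add: arrow_space_eq arrow_map_eq)
qed

lemma xi_sub_rep:
  assumes V: "good V" and U: "U \<in> graded_subspaces D Q V" and k: "k \<in> arrows D" and u: "u \<in> U (src D k)"
  shows "xi (sub_space V U) (sub_rep D Q V U x) k u = xi V x k u"
proof -
  interpret T: scalar_extension_map "Ka k" "Kv (src D k)" "sub_space V U (src D k)"
    "Ka k" "Kv (src D k)" "V (src D k)" id
    by (rule sub_map[OF V U k])
  have "T.A.cls (frag_of (1, u)) \<in> carrier T.A.T"
    by (rule T.A.pure_closed[OF T.A.LD(1)]) (simp add: sub_space_def u)
  then show ?thesis
    using k by (simp add: xi_def pure_def sub_rep_def arrow_space_eq arrow_map_eq T.tmap_pure)
qed

end

section \<open>Induced representations on quotients\<close>

context quiver_rep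
begin

lemma quot_map:
  assumes V: "good V" and U: "U \<in> graded_subspaces D Q V" and k: "k \<in> arrows D"
  shows "scalar_extension_map (Ka k) (Kv (src D k)) (V (src D k)) (Ka k) (Kv (src D k)) (quot_space V U (src D k))
    (\<lambda>v. U (src D k) +>\<^bsub>V (src D k)\<^esub> v)"
proof -
  interpret q: quotient_space "Kv (src D k)" "V (src D k)" "U (src D k)"
    by (rule quotient_space[OF V U arrows_D(1)[OF k]])
  show ?thesis
    using scalar_extension[OF V k] scalar_extension[OF good_quot[OF V U] k] q.\<pi>_closed q.\<pi>_add q.\<pi>_smult
    by (auto simp: scalar_extension_map_def scalar_extension_map_axioms_def quot_space_def)
qed

text \<open>Cosets lift one at a time, hence so do integer combinations of pairs. Without a lift the
  union that defines \<open>quot_rep\<close> would be empty.\<close>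

lemma quot_map_surj:
  assumes V: "good V" and U: "U \<in> graded_subspaces D Q V" and k: "k \<in> arrows D"
    and Y: "Y \<in> carrier (arrow_space D Q (quot_space V U) k)"
  obtains Z where "Z \<in> carrier (arrow_space D Q V k)"
    "arrow_map D Q (quot_space V U) k (\<lambda>v. U (src D k) +>\<^bsub>V (src D k)\<^esub> v) Z = Y"
proof -
  let ?\<pi> = "\<lambda>v. U (src D k) +>\<^bsub>V (src D k)\<^esub> v"
  interpret q: quotient_space "Kv (src D k)" "V (src D k)" "U (src D k)"
    by (rule quotient_space[OF V U arrows_D(1)[OF k]])
  interpret T: scalar_extension_map "Ka k" "Kv (src D k)" "V (src D k)"
    "Ka k" "Kv (src D k)" "quot_space V U (src D k)" ?\<pi>
    by (rule quot_map[OF V U k])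
  obtain y where y: "Poly_Mapping.keys y \<subseteq> T.B.S" "Y = T.B.cls y"
    using Y T.B.carrier_T_E unfolding arrow_space_eq by blast
  have "\<exists>z. Poly_Mapping.keys z \<subseteq> T.A.S \<and> T.fmap z = y"
    using y(1)
  proof (induction y rule: free_Abelian_group_induct[consumes 1, case_names zero diff of])
    case zero
    show ?case by (intro exI[of _ 0]) simp
  next
    case (diff y w)
    then obtain z z' where "Poly_Mapping.keys z \<subseteq> T.A.S" "T.fmap z = y"
      "Poly_Mapping.keys z' \<subseteq> T.A.S" "T.fmap z' = w" by blast
    then show ?case
      by (intro exI[of _ "z - z'"]) (simp add: frag_extend_diff T.A.keys_diffI)
  next
    case (of p)
    then obtain a v where "p = (a, ?\<pi> v)" "a \<in> Ka k" "v \<in> carrier (V (src D k))"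
      by (auto simp: quot_space_def q.carrier_VW)
    then show ?case
      by (intro exI[of _ "frag_of (a, v)"]) simp
  qed
  then obtain z where z: "Poly_Mapping.keys z \<subseteq> T.A.S" "T.fmap z = y" by blast
  show ?thesis
  proof (rule that)
    show "T.A.cls z \<in> carrier (arrow_space D Q V k)"
      unfolding arrow_space_eq by (rule T.A.cls_carrier[OF z(1)])
    show "arrow_map D Q (quot_space V U) k ?\<pi> (T.A.cls z) = Y"
      by (simp add: arrow_map_eq T.tmap_cls z(2) y(2))
  qed
qed

text \<open>Independence of the lift comes from the universal property rather than from exactness of
  the tensor product: sending \<open>a\<close> and a coset to the class of x_k(a \<otimes> v), for a
  representative \<open>v\<close>, is balanced and yields \<open>F\<close> with F(tmap Z) equal to
  the class of x_k(Z). So this class depends on the image of \<open>Z\<close> only.\<close>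

lemma quot_rep_eq:
  assumes V: "good V" and x: "x \<in> reps D Q V" and U: "U \<in> graded_subspaces D Q V"
    and st: "stable D Q V x U" and k: "k \<in> arrows D" and Z: "Z \<in> carrier (arrow_space D Q V k)"
  shows "quot_rep D Q V U x k
      (arrow_map D Q (quot_space V U) k (\<lambda>v. U (src D k) +>\<^bsub>V (src D k)\<^esub> v) Z)
    = U (tgt D k) +>\<^bsub>V (tgt D k)\<^esub> x k Z"
proof -
  let ?s = "src D k" and ?t = "tgt D k"
  let ?\<pi> = "\<lambda>v. U ?s +>\<^bsub>V ?s\<^esub> v"
  interpret s: quotient_space "Kv ?s" "V ?s" "U ?s" by (rule quotient_space[OF V U arrows_D(1)[OF k]])
  interpret t: quotient_space "Kv ?t" "V ?t" "U ?t" by (rule quotient_space[OF V U arrows_D(2)[OF k]])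
  interpret T: scalar_extension_map "Ka k" "Kv ?s" "V ?s" "Ka k" "Kv ?s" "quot_space V U ?s" ?\<pi>
    by (rule quot_map[OF V U k])
  have xk: "x k \<in> module_hom (subring_of (Kv ?t)) T.A.T (V ?t)"
    using reps_hom[OF x k] by (simp add: arrow_space_eq)
  have xc: "x k Z \<in> carrier (V ?t)" if "Z \<in> carrier T.A.T" for Z
    using module_hom_closed[OF xk] that by blast
  have ab: "abelian_group t.VW"
    using t.vectorspace_VW vectorspace.axioms(1) Module.module.axioms(2) by blast
  define r where "r Y = (SOME v. v \<in> carrier (V ?s) \<and> ?\<pi> v = Y)" for Y
  have r: "r Y \<in> carrier (V ?s)" "?\<pi> (r Y) = Y" if "Y \<in> carrier (quot_space V U ?s)" for Y
    using someI_ex[of "\<lambda>v. v \<in> carrier (V ?s) \<and> ?\<pi> v = Y"] that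
    by (auto simp: r_def quot_space_def s.carrier_VW)
  define \<beta> where "\<beta> a Y = t.\<pi> (x k (T.A.cls (frag_of (a, r Y))))" for a Y
  have pa: "T.A.cls (frag_of (a, v \<oplus>\<^bsub>V ?s\<^esub> w)) = T.A.cls (frag_of (a, v)) \<oplus>\<^bsub>T.A.T\<^esub> T.A.cls (frag_of (a, w))"
    if "a \<in> Ka k" "v \<in> carrier (V ?s)" "w \<in> carrier (V ?s)" for a v w
    unfolding T.A.pure_add_right[OF that] using that by (intro T.A.add_T[symmetric]) simp_all
  have pl: "T.A.cls (frag_of (a + b, v)) = T.A.cls (frag_of (a, v)) \<oplus>\<^bsub>T.A.T\<^esub> T.A.cls (frag_of (b, v))"
    if "a \<in> Ka k" "b \<in> Ka k" "v \<in> carrier (V ?s)" for a b v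
    unfolding T.A.pure_add_left[OF that] using that by (intro T.A.add_T[symmetric]) simp_all
  have xadd: "x k (Y \<oplus>\<^bsub>T.A.T\<^esub> Z) = x k Y \<oplus>\<^bsub>V ?t\<^esub> x k Z" if "Y \<in> carrier T.A.T" "Z \<in> carrier T.A.T" for Y Z
    using module_hom_add[OF xk that] .
  \<comment> \<open>Two representatives of a coset differ by some \<open>w\<close> in
    \<open>U\<close>, and x_k(a \<otimes> w) lies in \<open>U\<close> by stability, so the choice
    made by \<open>r\<close> does not matter.\<close>
  have \<beta>: "\<beta> a (?\<pi> v) = t.\<pi> (x k (T.A.cls (frag_of (a, v))))" if a: "a \<in> Ka k" and v: "v \<in> carrier (V ?s)" for a v
  proof -
    have pv: "?\<pi> v \<in> carrier (quot_space V U ?s)" using s.\<pi>_closed[OF v] by (simp add: quot_space_def)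
    note r = r[OF pv]
    define w where "w = r (?\<pi> v) \<ominus>\<^bsub>V ?s\<^esub> v"
    have w: "w \<in> U ?s" using r v s.\<pi>_eq_iff by (simp add: w_def)
    then have wV: "w \<in> carrier (V ?s)" using s.WV by blast
    have rw: "r (?\<pi> v) = w \<oplus>\<^bsub>V ?s\<^esub> v"
      using r(1) v by (simp add: w_def s.V.M.minus_eq s.V.M.a_assoc s.V.M.l_neg)
    have pc: "T.A.cls (frag_of (a, u)) \<in> carrier T.A.T" if "u \<in> carrier (V ?s)" for u
      using T.A.pure_closed[OF a that] .
    have xU: "x k (T.A.cls (frag_of (a, w))) \<in> U ?t"
      using stable_pure[OF V U st k a w] by (simp add: pure_def)
    have "x k (T.A.cls (frag_of (a, r (?\<pi> v)))) = x k (T.A.cls (frag_of (a, w))) \<oplus>\<^bsub>V ?t\<^esub> x k (T.A.cls (frag_of (a, v)))"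
      unfolding rw pa[OF a wV v] by (rule xadd[OF pc[OF wV] pc[OF v]])
    then have "\<beta> a (?\<pi> v) = t.\<pi> (x k (T.A.cls (frag_of (a, w)))) \<oplus>\<^bsub>t.VW\<^esub> t.\<pi> (x k (T.A.cls (frag_of (a, v))))"
      unfolding \<beta>_def using t.\<pi>_add[OF xc[OF pc[OF wV]] xc[OF pc[OF v]]] by simp
    also have "t.\<pi> (x k (T.A.cls (frag_of (a, w)))) = \<zero>\<^bsub>t.VW\<^esub>"
      using t.\<pi>_eq_zero_iff[OF xc[OF pc[OF wV]]] xU by simp
    finally show ?thesis
      using abelian_group.l_neg[OF ab] abelian_monoid.l_zero[OF abelian_group.axioms(1)[OF ab]]
        t.\<pi>_closed[OF xc[OF pc[OF v]]] by simp
  qed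
  have pc: "T.A.cls (frag_of (a, v)) \<in> carrier T.A.T" if "a \<in> Ka k" "v \<in> carrier (V ?s)" for a v
    using T.A.pure_closed[OF that] .
  have qE: "\<exists>v\<in>carrier (V ?s). Y = ?\<pi> v" if "Y \<in> carrier (quot_space V U ?s)" for Y
    using that by (auto simp: quot_space_def s.carrier_VW)
  obtain F where F: "F \<in> carrier T.B.T \<rightarrow> carrier t.VW"
    "\<And>Y Z. Y \<in> carrier T.B.T \<Longrightarrow> Z \<in> carrier T.B.T \<Longrightarrow> F (Y \<oplus>\<^bsub>T.B.T\<^esub> Z) = F Y \<oplus>\<^bsub>t.VW\<^esub> F Z"
    "\<And>a v. a \<in> Ka k \<Longrightarrow> v \<in> carrier (quot_space V U ?s) \<Longrightarrow> F (T.B.cls (frag_of (a, v))) = \<beta> a v"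
  proof (rule T.B.tensor_universal[OF ab, of \<beta>])
    fix a b Y assume ab: "a \<in> Ka k" "b \<in> Ka k" and Y: "Y \<in> carrier (quot_space V U ?s)"
    obtain v where v: "v \<in> carrier (V ?s)" "Y = ?\<pi> v" using qE[OF Y] by blast
    show "\<beta> (a + b) Y = \<beta> a Y \<oplus>\<^bsub>t.VW\<^esub> \<beta> b Y"
      unfolding v(2) \<beta>[OF T.A.LD(3)[OF ab] v(1)] \<beta>[OF ab(1) v(1)] \<beta>[OF ab(2) v(1)] pl[OF ab v(1)]
        xadd[OF pc[OF ab(1) v(1)] pc[OF ab(2) v(1)]]
      by (rule t.\<pi>_add[symmetric, OF xc[OF pc[OF ab(1) v(1)]] xc[OF pc[OF ab(2) v(1)]]])
  next
    fix a Y Z assume a: "a \<in> Ka k" and Y: "Y \<in> carrier (quot_space V U ?s)" and Z: "Z \<in> carrier (quot_space V U ?s)"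
    obtain v where v: "v \<in> carrier (V ?s)" "Y = ?\<pi> v" using qE[OF Y] by blast
    obtain w where w: "w \<in> carrier (V ?s)" "Z = ?\<pi> w" using qE[OF Z] by blast
    have vw: "v \<oplus>\<^bsub>V ?s\<^esub> w \<in> carrier (V ?s)" using v w by simp
    have YZ: "Y \<oplus>\<^bsub>quot_space V U ?s\<^esub> Z = ?\<pi> (v \<oplus>\<^bsub>V ?s\<^esub> w)"
      using s.\<pi>_add[OF v(1) w(1)] v(2) w(2) by (simp add: quot_space_def)
    show "\<beta> a (Y \<oplus>\<^bsub>quot_space V U ?s\<^esub> Z) = \<beta> a Y \<oplus>\<^bsub>t.VW\<^esub> \<beta> a Z"
      unfolding YZ unfolding v(2) w(2) \<beta>[OF a v(1)] \<beta>[OF a w(1)] \<beta>[OF a vw] pa[OF a v(1) w(1)]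
        xadd[OF pc[OF a v(1)] pc[OF a w(1)]]
      by (rule t.\<pi>_add[symmetric, OF xc[OF pc[OF a v(1)]] xc[OF pc[OF a w(1)]]])
  next
    fix a c Y assume a: "a \<in> Ka k" and c: "c \<in> Kv ?s" and Y: "Y \<in> carrier (quot_space V U ?s)"
    obtain v where v: "v \<in> carrier (V ?s)" "Y = ?\<pi> v" using qE[OF Y] by blast
    have cv: "c \<odot>\<^bsub>V ?s\<^esub> v \<in> carrier (V ?s)" using s.V.smult_closed[of c v] c v(1) by simp
    have cY: "c \<odot>\<^bsub>quot_space V U ?s\<^esub> Y = ?\<pi> (c \<odot>\<^bsub>V ?s\<^esub> v)"
      using s.\<pi>_smult[OF c v(1)] v(2) by (simp add: quot_space_def)
    have ac: "a * c \<in> Ka k" using T.A.LD(4)[OF a] c Kv_Ka(1) by blast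
    show "\<beta> (a * c) Y = \<beta> a (c \<odot>\<^bsub>quot_space V U ?s\<^esub> Y)"
      unfolding cY unfolding v(2) \<beta>[OF a cv] \<beta>[OF ac v(1)] T.A.pure_balanced[OF a c v(1)] by (rule refl)
  next
    fix a Y assume a: "a \<in> Ka k" and Y: "Y \<in> carrier (quot_space V U ?s)"
    show "\<beta> a Y \<in> carrier t.VW"
      unfolding \<beta>_def by (intro t.\<pi>_closed xc pc a r Y)
  qed blast
  \<comment> \<open>Both sides are additive in \<open>Z\<close> and agree on pure tensors.\<close>
  have FZ: "F (T.tmap Z) = t.\<pi> (x k Z)" if Z: "Z \<in> carrier T.A.T" for Z
  proof -
    obtain z where z: "Poly_Mapping.keys z \<subseteq> T.A.S" "Z = T.A.cls z" by (rule T.A.carrier_T_E[OF Z])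
    have Fd: "F (T.B.cls (z - w)) = F (T.B.cls z) \<ominus>\<^bsub>t.VW\<^esub> F (T.B.cls w)"
      if "Poly_Mapping.keys z \<subseteq> T.B.S" "Poly_Mapping.keys w \<subseteq> T.B.S" for z w
      by (rule T.B.T_hom_diff[OF ab F(1) _ that]) (rule F(2))
    have td: "(\<lambda>Z. t.\<pi> (x k Z)) (T.A.cls (z - w)) = t.\<pi> (x k (T.A.cls z)) \<ominus>\<^bsub>t.VW\<^esub> t.\<pi> (x k (T.A.cls w))"
      if "Poly_Mapping.keys z \<subseteq> T.A.S" "Poly_Mapping.keys w \<subseteq> T.A.S" for z w
    proof (rule T.A.T_hom_diff[OF ab _ _ that])
      show "t.\<pi> (x k (Z \<oplus>\<^bsub>T.A.T\<^esub> W)) = t.\<pi> (x k Z) \<oplus>\<^bsub>t.VW\<^esub> t.\<pi> (x k W)"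
        if "Z \<in> carrier T.A.T" "W \<in> carrier T.A.T" for Z W
        unfolding xadd[OF that] by (rule t.\<pi>_add[symmetric, OF xc xc]) (fact that)+
    qed (use t.\<pi>_closed xc in blast)
    have "F (T.B.cls (T.fmap z)) = t.\<pi> (x k (T.A.cls z))"
      using z(1)
    proof (induction z rule: free_Abelian_group_induct[consumes 1, case_names zero diff of])
      case zero
      have z0: "Poly_Mapping.keys 0 \<subseteq> T.A.S" "Poly_Mapping.keys 0 \<subseteq> T.B.S"
        by simp_all
      have mz: "Y \<ominus>\<^bsub>t.VW\<^esub> Y = \<zero>\<^bsub>t.VW\<^esub>" if "Y \<in> carrier t.VW" for Y
        using abelian_group.r_neg[OF ab that] by (simp add: a_minus_def)
      have "F (T.B.cls 0) \<in> carrier t.VW" using F(1) T.B.cls_carrier[OF z0(2)] by blast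
      then have "F (T.B.cls 0) = \<zero>\<^bsub>t.VW\<^esub>" using Fd[OF z0(2) z0(2)] mz by simp
      moreover have "t.\<pi> (x k (T.A.cls 0)) = \<zero>\<^bsub>t.VW\<^esub>"
        using td[OF z0(1) z0(1)] mz[OF t.\<pi>_closed[OF xc[OF T.A.cls_carrier[OF z0(1)]]]] by simp
      ultimately show ?case by simp
    next
      case (diff z w)
      show ?case
        unfolding frag_extend_diff Fd[OF T.fmap_keys[OF diff(1)] T.fmap_keys[OF diff(2)]] diff(3,4)
        using td[OF diff(1,2)] by simp
    next
      case (of p)
      then obtain a v where p: "p = (a, v)" "a \<in> Ka k" "v \<in> carrier (V ?s)" by auto
      have "F (T.B.cls (frag_of (a, ?\<pi> v))) = \<beta> a (?\<pi> v)"
        by (rule F(3)[OF p(2)]) (use s.\<pi>_closed[OF p(3)] in \<open>simp add: quot_space_def\<close>)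
      then show ?case using \<beta>[OF p(2,3)] p(1) by simp
    qed
    then show ?thesis by (simp add: z(2) T.tmap_cls)
  qed
  have Z': "Z \<in> carrier T.A.T" using Z by (simp add: arrow_space_eq)
  have "quot_rep D Q V U x k (T.tmap Z) = (\<Union>Z'\<in>{Z' \<in> carrier T.A.T. T.tmap Z' = T.tmap Z}. t.\<pi> (x k Z'))"
    using k T.tmap_closed[OF Z'] by (simp add: quot_rep_def arrow_space_eq arrow_map_eq)
  also have "\<dots> = (\<Union>Z'\<in>{Z' \<in> carrier T.A.T. T.tmap Z' = T.tmap Z}. F (T.tmap Z))"
  proof (rule SUP_cong[OF refl])
    fix Z' assume "Z' \<in> {Z' \<in> carrier T.A.T. T.tmap Z' = T.tmap Z}"
    then show "t.\<pi> (x k Z') = F (T.tmap Z)" using FZ[of Z'] by simp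
  qed
  also have "\<dots> = t.\<pi> (x k Z)" using FZ[OF Z'] Z' by auto
  finally show ?thesis by (simp add: arrow_map_eq)
qed

lemma quot_rep_reps:
  assumes V: "good V" and x: "x \<in> reps D Q V" and U: "U \<in> graded_subspaces D Q V"
    and st: "stable D Q V x U"
  shows "quot_rep D Q V U x \<in> reps D Q (quot_space V U)"
proof -
  have "(\<lambda>k\<in>arrows D. \<lambda>Y\<in>carrier (arrow_space D Q (quot_space V U) k). quot_rep D Q V U x k Y)
     \<in> reps D Q (quot_space V U)"
  proof (rule repsI)
    fix k assume k: "k \<in> arrows D"
    let ?s = "src D k" and ?t = "tgt D k"
    let ?\<pi> = "\<lambda>v. U ?s +>\<^bsub>V ?s\<^esub> v"
    interpret t: quotient_space "Kv ?t" "V ?t" "U ?t" by (rule quotient_space[OF V U arrows_D(2)[OF k]])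
    interpret T: scalar_extension_map "Ka k" "Kv ?s" "V ?s" "Ka k" "Kv ?s" "quot_space V U ?s" ?\<pi>
      by (rule quot_map[OF V U k])
    have xk: "x k \<in> module_hom (subring_of (Kv ?t)) T.A.T (V ?t)"
      using reps_hom[OF x k] by (simp add: arrow_space_eq)
    have xc: "x k Z \<in> carrier (V ?t)" if "Z \<in> carrier T.A.T" for Z
      using module_hom_closed[OF xk] that by blast
    have surj: "\<exists>Z\<in>carrier T.A.T. T.tmap Z = Y" if "Y \<in> carrier T.B.T" for Y
      using quot_map_surj[OF V U k, of Y] that unfolding arrow_space_eq arrow_map_eq by blast
    have val: "quot_rep D Q V U x k (T.tmap Z) = t.\<pi> (x k Z)" if "Z \<in> carrier T.A.T" for Z
      using quot_rep_eq[OF V x U st k, of Z] that unfolding arrow_space_eq arrow_map_eq by blast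
    have "(\<lambda>Y\<in>carrier T.B.T. quot_rep D Q V U x k Y) \<in> module_hom (subring_of (Kv ?t)) T.B.T t.VW"
      unfolding module_hom_def
    proof (intro CollectI conjI allI impI; (elim conjE)?)
      have "quot_rep D Q V U x k Y \<in> carrier t.VW" if Y: "Y \<in> carrier T.B.T" for Y
      proof -
        obtain Z where Z: "Z \<in> carrier T.A.T" "T.tmap Z = Y" using surj Y by blast
        then show ?thesis using val[OF Z(1)] t.\<pi>_closed[OF xc[OF Z(1)]] by simp
      qed
      then show "(\<lambda>Y\<in>carrier T.B.T. quot_rep D Q V U x k Y) \<in> carrier T.B.T \<rightarrow> carrier t.VW" by auto
    next
      fix Y1 Y2 assume Y: "Y1 \<in> carrier T.B.T" "Y2 \<in> carrier T.B.T"
      obtain Z1 where Z1: "Z1 \<in> carrier T.A.T" "T.tmap Z1 = Y1" using surj Y by blast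
      obtain Z2 where Z2: "Z2 \<in> carrier T.A.T" "T.tmap Z2 = Y2" using surj Y by blast
      have "quot_rep D Q V U x k (Y1 \<oplus>\<^bsub>T.B.T\<^esub> Y2) = t.\<pi> (x k (Z1 \<oplus>\<^bsub>T.A.T\<^esub> Z2))"
        unfolding Z1(2)[symmetric] Z2(2)[symmetric] T.tmap_add[OF Z1(1) Z2(1), symmetric]
        by (rule val[OF T.A.T_add_closed[OF Z1(1) Z2(1)]])
      also have "\<dots> = t.\<pi> (x k Z1) \<oplus>\<^bsub>t.VW\<^esub> t.\<pi> (x k Z2)"
        unfolding module_hom_add[OF xk Z1(1) Z2(1)] by (rule t.\<pi>_add[symmetric, OF xc[OF Z1(1)] xc[OF Z2(1)]])
      finally show "(\<lambda>Y\<in>carrier T.B.T. quot_rep D Q V U x k Y) (Y1 \<oplus>\<^bsub>T.B.T\<^esub> Y2)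
          = (\<lambda>Y\<in>carrier T.B.T. quot_rep D Q V U x k Y) Y1 \<oplus>\<^bsub>t.VW\<^esub> (\<lambda>Y\<in>carrier T.B.T. quot_rep D Q V U x k Y) Y2"
        using Y T.B.T_add_closed[OF Y] val[OF Z1(1)] val[OF Z2(1)] Z1(2) Z2(2) by simp
    next
      fix c Y assume c: "c \<in> carrier (subring_of (Kv ?t))" and Y: "Y \<in> carrier T.B.T"
      obtain Z where Z: "Z \<in> carrier T.A.T" "T.tmap Z = Y" using surj Y by blast
      have c': "c \<in> Kv ?t" "c \<in> Ka k" using c Kv_Ka(2) by auto
      have "quot_rep D Q V U x k (c \<odot>\<^bsub>T.B.T\<^esub> Y) = t.\<pi> (x k (c \<odot>\<^bsub>T.A.T\<^esub> Z))"
        unfolding Z(2)[symmetric] T.tmap_smult[OF c'(2) Z(1), symmetric]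
        by (rule val[OF T.A.T_smult_closed[OF c'(2) Z(1)]])
      also have "\<dots> = c \<odot>\<^bsub>t.VW\<^esub> t.\<pi> (x k Z)"
        unfolding module_hom_smult[OF xk c Z(1)] by (rule t.\<pi>_smult[symmetric, OF c'(1) xc[OF Z(1)]])
      finally show "(\<lambda>Y\<in>carrier T.B.T. quot_rep D Q V U x k Y) (c \<odot>\<^bsub>T.B.T\<^esub> Y)
          = c \<odot>\<^bsub>t.VW\<^esub> (\<lambda>Y\<in>carrier T.B.T. quot_rep D Q V U x k Y) Y"
        using Y T.B.T_smult_closed[OF c'(2) Y] val[OF Z(1)] Z(2) by simp
    qed
    then show "(\<lambda>Y\<in>carrier (arrow_space D Q (quot_space V U) k). quot_rep D Q V U x k Y)
        \<in> module_hom (subring_of (Kv ?t)) (arrow_space D Q (quot_space V U) k) (quot_space V U ?t)"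
      by (simp add: arrow_space_eq quot_space_def)
  qed
  moreover have "(\<lambda>k\<in>arrows D. \<lambda>Y\<in>carrier (arrow_space D Q (quot_space V U) k). quot_rep D Q V U x k Y)
      = quot_rep D Q V U x"
    by (auto simp: quot_rep_def fun_eq_iff)
  ultimately show ?thesis by simp
qed

lemma xi_quot_rep:
  assumes V: "good V" and x: "x \<in> reps D Q V" and U: "U \<in> graded_subspaces D Q V"
    and st: "stable D Q V x U" and k: "k \<in> arrows D" and v: "v \<in> carrier (V (src D k))"
  shows "xi (quot_space V U) (quot_rep D Q V U x) k (U (src D k) +>\<^bsub>V (src D k)\<^esub> v)
    = U (tgt D k) +>\<^bsub>V (tgt D k)\<^esub> xi V x k v"
proof -
  interpret T: scalar_extension_map "Ka k" "Kv (src D k)" "V (src D k)"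
    "Ka k" "Kv (src D k)" "quot_space V U (src D k)" "\<lambda>v. U (src D k) +>\<^bsub>V (src D k)\<^esub> v"
    by (rule quot_map[OF V U k])
  show ?thesis
    using quot_rep_eq[OF V x U st k, of "T.A.cls (frag_of (1, v))"] T.A.pure_closed[OF T.A.LD(1) v]
    by (simp add: arrow_space_eq arrow_map_eq T.tmap_pure xi_def pure_def)
qed

lemma xi_closed:
  assumes "good V" "x \<in> reps D Q V" "k \<in> arrows D" "u \<in> carrier (V (src D k))"
  shows "xi V x k u \<in> carrier (V (tgt D k))"
proof -
  interpret T: scalar_extension "Ka k" "Kv (src D k)" "V (src D k)"
    by (rule scalar_extension[OF assms(1,3)])
  show ?thesis
    using module_hom_closed[OF reps_hom[OF assms(2,3)]] T.pure_closed[OF T.LD(1) assms(4)]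
    by (auto simp: xi_def pure_def arrow_space_eq)
qed

end

section \<open>Graded isomorphisms and standard spaces\<close>

context quiver_rep
begin

lemma graded_iso_inv:
  assumes V: "good V" and V': "good V'" and g: "g \<in> graded_isos D Q V V'" and i: "i \<in> vertices D"
  defines "h \<equiv> inv_into (carrier (V i)) (g i)"
  shows "\<And>v. v \<in> carrier (V' i) \<Longrightarrow> h v \<in> carrier (V i)"
    "\<And>v. v \<in> carrier (V' i) \<Longrightarrow> g i (h v) = v"
    "\<And>v. v \<in> carrier (V i) \<Longrightarrow> h (g i v) = v"
    "\<And>v w. v \<in> carrier (V' i) \<Longrightarrow> w \<in> carrier (V' i) \<Longrightarrow> h (v \<oplus>\<^bsub>V' i\<^esub> w) = h v \<oplus>\<^bsub>V i\<^esub> h w"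
    "\<And>c v. c \<in> Kv i \<Longrightarrow> v \<in> carrier (V' i) \<Longrightarrow> h (c \<odot>\<^bsub>V' i\<^esub> v) = c \<odot>\<^bsub>V i\<^esub> h v"
proof -
  have hom: "g i \<in> module_hom (subring_of (Kv i)) (V i) (V' i)"
    and bij: "bij_betw (g i) (carrier (V i)) (carrier (V' i))"
    using g i by (auto simp: graded_isos_def vfield_eq)
  interpret V: vectorspace "subring_of (Kv i)" "V i" by (rule goodD(1)[OF V i])
  show 1: "h v \<in> carrier (V i)" if "v \<in> carrier (V' i)" for v
    using bij_betw_apply[OF bij_betw_inv_into[OF bij] that] by (simp add: h_def)
  show 2: "g i (h v) = v" if "v \<in> carrier (V' i)" for v
    using bij_betw_inv_into_right[OF bij that] by (simp add: h_def)
  show 3: "h (g i v) = v" if "v \<in> carrier (V i)" for v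
    using bij_betw_inv_into_left[OF bij that] by (simp add: h_def)
  show "h (v \<oplus>\<^bsub>V' i\<^esub> w) = h v \<oplus>\<^bsub>V i\<^esub> h w" if "v \<in> carrier (V' i)" "w \<in> carrier (V' i)" for v w
    using module_hom_add[OF hom 1[OF that(1)] 1[OF that(2)]] 2[OF that(1)] 2[OF that(2)]
      3[of "h v \<oplus>\<^bsub>V i\<^esub> h w"] 1[OF that(1)] 1[OF that(2)] by simp
  show "h (c \<odot>\<^bsub>V' i\<^esub> v) = c \<odot>\<^bsub>V i\<^esub> h v" if "c \<in> Kv i" "v \<in> carrier (V' i)" for c v
    using module_hom_smult[OF hom, of c "h v"] 1[OF that(2)] 2[OF that(2)] that(1)
      3[of "c \<odot>\<^bsub>V i\<^esub> h v"] V.smult_closed[of c "h v"] by simp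
qed

lemma iso_map:
  assumes V: "good V" and V': "good V'" and g: "g \<in> graded_isos D Q V V'" and k: "k \<in> arrows D"
  shows "scalar_extension_map (Ka k) (Kv (src D k)) (V' (src D k)) (Ka k) (Kv (src D k)) (V (src D k))
    (inv_into (carrier (V (src D k))) (g (src D k)))"
  using scalar_extension[OF V k] scalar_extension[OF V' k] graded_iso_inv[OF V V' g arrows_D(1)[OF k]]
  by (simp add: scalar_extension_map_def scalar_extension_map_axioms_def)

lemma transport_reps:
  assumes V: "good V" and V': "good V'" and g: "g \<in> graded_isos D Q V V'" and x: "x \<in> reps D Q V"
  shows "transport D Q V V' g x \<in> reps D Q V'"
  unfolding transport_def
proof (rule repsI)
  fix k assume k: "k \<in> arrows D"
  let ?s = "src D k" and ?t = "tgt D k"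
  interpret T: scalar_extension_map "Ka k" "Kv ?s" "V' ?s" "Ka k" "Kv ?s" "V ?s" "inv_into (carrier (V ?s)) (g ?s)"
    by (rule iso_map[OF V V' g k])
  have gt: "g ?t \<in> module_hom (subring_of (Kv ?t)) (V ?t) (V' ?t)"
    using g arrows_D(2)[OF k] by (auto simp: graded_isos_def vfield_eq)
  have xk: "x k \<in> module_hom (subring_of (Kv ?t)) T.B.T (V ?t)"
    using reps_hom[OF x k] by (simp add: arrow_space_eq)
  have "(\<lambda>Y\<in>carrier T.A.T. g ?t (x k (T.tmap Y))) \<in> module_hom (subring_of (Kv ?t)) T.A.T (V' ?t)"
  proof (rule T.tmap_hom[where f = "x k" and g = "g ?t" and C = "carrier (V ?t)"])
    show "x k (T.tmap Y) \<in> carrier (V ?t)" if "Y \<in> carrier T.A.T" for Y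
      using module_hom_closed[OF xk] T.tmap_closed[OF that] by blast
    show "g ?t n \<in> carrier (V' ?t)" if "n \<in> carrier (V ?t)" for n
      using module_hom_closed[OF gt] that by blast
    show "Kv ?t \<subseteq> Kv ?t" by (rule order.refl)
  qed (use xk module_hom_add[OF gt] module_hom_smult[OF gt] Kv_Ka(2) in simp_all)
  then show "(\<lambda>Y\<in>carrier (arrow_space D Q V' k).
      g ?t (x k (arrow_map D Q V k (inv_into (carrier (V ?s)) (g ?s)) Y)))
    \<in> module_hom (subring_of (Kv ?t)) (arrow_space D Q V' k) (V' ?t)"
    by (simp add: arrow_space_eq arrow_map_eq)
qed

lemma xi_transport:
  assumes V: "good V" and V': "good V'" and g: "g \<in> graded_isos D Q V V'" and k: "k \<in> arrows D"
    and v: "v \<in> carrier (V (src D k))"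
  shows "xi V' (transport D Q V V' g x) k (g (src D k) v) = g (tgt D k) (xi V x k v)"
proof -
  let ?s = "src D k"
  interpret T: scalar_extension_map "Ka k" "Kv ?s" "V' ?s" "Ka k" "Kv ?s" "V ?s" "inv_into (carrier (V ?s)) (g ?s)"
    by (rule iso_map[OF V V' g k])
  note inv = graded_iso_inv[OF V V' g arrows_D(1)[OF k]]
  have "g ?s v \<in> carrier (V' ?s)"
    using g arrows_D(1)[OF k] v by (auto simp: graded_isos_def bij_betw_def)
  then have "T.A.cls (frag_of (1, g ?s v)) \<in> carrier T.A.T"
    by (rule T.A.pure_closed[OF T.A.LD(1)])
  then show ?thesis
    using k inv(3)[OF v] by (simp add: xi_def pure_def transport_def arrow_space_eq arrow_map_eq T.tmap_pure)
qed

lemma good_std: "good (std_space D Q \<nu> :: ('i, 'k, nat \<Rightarrow> 'k) gspace)"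
  unfolding good_def
proof (intro ballI conjI)
  fix i assume i: "i \<in> vertices D"
  note F = field_subring_of[OF Kv_subfield[OF i]]
  interpret F: field "subring_of (Kv i)" by (rule F)
  have "module (subring_of (Kv i)) (F.func_space {..<\<nu> i})" by (rule F.func_space_is_module)
  then show "vectorspace (subring_of (Kv i)) (std_space D Q \<nu> i)"
    unfolding std_space_def vfield_eq vectorspace_def using F by simp
  show "finite (carrier (std_space D Q \<nu> i :: ('k, nat \<Rightarrow> 'k) module))"
    unfolding std_space_def vfield_eq F.func_space_def
    using card_GFset(1)[OF char_power_power[OF Q vdeg_pos[OF i]]] by (simp add: finite_PiE)
qed

lemma card_std: "i \<in> vertices D \<Longrightarrow> card (carrier (std_space D Q \<nu> i :: ('k, nat \<Rightarrow> 'k) module)) = (Q ^ vdeg D i) ^ \<nu> i"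
proof -
  assume i: "i \<in> vertices D"
  interpret F: field "subring_of (Kv i)" by (rule field_subring_of[OF Kv_subfield[OF i]])
  show ?thesis
    unfolding std_space_def vfield_eq F.func_space_def by (simp add: card_PiE card_Kv[OF i])
qed

lemma card_good:
  assumes "good V" "i \<in> vertices D"
  shows "card (carrier (V i)) = (Q ^ vdeg D i) ^ gdim D Q V i"
  using vectorspace_card[OF goodD[OF assms]] assms(2) by (simp add: gdim_def vfield_eq card_Kv)

lemma Kv_card_gt_1: "i \<in> vertices D \<Longrightarrow> Q ^ vdeg D i > 1"
  by (rule one_less_power[OF char_power_gt_1[OF Q] vdeg_pos])

text \<open>Each vertex field has more than one element, so the exponent of its cardinality is
  determined; membership in \<open>NI\<close> settles the indices that are not vertices.\<close>

lemma gdim_eq_iff: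
  assumes "good V" "\<nu> \<in> NI D"
  shows "gdim D Q V = \<nu> \<longleftrightarrow> (\<forall>i\<in>vertices D. card (carrier (V i)) = (Q ^ vdeg D i) ^ \<nu> i)"
proof -
  have "gdim D Q V = \<nu> \<longleftrightarrow> (\<forall>i\<in>vertices D. gdim D Q V i = \<nu> i)"
    using assms(2) by (auto simp: fun_eq_iff NI_def gdim_def)
  also have "\<dots> \<longleftrightarrow> (\<forall>i\<in>vertices D. card (carrier (V i)) = (Q ^ vdeg D i) ^ \<nu> i)"
    using card_good[OF assms(1)] Kv_card_gt_1 by (metis power_inject_exp)
  finally show ?thesis .
qed

text \<open>A basis gives an isomorphism out of the standard space, which is then inverted. Its
  existence gives meaning to the choice operator in \<open>hall_value\<close>.\<close>

lemma graded_iso_std: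
  assumes V: "good V" and \<nu>: "gdim D Q V = \<nu>"
  shows "(SOME g. g \<in> graded_isos D Q V (std_space D Q \<nu>)) \<in> graded_isos D Q V (std_space D Q \<nu>)"
proof -
  have "\<exists>h. h \<in> module_hom (vfield D Q i) (V i) (std_space D Q \<nu> i)
      \<and> bij_betw h (carrier (V i)) (carrier (std_space D Q \<nu> i))" if i: "i \<in> vertices D" for i
  proof -
    let ?S = "std_space D Q \<nu> i"
    have d: "vectorspace.dim (subring_of (Kv i)) (V i) = \<nu> i"
      using \<nu> i by (auto simp: gdim_def vfield_eq)
    have S: "?S = ring.func_space (subring_of (Kv i)) {..<\<nu> i}" by (simp add: std_space_def vfield_eq)
    obtain g where g: "g \<in> module_hom (subring_of (Kv i)) ?S (V i)" "bij_betw g (carrier ?S) (carrier (V i))"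
      by (rule vectorspace_basis_iso[OF goodD[OF V i], unfolded d, folded S])
    define h where "h = inv_into (carrier ?S) g"

    interpret V: vectorspace "subring_of (Kv i)" "V i" by (rule goodD(1)[OF V i])
    interpret S: vectorspace "subring_of (Kv i)" ?S by (rule goodD(1)[OF good_std i])
    have bij: "bij_betw h (carrier (V i)) (carrier ?S)"
      unfolding h_def by (rule bij_betw_inv_into[OF g(2)])
    have hc: "h v \<in> carrier ?S" if "v \<in> carrier (V i)" for v using bij_betw_apply[OF bij that] .
    have gh: "g (h v) = v" if "v \<in> carrier (V i)" for v
      unfolding h_def by (rule bij_betw_inv_into_right[OF g(2) that])
    have inj: "v = w" if "v \<in> carrier ?S" "w \<in> carrier ?S" "g v = g w" for v w
      using g(2) that by (auto simp: bij_betw_def dest: inj_onD)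
    have "h \<in> module_hom (subring_of (Kv i)) (V i) ?S"
      unfolding module_hom_def
    proof (intro CollectI conjI allI impI; (elim conjE)?)
      show "h \<in> carrier (V i) \<rightarrow> carrier ?S" using hc by blast
    next
      fix v w assume vw: "v \<in> carrier (V i)" "w \<in> carrier (V i)"
      show "h (v \<oplus>\<^bsub>V i\<^esub> w) = h v \<oplus>\<^bsub>?S\<^esub> h w"
        by (rule inj) (use vw in \<open>simp_all add: hc gh module_hom_add[OF g(1)]\<close>)
    next
      fix c v assume cv: "c \<in> carrier (subring_of (Kv i))" "v \<in> carrier (V i)"
      have "c \<odot>\<^bsub>V i\<^esub> v \<in> carrier (V i)" "c \<odot>\<^bsub>?S\<^esub> h v \<in> carrier ?S"
        using V.smult_closed[OF cv] S.smult_closed[OF cv(1) hc[OF cv(2)]] .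
      then show "h (c \<odot>\<^bsub>V i\<^esub> v) = c \<odot>\<^bsub>?S\<^esub> h v"
        by (intro inj) (simp_all add: hc gh module_hom_smult[OF g(1) cv(1)] cv(2))
    qed
    then show ?thesis using bij unfolding vfield_eq by blast
  qed
  then have "\<exists>g. \<forall>i\<in>vertices D. g i \<in> module_hom (vfield D Q i) (V i) (std_space D Q \<nu> i)
      \<and> bij_betw (g i) (carrier (V i)) (carrier (std_space D Q \<nu> i))"
    by (intro bchoice) blast
  then have "\<exists>g. g \<in> graded_isos D Q V (std_space D Q \<nu>)"
    unfolding graded_isos_def by blast
  then show ?thesis by (rule someI_ex)
qed

end

section \<open>Restriction of scalars from F_{q^l} to F_q\<close>

locale quiver_rep_ext = quiver_rep D q kt for D :: "('i, 'a) quiver" and q :: nat and kt :: "'k::alg_closed_field itself" +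
  fixes l :: nat
  assumes l: "l > 0" and coprime_l: "\<forall>i\<in>vertices D. coprime l (vdeg D i)"
begin

text \<open>Unqualified notions refer to the base field F_q, those with prefix \<open>E\<close> to
  F_{q^l}; the quiver and the algebraic closure are shared.\<close>

sublocale E: quiver_rep D "q ^ l" kt
  using D charQ l by (simp add: quiver_rep_def char_power_def) (metis nat_0_less_mult_iff power_mult)

lemma Kv_E: "Kv i \<subseteq> E.Kv i" "Ka k \<subseteq> E.Ka k"
  by (simp_all only: power_mult[symmetric]) (intro GFset_dvd_mono; simp)+

lemma E_good: "E.good V \<Longrightarrow> good V"
  unfolding E.good_def good_def
  using vectorspace_restrict_scalars[OF _ Kv_subfield Kv_E(1)] by blast

lemma iota_map:
  assumes V: "E.good V" and k: "k \<in> arrows D"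
  shows "scalar_extension_map (Ka k) (Kv (src D k)) (V (src D k)) (E.Ka k) (E.Kv (src D k)) (V (src D k)) id"
  using scalar_extension[OF E_good[OF V] k] E.scalar_extension[OF V k] Kv_E
  by (simp add: scalar_extension_map_def scalar_extension_map_axioms_def)

lemma iota_reps:
  assumes V: "E.good V" and x: "x \<in> reps D (q ^ l) V"
  shows "iota D q l V x \<in> reps D q V"
  unfolding iota_def
proof (rule repsI)
  fix k assume k: "k \<in> arrows D"
  let ?s = "src D k" and ?t = "tgt D k"
  interpret T: scalar_extension_map "Ka k" "Kv ?s" "V ?s" "E.Ka k" "E.Kv ?s" "V ?s" id
    by (rule iota_map[OF V k])
  have xk: "x k \<in> module_hom (subring_of (E.Kv ?t)) T.B.T (V ?t)"
    using E.reps_hom[OF x k] by (simp add: E.arrow_space_eq)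
  have "(\<lambda>Y\<in>carrier T.A.T. id (x k (T.tmap Y))) \<in> module_hom (subring_of (Kv ?t)) T.A.T (V ?t)"
  proof (rule T.tmap_hom[where f = "x k" and g = id and C = "carrier (V ?t)"])
    show "x k (T.tmap Y) \<in> carrier (V ?t)" if "Y \<in> carrier T.A.T" for Y
      using module_hom_closed[OF xk] T.tmap_closed[OF that] by blast
  qed (use xk Kv_Ka(2) Kv_E(1) in simp_all)
  then show "(\<lambda>Y\<in>carrier (arrow_space D q V k). x k (arrow_map D (q ^ l) V k id Y))
    \<in> module_hom (subring_of (Kv ?t)) (arrow_space D q V k) (V ?t)"
    by (simp add: arrow_space_eq E.arrow_map_eq)
qed

text \<open>The natural map sends 1 \<otimes> u to 1 \<otimes> u, so \<open>iota\<close> leaves the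
  semilinear parts unchanged, and the two sides differ only in the fields over which subspaces are
  taken.\<close>

lemma xi_iota:
  assumes V: "E.good V" and k: "k \<in> arrows D" and u: "u \<in> carrier (V (src D k))"
  shows "xi V (iota D q l V x) k u = E.xi V x k u"
proof -
  interpret T: scalar_extension_map "Ka k" "Kv (src D k)" "V (src D k)" "E.Ka k" "E.Kv (src D k)" "V (src D k)" id
    by (rule iota_map[OF V k])
  have "T.A.cls (frag_of (1, u)) \<in> carrier T.A.T"
    by (rule T.A.pure_closed[OF T.A.LD(1) u])
  then show ?thesis
    using k by (simp add: xi_def pure_def E.xi_def E.pure_def iota_def arrow_space_eq E.arrow_map_eq T.tmap_pure)
qed

end

section \<open>Counting flags\<close>

text \<open>The dimension of a subquotient, multiplied out into an identity of cardinalities;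
  \<open>w i\<close> stands for the number of elements of the field at \<open>i\<close>.\<close>

definition flag_step :: "'i set \<Rightarrow> ('i \<Rightarrow> nat) \<Rightarrow> ('i \<Rightarrow> 'v set) \<Rightarrow> ('i \<Rightarrow> 'v set) \<Rightarrow> 'i \<times> nat \<Rightarrow> bool" where
  "flag_step I w A B p \<longleftrightarrow>
     (\<forall>i\<in>I. B i \<subseteq> A i \<and> card (A i) = card (B i) * w i ^ simple_weight (fst p) (snd p) i)"

text \<open>Flags without linear algebra: only the set \<open>S\<close> of admissible terms and the
  weights \<open>w\<close> vary. The recursion from the top term \<open>A\<close> down to
  \<open>C\<close> suits the orbit argument, which treats one term at a time, as well as the
  concatenation of types.\<close>

fun nchains :: "'i set \<Rightarrow> ('i \<Rightarrow> nat) \<Rightarrow> ('i \<Rightarrow> 'v set) set \<Rightarrow> ('i \<Rightarrow> 'v set) \<Rightarrow> ('i \<Rightarrow> 'v set)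
    \<Rightarrow> ('i \<times> nat) list \<Rightarrow> nat" where
  "nchains I w S A C [] = (if A = C then 1 else 0)"
| "nchains I w S A C (p # ps) = (\<Sum>B\<in>{B \<in> S. flag_step I w A B p}. nchains I w S B C ps)"

definition type_weight :: "('i \<times> nat) list \<Rightarrow> 'i \<Rightarrow> nat" where
  "type_weight ps i = (\<Sum>p\<leftarrow>ps. simple_weight (fst p) (snd p) i)"

lemma flag_weight_eq: "length js = length cs \<Longrightarrow> flag_weight js cs = type_weight (zip js cs)"
  unfolding flag_weight_def type_weight_def fun_eq_iff sum_list_sum_nth
  by (auto simp: atLeast0LessThan intro!: sum.cong)

text \<open>The sum runs over the term \<open>B\<close> at the seam of the two types; in the Hall
  product this term is the subspace W.\<close>

lemma nchains_append:
  assumes "finite S" "A \<in> S"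
  shows "nchains I w S A C (ps @ ps') = (\<Sum>B\<in>S. nchains I w S A B ps * nchains I w S B C ps')"
  using assms(2)
proof (induction ps arbitrary: A)
  case Nil
  have "(\<Sum>B\<in>S. nchains I w S A B [] * nchains I w S B C ps')
      = (\<Sum>B\<in>S. if A = B then nchains I w S B C ps' else 0)"
    by (intro sum.cong) auto
  also have "\<dots> = nchains I w S A C ps'" using Nil assms(1) by simp
  finally show ?case by simp
next
  case (Cons p ps)
  have "nchains I w S A C ((p # ps) @ ps')
      = (\<Sum>A'\<in>{B \<in> S. flag_step I w A B p}. \<Sum>B\<in>S. nchains I w S A' B ps * nchains I w S B C ps')"
    using Cons.IH by (auto intro!: sum.cong)
  also have "\<dots> = (\<Sum>B\<in>S. nchains I w S A B (p # ps) * nchains I w S B C ps')"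
    by (subst sum.swap) (simp add: sum_distrib_right)
  finally show ?case .
qed

lemma nchains_nonzero:
  "nchains I w S A C ps \<noteq> 0 \<Longrightarrow> i \<in> I \<Longrightarrow> C i \<subseteq> A i \<and> card (A i) = card (C i) * w i ^ type_weight ps i"
proof (induction ps arbitrary: A)
  case Nil
  then show ?case by (auto simp: type_weight_def split: if_splits)
next
  case (Cons p ps)
  then obtain B where B: "flag_step I w A B p" "nchains I w S B C ps \<noteq> 0"
    by (metis (mono_tags, lifting) mem_Collect_eq nchains.simps(2) sum.neutral)
  from Cons.IH[OF B(2) Cons.prems(2)] B(1) Cons.prems(2) show ?case
    by (auto simp: flag_step_def type_weight_def power_add mult_ac)
qed

text \<open>All terms of a chain from \<open>A\<close> to \<open>C\<close> lie between the two, so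
  other members of \<open>S\<close> contribute nothing. The bound \<open>A0\<close> is separate from
  \<open>A\<close> because \<open>A\<close> moves down during the induction while the restricted set
  stays fixed.\<close>

lemma nchains_interval:
  assumes "finite S" and "\<And>i. i \<in> I \<Longrightarrow> A i \<subseteq> A0 i"
  shows "nchains I w S A C ps = nchains I w {U \<in> S. \<forall>i\<in>I. C i \<subseteq> U i \<and> U i \<subseteq> A0 i} A C ps"
  using assms(2)
proof (induction ps arbitrary: A)
  case (Cons p ps)
  let ?S = "{U \<in> S. \<forall>i\<in>I. C i \<subseteq> U i \<and> U i \<subseteq> A0 i}"
  have "nchains I w ?S A C (p # ps) = (\<Sum>B\<in>{B \<in> ?S. flag_step I w A B p}. nchains I w S B C ps)"
    unfolding nchains.simps by (rule sum.cong[OF refl]) (rule Cons.IH[symmetric], auto)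
  also have "\<dots> = (\<Sum>B\<in>{B \<in> S. flag_step I w A B p}. nchains I w S B C ps)"
  proof (rule sum.mono_neutral_left)
    show "\<forall>B\<in>{B \<in> S. flag_step I w A B p} - {B \<in> ?S. flag_step I w A B p}. nchains I w S B C ps = 0"
    proof (rule ballI, rule ccontr)
      fix B assume B: "B \<in> {B \<in> S. flag_step I w A B p} - {B \<in> ?S. flag_step I w A B p}"
        and "nchains I w S B C ps \<noteq> 0"
      then have "\<forall>i\<in>I. C i \<subseteq> B i" using nchains_nonzero by metis
      moreover have "\<forall>i\<in>I. B i \<subseteq> A0 i" using B Cons.prems by (fastforce simp: flag_step_def)
      ultimately show False using B by blast
    qed
  qed (use assms(1) in auto)
  finally show ?case by simp
qed simp

lemma nchains_transfer:
  assumes \<phi>: "bij_betw \<phi> S S'" and A: "A \<in> S" "C \<in> S"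
    and step: "\<And>U U' p. U \<in> S \<Longrightarrow> U' \<in> S \<Longrightarrow> flag_step I w U U' p \<longleftrightarrow> flag_step I w' (\<phi> U) (\<phi> U') p"
  shows "nchains I w S A C ps = nchains I w' S' (\<phi> A) (\<phi> C) ps"
  using A(1)
proof (induction ps arbitrary: A)
  case Nil
  then show ?case using \<phi> A(2) by (auto simp: bij_betw_def dest: inj_onD)
next
  case (Cons p ps)
  have "bij_betw \<phi> {B \<in> S. flag_step I w A B p} {B \<in> S'. flag_step I w' (\<phi> A) B p}"
  proof (rule bij_betw_subset[OF \<phi>])
    have "\<phi> ` S = S'" using \<phi> by (simp add: bij_betw_def)
    moreover have "\<forall>B\<in>S. flag_step I w A B p \<longleftrightarrow> flag_step I w' (\<phi> A) (\<phi> B) p"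
      using step[OF Cons.prems] by blast
    ultimately show "\<phi> ` {B \<in> S. flag_step I w A B p} = {B \<in> S'. flag_step I w' (\<phi> A) B p}" by blast
  qed blast
  then have "(\<Sum>B\<in>{B \<in> S'. flag_step I w' (\<phi> A) B p}. nchains I w' S' B (\<phi> C) ps)
      = (\<Sum>B\<in>{B \<in> S. flag_step I w A B p}. nchains I w' S' (\<phi> B) (\<phi> C) ps)"
    by (rule sum.reindex_bij_betw[symmetric])
  then show ?case using Cons.IH by (auto intro: sum.cong)
qed

text \<open>Removing the first term of a list matches the recursion of \<open>nchains\<close>; lists
  with different second terms are disjoint.\<close>

lemma card_chain_lists:
  assumes "finite S" "A \<in> S"
  shows "card {Us. length Us = Suc (length ps) \<and> set Us \<subseteq> S \<and> hd Us = A \<and> last Us = C \<and>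
      (\<forall>n<length ps. flag_step I w (Us ! n) (Us ! Suc n) (ps ! n))} = nchains I w S A C ps"
proof -
  define L where "L A ps = {Us. length Us = Suc (length ps) \<and> set Us \<subseteq> S \<and> hd Us = A \<and> last Us = C \<and>
      (\<forall>n<length ps. flag_step I w (Us ! n) (Us ! Suc n) (ps ! n))}" for A and ps :: "('a \<times> nat) list"
  have fin: "finite (L A ps)" for A ps
    by (rule finite_subset[OF _ finite_lists_length_eq[OF assms(1), of "Suc (length ps)"]])
      (auto simp: L_def)
  have "card (L A ps) = nchains I w S A C ps"
    using assms(2)
  proof (induction ps arbitrary: A)
    case Nil
    have "L A [] = (if A = C then {[A]} else {})"
      using Nil by (auto simp: L_def length_Suc_conv)
    then show ?case by simp
  next
    case (Cons p ps)
    have eq: "L A (p # ps) = (\<Union>B\<in>{B \<in> S. flag_step I w A B p}. (#) A ` L B ps)"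
    proof (intro equalityI subsetI)
      fix Us assume Us: "Us \<in> L A (p # ps)"
      then have len: "length Us = Suc (Suc (length ps))" "hd Us = A" by (simp_all add: L_def)
      then obtain Us' where Us': "Us = A # Us'" by (cases Us) auto
      have ne: "Us' \<noteq> []" using len Us' by auto
      have "flag_step I w A (hd Us') p"
        using Us Us' ne unfolding L_def by (auto simp: hd_conv_nth dest!: spec[of _ 0])
      moreover have "Us' \<in> L (hd Us') ps"
        using Us Us' ne unfolding L_def by (auto dest!: spec[of _ "Suc _"])
      moreover have "hd Us' \<in> S" using Us Us' ne by (auto simp: L_def)
      ultimately show "Us \<in> (\<Union>B\<in>{B \<in> S. flag_step I w A B p}. (#) A ` L B ps)"
        using Us' by blast
    next
      fix Us assume "Us \<in> (\<Union>B\<in>{B \<in> S. flag_step I w A B p}. (#) A ` L B ps)"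
      then obtain B Us' where B: "B \<in> S" "flag_step I w A B p" "Us' \<in> L B ps" "Us = A # Us'" by blast
      then have "Us' \<noteq> []" by (auto simp: L_def)
      have "flag_step I w (Us ! n) (Us ! Suc n) ((p # ps) ! n)" if "n < length (p # ps)" for n
        using B \<open>Us' \<noteq> []\<close> that by (cases n) (auto simp: L_def hd_conv_nth)
      then show "Us \<in> L A (p # ps)"
        using B \<open>Us' \<noteq> []\<close> Cons.prems by (auto simp: L_def)
    qed
    have "card (L A (p # ps)) = (\<Sum>B\<in>{B \<in> S. flag_step I w A B p}. card ((#) A ` L B ps))"
      unfolding eq by (rule card_UN_disjoint) (use assms(1) fin in \<open>auto simp: L_def\<close>)
    also have "\<dots> = nchains I w S A C (p # ps)"
      using Cons.IH by (auto simp: card_image intro!: sum.cong)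
    finally show ?case .
  qed
  then show ?thesis unfolding L_def .
qed

text \<open>Every fibre over the image is a translate of the kernel. Additivity is asked on
  \<open>U\<close> alone, since the lemma is applied to maps controlled only on one term of a
  flag.\<close>

lemma card_linear_image:
  assumes V: "vectorspace (subring_of K) V" and V': "vectorspace (subring_of K) V'" and K: "is_subfield K"
    and A: "lin_closed K V U" "finite U"
    and hc: "\<And>u. u \<in> U \<Longrightarrow> h u \<in> carrier V'"
    and ha: "\<And>u w. u \<in> U \<Longrightarrow> w \<in> U \<Longrightarrow> h (u \<oplus>\<^bsub>V\<^esub> w) = h u \<oplus>\<^bsub>V'\<^esub> h w"
  shows "card U = card (h ` U) * card {u \<in> U. h u = \<zero>\<^bsub>V'\<^esub>}"
proof -
  interpret V: vectorspace "subring_of K" V by fact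
  interpret V': vectorspace "subring_of K" V' by fact
  let ?C = "{u \<in> U. h u = \<zero>\<^bsub>V'\<^esub>}"
  note UD = A(1)[unfolded lin_closed_def]
  have UV: "u \<in> carrier V" if "u \<in> U" for u using UD that by auto
  have fiber: "card {u \<in> U. h u = h u0} = card ?C" if u0: "u0 \<in> U" for u0
  proof -
    have inj: "inj_on (\<lambda>c. c \<oplus>\<^bsub>V\<^esub> u0) ?C"
      using UV u0 by (auto intro!: inj_onI)
    have "(\<lambda>c. c \<oplus>\<^bsub>V\<^esub> u0) ` ?C = {u \<in> U. h u = h u0}"
    proof (intro equalityI subsetI)
      fix u assume "u \<in> (\<lambda>c. c \<oplus>\<^bsub>V\<^esub> u0) ` ?C"
      then show "u \<in> {u \<in> U. h u = h u0}" using UD u0 hc ha by auto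
    next
      fix u assume u: "u \<in> {u \<in> U. h u = h u0}"
      define c where "c = u \<ominus>\<^bsub>V\<^esub> u0"
      have c: "c \<in> U" using lin_closed_diff(2)[OF V K A(1)] u u0 by (simp add: c_def)
      have cu: "c \<oplus>\<^bsub>V\<^esub> u0 = u"
        using UV u u0 by (simp add: c_def V.M.minus_eq V.M.a_assoc V.M.l_neg)
      have "h c \<oplus>\<^bsub>V'\<^esub> h u0 = h u0" using ha[OF c u0] cu u by simp
      then have "h c = \<zero>\<^bsub>V'\<^esub>" using hc[OF c] hc[OF u0] V'.M.add.r_cancel_one by simp
      then show "u \<in> (\<lambda>c. c \<oplus>\<^bsub>V\<^esub> u0) ` ?C" using c cu by blast
    qed
    then show ?thesis using card_image[OF inj] by simp
  qed
  have "card U = (\<Sum>y\<in>h ` U. card {u \<in> U. h u = y})"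
    using sum.image_gen[OF A(2), of "\<lambda>_. 1 :: nat" h] by simp
  also have "\<dots> = (\<Sum>y\<in>h ` U. card ?C)"
    using fiber by (intro sum.cong) auto
  finally show ?thesis by simp
qed

section \<open>Stable flags of a representation as chains\<close>

context quiver_rep
begin

abbreviation nch :: "('i \<Rightarrow> 'v set) set \<Rightarrow> ('i \<Rightarrow> 'v set) \<Rightarrow> ('i \<Rightarrow> 'v set) \<Rightarrow> ('i \<times> nat) list \<Rightarrow> nat" where
  "nch \<equiv> nchains (vertices D) (\<lambda>i. Q ^ vdeg D i)"

definition stable_subspaces :: "('i, 'k, 'v) gspace \<Rightarrow> ('a \<Rightarrow> 'v \<Rightarrow> 'v) \<Rightarrow> ('i \<Rightarrow> 'v set) set" where
  "stable_subspaces V \<xi> = {U \<in> graded_subspaces D Q V. xi_stable \<xi> U}"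

definition gtop :: "('i, 'k, 'v) gspace \<Rightarrow> 'i \<Rightarrow> 'v set" where
  "gtop V = (\<lambda>i\<in>vertices D. carrier (V i))"

definition gbot :: "('i, 'k, 'v) gspace \<Rightarrow> 'i \<Rightarrow> 'v set" where
  "gbot V = (\<lambda>i\<in>vertices D. {\<zero>\<^bsub>V i\<^esub>})"

lemma finite_graded_subspaces:
  assumes "good V" shows "finite (graded_subspaces D Q V)"
proof (rule finite_subset)
  show "graded_subspaces D Q V \<subseteq> (\<Pi>\<^sub>E i\<in>vertices D. Pow (carrier (V i)))"
  proof
    fix U assume "U \<in> graded_subspaces D Q V"
    then have U: "U \<in> extensional (vertices D)" "\<forall>i\<in>vertices D. U i \<subseteq> carrier (V i)"
      by (simp_all add: graded_subspaces_iff[OF assms] lin_closed_def)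
    then show "U \<in> (\<Pi>\<^sub>E i\<in>vertices D. Pow (carrier (V i)))" by (auto simp: PiE_def)
  qed
  show "finite (\<Pi>\<^sub>E i\<in>vertices D. Pow (carrier (V i)))"
    using finite_vertices goodD(2)[OF assms] by (intro finite_PiE) auto
qed

lemma finite_stable_subspaces: "good V \<Longrightarrow> finite (stable_subspaces V \<xi>)"
  by (rule finite_subset[OF _ finite_graded_subspaces]) (auto simp: stable_subspaces_def)

lemma stable_subspaces_lin:
  "good V \<Longrightarrow> U \<in> stable_subspaces V \<xi> \<Longrightarrow> i \<in> vertices D \<Longrightarrow> lin_closed (Kv i) (V i) (U i)"
  by (simp add: stable_subspaces_def graded_subspaces_iff)

lemma gtop_stable:
  assumes "good V" "x \<in> reps D Q V"
  shows "gtop V \<in> stable_subspaces V (xi V x)"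
proof -
  have "lin_closed (Kv i) (V i) (carrier (V i))" if i: "i \<in> vertices D" for i
  proof -
    interpret V: vectorspace "subring_of (Kv i)" "V i" by (rule goodD(1)[OF assms(1) i])
    show ?thesis using V.smult_closed by (auto simp: lin_closed_def)
  qed
  moreover have "xi_stable (xi V x) (gtop V)"
    using xi_closed[OF assms] arrows_D by (auto simp: xi_stable_def gtop_def)
  ultimately show ?thesis
    by (simp add: stable_subspaces_def graded_subspaces_iff[OF assms(1)]) (simp add: gtop_def)
qed

lemma xi_add:
  assumes "good V" "x \<in> reps D Q V" "k \<in> arrows D" "u \<in> carrier (V (src D k))" "w \<in> carrier (V (src D k))"
  shows "xi V x k (u \<oplus>\<^bsub>V (src D k)\<^esub> w) = xi V x k u \<oplus>\<^bsub>V (tgt D k)\<^esub> xi V x k w"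
proof -
  interpret T: scalar_extension "Ka k" "Kv (src D k)" "V (src D k)"
    by (rule scalar_extension[OF assms(1,3)])
  have xk: "x k \<in> module_hom (subring_of (Kv (tgt D k))) T.T (V (tgt D k))"
    using reps_hom[OF assms(2,3)] by (simp add: arrow_space_eq)
  have "T.cls (frag_of (1, u \<oplus>\<^bsub>V (src D k)\<^esub> w)) = T.cls (frag_of (1, u)) \<oplus>\<^bsub>T.T\<^esub> T.cls (frag_of (1, w))"
    unfolding T.pure_add_right[OF T.LD(1) assms(4,5)] using T.LD(1) assms(4,5)
    by (intro T.add_T[symmetric]) simp_all
  then show ?thesis
    using module_hom_add[OF xk T.pure_closed[OF T.LD(1) assms(4)] T.pure_closed[OF T.LD(1) assms(5)]]
    by (simp add: xi_def pure_def)
qed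

lemma xi_zero:
  assumes "good V" "x \<in> reps D Q V" "k \<in> arrows D"
  shows "xi V x k \<zero>\<^bsub>V (src D k)\<^esub> = \<zero>\<^bsub>V (tgt D k)\<^esub>"
proof -
  interpret s: abelian_group "V (src D k)" using good_abelian assms arrows_D by blast
  interpret t: abelian_group "V (tgt D k)" using good_abelian assms arrows_D by blast
  have c: "xi V x k \<zero>\<^bsub>V (src D k)\<^esub> \<in> carrier (V (tgt D k))" by (rule xi_closed[OF assms s.zero_closed])
  have "xi V x k \<zero>\<^bsub>V (src D k)\<^esub> \<oplus>\<^bsub>V (tgt D k)\<^esub> xi V x k \<zero>\<^bsub>V (src D k)\<^esub> = xi V x k \<zero>\<^bsub>V (src D k)\<^esub>"
    using xi_add[OF assms s.zero_closed s.zero_closed, symmetric] by simp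
  then show ?thesis using t.add.r_cancel_one[OF c c] by simp
qed

lemma gbot_stable:
  assumes "good V" "x \<in> reps D Q V"
  shows "gbot V \<in> stable_subspaces V (xi V x)"
proof -
  have "lin_closed (Kv i) (V i) {\<zero>\<^bsub>V i\<^esub>}" if i: "i \<in> vertices D" for i
  proof -
    interpret V: vectorspace "subring_of (Kv i)" "V i" by (rule goodD(1)[OF assms(1) i])
    show ?thesis using V.rmult_0 by (auto simp: lin_closed_def)
  qed
  moreover have "xi_stable (xi V x) (gbot V)"
    using xi_zero[OF assms] arrows_D by (auto simp: xi_stable_def gbot_def)
  ultimately show ?thesis
    by (simp add: stable_subspaces_def graded_subspaces_iff[OF assms(1)]) (simp add: gbot_def)
qed

text \<open>Lagrange's theorem for the additive groups turns the dimension of U/W into a ratio of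
  cardinalities.\<close>

lemma quot_dim_iff:
  assumes V: "good V" and U: "U \<in> graded_subspaces D Q V" and W: "W \<in> graded_subspaces D Q V"
    and WU: "\<forall>i\<in>vertices D. W i \<subseteq> U i" and \<nu>: "\<nu> \<in> NI D"
  shows "gdim D Q (quot_space (sub_space V U) W) = \<nu> \<longleftrightarrow>
    (\<forall>i\<in>vertices D. card (U i) = card (W i) * (Q ^ vdeg D i) ^ \<nu> i)"
proof -
  have gU: "good (sub_space V U)" by (rule good_sub[OF V U])
  have W': "W \<in> graded_subspaces D Q (sub_space V U)"
    using W[unfolded graded_subspaces_iff[OF V]] WU unfolding graded_subspaces_iff[OF gU]
    by (simp add: lin_closed_def sub_space_def)
  have "card (carrier (quot_space (sub_space V U) W i)) = n \<longleftrightarrow> card (U i) = card (W i) * n"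
    if i: "i \<in> vertices D" for i n
  proof -
    have "card (carrier (sub_space V U i)) = card (carrier (quot_module (sub_space V U i) (W i))) * card (W i)"
      by (rule quotient_space.card_VW[OF quotient_space[OF gU W' i] goodD(2)[OF gU i]])
    then have eq: "card (U i) = card (W i) * card (carrier (quot_space (sub_space V U) W i))"
      by (simp add: sub_space_def quot_space_def mult.commute)
    have "lin_closed (Kv i) (V i) (W i)" using W i by (simp add: graded_subspaces_iff[OF V])
    then have "card (W i) > 0"
      using goodD(2)[OF V i] by (auto simp: lin_closed_def card_gt_0_iff intro: finite_subset)
    then show ?thesis unfolding eq by auto
  qed
  then show ?thesis using gdim_eq_iff[OF good_quot[OF gU W'] \<nu>] by simp
qed

text \<open>The bridge from flags as lists of subspaces to the combinatorial count:
  \<open>stable_iff\<close> replaces stability, and \<open>quot_dim_iff\<close> replaces the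
  dimensions of subquotients.\<close>

lemma card_stable_flags:
  assumes V: "good V" and x: "x \<in> reps D Q V" and js: "set js \<subseteq> vertices D" "length js = length cs"
  shows "card {Us \<in> flags D Q V js cs. \<forall>U\<in>set Us. stable D Q V x U}
    = nch (stable_subspaces V (xi V x)) (gtop V) (gbot V) (zip js cs)"
proof -
  have "{Us \<in> flags D Q V js cs. \<forall>U\<in>set Us. stable D Q V x U}
    = {Us. length Us = Suc (length (zip js cs)) \<and> set Us \<subseteq> stable_subspaces V (xi V x) \<and> hd Us = gtop V
        \<and> last Us = gbot V \<and>
      (\<forall>n<length (zip js cs). flag_step (vertices D) (\<lambda>i. Q ^ vdeg D i) (Us ! n) (Us ! Suc n) (zip js cs ! n))}"
    (is "?L = ?R")
  proof -
    have st: "(set Us \<subseteq> graded_subspaces D Q V \<and> (\<forall>U\<in>set Us. stable D Q V x U))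
        \<longleftrightarrow> set Us \<subseteq> stable_subspaces V (xi V x)" for Us
      unfolding stable_subspaces_def using stable_iff[OF V x] by blast
    have step: "((\<forall>i\<in>vertices D. W i \<subseteq> U i) \<and> gdim D Q (quot_space (sub_space V U) W) = simple_weight j c)
       \<longleftrightarrow> flag_step (vertices D) (\<lambda>i. Q ^ vdeg D i) U W (j, c)"
      if "U \<in> graded_subspaces D Q V" "W \<in> graded_subspaces D Q V" "j \<in> vertices D" for U W j c
    proof -
      have "simple_weight j c \<in> NI D" using that(3) by (auto simp: simple_weight_def NI_def)
      then show ?thesis using quot_dim_iff[OF V that(1,2)] by (auto simp: flag_step_def)
    qed
    show ?thesis
    proof (rule Set.set_eqI)
      fix Us
      show "Us \<in> ?L \<longleftrightarrow> Us \<in> ?R"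
      proof (cases "length Us = Suc (length js) \<and> set Us \<subseteq> graded_subspaces D Q V")
        case True
        have "((\<forall>i\<in>vertices D. (Us ! Suc n) i \<subseteq> (Us ! n) i) \<and>
              gdim D Q (quot_space (sub_space V (Us ! n)) (Us ! Suc n)) = simple_weight (js ! n) (cs ! n))
            \<longleftrightarrow> flag_step (vertices D) (\<lambda>i. Q ^ vdeg D i) (Us ! n) (Us ! Suc n) (zip js cs ! n)"
          if n: "n < length js" for n
        proof -
          have "Us ! n \<in> graded_subspaces D Q V" "Us ! Suc n \<in> graded_subspaces D Q V"
            using True n by (auto intro!: subsetD[OF conjunct2[OF True]] nth_mem)
          moreover have "js ! n \<in> vertices D" using js n by (auto dest: nth_mem)
          ultimately show ?thesis using step[of "Us ! n" "Us ! Suc n" "js ! n" "cs ! n"] n js(2) by simp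
        qed
        then show ?thesis using True st[of Us] js(2)
          by (auto simp: flags_def gtop_def gbot_def)
      next
        case False
        then show ?thesis using st[of Us] js(2) by (auto simp: flags_def)
      qed
    qed
  qed
  also have "card \<dots> = nch (stable_subspaces V (xi V x)) (gtop V) (gbot V) (zip js cs)"
    by (rule card_chain_lists[OF finite_stable_subspaces[OF V] gtop_stable[OF V x]])
  finally show ?thesis .
qed

text \<open>A surjection from \<open>A\<close> onto \<open>V'\<close> with kernel \<open>C\<close> identifies the flags between \<open>A\<close> and \<open>C\<close> with
  those of \<open>V'\<close>; this covers subspaces, quotients and isomorphisms alike.\<close>

lemma nchains_pullback:
  assumes V: "good V" and V': "good V'" and A: "A \<in> stable_subspaces V \<xi>" and C: "C \<in> stable_subspaces V \<xi>"
    and him: "\<And>i. i \<in> vertices D \<Longrightarrow> h i ` A i = carrier (V' i)"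
    and ha: "\<And>i u w. i \<in> vertices D \<Longrightarrow> u \<in> A i \<Longrightarrow> w \<in> A i \<Longrightarrow> h i (u \<oplus>\<^bsub>V i\<^esub> w) = h i u \<oplus>\<^bsub>V' i\<^esub> h i w"
    and hs: "\<And>i c u. i \<in> vertices D \<Longrightarrow> c \<in> Kv i \<Longrightarrow> u \<in> A i \<Longrightarrow> h i (c \<odot>\<^bsub>V i\<^esub> u) = c \<odot>\<^bsub>V' i\<^esub> h i u"
    and ker: "\<And>i. i \<in> vertices D \<Longrightarrow> {u \<in> A i. h i u = \<zero>\<^bsub>V' i\<^esub>} = C i"
    and h\<xi>: "\<And>k u. k \<in> arrows D \<Longrightarrow> u \<in> A (src D k) \<Longrightarrow> h (tgt D k) (\<xi> k u) = \<xi>' k (h (src D k) u)"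
  shows "nch (stable_subspaces V \<xi>) A C ps = nch (stable_subspaces V' \<xi>') (gtop V') (gbot V') ps"
proof -
  define S where "S = {U \<in> stable_subspaces V \<xi>. \<forall>i\<in>vertices D. C i \<subseteq> U i \<and> U i \<subseteq> A i}"
  define \<phi> where "\<phi> U = (\<lambda>i\<in>vertices D. h i ` U i)" for U
  note lin = stable_subspaces_lin[OF V]
  have CA: "C i \<subseteq> A i" if "i \<in> vertices D" for i using ker[OF that] by blast
  have S: "U \<in> stable_subspaces V \<xi>" "i \<in> vertices D \<Longrightarrow> C i \<subseteq> U i" "i \<in> vertices D \<Longrightarrow> U i \<subseteq> A i"
    if "U \<in> S" for U i using that by (auto simp: S_def)
  have hc: "h i u \<in> carrier (V' i)" if "i \<in> vertices D" "u \<in> A i" for i u using him[OF that(1)] that(2) by blast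
  have h0: "h i \<zero>\<^bsub>V i\<^esub> = \<zero>\<^bsub>V' i\<^esub>" if i: "i \<in> vertices D" for i
  proof -
    have "\<zero>\<^bsub>V i\<^esub> \<in> C i" using lin[OF C i] by (simp add: lin_closed_def)
    then show ?thesis using ker[OF i] by blast
  qed
  \<comment> \<open>Members of \<open>S\<close> contain the kernel \<open>C\<close>, so each is the
    full preimage in \<open>A\<close> of its image and is determined by it.\<close>
  have sat: "u \<in> U i" if U: "U \<in> S" and i: "i \<in> vertices D" and u: "u \<in> A i" "h i u \<in> h i ` U i" for U i u
  proof -
    obtain w where w: "w \<in> U i" "h i w = h i u" using u(2) by force
    have wA: "w \<in> A i" using S(3)[OF U i] w(1) by blast
    interpret V: vectorspace "subring_of (Kv i)" "V i" by (rule goodD(1)[OF V i])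
    interpret V': vectorspace "subring_of (Kv i)" "V' i" by (rule goodD(1)[OF V' i])
    define c where "c = u \<ominus>\<^bsub>V i\<^esub> w"
    have c: "c \<in> A i"
      unfolding c_def by (rule lin_closed_diff(2)[OF goodD(1)[OF V i] Kv_subfield[OF i] lin[OF A i] u(1) wA])
    have uV: "u \<in> carrier (V i)" "w \<in> carrier (V i)" using lin[OF A i] u(1) wA by (auto simp: lin_closed_def)
    have cw: "c \<oplus>\<^bsub>V i\<^esub> w = u" using uV by (simp add: c_def V.M.minus_eq V.M.a_assoc V.M.l_neg)
    have "h i c \<oplus>\<^bsub>V' i\<^esub> h i w = h i w" using ha[OF i c wA] cw w(2) by simp
    then have "h i c = \<zero>\<^bsub>V' i\<^esub>" using hc[OF i c] hc[OF i wA] V'.M.add.r_cancel_one by simp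
    then have "c \<in> U i" using c ker[OF i] S(2)[OF U i] by blast
    then have "c \<oplus>\<^bsub>V i\<^esub> w \<in> U i" using w(1) lin[OF S(1)[OF U] i] by (simp add: lin_closed_def)
    then show ?thesis using cw by simp
  qed
  have \<phi>_S: "\<phi> U \<in> stable_subspaces V' \<xi>'" if U: "U \<in> S" for U
  proof -
    have "lin_closed (Kv i) (V' i) (h i ` U i)" if i: "i \<in> vertices D" for i
      unfolding lin_closed_def
    proof (intro conjI ballI)
      have UA: "u \<in> A i" if "u \<in> U i" for u using S(3)[OF U i] that by blast
      note Ui = lin[OF S(1)[OF U] i, unfolded lin_closed_def]
      show "h i ` U i \<subseteq> carrier (V' i)" using UA hc[OF i] by blast
      show "\<zero>\<^bsub>V' i\<^esub> \<in> h i ` U i" using h0[OF i] Ui by force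
      show "y \<oplus>\<^bsub>V' i\<^esub> z \<in> h i ` U i" if y: "y \<in> h i ` U i" and z: "z \<in> h i ` U i" for y z
      proof -
        obtain u where u: "u \<in> U i" "y = h i u" using y by blast
        obtain w where w: "w \<in> U i" "z = h i w" using z by blast
        have "u \<oplus>\<^bsub>V i\<^esub> w \<in> U i" using Ui u(1) w(1) by blast
        from imageI[OF this, of "h i"] show ?thesis
          unfolding u(2) w(2) ha[OF i UA[OF u(1)] UA[OF w(1)]] .
      qed
      show "c \<odot>\<^bsub>V' i\<^esub> y \<in> h i ` U i" if c: "c \<in> Kv i" and y: "y \<in> h i ` U i" for c y
      proof -
        obtain u where u: "u \<in> U i" "y = h i u" using y by blast
        have "c \<odot>\<^bsub>V i\<^esub> u \<in> U i" using Ui u(1) c by blast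
        from imageI[OF this, of "h i"] show ?thesis unfolding u(2) hs[OF i c UA[OF u(1)]] .
      qed
    qed
    moreover have "xi_stable \<xi>' (\<phi> U)"
      unfolding xi_stable_def
    proof (intro ballI)
      fix k y assume k: "k \<in> arrows D" and y: "y \<in> \<phi> U (src D k)"
      then obtain u where u: "u \<in> U (src D k)" "y = h (src D k) u" using arrows_D by (auto simp: \<phi>_def)
      have "\<xi> k u \<in> U (tgt D k)" using S(1)[OF U] k u(1) by (auto simp: stable_subspaces_def xi_stable_def)
      moreover have "\<xi>' k y = h (tgt D k) (\<xi> k u)"
        using h\<xi>[OF k] u S(3)[OF U arrows_D(1)[OF k]] by auto
      ultimately show "\<xi>' k y \<in> \<phi> U (tgt D k)" using arrows_D(2)[OF k] by (simp add: \<phi>_def)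
    qed
    ultimately show ?thesis
      by (simp add: stable_subspaces_def graded_subspaces_iff[OF V']) (simp add: \<phi>_def)
  qed
  have sub_iff: "(\<phi> U' i \<subseteq> \<phi> U i) \<longleftrightarrow> U' i \<subseteq> U i" if U: "U \<in> S" "U' \<in> S" and i: "i \<in> vertices D" for U U' i
  proof
    assume le: "\<phi> U' i \<subseteq> \<phi> U i"
    show "U' i \<subseteq> U i"
    proof
      fix u assume u: "u \<in> U' i"
      then have "h i u \<in> h i ` U i" using le i by (auto simp: \<phi>_def)
      then show "u \<in> U i" using sat[OF U(1) i] S(3)[OF U(2) i] u by blast
    qed
  qed (use i in \<open>auto simp: \<phi>_def\<close>)
  have ext: "U \<in> extensional (vertices D)" if "U \<in> S" for U
    using S(1)[OF that] by (simp add: stable_subspaces_def graded_subspaces_iff[OF V])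
  have bij: "bij_betw \<phi> S (stable_subspaces V' \<xi>')"
  proof (rule bij_betw_imageI)
    show "inj_on \<phi> S"
    proof (rule inj_onI)
      fix U U' assume U: "U \<in> S" "U' \<in> S" and eq: "\<phi> U = \<phi> U'"
      show "U = U'"
      proof (rule extensionalityI[OF ext[OF U(1)] ext[OF U(2)]])
        fix i assume i: "i \<in> vertices D"
        show "U i = U' i" using sub_iff[OF U i] sub_iff[OF U(2,1) i] eq by auto
      qed
    qed
    show "\<phi> ` S = stable_subspaces V' \<xi>'"
    proof (intro equalityI subsetI)
      fix U' assume U': "U' \<in> stable_subspaces V' \<xi>'"
      note lin' = stable_subspaces_lin[OF V' U', unfolded lin_closed_def]
      \<comment> \<open>The preimage of \<open>U'\<close> in \<open>A\<close>, which contains the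
        kernel.\<close>
      define U where "U = (\<lambda>i\<in>vertices D. {u \<in> A i. h i u \<in> U' i})"
      have linU: "lin_closed (Kv i) (V i) (U i)" if i: "i \<in> vertices D" for i
        using lin[OF A i] lin'[OF i] i h0[OF i] ha[OF i] hs[OF i] by (auto simp: U_def lin_closed_def)
      have stU: "xi_stable \<xi> U"
        unfolding xi_stable_def
      proof (intro ballI)
        fix k u assume k: "k \<in> arrows D" and "u \<in> U (src D k)"
        then have u: "u \<in> A (src D k)" "h (src D k) u \<in> U' (src D k)" using arrows_D by (simp_all add: U_def)
        have "\<xi> k u \<in> A (tgt D k)" using A k u(1) by (auto simp: stable_subspaces_def xi_stable_def)
        moreover have "h (tgt D k) (\<xi> k u) \<in> U' (tgt D k)"
          using U' k u(2) h\<xi>[OF k u(1)] by (auto simp: stable_subspaces_def xi_stable_def)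
        ultimately show "\<xi> k u \<in> U (tgt D k)" using arrows_D(2)[OF k] by (simp add: U_def)
      qed
      have "U \<in> stable_subspaces V \<xi>"
        using linU stU by (simp add: stable_subspaces_def graded_subspaces_iff[OF V]) (simp add: U_def)
      moreover have "C i \<subseteq> U i \<and> U i \<subseteq> A i" if i: "i \<in> vertices D" for i
      proof -
        have "u \<in> A i \<and> h i u \<in> U' i" if "u \<in> C i" for u
        proof -
          have "u \<in> {u \<in> A i. h i u = \<zero>\<^bsub>V' i\<^esub>}" using that ker[OF i] by simp
          then show ?thesis using lin'[OF i] by simp
        qed
        then show ?thesis using i by (auto simp: U_def)
      qed
      ultimately have US: "U \<in> S" by (simp add: S_def)
      have "\<phi> U = U'"
      proof (rule extensionalityI[of _ "vertices D"])
        fix i assume i: "i \<in> vertices D"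
        have "U' i \<subseteq> h i ` A i" using him[OF i] lin'[OF i] by blast
        then show "\<phi> U i = U' i" using i by (auto simp: \<phi>_def U_def)
      qed (use U' in \<open>simp_all add: \<phi>_def stable_subspaces_def graded_subspaces_iff[OF V']\<close>)
      then show "U' \<in> \<phi> ` S" using US by blast
    qed (use \<phi>_S in blast)
  qed
  \<comment> \<open>Taking images divides every cardinality by the same number
    \<open>card (C i)\<close>, so the ratios in \<open>flag_step\<close> do not change.\<close>
  have card: "card (U i) = card (\<phi> U i) * card (C i)" if U: "U \<in> S" and i: "i \<in> vertices D" for U i
  proof -
    have UA: "U i \<subseteq> A i" by (rule S(3)[OF U i])
    have lU: "lin_closed (Kv i) (V i) (U i)" by (rule lin[OF S(1)[OF U] i])
    have "finite (U i)" using lU goodD(2)[OF V i] by (auto simp: lin_closed_def intro: finite_subset)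
    then have "card (U i) = card (h i ` U i) * card {u \<in> U i. h i u = \<zero>\<^bsub>V' i\<^esub>}"
    proof (rule card_linear_image[OF goodD(1)[OF V i] goodD(1)[OF V' i] Kv_subfield[OF i] lU])
      show "h i u \<in> carrier (V' i)" if "u \<in> U i" for u using hc[OF i] UA that by blast
      show "h i (u \<oplus>\<^bsub>V i\<^esub> w) = h i u \<oplus>\<^bsub>V' i\<^esub> h i w" if "u \<in> U i" "w \<in> U i" for u w
        using that by (intro ha[OF i] subsetD[OF UA])
    qed
    moreover have "{u \<in> U i. h i u = \<zero>\<^bsub>V' i\<^esub>} = C i"
      using ker[OF i] S(2)[OF U i] UA by blast
    ultimately show ?thesis using i by (simp add: \<phi>_def)
  qed
  have Cpos: "card (C i) > 0" if i: "i \<in> vertices D" for i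
    using lin[OF C i] goodD(2)[OF V i] by (auto simp: lin_closed_def card_gt_0_iff intro: finite_subset)
  have AS: "A \<in> S" "C \<in> S" using A C CA by (auto simp: S_def)
  have "nch (stable_subspaces V \<xi>) A C ps = nch S A C ps"
    unfolding S_def by (rule nchains_interval[OF finite_stable_subspaces[OF V]]) simp
  also have "\<dots> = nch (stable_subspaces V' \<xi>') (\<phi> A) (\<phi> C) ps"
  proof (rule nchains_transfer[OF bij AS])
    fix U U' p assume U: "U \<in> S" "U' \<in> S"
    show "flag_step (vertices D) (\<lambda>i. Q ^ vdeg D i) U U' p
        \<longleftrightarrow> flag_step (vertices D) (\<lambda>i. Q ^ vdeg D i) (\<phi> U) (\<phi> U') p"
      unfolding flag_step_def
    proof (rule ball_cong[OF refl])
      fix i assume i: "i \<in> vertices D"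
      show "(U' i \<subseteq> U i \<and> card (U i) = card (U' i) * (Q ^ vdeg D i) ^ simple_weight (fst p) (snd p) i)
        = (\<phi> U' i \<subseteq> \<phi> U i \<and> card (\<phi> U i) = card (\<phi> U' i) * (Q ^ vdeg D i) ^ simple_weight (fst p) (snd p) i)"
        unfolding sub_iff[OF U i] card[OF U(1) i] card[OF U(2) i] using Cpos[OF i] by (auto simp: mult_ac)
    qed
  qed
  also have "\<phi> A = gtop V'" unfolding \<phi>_def gtop_def by (rule restrict_ext) (rule him)
  also have "\<phi> C = gbot V'"
  proof -
    have "h i ` C i = {\<zero>\<^bsub>V' i\<^esub>}" if i: "i \<in> vertices D" for i
    proof -
      have "\<zero>\<^bsub>V i\<^esub> \<in> C i" using lin[OF C i] by (simp add: lin_closed_def)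
      moreover have "h i u = \<zero>\<^bsub>V' i\<^esub>" if "u \<in> C i" for u using ker[OF i] that by blast
      ultimately show ?thesis using h0[OF i] by force
    qed
    then show ?thesis unfolding \<phi>_def gbot_def by (rule restrict_ext)
  qed
  finally show ?thesis .
qed

end

section \<open>Reduction modulo the cyclotomic ideal\<close>

text \<open>An orbit other than a fixed point contributes its size times a constant, which lies in
  \<open>J\<close>. Orbits enter through the map \<open>orb\<close> alone, and \<open>J\<close> only
  through sums and natural multiples. Counts are compared as complex numbers because
  \<open>J\<close> will be an ideal in a subring of the complex field.\<close>

lemma sum_orbits:
  fixes f :: "'x \<Rightarrow> nat" and J :: "complex set"
  assumes fin: "finite T" and self: "\<And>B. B \<in> T \<Longrightarrow> B \<in> orb B" and sub: "\<And>B. B \<in> T \<Longrightarrow> orb B \<subseteq> T"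
    and eq: "\<And>B B'. B \<in> T \<Longrightarrow> B' \<in> orb B \<Longrightarrow> orb B' = orb B"
    and f: "\<And>B B'. B \<in> T \<Longrightarrow> B' \<in> orb B \<Longrightarrow> f B' = f B"
    and J: "0 \<in> J" "\<And>a b. a \<in> J \<Longrightarrow> b \<in> J \<Longrightarrow> a + b \<in> J" "\<And>a n. a \<in> J \<Longrightarrow> a * of_nat n \<in> J"
    and size: "\<And>B. B \<in> T \<Longrightarrow> orb B \<noteq> {B} \<Longrightarrow> of_nat (card (orb B)) \<in> J"
  shows "of_nat (\<Sum>B\<in>T. f B) - of_nat (\<Sum>B\<in>{B \<in> T. orb B = {B}}. f B) \<in> J"
proof -
  let ?N = "{B \<in> T. orb B \<noteq> {B}}"
  have N: "B' \<in> ?N" if "B \<in> ?N" "B' \<in> orb B" for B B'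
  proof -
    have B': "B' \<in> T" "orb B' = orb B" using sub eq that by blast+
    have "orb B' \<noteq> {B'}"
    proof
      assume "orb B' = {B'}"
      then have "orb B = {B'}" using B' by simp
      moreover have "B \<in> orb B" using self that(1) by blast
      ultimately have "orb B = {B}" by simp
      then show False using that(1) by simp
    qed
    then show ?thesis using B' by simp
  qed
  have un: "?N = \<Union>(orb ` ?N)" using N self by blast
  have Neq: "(\<Sum>B\<in>?N. f B) = (\<Sum>Ob\<in>orb ` ?N. \<Sum>B\<in>Ob. f B)"
  proof -
    have "(\<Sum>B\<in>\<Union>(orb ` ?N). f B) = (\<Sum>Ob\<in>orb ` ?N. \<Sum>B\<in>Ob. f B)"
    proof (rule sum.Union_disjoint[simplified comp_def])
      show "\<forall>A\<in>orb ` ?N. finite A"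
        using finite_subset[OF sub fin] by blast
      show "\<forall>A\<in>orb ` ?N. \<forall>B\<in>orb ` ?N. A \<noteq> B \<longrightarrow> A \<inter> B = {}"
      proof (intro ballI impI, rule ccontr)
        fix A B assume A: "A \<in> orb ` ?N" and B: "B \<in> orb ` ?N" and ne: "A \<noteq> B" and int: "A \<inter> B \<noteq> {}"
        obtain a where a: "a \<in> T" "A = orb a" using A by blast
        obtain b where b: "b \<in> T" "B = orb b" using B by blast
        obtain c where "c \<in> A" "c \<in> B" using int by blast
        then have "orb c = A" "orb c = B" using eq[OF a(1), of c] eq[OF b(1), of c] a(2) b(2) by simp_all
        then show False using ne by simp
      qed
    qed
    then show ?thesis using un by simp
  qed
  have OJ: "of_nat (\<Sum>B\<in>Ob. f B) \<in> J" if Ob: "Ob \<in> orb ` ?N" for Ob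
  proof -
    obtain B where B: "B \<in> T" "orb B \<noteq> {B}" "Ob = orb B" using Ob by blast
    have "(\<Sum>B'\<in>Ob. f B') = card Ob * f B"
      using f[OF B(1)] B(3) by simp
    then show ?thesis using J(3)[OF size[OF B(1,2)], of "f B"] B(3) by simp
  qed
  have sumJ: "(\<Sum>Ob\<in>Xs. g Ob) \<in> J" if "\<And>Ob. Ob \<in> Xs \<Longrightarrow> g Ob \<in> J" for Xs :: "'x set set" and g
    using that by (induction Xs rule: infinite_finite_induct) (auto intro: J)
  have "of_nat (\<Sum>Ob\<in>orb ` ?N. \<Sum>B\<in>Ob. f B) \<in> J"
    unfolding of_nat_sum[of _ "orb ` ?N"] by (rule sumJ) (rule OJ)
  moreover have "(\<Sum>B\<in>T. f B) = (\<Sum>B\<in>{B \<in> T. orb B = {B}}. f B) + (\<Sum>B\<in>?N. f B)"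
    using fin by (subst sum.union_disjoint[symmetric]) (auto intro!: sum.cong)
  ultimately show ?thesis using Neq by simp
qed

section \<open>Scaling of F_q-subspaces by F_{q^l}\<close>

context quiver_rep_ext
begin

abbreviation Fl :: "'k set" where "Fl \<equiv> GFset (q ^ l)"

lemma Fl_E: "Fl \<subseteq> E.Kv i"
  by (rule GFset_mono)

lemma Fl_subfield: "is_subfield Fl"
  by (rule is_subfield_GFset[OF E.Q])

lemma xi_stable_iota:
  assumes V: "E.good V" and U: "U \<in> graded_subspaces D q V"
  shows "xi_stable (xi V (iota D q l V x)) U \<longleftrightarrow> xi_stable (E.xi V x) U"
proof -
  have "U (src D k) \<subseteq> carrier (V (src D k))" if "k \<in> arrows D" for k
    using U arrows_D(1)[OF that] by (simp add: graded_subspaces_iff[OF E_good[OF V]] lin_closed_def)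
  then show ?thesis
    unfolding xi_stable_def using xi_iota[OF V] by (intro ball_cong refl) (metis subsetD)
qed

lemma stable_subspaces_iota:
  "E.good V \<Longrightarrow> stable_subspaces V (xi V (iota D q l V x)) = stable_subspaces V (E.xi V x)"
  unfolding stable_subspaces_def using xi_stable_iota by blast

lemma E_stable_subset:
  assumes V: "E.good V" and U: "U \<in> E.stable_subspaces V \<xi>"
  shows "U \<in> stable_subspaces V \<xi>"
proof -
  have "lin_closed (Kv i) (V i) (U i)" if "i \<in> vertices D" for i
    using E.stable_subspaces_lin[OF V U that] Kv_E(1)[of i] by (auto simp: lin_closed_def)
  then show ?thesis
    using U by (simp add: stable_subspaces_def E.stable_subspaces_def graded_subspaces_iff[OF E_good[OF V]]
        E.graded_subspaces_iff[OF V] xi_stable_def E.xi_stable_def)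
qed

text \<open>\<open>F_{q^l}\<close> acts on the \<open>F_q\<close>-subspaces of \<open>V\<close>; as \<open>l\<close> is prime to \<open>d_i\<close>, the compositum of
  \<open>F_{q^l}\<close> and \<open>F_{q^{d_i}}\<close> is \<open>F_{q^{l d_i}}\<close>, which makes its fixed points the subspaces over the
  larger fields.\<close>

definition multipliers :: "('i, 'k, 'v) gspace \<Rightarrow> ('i \<Rightarrow> 'v set) \<Rightarrow> 'k set" where
  "multipliers V U = {c \<in> Fl. \<forall>i\<in>vertices D. \<forall>u\<in>U i. c \<odot>\<^bsub>V i\<^esub> u \<in> U i}"

definition scale :: "('i, 'k, 'v) gspace \<Rightarrow> 'k \<Rightarrow> ('i \<Rightarrow> 'v set) \<Rightarrow> 'i \<Rightarrow> 'v set" where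
  "scale V c U = (\<lambda>i\<in>vertices D. (\<lambda>u. c \<odot>\<^bsub>V i\<^esub> u) ` U i)"

definition orbit :: "('i, 'k, 'v) gspace \<Rightarrow> ('i \<Rightarrow> 'v set) \<Rightarrow> ('i \<Rightarrow> 'v set) set" where
  "orbit V U = (\<lambda>c. scale V c U) ` (Fl - {0})"

lemma E_smult:
  assumes V: "E.good V" and i: "i \<in> vertices D"
  shows "\<And>c u. c \<in> E.Kv i \<Longrightarrow> u \<in> carrier (V i) \<Longrightarrow> c \<odot>\<^bsub>V i\<^esub> u \<in> carrier (V i)"
    "\<And>c d u. c \<in> E.Kv i \<Longrightarrow> d \<in> E.Kv i \<Longrightarrow> u \<in> carrier (V i) \<Longrightarrow> c \<odot>\<^bsub>V i\<^esub> (d \<odot>\<^bsub>V i\<^esub> u) = (c * d) \<odot>\<^bsub>V i\<^esub> u"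
    "\<And>u. u \<in> carrier (V i) \<Longrightarrow> 1 \<odot>\<^bsub>V i\<^esub> u = u"
    "\<And>c d u. c \<in> E.Kv i \<Longrightarrow> d \<in> E.Kv i \<Longrightarrow> u \<in> carrier (V i) \<Longrightarrow>
      (c + d) \<odot>\<^bsub>V i\<^esub> u = c \<odot>\<^bsub>V i\<^esub> u \<oplus>\<^bsub>V i\<^esub> d \<odot>\<^bsub>V i\<^esub> u"
    "\<And>c u w. c \<in> E.Kv i \<Longrightarrow> u \<in> carrier (V i) \<Longrightarrow> w \<in> carrier (V i) \<Longrightarrow>
      c \<odot>\<^bsub>V i\<^esub> (u \<oplus>\<^bsub>V i\<^esub> w) = c \<odot>\<^bsub>V i\<^esub> u \<oplus>\<^bsub>V i\<^esub> c \<odot>\<^bsub>V i\<^esub> w"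
    "\<And>c. c \<in> E.Kv i \<Longrightarrow> c \<odot>\<^bsub>V i\<^esub> \<zero>\<^bsub>V i\<^esub> = \<zero>\<^bsub>V i\<^esub>"
    "\<And>u. u \<in> carrier (V i) \<Longrightarrow> 0 \<odot>\<^bsub>V i\<^esub> u = \<zero>\<^bsub>V i\<^esub>"
proof -
  interpret V: vectorspace "subring_of (E.Kv i)" "V i" by (rule E.goodD(1)[OF V i])
  show "c \<odot>\<^bsub>V i\<^esub> u \<in> carrier (V i)" if "c \<in> E.Kv i" "u \<in> carrier (V i)" for c u
    using V.smult_closed[of c u] that by simp
  show "c \<odot>\<^bsub>V i\<^esub> (d \<odot>\<^bsub>V i\<^esub> u) = (c * d) \<odot>\<^bsub>V i\<^esub> u"
    if "c \<in> E.Kv i" "d \<in> E.Kv i" "u \<in> carrier (V i)" for c d u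
    using V.smult_assoc1[of c d u] that by simp
  show "1 \<odot>\<^bsub>V i\<^esub> u = u" if "u \<in> carrier (V i)" for u
    using V.smult_one[OF that] by simp
  show "(c + d) \<odot>\<^bsub>V i\<^esub> u = c \<odot>\<^bsub>V i\<^esub> u \<oplus>\<^bsub>V i\<^esub> d \<odot>\<^bsub>V i\<^esub> u"
    if "c \<in> E.Kv i" "d \<in> E.Kv i" "u \<in> carrier (V i)" for c d u
    using V.smult_l_distr[of c d u] that by simp
  show "c \<odot>\<^bsub>V i\<^esub> (u \<oplus>\<^bsub>V i\<^esub> w) = c \<odot>\<^bsub>V i\<^esub> u \<oplus>\<^bsub>V i\<^esub> c \<odot>\<^bsub>V i\<^esub> w"
    if "c \<in> E.Kv i" "u \<in> carrier (V i)" "w \<in> carrier (V i)" for c u w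
    using V.smult_r_distr[of c u w] that by simp
  show "c \<odot>\<^bsub>V i\<^esub> \<zero>\<^bsub>V i\<^esub> = \<zero>\<^bsub>V i\<^esub>" if "c \<in> E.Kv i" for c
    using V.rmult_0[of c] that by simp
  show "0 \<odot>\<^bsub>V i\<^esub> u = \<zero>\<^bsub>V i\<^esub>" if "u \<in> carrier (V i)" for u
    using V.lmult_0[OF that] by simp
qed

text \<open>F_{q^l} lies in every vertex field, so \<open>c\<close> crosses the tensor sign as a
  scalar of the source and leaves x_k as a scalar of the target. Hence scaling preserves
  stability.\<close>

lemma xi_smult:
  assumes V: "E.good V" and x: "x \<in> reps D (q ^ l) V" and k: "k \<in> arrows D" and c: "c \<in> Fl"
    and u: "u \<in> carrier (V (src D k))"
  shows "E.xi V x k (c \<odot>\<^bsub>V (src D k)\<^esub> u) = c \<odot>\<^bsub>V (tgt D k)\<^esub> E.xi V x k u"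
proof -
  interpret T: scalar_extension "E.Ka k" "E.Kv (src D k)" "V (src D k)"
    by (rule E.scalar_extension[OF V k])
  have xk: "x k \<in> module_hom (subring_of (E.Kv (tgt D k))) T.T (V (tgt D k))"
    using E.reps_hom[OF x k] by (simp add: E.arrow_space_eq)
  have cs: "c \<in> E.Kv (src D k)" and ct: "c \<in> E.Kv (tgt D k)" using c Fl_E by blast+
  then have ca: "c \<in> E.Ka k" using E.Kv_Ka(1) by blast
  have "T.cls (frag_of (1, c \<odot>\<^bsub>V (src D k)\<^esub> u)) = c \<odot>\<^bsub>T.T\<^esub> T.cls (frag_of (1, u))"
    using T.pure_balanced[OF T.LD(1) cs u] T.smult_pure[OF ca, of 1 u] by simp
  then show ?thesis
    using module_hom_smult[OF xk _ T.pure_closed[OF T.LD(1) u], of c] ct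
    by (simp add: E.xi_def E.pure_def)
qed

context
  fixes V :: "('i, 'k, 'v) gspace" and x :: "('a, 'k, 'v) rep" and \<xi> :: "'a \<Rightarrow> 'v \<Rightarrow> 'v"
  assumes V: "E.good V" and x: "x \<in> reps D (q ^ l) V" and \<xi>: "\<xi> = E.xi V x"
begin

lemma stable_carrier: "U \<in> stable_subspaces V \<xi> \<Longrightarrow> i \<in> vertices D \<Longrightarrow> U i \<subseteq> carrier (V i)"
  using stable_subspaces_lin[OF E_good[OF V]] by (simp add: lin_closed_def)

lemma stable_finite: "U \<in> stable_subspaces V \<xi> \<Longrightarrow> i \<in> vertices D \<Longrightarrow> finite (U i)"
  using stable_carrier goodD(2)[OF E_good[OF V]] finite_subset by metis

lemma scale_stable:
  assumes U: "U \<in> stable_subspaces V \<xi>" and c: "c \<in> Fl"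
  shows "scale V c U \<in> stable_subspaces V \<xi>"
proof -
  have cE: "c \<in> E.Kv i" for i using c Fl_E by blast
  have "lin_closed (Kv i) (V i) ((\<lambda>u. c \<odot>\<^bsub>V i\<^esub> u) ` U i)" if i: "i \<in> vertices D" for i
    unfolding lin_closed_def
  proof (intro conjI ballI)
    note Ui = stable_subspaces_lin[OF E_good[OF V] U i, unfolded lin_closed_def]
    have UV: "u \<in> carrier (V i)" if "u \<in> U i" for u using Ui that by blast
    note sm = E_smult[OF V i]
    show "(\<lambda>u. c \<odot>\<^bsub>V i\<^esub> u) ` U i \<subseteq> carrier (V i)" using sm(1)[OF cE] UV by blast
    have "\<zero>\<^bsub>V i\<^esub> \<in> U i" using Ui by blast
    from imageI[OF this, of "\<lambda>u. c \<odot>\<^bsub>V i\<^esub> u"] show "\<zero>\<^bsub>V i\<^esub> \<in> (\<lambda>u. c \<odot>\<^bsub>V i\<^esub> u) ` U i"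
      unfolding sm(6)[OF cE] .
    show "y \<oplus>\<^bsub>V i\<^esub> z \<in> (\<lambda>u. c \<odot>\<^bsub>V i\<^esub> u) ` U i"
      if y: "y \<in> (\<lambda>u. c \<odot>\<^bsub>V i\<^esub> u) ` U i" and z: "z \<in> (\<lambda>u. c \<odot>\<^bsub>V i\<^esub> u) ` U i" for y z
    proof -
      obtain u where u: "u \<in> U i" "y = c \<odot>\<^bsub>V i\<^esub> u" using y by blast
      obtain w where w: "w \<in> U i" "z = c \<odot>\<^bsub>V i\<^esub> w" using z by blast
      have "u \<oplus>\<^bsub>V i\<^esub> w \<in> U i" using Ui u(1) w(1) by blast
      from imageI[OF this, of "\<lambda>u. c \<odot>\<^bsub>V i\<^esub> u"] show ?thesis
        unfolding u(2) w(2) sm(5)[OF cE UV[OF u(1)] UV[OF w(1)]] .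
    qed
    show "d \<odot>\<^bsub>V i\<^esub> y \<in> (\<lambda>u. c \<odot>\<^bsub>V i\<^esub> u) ` U i"
      if d: "d \<in> Kv i" and y: "y \<in> (\<lambda>u. c \<odot>\<^bsub>V i\<^esub> u) ` U i" for d y
    proof -
      obtain u where u: "u \<in> U i" "y = c \<odot>\<^bsub>V i\<^esub> u" using y by blast
      have dE: "d \<in> E.Kv i" using d Kv_E(1) by blast
      have "d \<odot>\<^bsub>V i\<^esub> u \<in> U i" using Ui u(1) d by blast
      from imageI[OF this, of "\<lambda>u. c \<odot>\<^bsub>V i\<^esub> u"] show ?thesis
        unfolding u(2) sm(2)[OF cE dE UV[OF u(1)]] sm(2)[OF dE cE UV[OF u(1)]] mult.commute[of d c] .
    qed
  qed
  moreover have "xi_stable \<xi> (scale V c U)"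
    unfolding xi_stable_def
  proof (intro ballI)
    fix k y assume k: "k \<in> arrows D" and "y \<in> scale V c U (src D k)"
    then obtain u where u: "u \<in> U (src D k)" "y = c \<odot>\<^bsub>V (src D k)\<^esub> u"
      using arrows_D by (auto simp: scale_def)
    have uV: "u \<in> carrier (V (src D k))" using stable_carrier[OF U arrows_D(1)[OF k]] u(1) by blast
    have "\<xi> k u \<in> U (tgt D k)" using U k u(1) by (auto simp: stable_subspaces_def xi_stable_def)
    then show "\<xi> k y \<in> scale V c U (tgt D k)"
      using arrows_D(2)[OF k] xi_smult[OF V x k c uV] u(2) by (simp add: scale_def \<xi>)
  qed
  ultimately show ?thesis
    by (simp add: stable_subspaces_def graded_subspaces_iff[OF E_good[OF V]]) (simp add: scale_def)
qed

lemma scale_scale: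
  assumes U: "U \<in> stable_subspaces V \<xi>" and c: "c \<in> Fl" and d: "d \<in> Fl"
  shows "scale V c (scale V d U) = scale V (c * d) U"
  unfolding scale_def
proof (rule restrict_ext)
  fix i assume i: "i \<in> vertices D"
  have "(\<lambda>u. c \<odot>\<^bsub>V i\<^esub> (d \<odot>\<^bsub>V i\<^esub> u)) ` U i = (\<lambda>u. (c * d) \<odot>\<^bsub>V i\<^esub> u) ` U i"
    using c d Fl_E stable_carrier[OF U i] by (intro image_cong refl E_smult(2)[OF V i]) blast+
  then show "(\<odot>\<^bsub>V i\<^esub>) c ` (\<lambda>i\<in>vertices D. (\<odot>\<^bsub>V i\<^esub>) d ` U i) i = (\<odot>\<^bsub>V i\<^esub>) (c * d) ` U i"
    using i by (simp add: image_image)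
qed

lemma scale_one:
  assumes U: "U \<in> stable_subspaces V \<xi>"
  shows "scale V 1 U = U"
proof (rule extensionalityI[of _ "vertices D"])
  show "U \<in> extensional (vertices D)"
    using U by (simp add: stable_subspaces_def graded_subspaces_iff[OF E_good[OF V]])
  fix i assume i: "i \<in> vertices D"
  have "(\<lambda>u. 1 \<odot>\<^bsub>V i\<^esub> u) ` U i = (\<lambda>u. u) ` U i"
    using stable_carrier[OF U i] by (intro image_cong refl E_smult(3)[OF V i]) blast
  then show "scale V 1 U i = U i" using i by (simp add: scale_def)
qed (simp add: scale_def)

lemma scale_inj:
  assumes "U \<in> stable_subspaces V \<xi>" "c \<in> Fl - {0}" "i \<in> vertices D"
  shows "inj_on (\<lambda>u. c \<odot>\<^bsub>V i\<^esub> u) (U i)"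
proof (rule inj_onI)
  fix u w assume u: "u \<in> U i" "w \<in> U i" and eq: "c \<odot>\<^bsub>V i\<^esub> u = c \<odot>\<^bsub>V i\<^esub> w"
  have uV: "u \<in> carrier (V i)" "w \<in> carrier (V i)" using stable_carrier[OF assms(1,3)] u by blast+
  have c: "c \<in> E.Kv i" "inverse c \<in> E.Kv i"
    using assms(2) Fl_E is_subfieldD(6)[OF Fl_subfield] by blast+
  have "inverse c * c = 1" using assms(2) by simp
  then have "u = inverse c \<odot>\<^bsub>V i\<^esub> (c \<odot>\<^bsub>V i\<^esub> u)" "w = inverse c \<odot>\<^bsub>V i\<^esub> (c \<odot>\<^bsub>V i\<^esub> w)"
    using E_smult(2,3)[OF V assms(3)] c uV by simp_all
  then show "u = w" using eq by simp
qed

lemma scale_card: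
  "U \<in> stable_subspaces V \<xi> \<Longrightarrow> c \<in> Fl - {0} \<Longrightarrow> i \<in> vertices D \<Longrightarrow> card (scale V c U i) = card (U i)"
  using card_image[OF scale_inj] by (simp add: scale_def)

text \<open>A multiplier maps \<open>U\<close> into itself; equality follows because scaling by a
  nonzero element preserves the finite cardinalities.\<close>

lemma scale_eq_iff:
  assumes U: "U \<in> stable_subspaces V \<xi>" and c: "c \<in> Fl - {0}"
  shows "scale V c U = U \<longleftrightarrow> c \<in> multipliers V U"
proof
  assume eq: "scale V c U = U"
  have "c \<odot>\<^bsub>V i\<^esub> u \<in> U i" if "i \<in> vertices D" "u \<in> U i" for i u
  proof -
    have "c \<odot>\<^bsub>V i\<^esub> u \<in> scale V c U i" using that by (simp add: scale_def)
    then show ?thesis by (simp add: eq)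
  qed
  then show "c \<in> multipliers V U" using c by (simp add: multipliers_def)
next
  assume m: "c \<in> multipliers V U"
  show "scale V c U = U"
  proof (rule extensionalityI[of _ "vertices D"])
    show "U \<in> extensional (vertices D)"
      using U by (simp add: stable_subspaces_def graded_subspaces_iff[OF E_good[OF V]])
    fix i assume i: "i \<in> vertices D"
    have "scale V c U i \<subseteq> U i" using m i by (auto simp: scale_def multipliers_def)
    then show "scale V c U i = U i"
      using scale_card[OF U c i] stable_finite[OF U i] by (simp add: card_subset_eq)
  qed (simp add: scale_def)
qed

text \<open>Inverses are the point: a nonzero multiplier scales \<open>U\<close> onto itself, hence
  so does its inverse. Negatives come from -1 in the vertex fields.\<close>

lemma multipliers_subfield:
  assumes U: "U \<in> stable_subspaces V \<xi>"
  shows "is_subfield (multipliers V U)"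
proof -
  note FD = is_subfieldD[OF Fl_subfield]
  have FE: "c \<in> E.Kv i" if "c \<in> Fl" for c i using that Fl_E by blast
  have M: "c \<in> Fl" "i \<in> vertices D \<Longrightarrow> u \<in> U i \<Longrightarrow> c \<odot>\<^bsub>V i\<^esub> u \<in> U i" if "c \<in> multipliers V U" for c i u
    using that by (simp_all add: multipliers_def)
  have one: "1 \<in> multipliers V U"
    using scale_eq_iff[OF U, of 1] scale_one[OF U] FD(1) by simp
  have add: "c + d \<in> multipliers V U" if "c \<in> multipliers V U" "d \<in> multipliers V U" for c d
  proof -
    have "(c + d) \<odot>\<^bsub>V i\<^esub> u \<in> U i" if i: "i \<in> vertices D" and u: "u \<in> U i" for i u
    proof -
      have uV: "u \<in> carrier (V i)" using stable_carrier[OF U i] u by blast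
      note Ui = stable_subspaces_lin[OF E_good[OF V] U i, unfolded lin_closed_def]
      show ?thesis
        unfolding E_smult(4)[OF V i FE[OF M(1)[OF \<open>c \<in> _\<close>]] FE[OF M(1)[OF \<open>d \<in> _\<close>]] uV]
        using Ui M(2)[OF \<open>c \<in> multipliers V U\<close> i u] M(2)[OF \<open>d \<in> multipliers V U\<close> i u] by blast
    qed
    then show ?thesis using FD(3) M(1) that by (simp add: multipliers_def)
  qed
  have mul: "c * d \<in> multipliers V U" if "c \<in> multipliers V U" "d \<in> multipliers V U" for c d
  proof -
    have "(c * d) \<odot>\<^bsub>V i\<^esub> u \<in> U i" if i: "i \<in> vertices D" and u: "u \<in> U i" for i u
    proof -
      have uV: "u \<in> carrier (V i)" using stable_carrier[OF U i] u by blast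
      show ?thesis
        unfolding E_smult(2)[symmetric, OF V i FE[OF M(1)[OF \<open>c \<in> _\<close>]] FE[OF M(1)[OF \<open>d \<in> _\<close>]] uV]
        using M(2)[OF \<open>c \<in> multipliers V U\<close> i M(2)[OF \<open>d \<in> multipliers V U\<close> i u]] .
    qed
    then show ?thesis using FD(4) M(1) that by (simp add: multipliers_def)
  qed
  have inv: "inverse c \<in> multipliers V U" if c: "c \<in> multipliers V U" for c
  proof (cases "c = 0")
    case False
    then have c': "c \<in> Fl - {0}" "inverse c \<in> Fl - {0}" using M(1)[OF c] FD(6) by auto
    have "scale V (inverse c) U = scale V (inverse c) (scale V c U)"
      using scale_eq_iff[OF U c'(1)] c by simp
    also have "\<dots> = U"
      using scale_scale[OF U, of "inverse c" c] scale_one[OF U] c' by simp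
    finally show ?thesis using scale_eq_iff[OF U c'(2)] by simp
  qed (use c in simp)
  have "0 \<in> multipliers V U"
    using FD(2) E_smult(7)[OF V] stable_carrier[OF U] stable_subspaces_lin[OF E_good[OF V] U]
    by (auto simp: multipliers_def lin_closed_def subset_iff)
  have neg: "- c \<in> multipliers V U" if c: "c \<in> multipliers V U" for c
  proof -
    have "- 1 \<in> Kv i" "1 \<in> Kv i" if "i \<in> vertices D" for i
      using is_subfieldD(1,5)[OF Kv_subfield[OF that]] by blast+
    then have "(- 1) \<odot>\<^bsub>V i\<^esub> u \<in> U i" if "i \<in> vertices D" "u \<in> U i" for i u
      using stable_subspaces_lin[OF E_good[OF V] U that(1)] that by (simp add: lin_closed_def)
    then have "- 1 \<in> multipliers V U" using FD(1,5) by (simp add: multipliers_def)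
    from mul[OF this c] show ?thesis by simp
  qed
  show ?thesis unfolding is_subfield_def using one add mul neg inv by (intro conjI ballI)
qed

text \<open>Orbit and stabilizer: the nonzero multipliers are the stabilizer of \<open>U\<close>,
  and the fibres of c -> cU are its cosets in the multiplicative group of F_{q^l}.\<close>

lemma orbit_card:
  assumes U: "U \<in> stable_subspaces V \<xi>"
  shows "card (orbit V U) * (card (multipliers V U) - 1) = q ^ l - 1"
proof -
  let ?M = "multipliers V U - {0}"
  note FD = is_subfieldD[OF Fl_subfield]
  note MD = is_subfieldD[OF multipliers_subfield[OF U]]
  have fin: "finite Fl" and card: "card Fl = q ^ l" using card_GFset[OF E.Q] by simp_all
  have mult_Fl: "multipliers V U \<subseteq> Fl" by (auto simp: multipliers_def)
  have fiber: "{c \<in> Fl - {0}. scale V c U = scale V d U} = (\<lambda>m. d * m) ` ?M" if d: "d \<in> Fl - {0}" for d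
  proof (intro equalityI subsetI)
    fix c assume c: "c \<in> {c \<in> Fl - {0}. scale V c U = scale V d U}"
    have dc: "inverse d \<in> Fl" "inverse d * c \<in> Fl - {0}" using c d FD(4,6) by auto
    have cd: "c \<in> Fl" "d \<in> Fl" "scale V c U = scale V d U" using c d by blast+
    have "scale V (inverse d * c) U = scale V (inverse d) (scale V c U)"
      by (rule scale_scale[symmetric, OF U dc(1) cd(1)])
    also have "\<dots> = scale V (inverse d) (scale V d U)" unfolding cd(3) ..
    also have "\<dots> = scale V (inverse d * d) U" by (rule scale_scale[OF U dc(1) cd(2)])
    also have "\<dots> = U" using d scale_one[OF U] by simp
    finally have "inverse d * c \<in> ?M" using scale_eq_iff[OF U dc(2)] dc(2) by simp
    moreover have "c = d * (inverse d * c)" using d by simp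
    ultimately show "c \<in> (\<lambda>m. d * m) ` ?M" by blast
  next
    fix c assume "c \<in> (\<lambda>m. d * m) ` ?M"
    then obtain m where m: "m \<in> ?M" "c = d * m" by blast
    then have mF: "m \<in> Fl - {0}" using mult_Fl by blast
    have "scale V c U = scale V d (scale V m U)" using scale_scale[OF U, of d m] d mF m(2) by simp
    also have "scale V m U = U" using scale_eq_iff[OF U mF] m(1) by simp
    finally show "c \<in> {c \<in> Fl - {0}. scale V c U = scale V d U}"
      using FD(4)[of d m] d mF m(2) by simp
  qed
  have "q ^ l - 1 = card (Fl - {0})"
    using fin card FD(2) by simp
  also have "\<dots> = (\<Sum>y\<in>orbit V U. card {c \<in> Fl - {0}. scale V c U = y})"
    unfolding orbit_def using sum.image_gen[of "Fl - {0}" "\<lambda>_. 1 :: nat" "\<lambda>c. scale V c U"] fin by simp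
  also have "\<dots> = (\<Sum>y\<in>orbit V U. card ?M)"
  proof (rule sum.cong[OF refl])
    fix y assume "y \<in> orbit V U"
    then obtain d where d: "d \<in> Fl - {0}" "y = scale V d U" by (auto simp: orbit_def)
    have "inj_on (\<lambda>m. d * m) ?M" using d(1) by (auto intro: inj_onI)
    then show "card {c \<in> Fl - {0}. scale V c U = y} = card ?M"
      unfolding d(2) fiber[OF d(1)] by (rule card_image)
  qed
  also have "\<dots> = card (orbit V U) * (card (multipliers V U) - 1)"
    using MD(2) finite_subset[OF mult_Fl fin] by simp
  finally show ?thesis by simp
qed

text \<open>The multipliers form a field between F_q and F_{q^l}. Counting it as a space over F_q,
  and F_{q^l} as a space over it, shows that it has q^e elements with \<open>e\<close> dividing
  \<open>l\<close>. If \<open>e\<close> were equal to \<open>l\<close>, every scalar would fix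
  \<open>U\<close> and the orbit would be a single point.\<close>

lemma orbit_size:
  assumes U: "U \<in> stable_subspaces V \<xi>" and ne: "orbit V U \<noteq> {U}"
  obtains e where "e dvd l" "0 < e" "e < l" "card (orbit V U) * (q ^ e - 1) = q ^ l - 1"
proof -
  note MD = is_subfieldD[OF multipliers_subfield[OF U]]
  note FD = is_subfieldD[OF Fl_subfield]
  have fin: "finite Fl" and card: "card Fl = q ^ l" using card_GFset[OF E.Q] by simp_all
  have mult_Fl: "multipliers V U \<subseteq> Fl" by (auto simp: multipliers_def)
  note finM = finite_subset[OF mult_Fl fin]
  have q1: "q > 1" by (rule char_power_gt_1[OF Q])
  have one: "card (GFset q :: 'k set) = q" by (rule card_GFset(2)[OF Q])
  have qM: "c * a \<in> multipliers V U" if "c \<in> GFset q" "a \<in> multipliers V U" for c a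
  proof -
    have "c \<in> Fl" using GFset_mono[of q l] that(1) by blast
    moreover have "c \<odot>\<^bsub>V i\<^esub> u \<in> U i" if "i \<in> vertices D" "u \<in> U i" for i u
    proof -
      have "c \<in> Kv i" using GFset_mono[of q "vdeg D i"] \<open>c \<in> GFset q\<close> by blast
      then show ?thesis using stable_subspaces_lin[OF E_good[OF V] U that(1)] that(2) by (simp add: lin_closed_def)
    qed
    ultimately have "c \<in> multipliers V U" by (simp add: multipliers_def)
    then show ?thesis using MD(4) that(2) by blast
  qed
  have "K_closed (GFset q) (multipliers V U)"
    using MD(2,3) qM by (simp add: K_closed_def)
  then obtain e where e: "card (multipliers V U) = card (GFset q :: 'k set) ^ e"
    by (rule card_K_closed[OF is_subfield_GFset[OF Q] _ finM])
  have "K_closed (multipliers V U) Fl"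
    unfolding K_closed_def using FD(2,3,4) mult_Fl by blast
  then obtain f where f: "card Fl = card (multipliers V U) ^ f"
    by (rule card_K_closed[OF multipliers_subfield[OF U] _ fin])
  have "q ^ l = q ^ (e * f)" using e f card one by (simp add: power_mult)
  then have lef: "l = e * f" using q1 by (metis power_inject_exp)
  have e0: "e > 0" using lef l by (cases e) auto
  moreover have "e \<noteq> l"
  proof
    assume "e = l"
    then have "multipliers V U = Fl" using card_subset_eq[OF fin mult_Fl] e card one by simp
    then have sc: "scale V c U = U" if "c \<in> Fl - {0}" for c using scale_eq_iff[OF U that] that by simp
    have "orbit V U = (\<lambda>c. U) ` (Fl - {0})" unfolding orbit_def by (intro image_cong refl sc)
    moreover have "1 \<in> Fl - {0}" using FD(1) by simp
    ultimately have "orbit V U = {U}" by blast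
    then show False using ne by simp
  qed
  moreover have "e dvd l" using lef by simp
  moreover have "e \<le> l" using \<open>e dvd l\<close> l by (simp add: dvd_imp_le)
  moreover have "card (orbit V U) * (q ^ e - 1) = q ^ l - 1" using orbit_card[OF U] e one by simp
  ultimately show ?thesis using that by simp
qed

lemma orbit_fixed_iff:
  assumes U: "U \<in> stable_subspaces V \<xi>"
  shows "orbit V U = {U} \<longleftrightarrow> U \<in> E.stable_subspaces V \<xi>"
proof
  assume "orbit V U = {U}"
  then have fixed: "scale V c U = U" if "c \<in> Fl - {0}" for c using that by (auto simp: orbit_def)
  have mult: "c \<in> multipliers V U" if "c \<in> Fl" for c
  proof (cases "c = 0")
    case True
    then show ?thesis using is_subfieldD(2)[OF multipliers_subfield[OF U]] by simp
  next
    case False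
    then show ?thesis using scale_eq_iff[OF U] fixed that by simp
  qed
  have "lin_closed (E.Kv i) (V i) (U i)" if i: "i \<in> vertices D" for i
  proof -
    note Ui = stable_subspaces_lin[OF E_good[OF V] U i, unfolded lin_closed_def]
    have UV: "u \<in> carrier (V i)" if "u \<in> U i" for u using Ui that by blast
    \<comment> \<open>Here the scalars come from the large field at \<open>i\<close>, whereas
      \<open>multipliers\<close> stays inside F_{q^l}. \<open>M\<close> contains F_{q^l} because
      \<open>U\<close> is fixed, and \<open>Kv i\<close> because \<open>U\<close> is a
      subspace.\<close>
    define M where "M = {c \<in> E.Kv i. \<forall>u\<in>U i. c \<odot>\<^bsub>V i\<^esub> u \<in> U i}"
    have lcm: "lcm l (vdeg D i) = l * vdeg D i"
      using coprime_l i by (simp add: lcm_coprime)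
    have EKv: "E.Kv i = GFset (q ^ lcm l (vdeg D i))" by (simp add: lcm power_mult)
    note ED = is_subfieldD[OF E.Kv_subfield[OF i]]
    have ME: "c \<in> E.Kv i" "u \<in> U i \<Longrightarrow> c \<odot>\<^bsub>V i\<^esub> u \<in> U i" if "c \<in> M" for c u using that by (simp_all add: M_def)
    have "K_closed Fl M \<and> K_closed (Kv i) M \<and> 1 \<in> M"
    proof -
      have zero: "0 \<in> M" using ED(2) E_smult(7)[OF V i] UV Ui by (simp add: M_def)
      have one: "1 \<in> M" using ED(1) E_smult(3)[OF V i] UV by (simp add: M_def)
      have add: "a + b \<in> M" if a: "a \<in> M" and b: "b \<in> M" for a b
      proof -
        have "(a + b) \<odot>\<^bsub>V i\<^esub> u \<in> U i" if u: "u \<in> U i" for u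
          unfolding E_smult(4)[OF V i ME(1)[OF a] ME(1)[OF b] UV[OF u]]
          using Ui ME(2)[OF a u] ME(2)[OF b u] by blast
        then show ?thesis using ED(3) ME(1) a b by (simp add: M_def)
      qed
      have mul: "a * b \<in> M" if a: "a \<in> M" and b: "b \<in> M" for a b
      proof -
        have "(a * b) \<odot>\<^bsub>V i\<^esub> u \<in> U i" if u: "u \<in> U i" for u
          unfolding E_smult(2)[symmetric, OF V i ME(1)[OF a] ME(1)[OF b] UV[OF u]]
          by (rule ME(2)[OF a ME(2)[OF b u]])
        then show ?thesis using ED(4) ME(1) a b by (simp add: M_def)
      qed
      have "Fl \<subseteq> M"
      proof
        fix c assume c: "c \<in> Fl"
        then have "c \<in> E.Kv i" using Fl_E by blast
        then show "c \<in> M" using mult[OF c] i by (simp add: M_def multipliers_def)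
      qed
      moreover have "Kv i \<subseteq> M"
      proof
        fix c assume c: "c \<in> Kv i"
        then have "c \<in> E.Kv i" using Kv_E(1) by blast
        then show "c \<in> M" using Ui c by (simp add: M_def)
      qed
      ultimately show ?thesis using zero one add mul unfolding K_closed_def by blast
    qed
    then have "M = E.Kv i"
      unfolding EKv using vdeg_pos[OF i] l
      by (intro GFset_compositum[OF Q]) (auto simp: M_def EKv)
    then show ?thesis using Ui by (auto simp: lin_closed_def M_def)
  qed
  then show "U \<in> E.stable_subspaces V \<xi>"
    using U by (simp add: stable_subspaces_def E.stable_subspaces_def graded_subspaces_iff[OF E_good[OF V]]
        E.graded_subspaces_iff[OF V] xi_stable_def E.xi_stable_def)
next
  assume UE: "U \<in> E.stable_subspaces V \<xi>"
  have fixed: "scale V c U = U" if c: "c \<in> Fl - {0}" for c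
  proof -
    have "c \<odot>\<^bsub>V i\<^esub> u \<in> U i" if i: "i \<in> vertices D" and u: "u \<in> U i" for i u
    proof -
      have "c \<in> E.Kv i" using c Fl_E by blast
      then show ?thesis using E.stable_subspaces_lin[OF V UE i] u by (simp add: lin_closed_def)
    qed
    then show ?thesis using scale_eq_iff[OF U c] c by (simp add: multipliers_def)
  qed
  have "orbit V U = (\<lambda>c. U) ` (Fl - {0})" unfolding orbit_def by (intro image_cong refl fixed)
  moreover have "1 \<in> Fl - {0}" using is_subfieldD(1)[OF Fl_subfield] by simp
  ultimately show "orbit V U = {U}" by blast
qed

text \<open>A subspace over the large field at \<open>j\<close> has as cardinality a power of q^{l
  d_j}, so a step of ratio q^{d_j c} forces \<open>l\<close> to divide d_j c, hence \<open>c\<close>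
  by coprimality. Conversely, for \<open>c\<close> divisible by \<open>l\<close> the ratio is the
  (c/l)-th power of q^{l d_j}.\<close>

lemma flag_step_ext:
  assumes A: "A \<in> E.stable_subspaces V \<xi>" and B: "B \<in> E.stable_subspaces V \<xi>" and j: "j \<in> vertices D"
  shows "flag_step (vertices D) (\<lambda>i. q ^ vdeg D i) A B (j, c) \<longleftrightarrow>
    l dvd c \<and> flag_step (vertices D) (\<lambda>i. (q ^ l) ^ vdeg D i) A B (j, c div l)"
proof -
  have pw: "(q ^ vdeg D i) ^ simple_weight j c i = ((q ^ l) ^ vdeg D i) ^ simple_weight j (c div l) i"
    if "l dvd c" for i
  proof -
    obtain k where "c = l * k" using \<open>l dvd c\<close> by (rule dvdE)
    then show ?thesis using l by (simp add: simple_weight_def mult_ac flip: power_mult)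
  qed
  have "l dvd c" if step: "flag_step (vertices D) (\<lambda>i. q ^ vdeg D i) A B (j, c)"
  proof -
    have dim: "\<exists>d. card (U j) = q ^ (l * (vdeg D j * d))" if "U \<in> E.stable_subspaces V \<xi>" for U
    proof -
      have "vectorspace (subring_of (E.Kv j)) ((V j)\<lparr>carrier := U j\<rparr>)"
        by (rule vectorspace_sub[OF E.goodD(1)[OF V j] E.stable_subspaces_lin[OF V that j]])
      then have "card (U j) = card (E.Kv j) ^ vectorspace.dim (subring_of (E.Kv j)) ((V j)\<lparr>carrier := U j\<rparr>)"
        using vectorspace_card[of "subring_of (E.Kv j)" "(V j)\<lparr>carrier := U j\<rparr>"]
          stable_finite[OF E_stable_subset[OF V that] j] by simp
      then have "card (U j) = ((q ^ l) ^ vdeg D j) ^ vectorspace.dim (subring_of (E.Kv j)) ((V j)\<lparr>carrier := U j\<rparr>)"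
        unfolding E.card_Kv[OF j] .
      then show ?thesis unfolding power_mult[symmetric] mult.assoc by blast
    qed
    obtain a where a: "card (A j) = q ^ (l * (vdeg D j * a))" using dim[OF A] by blast
    obtain b where b: "card (B j) = q ^ (l * (vdeg D j * b))" using dim[OF B] by blast
    have "card (A j) = card (B j) * (q ^ vdeg D j) ^ c"
      using step j by (simp add: flag_step_def simple_weight_def)
    then have "q ^ (l * (vdeg D j * a)) = q ^ (l * (vdeg D j * b) + vdeg D j * c)"
      unfolding a b by (simp add: power_add power_mult)
    then have "l * (vdeg D j * a) = l * (vdeg D j * b) + vdeg D j * c"
      using char_power_gt_1[OF Q] by (metis power_inject_exp)
    then have "l dvd vdeg D j * c" by (metis dvd_add_right_iff dvd_triv_left)
    then show ?thesis using coprime_l j by (simp add: coprime_dvd_mult_right_iff)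
  qed
  then show ?thesis using pw by (auto simp: flag_step_def)
qed

text \<open>The orbit argument is applied to the next term alone. \<open>A\<close> and
  \<open>C\<close> are subspaces over the large fields, so scaling fixes them; it permutes the
  candidates \<open>B\<close> below \<open>A\<close> and preserves the number of chains from
  \<open>B\<close> to \<open>C\<close>. Modulo \<open>J\<close> only the fixed \<open>B\<close>
  survive; these are again subspaces over the large fields, so the induction hypothesis applies to
  them.\<close>

lemma nchains_mod:
  fixes J :: "complex set"
  assumes J: "0 \<in> J" "\<And>a b. a \<in> J \<Longrightarrow> b \<in> J \<Longrightarrow> a + b \<in> J" "\<And>a n. a \<in> J \<Longrightarrow> a * of_nat n \<in> J"
    and size: "\<And>e m. e dvd l \<Longrightarrow> 0 < e \<Longrightarrow> e < l \<Longrightarrow> m * (q ^ e - 1) = q ^ l - 1 \<Longrightarrow> of_nat m \<in> J"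
    and A: "A \<in> E.stable_subspaces V \<xi>" and C: "C \<in> E.stable_subspaces V \<xi>"
    and ps: "fst ` set ps \<subseteq> vertices D"
  shows "of_nat (nch (stable_subspaces V \<xi>) A C ps)
    - of_nat (if \<forall>p\<in>set ps. l dvd snd p
        then E.nch (E.stable_subspaces V \<xi>) A C (map (\<lambda>(j, c). (j, c div l)) ps) else 0) \<in> J"
  using A ps
proof (induction ps arbitrary: A)
  case Nil
  then show ?case using J(1) by simp
next
  case (Cons p ps)
  obtain j c where p: "p = (j, c)" by fastforce
  have j: "j \<in> vertices D" using Cons.prems(2) p by simp
  let ?S = "stable_subspaces V \<xi>" and ?SE = "E.stable_subspaces V \<xi>"
  let ?step = "\<lambda>A B. flag_step (vertices D) (\<lambda>i. q ^ vdeg D i) A B"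
  define T where "T = {B \<in> ?S. ?step A B p}"
  define f where "f B = nch ?S B C ps" for B
  define g where "g B = (if \<forall>p\<in>set ps. l dvd snd p
      then E.nch ?SE B C (map (\<lambda>(j, c). (j, c div l)) ps) else 0)" for B
  note FD = is_subfieldD[OF Fl_subfield]
  have TS: "B \<in> ?S" if "B \<in> T" for B using that by (simp add: T_def)
  have finT: "finite T"
    using finite_stable_subspaces[OF E_good[OF V], of \<xi>] by (simp add: T_def)
  have scale_step: "?step (scale V d U) (scale V d W) r \<longleftrightarrow> ?step U W r"
    if "U \<in> ?S" "W \<in> ?S" "d \<in> Fl - {0}" for U W d r
  proof -
    have "scale V d W i \<subseteq> scale V d U i \<longleftrightarrow> W i \<subseteq> U i" if "i \<in> vertices D" for i
    proof
      assume le: "scale V d W i \<subseteq> scale V d U i"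
      have d': "inverse d \<in> Fl" "d \<in> Fl" "inverse d * d = 1" using \<open>d \<in> Fl - {0}\<close> FD(6) by auto
      have unscale: "scale V (inverse d) (scale V d Y) = Y" if "Y \<in> ?S" for Y
        using scale_scale[OF that d'(1,2)] d'(3) scale_one[OF that] by simp
      have "scale V (inverse d) (scale V d W) i \<subseteq> scale V (inverse d) (scale V d U) i"
        using le \<open>i \<in> vertices D\<close> by (auto simp: scale_def)
      then show "W i \<subseteq> U i" using unscale \<open>U \<in> ?S\<close> \<open>W \<in> ?S\<close> by simp
    qed (use that in \<open>auto simp: scale_def\<close>)
    then show ?thesis
      using scale_card[OF that(1) that(3)] scale_card[OF that(2) that(3)] by (simp add: flag_step_def)
  qed
  have fixE: "scale V d U = U" if "U \<in> ?SE" "d \<in> Fl - {0}" for U d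
    using orbit_fixed_iff[OF E_stable_subset[OF V that(1)]] that by (auto simp: orbit_def)
  have orbE: "\<exists>d\<in>Fl - {0}. B' = scale V d B" if "B' \<in> orbit V B" for B B'
    using that by (auto simp: orbit_def)
  have invol: "B = scale V (inverse d) (scale V d B)" "inverse d \<in> Fl - {0}"
    if "B \<in> ?S" "d \<in> Fl - {0}" for B d
  proof -
    have "inverse d * d = 1" "inverse d \<in> Fl" using that(2) FD(6) by auto
    then show "B = scale V (inverse d) (scale V d B)" "inverse d \<in> Fl - {0}"
      using scale_scale[OF that(1), of "inverse d" d] scale_one[OF that(1)] that(2) by auto
  qed
  have sum1: "of_nat (\<Sum>B\<in>T. f B) - of_nat (\<Sum>B\<in>{B \<in> T. orbit V B = {B}}. f B) \<in> J"
  proof (rule sum_orbits[OF finT])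
    fix B assume B: "B \<in> T"
    show "B \<in> orbit V B"
      unfolding orbit_def by (rule image_eqI[of _ _ 1]) (use scale_one[OF TS[OF B]] FD(1) in auto)
    show "orbit V B \<subseteq> T"
    proof
      fix B' assume "B' \<in> orbit V B"
      then obtain d where d: "d \<in> Fl - {0}" "B' = scale V d B" using orbE by blast
      then have "?step (scale V d A) (scale V d B) p"
        using scale_step[OF E_stable_subset[OF V Cons.prems(1)] TS[OF B] d(1)] B by (simp add: T_def)
      then show "B' \<in> T"
        using fixE[OF Cons.prems(1) d(1)] scale_stable[OF TS[OF B]] d by (simp add: T_def)
    qed
    show "of_nat (card (orbit V B)) \<in> J" if "orbit V B \<noteq> {B}"
      using orbit_size[OF TS[OF B] that] size by metis
    fix B' assume "B' \<in> orbit V B"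
    then obtain d where d: "d \<in> Fl - {0}" "B' = scale V d B" using orbE by blast
    show "orbit V B' = orbit V B"
    proof (intro equalityI subsetI)
      fix Y assume "Y \<in> orbit V B'"
      then obtain e where e: "e \<in> Fl - {0}" "Y = scale V e B'" using orbE by blast
      then have "Y = scale V (e * d) B" using scale_scale[OF TS[OF B], of e d] d by simp
      moreover have "e * d \<in> Fl - {0}" using FD(4)[of e d] e d by simp
      ultimately show "Y \<in> orbit V B" by (simp add: orbit_def)
    next
      fix Y assume "Y \<in> orbit V B"
      then obtain e where e: "e \<in> Fl - {0}" "Y = scale V e B" using orbE by blast
      have dB: "scale V d B \<in> ?S" using scale_stable[OF TS[OF B]] d by simp
      have "Y = scale V (e * inverse d) B'"
        using scale_scale[OF dB, of e "inverse d"] invol[OF TS[OF B] d(1)] e d(2) by simp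
      moreover have "e * inverse d \<in> Fl - {0}" using FD(4)[of e "inverse d"] e invol(2)[OF TS[OF B] d(1)] by simp
      ultimately show "Y \<in> orbit V B'" by (simp add: orbit_def)
    qed
    \<comment> \<open>Scaling by \<open>d\<close> permutes the stable subspaces, respects steps and
      fixes \<open>C\<close>.\<close>
    show "f B' = f B"
    proof -
      have bij: "bij_betw (scale V d) ?S ?S"
      proof (rule bij_betw_byWitness[where f' = "scale V (inverse d)"])
        show "\<forall>Y\<in>?S. scale V (inverse d) (scale V d Y) = Y"
          using invol(1)[OF _ d(1), symmetric] by blast
        show "\<forall>Y\<in>?S. scale V d (scale V (inverse d) Y) = Y"
        proof
          fix Y assume Y: "Y \<in> ?S"
          have "d * inverse d = 1" "inverse d \<in> Fl" "d \<in> Fl" using d(1) FD(6) by auto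
          then show "scale V d (scale V (inverse d) Y) = Y"
            using scale_scale[OF Y, of d "inverse d"] scale_one[OF Y] by simp
        qed
        show "scale V d ` ?S \<subseteq> ?S" "scale V (inverse d) ` ?S \<subseteq> ?S"
          using scale_stable d(1) invol(2)[OF TS[OF B] d(1)] by blast+
      qed
      have "f B = nch ?S (scale V d B) (scale V d C) ps"
        unfolding f_def
        by (rule nchains_transfer[OF bij TS[OF B] E_stable_subset[OF V C]]) (use scale_step d(1) in blast)
      then show ?thesis using fixE[OF C d(1)] d(2) by (simp add: f_def)
    qed
  qed (fact J)+
  have fixT: "{B \<in> T. orbit V B = {B}} = {B \<in> ?SE. ?step A B p}"
    using orbit_fixed_iff E_stable_subset[OF V] by (auto simp: T_def)
  have sumJ: "(\<Sum>B\<in>Xs. h B) \<in> J" if "\<And>B. B \<in> Xs \<Longrightarrow> h B \<in> J" for Xs :: "('i \<Rightarrow> 'v set) set" and h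
    using that by (induction Xs rule: infinite_finite_induct) (auto intro: J)
  have "(\<Sum>B\<in>{B \<in> ?SE. ?step A B p}. of_nat (f B) - of_nat (g B)) \<in> J"
    using Cons.IH Cons.prems(2) unfolding f_def g_def by (intro sumJ) simp
  from J(2)[OF sum1[unfolded fixT] this]
  have "of_nat (\<Sum>B\<in>T. f B) - of_nat (\<Sum>B\<in>{B \<in> ?SE. ?step A B p}. g B) \<in> J"
    by (simp add: sum_subtractf)
  moreover have "(\<Sum>B\<in>T. f B) = nch ?S A C (p # ps)"
    by (simp add: T_def f_def)
  moreover have "(\<Sum>B\<in>{B \<in> ?SE. ?step A B p}. g B)
      = (if \<forall>p\<in>set (p # ps). l dvd snd p
         then E.nch ?SE A C (map (\<lambda>(j, c). (j, c div l)) (p # ps)) else 0)"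
  proof (cases "l dvd c")
    case True
    then have "{B \<in> ?SE. ?step A B p} = {B \<in> ?SE. flag_step (vertices D) (\<lambda>i. (q ^ l) ^ vdeg D i) A B (j, c div l)}"
      using flag_step_ext[OF Cons.prems(1) _ j, of _ c] p by blast
    note steps = this
    show ?thesis
    proof (cases "\<forall>p\<in>set ps. l dvd snd p")
      case True
      then show ?thesis using steps \<open>l dvd c\<close> p by (simp add: g_def)
    next
      case False
      then have "g B = 0" for B unfolding g_def by (rule if_not_P)
      moreover have nall: "\<not> (\<forall>p\<in>set (p # ps). l dvd snd p)" using False by auto
      ultimately show ?thesis unfolding if_not_P[OF nall] by simp
    qed
  next
    \<comment> \<open>A step whose multiplicity \<open>c\<close> is not divisible by
      \<open>l\<close> has no fixed candidate, so the sum is empty and matches the value 0.\<close>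
    case False
    then have "{B \<in> ?SE. ?step A B p} = {}"
      using flag_step_ext[OF Cons.prems(1) _ j, of _ c] p by blast
    then have "(\<Sum>B\<in>{B \<in> ?SE. ?step A B p}. g B) = 0" by (simp only: sum.empty)
    then show ?thesis using False p by simp
  qed
  ultimately show ?case by simp
qed

end

end

section \<open>The Hall algebra as a module\<close>

locale hall = quiver_rep D Q kt + A: cring A
  for D :: "('i, 'a) quiver" and Q :: nat and kt :: "'k::alg_closed_field itself" and A :: "'r ring" +
  fixes e :: 'r
  assumes e_unit: "e \<in> Units A"
begin

abbreviation std :: "('i \<Rightarrow> nat) \<Rightarrow> ('i, 'k, nat \<Rightarrow> 'k) gspace" where "std \<nu> \<equiv> std_space D Q \<nu>"
abbreviation Er :: "('i \<Rightarrow> nat) \<Rightarrow> ('a, 'k, nat \<Rightarrow> 'k) rep set" where "Er \<nu> \<equiv> reps D Q (std \<nu>)"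
abbreviation H :: "('r, ('i, 'a, 'k, 'r) hall) module" where "H \<equiv> hall_algebra D Q A e"

text \<open>Elements of the Hall algebra are extensional in both arguments. Its operations are
  written as \<open>hfun\<close> of pointwise formulas, so that equations reduce to values by
  \<open>hfun_cong\<close>.\<close>

definition hfun :: "('i, 'a, 'k, 'r) hall \<Rightarrow> ('i, 'a, 'k, 'r) hall" where
  "hfun f = (\<lambda>\<nu>\<in>NI D. \<lambda>x\<in>Er \<nu>. f \<nu> x)"

lemma hfun_cong: "(\<And>\<nu> x. \<nu> \<in> NI D \<Longrightarrow> x \<in> Er \<nu> \<Longrightarrow> f \<nu> x = g \<nu> x) \<Longrightarrow> hfun f = hfun g"
  unfolding hfun_def by (intro restrict_ext)

lemma hfun_apply: "\<nu> \<in> NI D \<Longrightarrow> x \<in> Er \<nu> \<Longrightarrow> hfun f \<nu> x = f \<nu> x"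
  by (simp add: hfun_def)

lemma H_ops:
  "f \<oplus>\<^bsub>H\<^esub> g = hfun (\<lambda>\<nu> x. f \<nu> x \<oplus>\<^bsub>A\<^esub> g \<nu> x)"
  "\<zero>\<^bsub>H\<^esub> = hfun (\<lambda>\<nu> x. \<zero>\<^bsub>A\<^esub>)"
  "a \<odot>\<^bsub>H\<^esub> f = hfun (\<lambda>\<nu> x. a \<otimes>\<^bsub>A\<^esub> f \<nu> x)"
  by (simp_all add: hall_algebra_def Let_def hfun_def)

definition invariant :: "('i, 'a, 'k, 'r) hall \<Rightarrow> bool" where
  "invariant f \<longleftrightarrow> (\<forall>\<nu>\<in>NI D. \<forall>g\<in>graded_isos D Q (std \<nu>) (std \<nu>). \<forall>x\<in>Er \<nu>.
     f \<nu> (transport D Q (std \<nu>) (std \<nu>) g x) = f \<nu> x)"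

definition supp :: "('i, 'a, 'k, 'r) hall \<Rightarrow> ('i \<Rightarrow> nat) set" where
  "supp f = {\<nu> \<in> NI D. \<exists>x\<in>Er \<nu>. f \<nu> x \<noteq> \<zero>\<^bsub>A\<^esub>}"

lemma carrier_H:
  "f \<in> carrier H \<longleftrightarrow> hfun f = f \<and> (\<forall>\<nu>\<in>NI D. \<forall>x\<in>Er \<nu>. f \<nu> x \<in> carrier A) \<and> invariant f \<and> finite (supp f)"
proof -
  have "f \<in> (\<Pi>\<^sub>E \<nu>\<in>NI D. hall_component D Q A \<nu>) \<longleftrightarrow>
      hfun f = f \<and> (\<forall>\<nu>\<in>NI D. \<forall>x\<in>Er \<nu>. f \<nu> x \<in> carrier A) \<and> invariant f"
  proof
    assume f: "f \<in> (\<Pi>\<^sub>E \<nu>\<in>NI D. hall_component D Q A \<nu>)"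
    then have c: "f \<nu> \<in> hall_component D Q A \<nu>" if "\<nu> \<in> NI D" for \<nu> using that by (rule PiE_mem)
    then have c1: "f \<nu> \<in> Er \<nu> \<rightarrow>\<^sub>E carrier A" if "\<nu> \<in> NI D" for \<nu>
      using that by (simp add: hall_component_def Let_def)
    have "hfun f = f"
    proof (rule extensionalityI[of _ "NI D"])
      show "f \<in> extensional (NI D)" using f by (simp add: PiE_def)
      fix \<nu> assume \<nu>: "\<nu> \<in> NI D"
      have "f \<nu> \<in> extensional (Er \<nu>)" using c1[OF \<nu>] by (simp add: PiE_def)
      then show "hfun f \<nu> = f \<nu>" using \<nu> by (simp add: hfun_def extensional_restrict)
    qed (simp add: hfun_def)
    moreover have "invariant f" using c by (simp add: invariant_def hall_component_def Let_def)
    ultimately show "hfun f = f \<and> (\<forall>\<nu>\<in>NI D. \<forall>x\<in>Er \<nu>. f \<nu> x \<in> carrier A) \<and> invariant f"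
      using c1 PiE_mem by blast
  next
    assume f: "hfun f = f \<and> (\<forall>\<nu>\<in>NI D. \<forall>x\<in>Er \<nu>. f \<nu> x \<in> carrier A) \<and> invariant f"
    have "hfun f \<in> (\<Pi>\<^sub>E \<nu>\<in>NI D. hall_component D Q A \<nu>)"
      unfolding hfun_def
    proof (rule restrict_PiE_iff[THEN iffD2], rule ballI)
      fix \<nu> assume \<nu>: "\<nu> \<in> NI D"
      have tr: "transport D Q (std \<nu>) (std \<nu>) g x \<in> Er \<nu>"
        if "g \<in> graded_isos D Q (std \<nu>) (std \<nu>)" "x \<in> Er \<nu>" for g x
        using transport_reps[OF good_std good_std that] .
      show "(\<lambda>x\<in>Er \<nu>. f \<nu> x) \<in> hall_component D Q A \<nu>"
        using f \<nu> tr by (simp add: hall_component_def Let_def invariant_def)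
    qed
    then show "f \<in> (\<Pi>\<^sub>E \<nu>\<in>NI D. hall_component D Q A \<nu>)" using f by simp
  qed
  then show ?thesis by (simp add: hall_algebra_def Let_def supp_def)
qed

lemma H_val: "f \<in> carrier H \<Longrightarrow> \<nu> \<in> NI D \<Longrightarrow> x \<in> Er \<nu> \<Longrightarrow> f \<nu> x \<in> carrier A"
  by (simp add: carrier_H)

lemma H_hfun: "f \<in> carrier H \<Longrightarrow> hfun f = f"
  by (simp add: carrier_H)

lemma hfun_H:
  assumes val: "\<And>\<nu> x. \<nu> \<in> NI D \<Longrightarrow> x \<in> Er \<nu> \<Longrightarrow> f \<nu> x \<in> carrier A"
    and inv: "\<And>\<nu> g x. \<nu> \<in> NI D \<Longrightarrow> g \<in> graded_isos D Q (std \<nu>) (std \<nu>) \<Longrightarrow> x \<in> Er \<nu> \<Longrightarrow>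
      f \<nu> (transport D Q (std \<nu>) (std \<nu>) g x) = f \<nu> x"
    and supp: "finite S" "\<And>\<nu> x. \<nu> \<in> NI D \<Longrightarrow> x \<in> Er \<nu> \<Longrightarrow> \<nu> \<notin> S \<Longrightarrow> f \<nu> x = \<zero>\<^bsub>A\<^esub>"
  shows "hfun f \<in> carrier H"
proof -
  have tr: "transport D Q (std \<nu>) (std \<nu>) g x \<in> Er \<nu>"
    if "g \<in> graded_isos D Q (std \<nu>) (std \<nu>)" "x \<in> Er \<nu>" for g x \<nu>
    using transport_reps[OF good_std good_std that] .
  have "hfun (hfun f) = hfun f" by (rule hfun_cong) (simp add: hfun_apply)
  moreover have "invariant (hfun f)" using inv tr by (simp add: invariant_def hfun_apply)
  moreover have "supp (hfun f) \<subseteq> S"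
  proof
    fix \<nu> assume "\<nu> \<in> supp (hfun f)"
    then obtain x where x: "\<nu> \<in> NI D" "x \<in> Er \<nu>" "f \<nu> x \<noteq> \<zero>\<^bsub>A\<^esub>"
      unfolding supp_def by (auto simp: hfun_apply)
    show "\<nu> \<in> S" by (rule ccontr) (use supp(2)[OF x(1,2)] x(3) in simp)
  qed
  then have "finite (supp (hfun f))" using supp(1) by (rule finite_subset)
  ultimately show ?thesis using val by (simp add: carrier_H hfun_apply)
qed

lemma H_inv: "f \<in> carrier H \<Longrightarrow> \<nu> \<in> NI D \<Longrightarrow> g \<in> graded_isos D Q (std \<nu>) (std \<nu>) \<Longrightarrow> x \<in> Er \<nu> \<Longrightarrow>
    f \<nu> (transport D Q (std \<nu>) (std \<nu>) g x) = f \<nu> x"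
  by (simp add: carrier_H invariant_def)

lemma H_supp: "f \<in> carrier H \<Longrightarrow> finite (supp f)" "\<nu> \<in> NI D \<Longrightarrow> x \<in> Er \<nu> \<Longrightarrow> \<nu> \<notin> supp f \<Longrightarrow> f \<nu> x = \<zero>\<^bsub>A\<^esub>"
  by (simp add: carrier_H) (auto simp: supp_def)

lemma H_map_closed:
  assumes f: "f \<in> carrier H" and h: "\<And>a. a \<in> carrier A \<Longrightarrow> h a \<in> carrier A" "h \<zero>\<^bsub>A\<^esub> = \<zero>\<^bsub>A\<^esub>"
  shows "hfun (\<lambda>\<nu> x. h (f \<nu> x)) \<in> carrier H"
  by (rule hfun_H[OF _ _ H_supp(1)[OF f]]) (use h H_val[OF f] H_inv[OF f] H_supp(2) in simp_all)

lemma H_add_closed: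
  assumes f: "f \<in> carrier H" and g: "g \<in> carrier H"
  shows "f \<oplus>\<^bsub>H\<^esub> g \<in> carrier H"
  unfolding H_ops
proof (rule hfun_H)
  show "finite (supp f \<union> supp g)" using H_supp(1)[OF f] H_supp(1)[OF g] by simp
  show "f \<nu> x \<oplus>\<^bsub>A\<^esub> g \<nu> x = \<zero>\<^bsub>A\<^esub>" if "\<nu> \<in> NI D" "x \<in> Er \<nu>" "\<nu> \<notin> supp f \<union> supp g" for \<nu> x
    using H_supp(2)[OF that(1,2), of f] H_supp(2)[OF that(1,2), of g] that(3) by simp
qed (use H_val[OF f] H_inv[OF f] H_val[OF g] H_inv[OF g] in simp_all)

lemma H_zero_closed: "\<zero>\<^bsub>H\<^esub> \<in> carrier H"
  unfolding H_ops by (rule hfun_H[of _ "{}"]) simp_all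

lemma module_H: "module A H"
proof (rule module_criteria)
  show "cring A" by (rule A.is_cring)
  show "\<zero>\<^bsub>H\<^esub> \<in> carrier H" by (rule H_zero_closed)
  show "\<forall>v w. v \<in> carrier H \<and> w \<in> carrier H \<longrightarrow> v \<oplus>\<^bsub>H\<^esub> w \<in> carrier H" using H_add_closed by blast
  show "\<forall>v\<in>carrier H. \<exists>neg_v\<in>carrier H. v \<oplus>\<^bsub>H\<^esub> neg_v = \<zero>\<^bsub>H\<^esub>"
  proof
    fix f assume f: "f \<in> carrier H"
    have "f \<oplus>\<^bsub>H\<^esub> hfun (\<lambda>\<nu> x. \<ominus>\<^bsub>A\<^esub> f \<nu> x) = \<zero>\<^bsub>H\<^esub>"
      unfolding H_ops by (rule hfun_cong) (simp add: hfun_apply H_val[OF f] A.r_neg)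
    moreover have "hfun (\<lambda>\<nu> x. \<ominus>\<^bsub>A\<^esub> f \<nu> x) \<in> carrier H" by (rule H_map_closed[OF f]) simp_all
    ultimately show "\<exists>neg_v\<in>carrier H. f \<oplus>\<^bsub>H\<^esub> neg_v = \<zero>\<^bsub>H\<^esub>" by blast
  qed
  show "\<forall>c v. c \<in> carrier A \<and> v \<in> carrier H \<longrightarrow> c \<odot>\<^bsub>H\<^esub> v \<in> carrier H"
    unfolding H_ops by (intro allI impI H_map_closed) auto
  show "\<forall>v w. v \<in> carrier H \<and> w \<in> carrier H \<longrightarrow> v \<oplus>\<^bsub>H\<^esub> w = w \<oplus>\<^bsub>H\<^esub> v"
    unfolding H_ops by (auto intro!: hfun_cong simp: H_val A.a_comm)
  show "\<forall>v w x. v \<in> carrier H \<and> w \<in> carrier H \<and> x \<in> carrier H \<longrightarrow> v \<oplus>\<^bsub>H\<^esub> w \<oplus>\<^bsub>H\<^esub> x = v \<oplus>\<^bsub>H\<^esub> (w \<oplus>\<^bsub>H\<^esub> x)"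
    unfolding H_ops by (auto intro!: hfun_cong simp: H_val A.a_assoc hfun_apply)
  show "\<forall>v\<in>carrier H. v \<oplus>\<^bsub>H\<^esub> \<zero>\<^bsub>H\<^esub> = v"
  proof
    fix f assume f: "f \<in> carrier H"
    have "f \<oplus>\<^bsub>H\<^esub> \<zero>\<^bsub>H\<^esub> = hfun f" unfolding H_ops by (rule hfun_cong) (simp add: hfun_apply H_val[OF f])
    then show "f \<oplus>\<^bsub>H\<^esub> \<zero>\<^bsub>H\<^esub> = f" using H_hfun[OF f] by simp
  qed
  show "\<forall>v\<in>carrier H. \<one>\<^bsub>A\<^esub> \<odot>\<^bsub>H\<^esub> v = v"
  proof
    fix f assume f: "f \<in> carrier H"
    have "\<one>\<^bsub>A\<^esub> \<odot>\<^bsub>H\<^esub> f = hfun f" unfolding H_ops by (rule hfun_cong) (simp add: H_val[OF f])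
    then show "\<one>\<^bsub>A\<^esub> \<odot>\<^bsub>H\<^esub> f = f" using H_hfun[OF f] by simp
  qed
  show "\<forall>a b v. a \<in> carrier A \<and> b \<in> carrier A \<and> v \<in> carrier H \<longrightarrow>
      (a \<otimes>\<^bsub>A\<^esub> b) \<odot>\<^bsub>H\<^esub> v = a \<odot>\<^bsub>H\<^esub> (b \<odot>\<^bsub>H\<^esub> v)"
    unfolding H_ops by (auto intro!: hfun_cong simp: H_val A.m_assoc hfun_apply)
  show "\<forall>a b v. a \<in> carrier A \<and> b \<in> carrier A \<and> v \<in> carrier H \<longrightarrow>
      (a \<oplus>\<^bsub>A\<^esub> b) \<odot>\<^bsub>H\<^esub> v = a \<odot>\<^bsub>H\<^esub> v \<oplus>\<^bsub>H\<^esub> b \<odot>\<^bsub>H\<^esub> v"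
    unfolding H_ops by (auto intro!: hfun_cong simp: H_val A.l_distr hfun_apply)
  show "\<forall>a v w. a \<in> carrier A \<and> v \<in> carrier H \<and> w \<in> carrier H \<longrightarrow>
      a \<odot>\<^bsub>H\<^esub> (v \<oplus>\<^bsub>H\<^esub> w) = a \<odot>\<^bsub>H\<^esub> v \<oplus>\<^bsub>H\<^esub> a \<odot>\<^bsub>H\<^esub> w"
    unfolding H_ops by (auto intro!: hfun_cong simp: H_val A.r_distr hfun_apply)
qed

section \<open>Flag functions as elements of the Hall algebra\<close>

lemma gdim_NI: "gdim D Q V \<in> NI D"
  by (auto simp: gdim_def NI_def)

lemma gdim_std: "\<nu> \<in> NI D \<Longrightarrow> gdim D Q (std \<nu>) = \<nu>"
  by (subst gdim_eq_iff[OF good_std]) (simp_all add: card_std)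

text \<open>The representation on the standard space at which \<open>hall_value\<close> evaluates,
  separated from the function being evaluated.\<close>

definition standardize :: "('i, 'k, 'v) gspace \<Rightarrow> ('a, 'k, 'v) rep \<Rightarrow> ('a, 'k, nat \<Rightarrow> 'k) rep" where
  "standardize V x = transport D Q V (std (gdim D Q V))
     (SOME g. g \<in> graded_isos D Q V (std (gdim D Q V))) x"

lemma hall_value_eq: "gdim D Q V = \<nu> \<Longrightarrow> hall_value D Q \<nu> f V x = f (standardize V x)"
  by (simp add: hall_value_def standardize_def)

lemma standardize_reps: "good V \<Longrightarrow> x \<in> reps D Q V \<Longrightarrow> standardize V x \<in> Er (gdim D Q V)"
  unfolding standardize_def by (rule transport_reps[OF _ good_std graded_iso_std[OF _ refl]])

text \<open>The pullback principle for a map with zero kernel. It makes flag functions invariant and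
  lets flags be counted on any model of a representation.\<close>

lemma nch_iso:
  assumes V: "good V" and V': "good V'" and g: "g \<in> graded_isos D Q V V'" and x: "x \<in> reps D Q V"
  shows "nch (stable_subspaces V' (xi V' (transport D Q V V' g x))) (gtop V') (gbot V') ps
    = nch (stable_subspaces V (xi V x)) (gtop V) (gbot V) ps"
proof (rule sym, rule nchains_pullback[OF V V' gtop_stable[OF V x] gbot_stable[OF V x], of g])
  have hom: "g i \<in> module_hom (subring_of (Kv i)) (V i) (V' i)"
    and bij: "bij_betw (g i) (carrier (V i)) (carrier (V' i))" if "i \<in> vertices D" for i
    using g that by (auto simp: graded_isos_def vfield_eq)
  show "g i ` gtop V i = carrier (V' i)" if "i \<in> vertices D" for i
    using bij[OF that] that by (simp add: gtop_def bij_betw_def)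
  show "g i (u \<oplus>\<^bsub>V i\<^esub> w) = g i u \<oplus>\<^bsub>V' i\<^esub> g i w" if "i \<in> vertices D" "u \<in> gtop V i" "w \<in> gtop V i" for i u w
    using module_hom_add[OF hom[OF that(1)]] that by (simp add: gtop_def)
  show "g i (c \<odot>\<^bsub>V i\<^esub> u) = c \<odot>\<^bsub>V' i\<^esub> g i u" if "i \<in> vertices D" "c \<in> Kv i" "u \<in> gtop V i" for i c u
    using module_hom_smult[OF hom[OF that(1)], of c u] that by (simp add: gtop_def)
  show "{u \<in> gtop V i. g i u = \<zero>\<^bsub>V' i\<^esub>} = gbot V i" if i: "i \<in> vertices D" for i
  proof -
    interpret V: vectorspace "subring_of (Kv i)" "V i" by (rule goodD(1)[OF V i])
    interpret V': vectorspace "subring_of (Kv i)" "V' i" by (rule goodD(1)[OF V' i])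
    interpret mod_hom "subring_of (Kv i)" "V i" "V' i" "g i"
      by (intro mod_hom.intro mod_hom_axioms.intro hom[OF i]) unfold_locales
    have "g i u = \<zero>\<^bsub>V' i\<^esub> \<longleftrightarrow> u = \<zero>\<^bsub>V i\<^esub>" if "u \<in> carrier (V i)" for u
      using bij[OF i] that f0_is_0 V.M.zero_closed unfolding bij_betw_def by (metis inj_onD)
    then show ?thesis using i V.M.zero_closed by (auto simp: gtop_def gbot_def)
  qed
  show "g (tgt D k) (xi V x k u) = xi V' (transport D Q V V' g x) k (g (src D k) u)"
    if "k \<in> arrows D" "u \<in> gtop V (src D k)" for k u
    using xi_transport[OF V V' g that(1)] that arrows_D(1)[OF that(1)] by (simp add: gtop_def)
qed

lemma nch_standardize:
  assumes "good V" "x \<in> reps D Q V"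
  shows "nch (stable_subspaces (std (gdim D Q V)) (xi (std (gdim D Q V)) (standardize V x)))
      (gtop (std (gdim D Q V))) (gbot (std (gdim D Q V))) ps
    = nch (stable_subspaces V (xi V x)) (gtop V) (gbot V) ps"
  unfolding standardize_def by (rule nch_iso[OF assms(1) good_std graded_iso_std[OF assms(1) refl] assms(2)])

definition types :: "('i list \<times> nat list) set" where
  "types = {(js, cs). length js = length cs \<and> set js \<subseteq> vertices D}"

abbreviation FF :: "'i list \<Rightarrow> nat list \<Rightarrow> ('i, 'a, 'k, 'r) hall" where
  "FF \<equiv> flag_function D Q A"

lemma flag_function_val:
  assumes "(js, cs) \<in> types" "\<nu> \<in> NI D" "x \<in> Er \<nu>"
  shows "FF js cs \<nu> x = (if \<nu> = flag_weight js cs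
    then [nch (stable_subspaces (std \<nu>) (xi (std \<nu>) x)) (gtop (std \<nu>)) (gbot (std \<nu>)) (zip js cs)] \<cdot>\<^bsub>A\<^esub> \<one>\<^bsub>A\<^esub>
    else \<zero>\<^bsub>A\<^esub>)"
proof -
  have c: "card {Us \<in> flags D Q (std \<nu>) js cs. \<forall>U\<in>set Us. stable D Q (std \<nu>) x U}
      = nch (stable_subspaces (std \<nu>) (xi (std \<nu>) x)) (gtop (std \<nu>)) (gbot (std \<nu>)) (zip js cs)"
    using assms(1) by (intro card_stable_flags[OF good_std assms(3)]) (auto simp: types_def)
  have "FF js cs \<nu> x = (if \<nu> = flag_weight js cs
      then [card {Us \<in> flags D Q (std \<nu>) js cs. \<forall>U\<in>set Us. stable D Q (std \<nu>) x U}] \<cdot>\<^bsub>A\<^esub> \<one>\<^bsub>A\<^esub> else \<zero>\<^bsub>A\<^esub>)"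
    using assms(2,3) by (simp only: flag_function_def Let_def restrict_apply if_True)
  then show ?thesis unfolding c .
qed

lemma flag_function_H:
  assumes t: "(js, cs) \<in> types"
  shows "FF js cs \<in> carrier H"
proof -
  have "hfun (FF js cs) \<in> carrier H"
  proof (rule hfun_H[of _ "{flag_weight js cs}"])
    show "FF js cs \<nu> x \<in> carrier A" if "\<nu> \<in> NI D" "x \<in> Er \<nu>" for \<nu> x
      by (simp add: flag_function_val[OF t that])
    show "FF js cs \<nu> (transport D Q (std \<nu>) (std \<nu>) g x) = FF js cs \<nu> x"
      if "\<nu> \<in> NI D" "g \<in> graded_isos D Q (std \<nu>) (std \<nu>)" "x \<in> Er \<nu>" for \<nu> g x
      unfolding flag_function_val[OF t that(1) transport_reps[OF good_std good_std that(2,3)]]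
        flag_function_val[OF t that(1,3)] nch_iso[OF good_std good_std that(2,3)] ..
  qed (simp_all add: flag_function_val[OF t])
  moreover have "hfun (FF js cs) = FF js cs"
    by (simp add: hfun_def flag_function_def Let_def fun_eq_iff restrict_def)
  ultimately show ?thesis by simp
qed

text \<open>The transport disappears: flags are counted on \<open>V\<close> itself, which may be a
  subspace, a quotient or a space with restricted scalars.\<close>

lemma hall_value_flag_function:
  assumes V: "good V" and x: "x \<in> reps D Q V" and \<nu>: "gdim D Q V = \<nu>" and t: "(js, cs) \<in> types"
  shows "hall_value D Q \<nu> (FF js cs \<nu>) V x = (if \<nu> = flag_weight js cs
    then [nch (stable_subspaces V (xi V x)) (gtop V) (gbot V) (zip js cs)] \<cdot>\<^bsub>A\<^esub> \<one>\<^bsub>A\<^esub> else \<zero>\<^bsub>A\<^esub>)"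
  unfolding hall_value_eq[OF \<nu>]
    flag_function_val[OF t gdim_NI standardize_reps[OF V x], unfolded \<nu> nch_standardize[OF V x, unfolded \<nu>]] ..

end

section \<open>Flags of a subspace and of a quotient\<close>

context quiver_rep
begin

text \<open>Pullback along the identity of \<open>W\<close>, with zero kernel: flags of the
  subrepresentation are the lower halves of flags through \<open>W\<close>.\<close>

lemma nch_sub:
  assumes V: "good V" and x: "x \<in> reps D Q V" and W: "W \<in> stable_subspaces V (xi V x)"
  shows "nch (stable_subspaces (sub_space V W) (xi (sub_space V W) (sub_rep D Q V W x)))
      (gtop (sub_space V W)) (gbot (sub_space V W)) ps
    = nch (stable_subspaces V (xi V x)) W (gbot V) ps"
proof -
  have gs: "W \<in> graded_subspaces D Q V" using W by (simp add: stable_subspaces_def)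
  note lin = stable_subspaces_lin[OF V W, unfolded lin_closed_def]
  show ?thesis
  proof (rule sym, rule nchains_pullback[OF V good_sub[OF V gs] W gbot_stable[OF V x], of "\<lambda>_. id"])
    show "id (xi V x k u) = xi (sub_space V W) (sub_rep D Q V W x) k (id u)"
      if "k \<in> arrows D" "u \<in> W (src D k)" for k u
      using xi_sub_rep[OF V gs that] by simp
    show "{u \<in> W i. id u = \<zero>\<^bsub>sub_space V W i\<^esub>} = gbot V i" if "i \<in> vertices D" for i
      using lin[OF that] that by (auto simp: sub_space_def gbot_def)
  qed (simp_all add: sub_space_def)
qed

text \<open>Pullback along the projection, with kernel \<open>W\<close>: flags of the quotient are
  the upper halves.\<close>

lemma nch_quot:
  assumes V: "good V" and x: "x \<in> reps D Q V" and W: "W \<in> stable_subspaces V (xi V x)"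
  shows "nch (stable_subspaces (quot_space V W) (xi (quot_space V W) (quot_rep D Q V W x)))
      (gtop (quot_space V W)) (gbot (quot_space V W)) ps
    = nch (stable_subspaces V (xi V x)) (gtop V) W ps"
proof -
  have gs: "W \<in> graded_subspaces D Q V" using W by (simp add: stable_subspaces_def)
  have st: "stable D Q V x W" using W stable_iff[OF V x gs] by (simp add: stable_subspaces_def)
  note q = quotient_space[OF V gs]
  show ?thesis
  proof (rule sym, rule nchains_pullback[OF V good_quot[OF V gs] gtop_stable[OF V x] W,
        of "\<lambda>i v. W i +>\<^bsub>V i\<^esub> v"])
    fix i assume i: "i \<in> vertices D"
    interpret q: quotient_space "Kv i" "V i" "W i" by (rule q[OF i])
    show "(\<lambda>v. W i +>\<^bsub>V i\<^esub> v) ` gtop V i = carrier (quot_space V W i)"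
      using i by (simp add: gtop_def quot_space_def q.carrier_VW)
    show "W i +>\<^bsub>V i\<^esub> (u \<oplus>\<^bsub>V i\<^esub> w) = (W i +>\<^bsub>V i\<^esub> u) \<oplus>\<^bsub>quot_space V W i\<^esub> (W i +>\<^bsub>V i\<^esub> w)"
      if "u \<in> gtop V i" "w \<in> gtop V i" for u w
      using q.\<pi>_add[of u w] that i by (simp add: gtop_def quot_space_def)
    show "W i +>\<^bsub>V i\<^esub> (c \<odot>\<^bsub>V i\<^esub> u) = c \<odot>\<^bsub>quot_space V W i\<^esub> (W i +>\<^bsub>V i\<^esub> u)"
      if "c \<in> Kv i" "u \<in> gtop V i" for c u
      using q.\<pi>_smult[of c u] that i by (simp add: gtop_def quot_space_def)
    have "{u \<in> carrier (V i). W i +>\<^bsub>V i\<^esub> u = \<zero>\<^bsub>quot_module (V i) (W i)\<^esub>} = W i"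
      using q.\<pi>_eq_zero_iff q.WV by blast
    then show "{u \<in> gtop V i. W i +>\<^bsub>V i\<^esub> u = \<zero>\<^bsub>quot_space V W i\<^esub>} = W i"
      using i by (simp add: gtop_def quot_space_def)
  next
    fix k u assume "k \<in> arrows D" "u \<in> gtop V (src D k)"
    then show "W (tgt D k) +>\<^bsub>V (tgt D k)\<^esub> xi V x k u
        = xi (quot_space V W) (quot_rep D Q V W x) k (W (src D k) +>\<^bsub>V (src D k)\<^esub> u)"
      using xi_quot_rep[OF V x gs st, of k u] arrows_D by (simp add: gtop_def)
  qed
qed

lemma gdim_quot:
  assumes V: "good V" and W: "W \<in> graded_subspaces D Q V" and \<nu>: "\<nu>1 \<in> NI D"
    and dims: "gdim D Q V = (\<lambda>i. \<nu>1 i + \<nu>2 i)" "gdim D Q (sub_space V W) = \<nu>2"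
  shows "gdim D Q (quot_space V W) = \<nu>1"
  unfolding gdim_eq_iff[OF good_quot[OF V W] \<nu>]
proof
  fix i assume i: "i \<in> vertices D"
  let ?w = "Q ^ vdeg D i"
  have "card (carrier (V i)) = card (carrier (quot_space V W i)) * card (W i)"
    using quotient_space.card_VW[OF quotient_space[OF V W i] goodD(2)[OF V i]] by (simp add: quot_space_def)
  also have "card (W i) = ?w ^ \<nu>2 i"
    using card_good[OF good_sub[OF V W] i] dims(2) by (simp add: sub_space_def)
  finally have "card (carrier (V i)) = card (carrier (quot_space V W i)) * ?w ^ \<nu>2 i" .
  moreover have "card (carrier (V i)) = ?w ^ \<nu>1 i * ?w ^ \<nu>2 i"
    using card_good[OF V i] dims(1) by (simp add: power_add)
  ultimately have "card (carrier (quot_space V W i)) * ?w ^ \<nu>2 i = ?w ^ \<nu>1 i * ?w ^ \<nu>2 i" by (simp only:)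
  moreover have "?w \<noteq> 0" using Kv_card_gt_1[OF i] by linarith
  then have "?w ^ \<nu>2 i \<noteq> 0" by (rule power_not_zero)
  ultimately show "card (carrier (quot_space V W i)) = ?w ^ \<nu>1 i" by (simp only: mult_cancel_right) blast
qed

end

section \<open>Products in the Hall algebra\<close>

context hall
begin

text \<open>The index set of the sum in \<open>hall_star\<close>.\<close>

definition pieces :: "('i \<Rightarrow> nat) \<Rightarrow> ('i \<Rightarrow> nat) \<Rightarrow> ('a, 'k, nat \<Rightarrow> 'k) rep \<Rightarrow> ('i \<Rightarrow> (nat \<Rightarrow> 'k) set) set" where
  "pieces \<nu>1 \<nu>2 x = (let V = std (\<lambda>i. \<nu>1 i + \<nu>2 i) in
     {W \<in> graded_subspaces D Q V. stable D Q V x W \<and> gdim D Q (sub_space V W) = \<nu>2})"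

definition quot_part where
  "quot_part \<nu> x W = standardize (quot_space (std \<nu>) W) (quot_rep D Q (std \<nu>) W x)"

definition sub_part where
  "sub_part \<nu> x W = standardize (sub_space (std \<nu>) W) (sub_rep D Q (std \<nu>) W x)"

lemma finite_pieces: "finite (pieces \<nu>1 \<nu>2 x)"
  unfolding pieces_def Let_def by (rule finite_subset[OF _ finite_graded_subspaces[OF good_std]]) auto

lemma NI_add: "\<nu>1 \<in> NI D \<Longrightarrow> \<nu>2 \<in> NI D \<Longrightarrow> (\<lambda>i. \<nu>1 i + \<nu>2 i) \<in> NI D"
  by (simp add: NI_def)

lemma piecesD:
  assumes \<nu>: "\<nu>1 \<in> NI D" "\<nu>2 \<in> NI D" and x: "x \<in> Er (\<lambda>i. \<nu>1 i + \<nu>2 i)" and W: "W \<in> pieces \<nu>1 \<nu>2 x"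
  defines "V \<equiv> std (\<lambda>i. \<nu>1 i + \<nu>2 i)"
  shows "W \<in> graded_subspaces D Q V" "stable D Q V x W" "gdim D Q (sub_space V W) = \<nu>2"
    "gdim D Q (quot_space V W) = \<nu>1"
    "quot_part (\<lambda>i. \<nu>1 i + \<nu>2 i) x W \<in> Er \<nu>1" "sub_part (\<lambda>i. \<nu>1 i + \<nu>2 i) x W \<in> Er \<nu>2"
proof -
  show W: "W \<in> graded_subspaces D Q V" "stable D Q V x W" "gdim D Q (sub_space V W) = \<nu>2"
    using W by (simp_all add: pieces_def V_def Let_def)
  have V: "good V" and xV: "x \<in> reps D Q V" unfolding V_def using good_std x by blast+
  show q: "gdim D Q (quot_space V W) = \<nu>1"
    by (rule gdim_quot[OF V W(1) \<nu>(1) _ W(3)]) (simp add: V_def gdim_std NI_add[OF \<nu>])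
  show "quot_part (\<lambda>i. \<nu>1 i + \<nu>2 i) x W \<in> Er \<nu>1"
    using standardize_reps[OF good_quot[OF V W(1)] quot_rep_reps[OF V xV W(1,2)]] q
    by (simp add: quot_part_def V_def)
  show "sub_part (\<lambda>i. \<nu>1 i + \<nu>2 i) x W \<in> Er \<nu>2"
    using standardize_reps[OF good_sub[OF V W(1)] sub_rep_reps[OF V xV W(1,2)]] W(3)
    by (simp add: sub_part_def V_def)
qed

lemma hall_star_eq:
  assumes \<nu>: "\<nu>1 \<in> NI D" "\<nu>2 \<in> NI D" and x: "x \<in> Er (\<lambda>i. \<nu>1 i + \<nu>2 i)"
    and f1: "\<And>y. y \<in> Er \<nu>1 \<Longrightarrow> f1 y \<in> carrier A" and f2: "\<And>y. y \<in> Er \<nu>2 \<Longrightarrow> f2 y \<in> carrier A"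
  shows "hall_star D Q A \<nu>1 \<nu>2 f1 f2 x = (\<Oplus>\<^bsub>A\<^esub>W\<in>pieces \<nu>1 \<nu>2 x.
    f1 (quot_part (\<lambda>i. \<nu>1 i + \<nu>2 i) x W) \<otimes>\<^bsub>A\<^esub> f2 (sub_part (\<lambda>i. \<nu>1 i + \<nu>2 i) x W))"
proof -
  note P = piecesD[OF \<nu> x]
  let ?V = "std (\<lambda>i. \<nu>1 i + \<nu>2 i)"
  have "hall_star D Q A \<nu>1 \<nu>2 f1 f2 x = (\<Oplus>\<^bsub>A\<^esub>W\<in>pieces \<nu>1 \<nu>2 x.
     hall_value D Q \<nu>1 f1 (quot_space ?V W) (quot_rep D Q ?V W x)
      \<otimes>\<^bsub>A\<^esub> hall_value D Q \<nu>2 f2 (sub_space ?V W) (sub_rep D Q ?V W x))"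
    using x by (simp add: hall_star_def pieces_def Let_def)
  also have "\<dots> = (\<Oplus>\<^bsub>A\<^esub>W\<in>pieces \<nu>1 \<nu>2 x.
    f1 (quot_part (\<lambda>i. \<nu>1 i + \<nu>2 i) x W) \<otimes>\<^bsub>A\<^esub> f2 (sub_part (\<lambda>i. \<nu>1 i + \<nu>2 i) x W))"
  proof (rule A.finsum_cong'[OF refl])
    show "(\<lambda>W. f1 (quot_part (\<lambda>i. \<nu>1 i + \<nu>2 i) x W) \<otimes>\<^bsub>A\<^esub> f2 (sub_part (\<lambda>i. \<nu>1 i + \<nu>2 i) x W))
      \<in> pieces \<nu>1 \<nu>2 x \<rightarrow> carrier A"
      using f1[OF P(5)] f2[OF P(6)] by simp
    fix W assume W: "W \<in> pieces \<nu>1 \<nu>2 x"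
    show "hall_value D Q \<nu>1 f1 (quot_space ?V W) (quot_rep D Q ?V W x)
      \<otimes>\<^bsub>A\<^esub> hall_value D Q \<nu>2 f2 (sub_space ?V W) (sub_rep D Q ?V W x)
      = f1 (quot_part (\<lambda>i. \<nu>1 i + \<nu>2 i) x W) \<otimes>\<^bsub>A\<^esub> f2 (sub_part (\<lambda>i. \<nu>1 i + \<nu>2 i) x W)"
      unfolding hall_value_eq[OF P(4)[OF W]] hall_value_eq[OF P(3)[OF W]] quot_part_def sub_part_def ..
  qed
  finally show ?thesis .
qed

definition splittings :: "('i \<Rightarrow> nat) \<Rightarrow> (('i \<Rightarrow> nat) \<times> ('i \<Rightarrow> nat)) set" where
  "splittings \<nu> = {(\<nu>1, \<nu>2). \<nu>1 \<in> NI D \<and> \<nu>2 \<in> NI D \<and> (\<lambda>i. \<nu>1 i + \<nu>2 i) = \<nu>}"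

text \<open>The form has nonnegative coefficients, so on dimension vectors the exponent is a natural
  number and the twist is the inverse of an ordinary power of the unit \<open>e\<close>.\<close>

definition twist :: "('i \<Rightarrow> nat) \<Rightarrow> ('i \<Rightarrow> nat) \<Rightarrow> nat" where
  "twist \<nu>1 \<nu>2 = nat (twist_form D (\<lambda>i. int (\<nu>1 i)) (\<lambda>i. int (\<nu>2 i)))"

definition twist_coeff :: "('i \<Rightarrow> nat) \<Rightarrow> ('i \<Rightarrow> nat) \<Rightarrow> 'r" where
  "twist_coeff \<nu>1 \<nu>2 = inv\<^bsub>A\<^esub> (e [^]\<^bsub>A\<^esub> twist \<nu>1 \<nu>2)"

lemma twist_form_nonneg: "twist_form D (\<lambda>i. int (\<nu>1 i)) (\<lambda>i. int (\<nu>2 i)) \<ge> 0"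
  unfolding twist_form_def by (intro add_nonneg_nonneg sum_nonneg) simp_all

lemma twist_coeff_eq:
  "e [^]\<^bsub>A\<^esub> (- twist_form D (\<lambda>i. int (\<nu>1 i)) (\<lambda>i. int (\<nu>2 i))) = twist_coeff \<nu>1 \<nu>2"
proof -
  have *: "twist_form D (\<lambda>i. int (\<nu>1 i)) (\<lambda>i. int (\<nu>2 i)) = int (twist \<nu>1 \<nu>2)"
    using twist_form_nonneg by (simp add: twist_def)
  \<comment> \<open>At exponent 0 the integer power does not go through an inverse, so this case is
    treated separately.\<close>
  show ?thesis unfolding * twist_coeff_def
    by (cases "twist \<nu>1 \<nu>2 = 0") (simp_all add: int_pow_def nat_pow_def)
qed

lemma twist_coeff_closed: "twist_coeff \<nu>1 \<nu>2 \<in> carrier A"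
  unfolding twist_coeff_def using e_unit by (intro A.Units_inv_closed A.Units_pow_closed)

lemma finite_splittings: "finite (splittings \<nu>)"
proof (rule finite_subset)
  let ?B = "{f. \<forall>i. (i \<in> vertices D \<longrightarrow> f i \<in> {..\<nu> i}) \<and> (i \<notin> vertices D \<longrightarrow> f i = 0)}"
  show "splittings \<nu> \<subseteq> ?B \<times> ?B"
    by (auto simp: splittings_def NI_def)
  have "finite ?B"
  proof (rule finite_subset)
    show "?B \<subseteq> {f. \<forall>i. (i \<in> vertices D \<longrightarrow> f i \<in> {..Max (\<nu> ` vertices D)}) \<and> (i \<notin> vertices D \<longrightarrow> f i = 0)}"
    proof (intro subsetI CollectI allI conjI impI)
      fix f i assume f: "f \<in> ?B" and i: "i \<in> vertices D"
      have "f i \<le> \<nu> i" using f i by blast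
      also have "\<nu> i \<le> Max (\<nu> ` vertices D)" using finite_vertices i by (intro Max_ge) auto
      finally show "f i \<in> {..Max (\<nu> ` vertices D)}" by simp
    qed blast
    show "finite {f. \<forall>i. (i \<in> vertices D \<longrightarrow> f i \<in> {..Max (\<nu> ` vertices D)}) \<and> (i \<notin> vertices D \<longrightarrow> f i = (0 :: nat))}"
      by (rule finite_set_of_finite_funs[OF finite_vertices]) simp
  qed
  then show "finite (?B \<times> ?B)" by simp
qed

text \<open>The product at a single representation, where bilinearity can be proved without the
  restrictions that make Hall algebra elements extensional.\<close>

definition product_value :: "('i, 'a, 'k, 'r) hall \<Rightarrow> ('i, 'a, 'k, 'r) hall \<Rightarrow> ('i, 'a, 'k, 'r) hall" where
  "product_value f1 f2 \<nu> x = (\<Oplus>\<^bsub>A\<^esub>s\<in>splittings \<nu>. twist_coeff (fst s) (snd s) \<otimes>\<^bsub>A\<^esub>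
     (\<Oplus>\<^bsub>A\<^esub>W\<in>pieces (fst s) (snd s) x. f1 (fst s) (quot_part \<nu> x W) \<otimes>\<^bsub>A\<^esub> f2 (snd s) (sub_part \<nu> x W)))"

lemma splittingsD: "s \<in> splittings \<nu> \<Longrightarrow> fst s \<in> NI D \<and> snd s \<in> NI D \<and> (\<lambda>i. fst s i + snd s i) = \<nu>"
  by (auto simp: splittings_def)

lemma term_closed:
  assumes "f1 \<in> carrier H" "f2 \<in> carrier H" "s \<in> splittings \<nu>" "x \<in> Er \<nu>" "W \<in> pieces (fst s) (snd s) x"
  shows "f1 (fst s) (quot_part \<nu> x W) \<in> carrier A" "f2 (snd s) (sub_part \<nu> x W) \<in> carrier A"
  using piecesD(5,6)[of "fst s" "snd s" x W] splittingsD[OF assms(3)] assms H_val by auto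

lemma inner_closed:
  assumes "f1 \<in> carrier H" "f2 \<in> carrier H" "s \<in> splittings \<nu>" "x \<in> Er \<nu>"
  shows "(\<Oplus>\<^bsub>A\<^esub>W\<in>pieces (fst s) (snd s) x. f1 (fst s) (quot_part \<nu> x W) \<otimes>\<^bsub>A\<^esub> f2 (snd s) (sub_part \<nu> x W)) \<in> carrier A"
  using term_closed[OF assms] by (intro A.finsum_closed) auto

lemma H_mult:
  assumes f1: "f1 \<in> carrier H" and f2: "f2 \<in> carrier H"
  shows "f1 \<otimes>\<^bsub>H\<^esub> f2 = hfun (product_value f1 f2)"
proof -
  have "f1 \<otimes>\<^bsub>H\<^esub> f2 = hfun (\<lambda>\<nu> x. finsum A (\<lambda>(\<nu>1, \<nu>2). (e [^]\<^bsub>A\<^esub> (- twist_form D (\<lambda>i. int (\<nu>1 i)) (\<lambda>i. int (\<nu>2 i))))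
        \<otimes>\<^bsub>A\<^esub> hall_star D Q A \<nu>1 \<nu>2 (f1 \<nu>1) (f2 \<nu>2) x) (splittings \<nu>))"
    by (simp add: hall_algebra_def Let_def twisted_mult_def hfun_def splittings_def)
  also have "\<dots> = hfun (product_value f1 f2)"
  proof (rule hfun_cong)
    fix \<nu> x assume \<nu>: "\<nu> \<in> NI D" and x: "x \<in> Er \<nu>"
    show "finsum A (\<lambda>(\<nu>1, \<nu>2). (e [^]\<^bsub>A\<^esub> (- twist_form D (\<lambda>i. int (\<nu>1 i)) (\<lambda>i. int (\<nu>2 i))))
        \<otimes>\<^bsub>A\<^esub> hall_star D Q A \<nu>1 \<nu>2 (f1 \<nu>1) (f2 \<nu>2) x) (splittings \<nu>) = product_value f1 f2 \<nu> x"
      unfolding product_value_def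
    proof (rule A.finsum_cong'[OF refl])
      show "(\<lambda>s. twist_coeff (fst s) (snd s) \<otimes>\<^bsub>A\<^esub>
        (\<Oplus>\<^bsub>A\<^esub>W\<in>pieces (fst s) (snd s) x. f1 (fst s) (quot_part \<nu> x W) \<otimes>\<^bsub>A\<^esub> f2 (snd s) (sub_part \<nu> x W)))
        \<in> splittings \<nu> \<rightarrow> carrier A"
        using inner_closed[OF f1 f2 _ x] twist_coeff_closed by simp
      fix s assume s: "s \<in> splittings \<nu>"
      obtain \<nu>1 \<nu>2 where s': "s = (\<nu>1, \<nu>2)" by fastforce
      have \<nu>s: "\<nu>1 \<in> NI D" "\<nu>2 \<in> NI D" and eq: "(\<lambda>i. \<nu>1 i + \<nu>2 i) = \<nu>"
        using splittingsD[OF s] s' by simp_all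
      have x': "x \<in> Er (\<lambda>i. \<nu>1 i + \<nu>2 i)" using x eq by simp
      show "(case s of (\<nu>1, \<nu>2) \<Rightarrow> (e [^]\<^bsub>A\<^esub> (- twist_form D (\<lambda>i. int (\<nu>1 i)) (\<lambda>i. int (\<nu>2 i))))
        \<otimes>\<^bsub>A\<^esub> hall_star D Q A \<nu>1 \<nu>2 (f1 \<nu>1) (f2 \<nu>2) x)
        = twist_coeff (fst s) (snd s) \<otimes>\<^bsub>A\<^esub>
        (\<Oplus>\<^bsub>A\<^esub>W\<in>pieces (fst s) (snd s) x. f1 (fst s) (quot_part \<nu> x W) \<otimes>\<^bsub>A\<^esub> f2 (snd s) (sub_part \<nu> x W))"
      proof -
        have "hall_star D Q A \<nu>1 \<nu>2 (f1 \<nu>1) (f2 \<nu>2) x = (\<Oplus>\<^bsub>A\<^esub>W\<in>pieces \<nu>1 \<nu>2 x.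
            f1 \<nu>1 (quot_part (\<lambda>i. \<nu>1 i + \<nu>2 i) x W) \<otimes>\<^bsub>A\<^esub> f2 \<nu>2 (sub_part (\<lambda>i. \<nu>1 i + \<nu>2 i) x W))"
          by (rule hall_star_eq[OF \<nu>s x']) (simp_all add: H_val f1 f2 \<nu>s)
        then show ?thesis unfolding s' prod.case fst_conv snd_conv twist_coeff_eq eq by simp
      qed
    qed
  qed
  finally show ?thesis .
qed

lemma H_add_val: "f \<in> carrier H \<Longrightarrow> g \<in> carrier H \<Longrightarrow> \<nu> \<in> NI D \<Longrightarrow> x \<in> Er \<nu> \<Longrightarrow> (f \<oplus>\<^bsub>H\<^esub> g) \<nu> x = f \<nu> x \<oplus>\<^bsub>A\<^esub> g \<nu> x"
  by (simp add: H_ops hfun_apply)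

lemma H_smult_val: "\<nu> \<in> NI D \<Longrightarrow> x \<in> Er \<nu> \<Longrightarrow> (a \<odot>\<^bsub>H\<^esub> f) \<nu> x = a \<otimes>\<^bsub>A\<^esub> f \<nu> x"
  by (simp add: H_ops hfun_apply)

lemma H_smult_closed: "a \<in> carrier A \<Longrightarrow> f \<in> carrier H \<Longrightarrow> a \<odot>\<^bsub>H\<^esub> f \<in> carrier H"
  using module_H by (rule module.smult_closed)

lemma product_value_closed:
  assumes "f \<in> carrier H" "g \<in> carrier H" "x \<in> Er \<nu>"
  shows "product_value f g \<nu> x \<in> carrier A"
  unfolding product_value_def
  using inner_closed[OF assms(1,2) _ assms(3)] twist_coeff_closed by (intro A.finsum_closed) auto

lemma twist_coeff_comm:
  assumes "a \<in> carrier A" "b \<in> carrier A"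
  shows "twist_coeff \<nu>1 \<nu>2 \<otimes>\<^bsub>A\<^esub> (a \<otimes>\<^bsub>A\<^esub> b) = a \<otimes>\<^bsub>A\<^esub> (twist_coeff \<nu>1 \<nu>2 \<otimes>\<^bsub>A\<^esub> b)"
  using assms twist_coeff_closed by (simp add: A.m_lcomm)

lemma product_value_smult:
  assumes a: "a \<in> carrier A" and f: "f \<in> carrier H" and g: "g \<in> carrier H" and x: "x \<in> Er \<nu>"
  shows "product_value (a \<odot>\<^bsub>H\<^esub> f) g \<nu> x = a \<otimes>\<^bsub>A\<^esub> product_value f g \<nu> x"
    "product_value g (a \<odot>\<^bsub>H\<^esub> f) \<nu> x = a \<otimes>\<^bsub>A\<^esub> product_value g f \<nu> x"
proof -
  note part = piecesD(5,6)[of "fst s" "snd s" x W for s W]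
  have val: "(a \<odot>\<^bsub>H\<^esub> f) (fst s) (quot_part \<nu> x W) = a \<otimes>\<^bsub>A\<^esub> f (fst s) (quot_part \<nu> x W)"
    "(a \<odot>\<^bsub>H\<^esub> f) (snd s) (sub_part \<nu> x W) = a \<otimes>\<^bsub>A\<^esub> f (snd s) (sub_part \<nu> x W)"
    if s: "s \<in> splittings \<nu>" and W: "W \<in> pieces (fst s) (snd s) x" for s W
    using part[of s W] splittingsD[OF s] W x H_smult_val by auto
  show "product_value (a \<odot>\<^bsub>H\<^esub> f) g \<nu> x = a \<otimes>\<^bsub>A\<^esub> product_value f g \<nu> x"
  proof -
    note tc = term_closed[OF f g _ x] and ic = inner_closed[OF f g _ x]
    have "product_value (a \<odot>\<^bsub>H\<^esub> f) g \<nu> x = (\<Oplus>\<^bsub>A\<^esub>s\<in>splittings \<nu>. a \<otimes>\<^bsub>A\<^esub> (twist_coeff (fst s) (snd s) \<otimes>\<^bsub>A\<^esub>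
      (\<Oplus>\<^bsub>A\<^esub>W\<in>pieces (fst s) (snd s) x. f (fst s) (quot_part \<nu> x W) \<otimes>\<^bsub>A\<^esub> g (snd s) (sub_part \<nu> x W))))"
      unfolding product_value_def
    proof (rule A.finsum_cong'[OF refl])
      fix s assume s: "s \<in> splittings \<nu>"
      have "(\<Oplus>\<^bsub>A\<^esub>W\<in>pieces (fst s) (snd s) x. (a \<odot>\<^bsub>H\<^esub> f) (fst s) (quot_part \<nu> x W) \<otimes>\<^bsub>A\<^esub> g (snd s) (sub_part \<nu> x W))
        = (\<Oplus>\<^bsub>A\<^esub>W\<in>pieces (fst s) (snd s) x. a \<otimes>\<^bsub>A\<^esub> (f (fst s) (quot_part \<nu> x W) \<otimes>\<^bsub>A\<^esub> g (snd s) (sub_part \<nu> x W)))"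
        using tc[OF s] val(1)[OF s] a by (intro A.finsum_cong') (auto simp: A.m_assoc)
      also have "\<dots> = a \<otimes>\<^bsub>A\<^esub> (\<Oplus>\<^bsub>A\<^esub>W\<in>pieces (fst s) (snd s) x. f (fst s) (quot_part \<nu> x W) \<otimes>\<^bsub>A\<^esub> g (snd s) (sub_part \<nu> x W))"
        using tc[OF s] a by (intro A.finsum_rdistr[symmetric] finite_pieces) auto
      finally show "twist_coeff (fst s) (snd s) \<otimes>\<^bsub>A\<^esub> (\<Oplus>\<^bsub>A\<^esub>W\<in>pieces (fst s) (snd s) x. (a \<odot>\<^bsub>H\<^esub> f) (fst s) (quot_part \<nu> x W) \<otimes>\<^bsub>A\<^esub> g (snd s) (sub_part \<nu> x W))
        = a \<otimes>\<^bsub>A\<^esub> (twist_coeff (fst s) (snd s) \<otimes>\<^bsub>A\<^esub> (\<Oplus>\<^bsub>A\<^esub>W\<in>pieces (fst s) (snd s) x. f (fst s) (quot_part \<nu> x W) \<otimes>\<^bsub>A\<^esub> g (snd s) (sub_part \<nu> x W)))"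
        using twist_coeff_comm[OF a ic[OF s]] by simp
    qed (use ic a twist_coeff_closed in auto)
    also have "\<dots> = a \<otimes>\<^bsub>A\<^esub> product_value f g \<nu> x"
      unfolding product_value_def
      using ic a twist_coeff_closed by (intro A.finsum_rdistr[symmetric] finite_splittings) auto
    finally show ?thesis .
  qed
  show "product_value g (a \<odot>\<^bsub>H\<^esub> f) \<nu> x = a \<otimes>\<^bsub>A\<^esub> product_value g f \<nu> x"
  proof -
    note tc = term_closed[OF g f _ x] and ic = inner_closed[OF g f _ x]
    have "product_value g (a \<odot>\<^bsub>H\<^esub> f) \<nu> x = (\<Oplus>\<^bsub>A\<^esub>s\<in>splittings \<nu>. a \<otimes>\<^bsub>A\<^esub> (twist_coeff (fst s) (snd s) \<otimes>\<^bsub>A\<^esub>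
      (\<Oplus>\<^bsub>A\<^esub>W\<in>pieces (fst s) (snd s) x. g (fst s) (quot_part \<nu> x W) \<otimes>\<^bsub>A\<^esub> f (snd s) (sub_part \<nu> x W))))"
      unfolding product_value_def
    proof (rule A.finsum_cong'[OF refl])
      fix s assume s: "s \<in> splittings \<nu>"
      have "(\<Oplus>\<^bsub>A\<^esub>W\<in>pieces (fst s) (snd s) x. g (fst s) (quot_part \<nu> x W) \<otimes>\<^bsub>A\<^esub> (a \<odot>\<^bsub>H\<^esub> f) (snd s) (sub_part \<nu> x W))
        = (\<Oplus>\<^bsub>A\<^esub>W\<in>pieces (fst s) (snd s) x. a \<otimes>\<^bsub>A\<^esub> (g (fst s) (quot_part \<nu> x W) \<otimes>\<^bsub>A\<^esub> f (snd s) (sub_part \<nu> x W)))"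
        using tc[OF s] val(2)[OF s] a by (intro A.finsum_cong') (auto simp: A.m_lcomm)
      also have "\<dots> = a \<otimes>\<^bsub>A\<^esub> (\<Oplus>\<^bsub>A\<^esub>W\<in>pieces (fst s) (snd s) x. g (fst s) (quot_part \<nu> x W) \<otimes>\<^bsub>A\<^esub> f (snd s) (sub_part \<nu> x W))"
        using tc[OF s] a by (intro A.finsum_rdistr[symmetric] finite_pieces) auto
      finally show "twist_coeff (fst s) (snd s) \<otimes>\<^bsub>A\<^esub> (\<Oplus>\<^bsub>A\<^esub>W\<in>pieces (fst s) (snd s) x. g (fst s) (quot_part \<nu> x W) \<otimes>\<^bsub>A\<^esub> (a \<odot>\<^bsub>H\<^esub> f) (snd s) (sub_part \<nu> x W))
        = a \<otimes>\<^bsub>A\<^esub> (twist_coeff (fst s) (snd s) \<otimes>\<^bsub>A\<^esub> (\<Oplus>\<^bsub>A\<^esub>W\<in>pieces (fst s) (snd s) x. g (fst s) (quot_part \<nu> x W) \<otimes>\<^bsub>A\<^esub> f (snd s) (sub_part \<nu> x W)))"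
        using twist_coeff_comm[OF a ic[OF s]] by simp
    qed (use ic a twist_coeff_closed in auto)
    also have "\<dots> = a \<otimes>\<^bsub>A\<^esub> product_value g f \<nu> x"
      unfolding product_value_def
      using ic a twist_coeff_closed by (intro A.finsum_rdistr[symmetric] finite_splittings) auto
    finally show ?thesis .
  qed
qed

section \<open>Products of flag functions\<close>

lemma flag_weight_NI: "(js, cs) \<in> types \<Longrightarrow> flag_weight js cs \<in> NI D"
  unfolding NI_def flag_weight_def simple_weight_def types_def
  by (auto intro!: sum.neutral) (metis nth_mem subsetD)

lemma flag_weight_append:
  assumes "(js, cs) \<in> types" "(js', cs') \<in> types"
  shows "flag_weight (js @ js') (cs @ cs') = (\<lambda>i. flag_weight js cs i + flag_weight js' cs' i)"
  using assms by (simp add: types_def flag_weight_eq type_weight_def fun_eq_iff)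

lemma add_pow_one: "[(m + n :: nat)] \<cdot>\<^bsub>A\<^esub> \<one>\<^bsub>A\<^esub> = [m] \<cdot>\<^bsub>A\<^esub> \<one>\<^bsub>A\<^esub> \<oplus>\<^bsub>A\<^esub> [n] \<cdot>\<^bsub>A\<^esub> \<one>\<^bsub>A\<^esub>"
  by (simp add: A.add.nat_pow_mult)

lemma mult_pow_one: "[(m * n :: nat)] \<cdot>\<^bsub>A\<^esub> \<one>\<^bsub>A\<^esub> = [m] \<cdot>\<^bsub>A\<^esub> \<one>\<^bsub>A\<^esub> \<otimes>\<^bsub>A\<^esub> [n] \<cdot>\<^bsub>A\<^esub> \<one>\<^bsub>A\<^esub>"
proof -
  have "[m] \<cdot>\<^bsub>A\<^esub> \<one>\<^bsub>A\<^esub> \<otimes>\<^bsub>A\<^esub> [n] \<cdot>\<^bsub>A\<^esub> \<one>\<^bsub>A\<^esub> = [m] \<cdot>\<^bsub>A\<^esub> ([n] \<cdot>\<^bsub>A\<^esub> \<one>\<^bsub>A\<^esub>)"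
    using A.add_pow_ldistr[of "\<one>\<^bsub>A\<^esub>" "[n] \<cdot>\<^bsub>A\<^esub> \<one>\<^bsub>A\<^esub>" m] by simp
  then show ?thesis by (simp add: A.add.nat_pow_pow mult.commute)
qed

lemma sum_pow_one:
  assumes "finite S"
  shows "[(\<Sum>W\<in>S. f W :: nat)] \<cdot>\<^bsub>A\<^esub> \<one>\<^bsub>A\<^esub> = (\<Oplus>\<^bsub>A\<^esub>W\<in>S. [f W] \<cdot>\<^bsub>A\<^esub> \<one>\<^bsub>A\<^esub>)"
  using assms
proof (induction S rule: finite_induct)
  case (insert W S)
  then show ?case by (simp add: add_pow_one A.finsum_insert)
qed simp

text \<open>Only the splitting into the two flag weights contributes. For a subspace W of the right
  dimension, flags of the quotient are chains from the top to W and flags of W are chains from W to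
  the bottom, so the sum over W is the count for the concatenated type by
  \<open>nchains_append\<close>.\<close>

lemma flag_function_mult:
  assumes t: "(js, cs) \<in> types" and t': "(js', cs') \<in> types"
  shows "FF js cs \<otimes>\<^bsub>H\<^esub> FF js' cs'
    = twist_coeff (flag_weight js cs) (flag_weight js' cs') \<odot>\<^bsub>H\<^esub> FF (js @ js') (cs @ cs')"
proof -
  let ?w = "flag_weight js cs" and ?w' = "flag_weight js' cs'"
  have t2: "(js @ js', cs @ cs') \<in> types" using t t' by (simp add: types_def)
  note Fc = flag_function_H[OF t] flag_function_H[OF t']
  have w: "?w \<in> NI D" "?w' \<in> NI D" using flag_weight_NI t t' by blast+
  have zip: "zip (js @ js') (cs @ cs') = zip js cs @ zip js' cs'" using t by (simp add: types_def)
  have len: "length js = length cs" "length js' = length cs'" using t t' by (simp_all add: types_def)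
  show ?thesis
    unfolding H_mult[OF Fc] H_ops
  proof (rule hfun_cong)
    fix \<nu> x assume \<nu>: "\<nu> \<in> NI D" and x: "x \<in> Er \<nu>"
    define inner where "inner s = (\<Oplus>\<^bsub>A\<^esub>W\<in>pieces (fst s) (snd s) x.
      FF js cs (fst s) (quot_part \<nu> x W) \<otimes>\<^bsub>A\<^esub> FF js' cs' (snd s) (sub_part \<nu> x W))" for s
    have ic: "inner s \<in> carrier A" if "s \<in> splittings \<nu>" for s
      unfolding inner_def by (rule inner_closed[OF Fc that x])
    have zero: "inner s = \<zero>\<^bsub>A\<^esub>" if s: "s \<in> splittings \<nu>" and ne: "s \<noteq> (?w, ?w')" for s
    proof -
      have "FF js cs (fst s) (quot_part \<nu> x W) \<otimes>\<^bsub>A\<^esub> FF js' cs' (snd s) (sub_part \<nu> x W) = \<zero>\<^bsub>A\<^esub>"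
        if W: "W \<in> pieces (fst s) (snd s) x" for W
      proof -
        note sD = splittingsD[OF s]
        have p: "quot_part \<nu> x W \<in> Er (fst s)" "sub_part \<nu> x W \<in> Er (snd s)"
          using piecesD(5,6)[of "fst s" "snd s" x W] sD x W by auto
        have "fst s \<noteq> ?w \<or> snd s \<noteq> ?w'" using ne by (cases s) auto
        then show ?thesis
          using flag_function_val[OF t _ p(1)] flag_function_val[OF t' _ p(2)] sD
            term_closed[OF Fc s x W] by (elim disjE) simp_all
      qed
      then show ?thesis unfolding inner_def by (simp cong: A.finsum_cong')
    qed
    have "product_value (FF js cs) (FF js' cs') \<nu> x
      = (\<Oplus>\<^bsub>A\<^esub>s\<in>splittings \<nu>. twist_coeff (fst s) (snd s) \<otimes>\<^bsub>A\<^esub> inner s)"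
      by (simp add: product_value_def inner_def)
    also have "\<dots> = twist_coeff ?w ?w' \<otimes>\<^bsub>A\<^esub> FF (js @ js') (cs @ cs') \<nu> x"
    proof (cases "\<nu> = flag_weight (js @ js') (cs @ cs')")
      case False
      then have "(?w, ?w') \<notin> splittings \<nu>"
        by (auto simp: splittings_def flag_weight_append[OF t t'])
      then have "(\<Oplus>\<^bsub>A\<^esub>s\<in>splittings \<nu>. twist_coeff (fst s) (snd s) \<otimes>\<^bsub>A\<^esub> inner s) = (\<Oplus>\<^bsub>A\<^esub>s\<in>splittings \<nu>. \<zero>\<^bsub>A\<^esub>)"
        using zero twist_coeff_closed by (intro A.finsum_cong') (auto, metis A.r_null)
      then show ?thesis using False flag_function_val[OF t2 \<nu> x] twist_coeff_closed by simp
    next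
      case True
      then have eq: "(\<lambda>i. ?w i + ?w' i) = \<nu>" by (simp add: flag_weight_append[OF t t'])
      have mem: "(?w, ?w') \<in> splittings \<nu>" using w eq by (simp add: splittings_def)
      have "(\<Oplus>\<^bsub>A\<^esub>s\<in>splittings \<nu>. twist_coeff (fst s) (snd s) \<otimes>\<^bsub>A\<^esub> inner s)
        = (\<Oplus>\<^bsub>A\<^esub>s\<in>splittings \<nu>. if (?w, ?w') = s then twist_coeff (fst s) (snd s) \<otimes>\<^bsub>A\<^esub> inner s else \<zero>\<^bsub>A\<^esub>)"
      proof (rule A.finsum_cong'[OF refl])
        fix s assume s: "s \<in> splittings \<nu>"
        show "twist_coeff (fst s) (snd s) \<otimes>\<^bsub>A\<^esub> inner s
          = (if (?w, ?w') = s then twist_coeff (fst s) (snd s) \<otimes>\<^bsub>A\<^esub> inner s else \<zero>\<^bsub>A\<^esub>)"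
          using zero[OF s] twist_coeff_closed by (cases "s = (?w, ?w')") auto
      qed (use ic twist_coeff_closed in auto)
      also have "\<dots> = twist_coeff ?w ?w' \<otimes>\<^bsub>A\<^esub> inner (?w, ?w')"
        using A.finsum_singleton[OF mem finite_splittings, of "\<lambda>s. twist_coeff (fst s) (snd s) \<otimes>\<^bsub>A\<^esub> inner s"]
          twist_coeff_closed ic by auto
      also have "inner (?w, ?w') = FF (js @ js') (cs @ cs') \<nu> x"
      proof -
        let ?V = "std \<nu>"
        have V: "good ?V" by (rule good_std)
        have x': "x \<in> Er (\<lambda>i. ?w i + ?w' i)" using x eq by simp
        let ?S = "stable_subspaces ?V (xi ?V x)"
        have gd: "gdim D Q ?V = \<nu>" by (rule gdim_std[OF \<nu>])
        define a where "a W = nch ?S (gtop ?V) W (zip js cs)" for W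
        define b where "b W = nch ?S W (gbot ?V) (zip js' cs')" for W
        have pS: "pieces ?w ?w' x \<subseteq> ?S"
          using piecesD(1,2)[OF w x'] stable_iff[OF V x] unfolding eq by (auto simp: stable_subspaces_def)
        have val: "FF js cs ?w (quot_part \<nu> x W) \<otimes>\<^bsub>A\<^esub> FF js' cs' ?w' (sub_part \<nu> x W)
            = [(a W * b W)] \<cdot>\<^bsub>A\<^esub> \<one>\<^bsub>A\<^esub>" if W: "W \<in> pieces ?w ?w' x" for W
        proof -
          note P = piecesD[OF w x' W, unfolded eq]
          have WS: "W \<in> ?S" using pS W by blast
          have "FF js cs ?w (quot_part \<nu> x W) = [(a W)] \<cdot>\<^bsub>A\<^esub> \<one>\<^bsub>A\<^esub>"
            using hall_value_flag_function[OF good_quot[OF V P(1)] quot_rep_reps[OF V x P(1,2)] P(4) t]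
            unfolding hall_value_eq[OF P(4)] by (simp add: quot_part_def a_def nch_quot[OF V x WS])
          moreover have "FF js' cs' ?w' (sub_part \<nu> x W) = [(b W)] \<cdot>\<^bsub>A\<^esub> \<one>\<^bsub>A\<^esub>"
            using hall_value_flag_function[OF good_sub[OF V P(1)] sub_rep_reps[OF V x P(1,2)] P(3) t']
            unfolding hall_value_eq[OF P(3)] by (simp add: sub_part_def b_def nch_sub[OF V x WS])
          ultimately show ?thesis by (simp add: mult_pow_one)
        qed
        \<comment> \<open>A chain of the second type from \<open>W\<close> to zero forces the
          dimension of \<open>W\<close>, so the sum may be extended from \<open>pieces\<close> to
          all stable subspaces.\<close>
        have outside: "a W * b W = 0" if W: "W \<in> ?S" "W \<notin> pieces ?w ?w' x" for W
        proof (rule ccontr)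
          assume "a W * b W \<noteq> 0"
          then have nz: "nch ?S W (gbot ?V) (zip js' cs') \<noteq> 0" by (simp add: b_def)
          have gs: "W \<in> graded_subspaces D Q ?V" and st: "stable D Q ?V x W"
            using W(1) stable_iff[OF V x] by (auto simp: stable_subspaces_def)
          have "gdim D Q (sub_space ?V W) = ?w'"
            unfolding gdim_eq_iff[OF good_sub[OF V gs] w(2)]
          proof
            fix i assume i: "i \<in> vertices D"
            have "card (W i) = card (gbot ?V i) * (Q ^ vdeg D i) ^ type_weight (zip js' cs') i"
              using nchains_nonzero[OF nz i] by blast
            then show "card (carrier (sub_space ?V W i)) = (Q ^ vdeg D i) ^ ?w' i"
              using i by (simp add: sub_space_def gbot_def flag_weight_eq[OF len(2)])
          qed
          then have "W \<in> pieces ?w ?w' x" using gs st eq by (simp add: pieces_def Let_def)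
          then show False using W(2) by simp
        qed
        have "inner (?w, ?w') = (\<Oplus>\<^bsub>A\<^esub>W\<in>pieces ?w ?w' x. [(a W * b W)] \<cdot>\<^bsub>A\<^esub> \<one>\<^bsub>A\<^esub>)"
          unfolding inner_def fst_conv snd_conv by (rule A.finsum_cong'[OF refl]) (simp_all add: val)
        also have "\<dots> = [(\<Sum>W\<in>pieces ?w ?w' x. a W * b W)] \<cdot>\<^bsub>A\<^esub> \<one>\<^bsub>A\<^esub>"
          by (rule sum_pow_one[OF finite_pieces, symmetric])
        also have "(\<Sum>W\<in>pieces ?w ?w' x. a W * b W) = (\<Sum>W\<in>?S. a W * b W)"
          by (rule sum.mono_neutral_left[OF finite_stable_subspaces[OF V] pS]) (use outside in auto)
        also have "\<dots> = nch ?S (gtop ?V) (gbot ?V) (zip (js @ js') (cs @ cs'))"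
          unfolding zip a_def b_def
          by (rule nchains_append[OF finite_stable_subspaces[OF V] gtop_stable[OF V x], symmetric])
        finally show ?thesis using flag_function_val[OF t2 \<nu> x] True by simp
      qed
      finally show ?thesis .
    qed
    finally show "product_value (FF js cs) (FF js' cs') \<nu> x
      = twist_coeff ?w ?w' \<otimes>\<^bsub>A\<^esub> FF (js @ js') (cs @ cs') \<nu> x" .
  qed
qed

lemma product_value_add:
  assumes f: "f \<in> carrier H" "f' \<in> carrier H" and g: "g \<in> carrier H" and x: "x \<in> Er \<nu>"
  shows "product_value (f \<oplus>\<^bsub>H\<^esub> f') g \<nu> x = product_value f g \<nu> x \<oplus>\<^bsub>A\<^esub> product_value f' g \<nu> x"
    "product_value g (f \<oplus>\<^bsub>H\<^esub> f') \<nu> x = product_value g f \<nu> x \<oplus>\<^bsub>A\<^esub> product_value g f' \<nu> x"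
proof -
  note part = piecesD(5,6)[of "fst s" "snd s" x W for s W]
  have val: "(f \<oplus>\<^bsub>H\<^esub> f') (fst s) (quot_part \<nu> x W) = f (fst s) (quot_part \<nu> x W) \<oplus>\<^bsub>A\<^esub> f' (fst s) (quot_part \<nu> x W)"
    "(f \<oplus>\<^bsub>H\<^esub> f') (snd s) (sub_part \<nu> x W) = f (snd s) (sub_part \<nu> x W) \<oplus>\<^bsub>A\<^esub> f' (snd s) (sub_part \<nu> x W)"
    if s: "s \<in> splittings \<nu>" and W: "W \<in> pieces (fst s) (snd s) x" for s W
    using part[of s W] splittingsD[OF s] W x H_add_val[OF f] by auto
  show "product_value (f \<oplus>\<^bsub>H\<^esub> f') g \<nu> x = product_value f g \<nu> x \<oplus>\<^bsub>A\<^esub> product_value f' g \<nu> x"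
  proof -
    have "product_value (f \<oplus>\<^bsub>H\<^esub> f') g \<nu> x = (\<Oplus>\<^bsub>A\<^esub>s\<in>splittings \<nu>.
      twist_coeff (fst s) (snd s) \<otimes>\<^bsub>A\<^esub> (\<Oplus>\<^bsub>A\<^esub>W\<in>pieces (fst s) (snd s) x. f (fst s) (quot_part \<nu> x W) \<otimes>\<^bsub>A\<^esub> g (snd s) (sub_part \<nu> x W))
      \<oplus>\<^bsub>A\<^esub> twist_coeff (fst s) (snd s) \<otimes>\<^bsub>A\<^esub> (\<Oplus>\<^bsub>A\<^esub>W\<in>pieces (fst s) (snd s) x. f' (fst s) (quot_part \<nu> x W) \<otimes>\<^bsub>A\<^esub> g (snd s) (sub_part \<nu> x W)))"
      unfolding product_value_def
    proof (rule A.finsum_cong'[OF refl])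
      fix s assume s: "s \<in> splittings \<nu>"
      have "(\<Oplus>\<^bsub>A\<^esub>W\<in>pieces (fst s) (snd s) x. (f \<oplus>\<^bsub>H\<^esub> f') (fst s) (quot_part \<nu> x W) \<otimes>\<^bsub>A\<^esub> g (snd s) (sub_part \<nu> x W))
        = (\<Oplus>\<^bsub>A\<^esub>W\<in>pieces (fst s) (snd s) x. f (fst s) (quot_part \<nu> x W) \<otimes>\<^bsub>A\<^esub> g (snd s) (sub_part \<nu> x W)
           \<oplus>\<^bsub>A\<^esub> f' (fst s) (quot_part \<nu> x W) \<otimes>\<^bsub>A\<^esub> g (snd s) (sub_part \<nu> x W))"
        using term_closed[OF f(1) g s x] term_closed[OF f(2) g s x] val(1)[OF s]
        by (intro A.finsum_cong') (auto simp: A.l_distr)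
      also have "\<dots> = (\<Oplus>\<^bsub>A\<^esub>W\<in>pieces (fst s) (snd s) x. f (fst s) (quot_part \<nu> x W) \<otimes>\<^bsub>A\<^esub> g (snd s) (sub_part \<nu> x W))
         \<oplus>\<^bsub>A\<^esub> (\<Oplus>\<^bsub>A\<^esub>W\<in>pieces (fst s) (snd s) x. f' (fst s) (quot_part \<nu> x W) \<otimes>\<^bsub>A\<^esub> g (snd s) (sub_part \<nu> x W))"
        using term_closed[OF f(1) g s x] term_closed[OF f(2) g s x] by (intro A.finsum_addf) auto
      finally show "twist_coeff (fst s) (snd s) \<otimes>\<^bsub>A\<^esub> (\<Oplus>\<^bsub>A\<^esub>W\<in>pieces (fst s) (snd s) x. (f \<oplus>\<^bsub>H\<^esub> f') (fst s) (quot_part \<nu> x W) \<otimes>\<^bsub>A\<^esub> g (snd s) (sub_part \<nu> x W))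
        = twist_coeff (fst s) (snd s) \<otimes>\<^bsub>A\<^esub> (\<Oplus>\<^bsub>A\<^esub>W\<in>pieces (fst s) (snd s) x. f (fst s) (quot_part \<nu> x W) \<otimes>\<^bsub>A\<^esub> g (snd s) (sub_part \<nu> x W))
        \<oplus>\<^bsub>A\<^esub> twist_coeff (fst s) (snd s) \<otimes>\<^bsub>A\<^esub> (\<Oplus>\<^bsub>A\<^esub>W\<in>pieces (fst s) (snd s) x. f' (fst s) (quot_part \<nu> x W) \<otimes>\<^bsub>A\<^esub> g (snd s) (sub_part \<nu> x W))"
        using inner_closed[OF f(1) g s x] inner_closed[OF f(2) g s x] twist_coeff_closed by (simp add: A.r_distr)
    qed (use inner_closed[OF f(1) g _ x] inner_closed[OF f(2) g _ x] twist_coeff_closed in auto)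
    also have "\<dots> = product_value f g \<nu> x \<oplus>\<^bsub>A\<^esub> product_value f' g \<nu> x"
      unfolding product_value_def
      using inner_closed[OF f(1) g _ x] inner_closed[OF f(2) g _ x] twist_coeff_closed by (intro A.finsum_addf) auto
    finally show ?thesis .
  qed
  show "product_value g (f \<oplus>\<^bsub>H\<^esub> f') \<nu> x = product_value g f \<nu> x \<oplus>\<^bsub>A\<^esub> product_value g f' \<nu> x"
  proof -
    have "product_value g (f \<oplus>\<^bsub>H\<^esub> f') \<nu> x = (\<Oplus>\<^bsub>A\<^esub>s\<in>splittings \<nu>.
      twist_coeff (fst s) (snd s) \<otimes>\<^bsub>A\<^esub> (\<Oplus>\<^bsub>A\<^esub>W\<in>pieces (fst s) (snd s) x. g (fst s) (quot_part \<nu> x W) \<otimes>\<^bsub>A\<^esub> f (snd s) (sub_part \<nu> x W))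
      \<oplus>\<^bsub>A\<^esub> twist_coeff (fst s) (snd s) \<otimes>\<^bsub>A\<^esub> (\<Oplus>\<^bsub>A\<^esub>W\<in>pieces (fst s) (snd s) x. g (fst s) (quot_part \<nu> x W) \<otimes>\<^bsub>A\<^esub> f' (snd s) (sub_part \<nu> x W)))"
      unfolding product_value_def
    proof (rule A.finsum_cong'[OF refl])
      fix s assume s: "s \<in> splittings \<nu>"
      have "(\<Oplus>\<^bsub>A\<^esub>W\<in>pieces (fst s) (snd s) x. g (fst s) (quot_part \<nu> x W) \<otimes>\<^bsub>A\<^esub> (f \<oplus>\<^bsub>H\<^esub> f') (snd s) (sub_part \<nu> x W))
        = (\<Oplus>\<^bsub>A\<^esub>W\<in>pieces (fst s) (snd s) x. g (fst s) (quot_part \<nu> x W) \<otimes>\<^bsub>A\<^esub> f (snd s) (sub_part \<nu> x W)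
           \<oplus>\<^bsub>A\<^esub> g (fst s) (quot_part \<nu> x W) \<otimes>\<^bsub>A\<^esub> f' (snd s) (sub_part \<nu> x W))"
        using term_closed[OF g f(1) s x] term_closed[OF g f(2) s x] val(2)[OF s]
        by (intro A.finsum_cong') (auto simp: A.r_distr)
      also have "\<dots> = (\<Oplus>\<^bsub>A\<^esub>W\<in>pieces (fst s) (snd s) x. g (fst s) (quot_part \<nu> x W) \<otimes>\<^bsub>A\<^esub> f (snd s) (sub_part \<nu> x W))
         \<oplus>\<^bsub>A\<^esub> (\<Oplus>\<^bsub>A\<^esub>W\<in>pieces (fst s) (snd s) x. g (fst s) (quot_part \<nu> x W) \<otimes>\<^bsub>A\<^esub> f' (snd s) (sub_part \<nu> x W))"
        using term_closed[OF g f(1) s x] term_closed[OF g f(2) s x] by (intro A.finsum_addf) auto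
      finally show "twist_coeff (fst s) (snd s) \<otimes>\<^bsub>A\<^esub> (\<Oplus>\<^bsub>A\<^esub>W\<in>pieces (fst s) (snd s) x. g (fst s) (quot_part \<nu> x W) \<otimes>\<^bsub>A\<^esub> (f \<oplus>\<^bsub>H\<^esub> f') (snd s) (sub_part \<nu> x W))
        = twist_coeff (fst s) (snd s) \<otimes>\<^bsub>A\<^esub> (\<Oplus>\<^bsub>A\<^esub>W\<in>pieces (fst s) (snd s) x. g (fst s) (quot_part \<nu> x W) \<otimes>\<^bsub>A\<^esub> f (snd s) (sub_part \<nu> x W))
        \<oplus>\<^bsub>A\<^esub> twist_coeff (fst s) (snd s) \<otimes>\<^bsub>A\<^esub> (\<Oplus>\<^bsub>A\<^esub>W\<in>pieces (fst s) (snd s) x. g (fst s) (quot_part \<nu> x W) \<otimes>\<^bsub>A\<^esub> f' (snd s) (sub_part \<nu> x W))"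
        using inner_closed[OF g f(1) s x] inner_closed[OF g f(2) s x] twist_coeff_closed by (simp add: A.r_distr)
    qed (use inner_closed[OF g f(1) _ x] inner_closed[OF g f(2) _ x] twist_coeff_closed in auto)
    also have "\<dots> = product_value g f \<nu> x \<oplus>\<^bsub>A\<^esub> product_value g f' \<nu> x"
      unfolding product_value_def
      using inner_closed[OF g f(1) _ x] inner_closed[OF g f(2) _ x] twist_coeff_closed by (intro A.finsum_addf) auto
    finally show ?thesis .
  qed
qed

end

section \<open>The restriction map\<close>

context hall
begin

definition flag_functions :: "('i, 'a, 'k, 'r) hall set" where
  "flag_functions = {FF js cs | js cs. (js, cs) \<in> types}"

abbreviation comp_alg :: "('i, 'a, 'k, 'r) hall set" where
  "comp_alg \<equiv> module.span A H flag_functions"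

lemma flag_functions_H: "flag_functions \<subseteq> carrier H"
  using flag_function_H by (auto simp: flag_functions_def)

lemma comp_alg_submodule: "LinearCombinations.submodule A comp_alg H"
  by (rule module.span_is_submodule[OF module_H flag_functions_H])

lemma comp_alg_H: "comp_alg \<subseteq> carrier H"
  by (rule module.span_is_subset2[OF module_H flag_functions_H])

lemma flag_in_comp_alg: "(js, cs) \<in> types \<Longrightarrow> FF js cs \<in> comp_alg"
  using module.in_own_span[OF module_H flag_functions_H] by (auto simp: flag_functions_def)

text \<open>The elements with property \<open>P\<close> form a submodule that contains the
  generators, hence the span. The cases offer membership in the Hall algebra; where membership in
  the span is wanted, it is made part of \<open>P\<close>.\<close>

lemma comp_alg_induct:
  assumes gen: "\<And>js cs. (js, cs) \<in> types \<Longrightarrow> P (FF js cs)"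
    and zero: "P \<zero>\<^bsub>H\<^esub>"
    and add: "\<And>f g. f \<in> carrier H \<Longrightarrow> g \<in> carrier H \<Longrightarrow> P f \<Longrightarrow> P g \<Longrightarrow> P (f \<oplus>\<^bsub>H\<^esub> g)"
    and smult: "\<And>a f. a \<in> carrier A \<Longrightarrow> f \<in> carrier H \<Longrightarrow> P f \<Longrightarrow> P (a \<odot>\<^bsub>H\<^esub> f)"
    and f: "f \<in> comp_alg"
  shows "P f"
proof -
  have "LinearCombinations.submodule A {f \<in> carrier H. P f} H"
    using module_H zero add smult H_zero_closed H_add_closed H_smult_closed
    by (intro LinearCombinations.submodule.intro) auto
  moreover have "flag_functions \<subseteq> {f \<in> carrier H. P f}"
    using gen flag_function_H by (auto simp: flag_functions_def)
  ultimately have "comp_alg \<subseteq> {f \<in> carrier H. P f}"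
    by (intro module.span_is_subset[OF module_H])
  then show ?thesis using f by blast
qed

lemma H_zero_smult: "f \<in> carrier H \<Longrightarrow> \<zero>\<^bsub>A\<^esub> \<odot>\<^bsub>H\<^esub> f = \<zero>\<^bsub>H\<^esub>"
  unfolding H_ops by (rule hfun_cong) (simp add: H_val)

lemma product_value_zero:
  assumes f: "f \<in> carrier H" and x: "x \<in> Er \<nu>"
  shows "product_value \<zero>\<^bsub>H\<^esub> f \<nu> x = \<zero>\<^bsub>A\<^esub>" "product_value f \<zero>\<^bsub>H\<^esub> \<nu> x = \<zero>\<^bsub>A\<^esub>"
  using product_value_smult[OF A.zero_closed H_zero_closed f x] product_value_closed[OF H_zero_closed f x]
    product_value_closed[OF f H_zero_closed x]
  by (simp_all add: H_zero_smult[OF H_zero_closed])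

lemma composition_algebra_eq: "composition_algebra D Q A e = H\<lparr>carrier := comp_alg\<rparr>"
  by (simp add: composition_algebra_def Let_def flag_functions_def types_def)

end

text \<open>What the argument asks of the coefficients: orbit sizes lie in \<open>J\<close>, and
  counts congruent modulo \<open>J\<close> have the same image in \<open>A\<close>. The exponent l^2
  in \<open>e'\<close> is the factor by which the bilinear twist form grows when both degrees are
  multiplied by \<open>l\<close>.\<close>

locale hall_restriction = quiver_rep_ext D q kt l + A: cring A
  for D :: "('i, 'a) quiver" and q :: nat and kt :: "'k::alg_closed_field itself" and l :: nat and A :: "'r ring" +
  fixes e e' :: 'r and J :: "complex set"
  assumes e: "e \<in> Units A" and e': "e' = e [^]\<^bsub>A\<^esub> (l * l)"
    and J: "0 \<in> J" "\<And>a b. a \<in> J \<Longrightarrow> b \<in> J \<Longrightarrow> a + b \<in> J" "\<And>a n. a \<in> J \<Longrightarrow> a * of_nat n \<in> J"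
    and J_size: "\<And>f m. f dvd l \<Longrightarrow> 0 < f \<Longrightarrow> f < l \<Longrightarrow> m * (q ^ f - 1) = q ^ l - 1 \<Longrightarrow> of_nat m \<in> J"
    and J_eq: "\<And>a b. of_nat a - of_nat b \<in> J \<Longrightarrow> [(a :: nat)] \<cdot>\<^bsub>A\<^esub> \<one>\<^bsub>A\<^esub> = [(b :: nat)] \<cdot>\<^bsub>A\<^esub> \<one>\<^bsub>A\<^esub>"
begin

text \<open>\<open>L\<close> is the algebra over F_q where the map starts, \<open>R\<close> the one
  over F_{q^l} where it ends; both have coefficients in \<open>A\<close>.\<close>

sublocale L: hall D q kt A e
  by unfold_locales (rule e)

sublocale R: hall D "q ^ l" kt A e'
  by unfold_locales (simp add: e' e A.Units_pow_closed)

definition mul :: "('i \<Rightarrow> nat) \<Rightarrow> 'i \<Rightarrow> nat" where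
  "mul \<mu> = (\<lambda>i. l * \<mu> i)"

text \<open>Restriction of scalars followed by transport to the standard space; with it the map Q
  becomes composition with a map of points.\<close>

definition pull :: "('i \<Rightarrow> nat) \<Rightarrow> ('a, 'k, nat \<Rightarrow> 'k) rep \<Rightarrow> ('a, 'k, nat \<Rightarrow> 'k) rep" where
  "pull \<mu> x = L.standardize (R.std \<mu>) (iota D q l (R.std \<mu>) x)"

lemma mul_NI: "\<mu> \<in> NI D \<Longrightarrow> mul \<mu> \<in> NI D"
  by (simp add: mul_def NI_def)

lemma mul_inj: "mul \<mu> = mul \<mu>' \<longleftrightarrow> \<mu> = \<mu>'"
  using l by (auto simp: mul_def fun_eq_iff)

lemma gdim_mul:
  assumes \<mu>: "\<mu> \<in> NI D"
  shows "gdim D q (R.std \<mu>) = mul \<mu>"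
  unfolding gdim_eq_iff[OF E_good[OF E.good_std] mul_NI[OF \<mu>]]
  by (simp add: E.card_std mul_def mult_ac flip: power_mult)

lemma pull_Er: "\<mu> \<in> NI D \<Longrightarrow> x \<in> R.Er \<mu> \<Longrightarrow> pull \<mu> x \<in> L.Er (mul \<mu>)"
  unfolding pull_def
  using L.standardize_reps[OF E_good[OF E.good_std] iota_reps[OF E.good_std]] gdim_mul by metis

lemma Q_map_eq: "Q_map D q l f = R.hfun (\<lambda>\<mu> x. f (mul \<mu>) (pull \<mu> x))"
proof -
  have "Q_map D q l f = R.hfun (\<lambda>\<mu> x. hall_value D q (mul \<mu>) (f (mul \<mu>)) (R.std \<mu>) (iota D q l (R.std \<mu>) x))"
    by (simp add: Q_map_def R.hfun_def Let_def mul_def)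
  also have "\<dots> = R.hfun (\<lambda>\<mu> x. f (mul \<mu>) (pull \<mu> x))"
    by (rule R.hfun_cong) (simp add: L.hall_value_eq[OF gdim_mul] pull_def)
  finally show ?thesis .
qed

abbreviation Qm :: "('i, 'a, 'k, 'r) hall \<Rightarrow> ('i, 'a, 'k, 'r) hall" where "Qm \<equiv> Q_map D q l"

lemma Qm_add:
  assumes "f \<in> carrier L.H" "g \<in> carrier L.H"
  shows "Qm (f \<oplus>\<^bsub>L.H\<^esub> g) = Qm f \<oplus>\<^bsub>R.H\<^esub> Qm g"
  unfolding Q_map_eq R.H_ops
  by (rule R.hfun_cong) (simp add: L.H_add_val[OF assms mul_NI pull_Er] R.hfun_apply)

lemma Qm_smult: "Qm (a \<odot>\<^bsub>L.H\<^esub> f) = a \<odot>\<^bsub>R.H\<^esub> Qm f"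
  unfolding Q_map_eq R.H_ops
  by (rule R.hfun_cong) (simp add: L.H_smult_val[OF mul_NI pull_Er] R.hfun_apply)

lemma Qm_zero: "Qm \<zero>\<^bsub>L.H\<^esub> = \<zero>\<^bsub>R.H\<^esub>"
  unfolding Q_map_eq R.H_ops L.H_ops
  by (rule R.hfun_cong) (simp add: L.hfun_apply[OF mul_NI pull_Er])

lemma Qm_one: "Qm \<one>\<^bsub>L.H\<^esub> = \<one>\<^bsub>R.H\<^esub>"
proof -
  have "\<one>\<^bsub>R.H\<^esub> = R.hfun (\<lambda>\<mu> x. if \<mu> = (\<lambda>_. 0) then \<one>\<^bsub>A\<^esub> else \<zero>\<^bsub>A\<^esub>)"
    by (simp add: hall_algebra_def Let_def R.hfun_def)
  moreover have "\<one>\<^bsub>L.H\<^esub> = L.hfun (\<lambda>\<mu> x. if \<mu> = (\<lambda>_. 0) then \<one>\<^bsub>A\<^esub> else \<zero>\<^bsub>A\<^esub>)"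
    by (simp add: hall_algebra_def Let_def L.hfun_def)
  moreover have "mul \<mu> = (\<lambda>_. 0) \<longleftrightarrow> \<mu> = (\<lambda>_. 0)" for \<mu>
    using l by (simp add: mul_def fun_eq_iff)
  ultimately show ?thesis
    unfolding Q_map_eq by (simp only:) (rule R.hfun_cong, simp add: L.hfun_apply[OF mul_NI pull_Er])
qed

section \<open>Images of the generators\<close>

definition divisible :: "nat list \<Rightarrow> bool" where
  "divisible cs \<longleftrightarrow> (\<forall>c\<in>set cs. l dvd c)"

definition quo :: "nat list \<Rightarrow> nat list" where
  "quo cs = map (\<lambda>c. c div l) cs"

lemma quo_types: "(js, cs) \<in> L.types \<Longrightarrow> (js, quo cs) \<in> L.types"
  by (simp add: L.types_def quo_def)

lemma flag_weight_quo:
  assumes "length js = length cs" "divisible cs"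
  shows "flag_weight js cs = mul (flag_weight js (quo cs))"
proof -
  have "simple_weight (js ! n) (cs ! n) i = l * simple_weight (js ! n) (quo cs ! n) i" if "n < length js" for n i
    using assms that by (simp add: simple_weight_def quo_def divisible_def)
  then show ?thesis by (simp add: flag_weight_def mul_def sum_distrib_left fun_eq_iff)
qed

text \<open>Over F_q the flags are counted on the same space and with the same semilinear parts as
  over F_{q^l}, so \<open>nchains_mod\<close> compares the two counts and \<open>J_eq\<close> makes
  them equal in \<open>A\<close>. For a type that is not divisible the comparison is with 0.\<close>

lemma Qm_flag_function:
  assumes t: "(js, cs) \<in> L.types"
  shows "Qm (L.FF js cs) = (if divisible cs then R.FF js (quo cs) else \<zero>\<^bsub>R.H\<^esub>)"
proof -
  have t': "(js, quo cs) \<in> R.types" and len: "length js = length cs" and js: "set js \<subseteq> vertices D"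
    using quo_types[OF t] t by (simp_all add: R.types_def L.types_def)
  have val: "L.FF js cs (mul \<mu>) (pull \<mu> x)
      = (if divisible cs then R.FF js (quo cs) \<mu> x else \<zero>\<^bsub>A\<^esub>)"
    if \<mu>: "\<mu> \<in> NI D" and x: "x \<in> R.Er \<mu>" for \<mu> x
  proof -
    let ?V = "R.std \<mu>"
    let ?\<xi> = "E.xi ?V x"
    have V: "E.good ?V" by (rule E.good_std)
    define n where "n = nch (stable_subspaces ?V ?\<xi>) (gtop ?V) (gbot ?V) (zip js cs)"
    define m where "m = (if divisible cs
      then E.nch (E.stable_subspaces ?V ?\<xi>) (gtop ?V) (gbot ?V) (zip js (quo cs)) else 0)"
    have lhs: "L.FF js cs (mul \<mu>) (pull \<mu> x) = (if mul \<mu> = flag_weight js cs then [n] \<cdot>\<^bsub>A\<^esub> \<one>\<^bsub>A\<^esub> else \<zero>\<^bsub>A\<^esub>)"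
      using L.hall_value_flag_function[OF E_good[OF V] iota_reps[OF V x] gdim_mul[OF \<mu>] t]
      unfolding L.hall_value_eq[OF gdim_mul[OF \<mu>]] stable_subspaces_iota[OF V] pull_def n_def .
    have sn: "snd ` set (zip js cs) = set cs"
      by (metis len list.set_map map_snd_zip)
    have dv: "(\<forall>p\<in>set (zip js cs). l dvd snd p) \<longleftrightarrow> divisible cs"
      unfolding divisible_def sn[symmetric] by blast
    have ps: "fst ` set (zip js cs) \<subseteq> vertices D"
      using js by (auto dest: set_zip_leftD)
    have zq: "map (\<lambda>(j, c). (j, c div l)) (zip js cs) = zip js (quo cs)"
      by (simp add: quo_def zip_map2)
    have "of_nat n - of_nat m \<in> J"
      using nchains_mod[OF V x refl J J_size E.gtop_stable[OF V x] E.gbot_stable[OF V x] ps]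
      unfolding dv zq n_def m_def by simp
    then have nm: "[n] \<cdot>\<^bsub>A\<^esub> \<one>\<^bsub>A\<^esub> = [m] \<cdot>\<^bsub>A\<^esub> \<one>\<^bsub>A\<^esub>" by (rule J_eq)
    show ?thesis
    proof (cases "divisible cs")
      case True
      then show ?thesis
        unfolding lhs nm R.flag_function_val[OF t' \<mu> x] flag_weight_quo[OF len True] mul_inj
        by (simp add: m_def)
    next
      case False
      then show ?thesis unfolding lhs nm by (simp add: m_def)
    qed
  qed
  have "Qm (L.FF js cs) = R.hfun (\<lambda>\<mu> x. if divisible cs then R.FF js (quo cs) \<mu> x else \<zero>\<^bsub>A\<^esub>)"
    unfolding Q_map_eq by (rule R.hfun_cong) (rule val)
  then show ?thesis
    using R.H_hfun[OF R.flag_function_H[OF t']] by (simp add: R.H_ops)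
qed

lemma Qm_comp_alg:
  assumes f: "f \<in> L.comp_alg"
  shows "Qm f \<in> R.comp_alg"
proof (rule L.comp_alg_induct[where P = "\<lambda>f. Qm f \<in> R.comp_alg", OF _ _ _ _ f])
  note sub = R.comp_alg_submodule
  show "Qm (L.FF js cs) \<in> R.comp_alg" if t: "(js, cs) \<in> L.types" for js cs
    using R.flag_in_comp_alg[OF quo_types[OF t, unfolded L.types_def, folded R.types_def]]
      LinearCombinations.submodule.zero_closed[OF sub]
    by (simp add: Qm_flag_function[OF t])
  show "Qm \<zero>\<^bsub>L.H\<^esub> \<in> R.comp_alg"
    unfolding Qm_zero by (rule LinearCombinations.submodule.zero_closed[OF sub])
  show "Qm (f \<oplus>\<^bsub>L.H\<^esub> g) \<in> R.comp_alg"
    if "f \<in> carrier L.H" "g \<in> carrier L.H" "Qm f \<in> R.comp_alg" "Qm g \<in> R.comp_alg" for f g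
    unfolding Qm_add[OF that(1,2)] by (rule LinearCombinations.submodule.m_closed[OF sub that(3,4)])
  show "Qm (a \<odot>\<^bsub>L.H\<^esub> f) \<in> R.comp_alg" if "a \<in> carrier A" "Qm f \<in> R.comp_alg" for a f
    unfolding Qm_smult by (rule LinearCombinations.submodule.smult_closed[OF sub that])
qed

section \<open>Multiplicativity of the restriction map\<close>

lemma twist_mul: "L.twist (mul \<mu>) (mul \<mu>') = (l * l) * R.twist \<mu> \<mu>'"
proof -
  have "twist_form D (\<lambda>i. int (mul \<mu> i)) (\<lambda>i. int (mul \<mu>' i))
      = int (l * l) * twist_form D (\<lambda>i. int (\<mu> i)) (\<lambda>i. int (\<mu>' i))"
    by (simp add: twist_form_def mul_def distrib_left sum_distrib_left mult_ac)
  then show ?thesis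
    by (simp add: L.twist_def R.twist_def nat_mult_distrib R.twist_form_nonneg)
qed

lemma twist_coeff_mul: "L.twist_coeff (mul \<mu>) (mul \<mu>') = R.twist_coeff \<mu> \<mu>'"
proof -
  have "e [^]\<^bsub>A\<^esub> (l * l * n) = e' [^]\<^bsub>A\<^esub> n" for n :: nat
    using e by (simp add: e' A.nat_pow_pow A.Units_closed)
  then show ?thesis unfolding L.twist_coeff_def R.twist_coeff_def twist_mul by simp
qed

text \<open>Multiplicativity tested at each representation, where it is an identity between bilinear
  expressions and spreads from generators to spans.\<close>

definition compatible :: "('i, 'a, 'k, 'r) hall \<Rightarrow> ('i, 'a, 'k, 'r) hall \<Rightarrow> bool" where
  "compatible f g \<longleftrightarrow> (\<forall>\<mu>\<in>NI D. \<forall>x\<in>R.Er \<mu>.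
     L.product_value f g (mul \<mu>) (pull \<mu> x) = R.product_value (Qm f) (Qm g) \<mu> x)"

lemma compatible_iff:
  assumes "f \<in> L.comp_alg" "g \<in> L.comp_alg"
  shows "Qm (f \<otimes>\<^bsub>L.H\<^esub> g) = Qm f \<otimes>\<^bsub>R.H\<^esub> Qm g \<longleftrightarrow> compatible f g"
proof -
  have c: "f \<in> carrier L.H" "g \<in> carrier L.H" "Qm f \<in> carrier R.H" "Qm g \<in> carrier R.H"
    using assms Qm_comp_alg L.comp_alg_H R.comp_alg_H by blast+
  have "Qm (f \<otimes>\<^bsub>L.H\<^esub> g) = R.hfun (\<lambda>\<mu> x. L.product_value f g (mul \<mu>) (pull \<mu> x))"
    unfolding Q_map_eq L.H_mult[OF c(1,2)]
    by (rule R.hfun_cong) (simp add: L.hfun_apply[OF mul_NI pull_Er])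
  moreover have "R.hfun u = R.hfun v \<longleftrightarrow> (\<forall>\<mu>\<in>NI D. \<forall>x\<in>R.Er \<mu>. u \<mu> x = v \<mu> x)" for u v
    using R.hfun_apply[of _ _ u] R.hfun_apply[of _ _ v] R.hfun_cong[of u v] by metis
  ultimately show ?thesis
    unfolding compatible_def R.H_mult[OF c(3,4)] by simp
qed

text \<open>A product of flag functions is a twist times the flag function of the concatenated type.
  A concatenation is divisible exactly if both parts are, and then the twists agree by
  \<open>twist_coeff_mul\<close>; otherwise both sides vanish.\<close>

lemma compatible_flags:
  assumes t: "(js, cs) \<in> L.types" and t': "(js', cs') \<in> L.types"
  shows "Qm (L.FF js cs \<otimes>\<^bsub>L.H\<^esub> L.FF js' cs') = Qm (L.FF js cs) \<otimes>\<^bsub>R.H\<^esub> Qm (L.FF js' cs')"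
proof -
  have t2: "(js @ js', cs @ cs') \<in> L.types" using t t' by (simp add: L.types_def)
  have len: "length js = length cs" "length js' = length cs'" using t t' by (simp_all add: L.types_def)
  have tq: "(js, quo cs) \<in> R.types" "(js', quo cs') \<in> R.types"
    using quo_types[OF t] quo_types[OF t'] by (simp_all add: R.types_def L.types_def)
  note RF = R.flag_function_H[OF tq(1)] R.flag_function_H[OF tq(2)]
  have lhs: "Qm (L.FF js cs \<otimes>\<^bsub>L.H\<^esub> L.FF js' cs')
      = L.twist_coeff (flag_weight js cs) (flag_weight js' cs') \<odot>\<^bsub>R.H\<^esub>
        (if divisible (cs @ cs') then R.FF (js @ js') (quo (cs @ cs')) else \<zero>\<^bsub>R.H\<^esub>)"
    unfolding L.flag_function_mult[OF t t'] Qm_smult Qm_flag_function[OF t2] ..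
  have dv: "divisible (cs @ cs') \<longleftrightarrow> divisible cs \<and> divisible cs'" by (auto simp: divisible_def)
  have zero: "R.hfun (R.product_value f g) = \<zero>\<^bsub>R.H\<^esub>"
    if "f \<in> carrier R.H" "g \<in> carrier R.H" "f = \<zero>\<^bsub>R.H\<^esub> \<or> g = \<zero>\<^bsub>R.H\<^esub>" for f g
    using that(3) R.product_value_zero that(1,2) unfolding R.H_ops(2)
    by (intro R.hfun_cong) (auto simp: R.H_ops(2))
  show ?thesis
  proof (cases "divisible cs \<and> divisible cs'")
    case True
    have "Qm (L.FF js cs) \<otimes>\<^bsub>R.H\<^esub> Qm (L.FF js' cs')
        = R.twist_coeff (flag_weight js (quo cs)) (flag_weight js' (quo cs')) \<odot>\<^bsub>R.H\<^esub> R.FF (js @ js') (quo cs @ quo cs')"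
      using True R.flag_function_mult[OF tq] by (simp add: Qm_flag_function[OF t] Qm_flag_function[OF t'])
    moreover have "quo (cs @ cs') = quo cs @ quo cs'" by (simp add: quo_def)
    ultimately show ?thesis
      unfolding lhs using True
      by (simp add: dv flag_weight_quo[OF len(1)] flag_weight_quo[OF len(2)] twist_coeff_mul)
  next
    case False
    have "Qm (L.FF js cs) \<otimes>\<^bsub>R.H\<^esub> Qm (L.FF js' cs') = \<zero>\<^bsub>R.H\<^esub>"
    proof -
      have c: "Qm (L.FF js cs) \<in> carrier R.H" "Qm (L.FF js' cs') \<in> carrier R.H"
        using RF R.H_zero_closed by (simp_all add: Qm_flag_function[OF t] Qm_flag_function[OF t'])
      show ?thesis
        unfolding R.H_mult[OF c]
        by (rule zero[OF c]) (use False in \<open>auto simp: Qm_flag_function[OF t] Qm_flag_function[OF t']\<close>)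
    qed
    moreover have "L.twist_coeff (flag_weight js cs) (flag_weight js' cs') \<odot>\<^bsub>R.H\<^esub> \<zero>\<^bsub>R.H\<^esub> = \<zero>\<^bsub>R.H\<^esub>"
      unfolding R.H_ops by (rule R.hfun_cong) (simp add: R.hfun_apply L.twist_coeff_closed)
    ultimately show ?thesis unfolding lhs dv if_not_P[OF False] by simp
  qed
qed

text \<open>Bilinearity, one argument at a time: \<open>step1\<close> varies the first factor
  against a generator, the second induction varies the other factor. Membership in the span is
  carried along because it guarantees that the image under \<open>Qm\<close> lies in the Hall
  algebra.\<close>

lemma compatible_comp_alg:
  assumes f: "f \<in> L.comp_alg" and g: "g \<in> L.comp_alg"
  shows "compatible f g"
proof -
  have RH: "Qm h \<in> carrier R.H" if "h \<in> L.comp_alg" for h :: "('i, 'a, 'k, 'r) hall" using Qm_comp_alg[OF that] R.comp_alg_H by blast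
  have LH: "h \<in> carrier L.H" if "h \<in> L.comp_alg" for h :: "('i, 'a, 'k, 'r) hall" using that L.comp_alg_H by blast
  note sub = LinearCombinations.submodule.m_closed[OF L.comp_alg_submodule]
    LinearCombinations.submodule.smult_closed[OF L.comp_alg_submodule]
    LinearCombinations.submodule.zero_closed[OF L.comp_alg_submodule]
  have step1: "h \<in> L.comp_alg \<and> compatible h (L.FF js' cs')"
    if t': "(js', cs') \<in> L.types" and h: "h \<in> L.comp_alg" for h :: "('i, 'a, 'k, 'r) hall" and js' cs'
  proof (rule L.comp_alg_induct[where P = "\<lambda>h. h \<in> L.comp_alg \<and> compatible h (L.FF js' cs')", OF _ _ _ _ h])
    let ?g = "L.FF js' cs'"
    have g: "?g \<in> L.comp_alg" by (rule L.flag_in_comp_alg[OF t'])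
    show "L.FF js cs \<in> L.comp_alg \<and> compatible (L.FF js cs) ?g" if "(js, cs) \<in> L.types" for js cs
      using compatible_flags[OF that t'] compatible_iff[OF L.flag_in_comp_alg[OF that] g] L.flag_in_comp_alg[OF that]
      by simp
    show "\<zero>\<^bsub>L.H\<^esub> \<in> L.comp_alg \<and> compatible \<zero>\<^bsub>L.H\<^esub> ?g"
      using sub(3) L.product_value_zero(1)[OF LH[OF g] pull_Er] R.product_value_zero(1)[OF RH[OF g]]
      by (simp add: compatible_def Qm_zero)
    show "f \<oplus>\<^bsub>L.H\<^esub> f' \<in> L.comp_alg \<and> compatible (f \<oplus>\<^bsub>L.H\<^esub> f') ?g"
      if "f \<in> carrier L.H" "f' \<in> carrier L.H" "f \<in> L.comp_alg \<and> compatible f ?g" "f' \<in> L.comp_alg \<and> compatible f' ?g" for f f'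
      using that sub(1)[of f f'] L.product_value_add(1)[OF that(1,2) LH[OF g] pull_Er]
        R.product_value_add(1)[OF RH RH RH[OF g], of f f']
      by (simp add: compatible_def Qm_add)
    show "a \<odot>\<^bsub>L.H\<^esub> f \<in> L.comp_alg \<and> compatible (a \<odot>\<^bsub>L.H\<^esub> f) ?g"
      if "a \<in> carrier A" "f \<in> carrier L.H" "f \<in> L.comp_alg \<and> compatible f ?g" for a f
      using that sub(2)[of a f] L.product_value_smult(1)[OF that(1,2) LH[OF g] pull_Er]
        R.product_value_smult(1)[OF that(1) RH RH[OF g], of f]
      by (simp add: compatible_def Qm_smult)
  qed
  have "g \<in> L.comp_alg \<and> compatible f g"
  proof (rule L.comp_alg_induct[where P = "\<lambda>g. g \<in> L.comp_alg \<and> compatible f g", OF _ _ _ _ g])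
    show "L.FF js cs \<in> L.comp_alg \<and> compatible f (L.FF js cs)" if "(js, cs) \<in> L.types" for js cs
      using step1[OF that f] L.flag_in_comp_alg[OF that] by simp
    show "\<zero>\<^bsub>L.H\<^esub> \<in> L.comp_alg \<and> compatible f \<zero>\<^bsub>L.H\<^esub>"
      using sub(3) L.product_value_zero(2)[OF LH[OF f] pull_Er] R.product_value_zero(2)[OF RH[OF f]]
      by (simp add: compatible_def Qm_zero)
    show "g \<oplus>\<^bsub>L.H\<^esub> g' \<in> L.comp_alg \<and> compatible f (g \<oplus>\<^bsub>L.H\<^esub> g')"
      if "g \<in> carrier L.H" "g' \<in> carrier L.H" "g \<in> L.comp_alg \<and> compatible f g" "g' \<in> L.comp_alg \<and> compatible f g'" for g g'
      using that sub(1)[of g g'] L.product_value_add(2)[OF that(1,2) LH[OF f] pull_Er]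
        R.product_value_add(2)[OF RH RH RH[OF f], of g g']
      by (simp add: compatible_def Qm_add)
    show "a \<odot>\<^bsub>L.H\<^esub> g \<in> L.comp_alg \<and> compatible f (a \<odot>\<^bsub>L.H\<^esub> g)"
      if "a \<in> carrier A" "g \<in> carrier L.H" "g \<in> L.comp_alg \<and> compatible f g" for a g
      using that sub(2)[of a g] L.product_value_smult(2)[OF that(1,2) LH[OF f] pull_Er]
        R.product_value_smult(2)[OF that(1) RH RH[OF f], of g]
      by (simp add: compatible_def Qm_smult)
  qed
  then show ?thesis by simp
qed

lemma Qm_ring_hom:
  "(Qm :: ('i, 'a, 'k, 'r) hall \<Rightarrow> _) \<in> ring_hom (composition_algebra D q A e) (composition_algebra D (q ^ l) A e')"
proof (rule ring_hom_memI)
  show "Qm f \<in> carrier (composition_algebra D (q ^ l) A e')"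
    if "f \<in> carrier (composition_algebra D q A e)" for f :: "('i, 'a, 'k, 'r) hall"
    using Qm_comp_alg[of f] that by (simp add: L.composition_algebra_eq R.composition_algebra_eq)
next
  fix f g :: "('i, 'a, 'k, 'r) hall"
  assume "f \<in> carrier (composition_algebra D q A e)" "g \<in> carrier (composition_algebra D q A e)"
  then have fg: "f \<in> L.comp_alg" "g \<in> L.comp_alg" by (simp_all add: L.composition_algebra_eq)
  then have c: "f \<in> carrier L.H" "g \<in> carrier L.H" using L.comp_alg_H by blast+
  show "Qm (f \<otimes>\<^bsub>composition_algebra D q A e\<^esub> g)
      = Qm f \<otimes>\<^bsub>composition_algebra D (q ^ l) A e'\<^esub> Qm g"
    using compatible_iff[OF fg] compatible_comp_alg[OF fg]
    by (simp add: L.composition_algebra_eq R.composition_algebra_eq)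
  show "Qm (f \<oplus>\<^bsub>composition_algebra D q A e\<^esub> g)
      = Qm f \<oplus>\<^bsub>composition_algebra D (q ^ l) A e'\<^esub> Qm g"
    using Qm_add[OF c] by (simp add: L.composition_algebra_eq R.composition_algebra_eq)
next
  show "Qm \<one>\<^bsub>composition_algebra D q A e\<^esub> = \<one>\<^bsub>composition_algebra D (q ^ l) A e'\<^esub>"
    using Qm_one by (simp add: L.composition_algebra_eq R.composition_algebra_eq)
qed

lemma Qm_smult_comp:
  fixes f :: "('i, 'a, 'k, 'r) hall"
  shows "Qm (a \<odot>\<^bsub>composition_algebra D q A e\<^esub> f) = a \<odot>\<^bsub>composition_algebra D (q ^ l) A e'\<^esub> Qm f"
  using Qm_smult by (simp add: L.composition_algebra_eq R.composition_algebra_eq)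

end

section \<open>The coefficient ring\<close>

lemma laurent_ring_eq: "laurent_ring \<epsilon> = subring_of (laurent \<epsilon>)"
  by (simp add: laurent_ring_def laurent_def)

lemma cring_laurent_ring: "cring (laurent_ring \<epsilon>)"
  unfolding laurent_ring_eq
proof (intro cringI abelian_groupI comm_monoidI)
  fix x assume "x \<in> carrier (subring_of (laurent \<epsilon>))"
  then show "\<exists>y\<in>carrier (subring_of (laurent \<epsilon>)). y \<oplus>\<^bsub>subring_of (laurent \<epsilon>)\<^esub> x = \<zero>\<^bsub>subring_of (laurent \<epsilon>)\<^esub>"
    using laurent_uminus[of x \<epsilon>] by (simp add: bexI[of _ "- x"])
qed (simp_all add: laurent_0 laurent_1 laurent_add laurent_mult algebra_simps)

lemma coeff_ideal_eq:
  "coeff_ideal l \<epsilon> = {poly (cyclotomic_poly (2 * l)) \<epsilon> * r | r. r \<in> laurent \<epsilon>}"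
  unfolding coeff_ideal_def laurent_ring_eq cgenideal_def by (auto simp: mult.commute)

text \<open>Integrality of the cyclotomic polynomial puts the generator of the ideal into the
  ring.\<close>

lemma cyclotomic_laurent: "l > 0 \<Longrightarrow> poly (cyclotomic_poly (2 * l)) \<epsilon> \<in> laurent \<epsilon>"
  by (rule laurent_poly[OF int_coeffs_cyclotomic]) simp

lemma ideal_coeff_ideal: "l > 0 \<Longrightarrow> ideal (coeff_ideal l \<epsilon>) (laurent_ring \<epsilon>)"
  unfolding coeff_ideal_def
  by (rule cring.cgenideal_ideal[OF cring_laurent_ring]) (simp add: laurent_ring_eq cyclotomic_laurent)

context
  fixes l :: nat and \<epsilon> :: complex
  assumes l: "l > 0"
begin

interpretation I: ideal "coeff_ideal l \<epsilon>" "laurent_ring \<epsilon>" by (rule ideal_coeff_ideal[OF l])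

lemma cring_coeff_ring: "cring (coeff_ring l \<epsilon>)"
  unfolding coeff_ring_def by (rule I.quotient_is_cring[OF cring_laurent_ring])

lemma coeff_class_hom: "coeff_class l \<epsilon> \<in> ring_hom (laurent_ring \<epsilon>) (coeff_ring l \<epsilon>)"
proof -
  have "coeff_class l \<epsilon> = (+>\<^bsub>laurent_ring \<epsilon>\<^esub>) (coeff_ideal l \<epsilon>)"
    by (simp add: coeff_class_def fun_eq_iff)
  then show ?thesis unfolding coeff_ring_def using I.rcos_ring_hom by simp
qed

lemma coeff_class_mult: "a \<in> laurent \<epsilon> \<Longrightarrow> b \<in> laurent \<epsilon> \<Longrightarrow>
    coeff_class l \<epsilon> (a * b) = coeff_class l \<epsilon> a \<otimes>\<^bsub>coeff_ring l \<epsilon>\<^esub> coeff_class l \<epsilon> b"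
  using ring_hom_mult[OF coeff_class_hom, of a b] by (simp add: laurent_ring_eq)

lemma coeff_class_add: "a \<in> laurent \<epsilon> \<Longrightarrow> b \<in> laurent \<epsilon> \<Longrightarrow>
    coeff_class l \<epsilon> (a + b) = coeff_class l \<epsilon> a \<oplus>\<^bsub>coeff_ring l \<epsilon>\<^esub> coeff_class l \<epsilon> b"
  using ring_hom_add[OF coeff_class_hom, of a b] by (simp add: laurent_ring_eq)

lemma coeff_class_one: "coeff_class l \<epsilon> 1 = \<one>\<^bsub>coeff_ring l \<epsilon>\<^esub>"
  using ring_hom_one[OF coeff_class_hom] by (simp add: laurent_ring_eq)

lemma coeff_class_closed: "a \<in> laurent \<epsilon> \<Longrightarrow> coeff_class l \<epsilon> a \<in> carrier (coeff_ring l \<epsilon>)"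
  using ring_hom_closed[OF coeff_class_hom, of a] by (simp add: laurent_ring_eq)

lemma coeff_class_eqI:
  assumes "a \<in> laurent \<epsilon>" "b \<in> laurent \<epsilon>" "a - b \<in> coeff_ideal l \<epsilon>"
  shows "coeff_class l \<epsilon> a = coeff_class l \<epsilon> b"
proof -
  have "a = (a - b) + b" by simp
  then have "a \<in> coeff_ideal l \<epsilon> +>\<^bsub>laurent_ring \<epsilon>\<^esub> b"
    using assms(3) unfolding a_r_coset_def' by (force simp: laurent_ring_eq)
  then show ?thesis
    unfolding coeff_class_def using I.a_repr_independence'[of a b] assms by (simp add: laurent_ring_eq)
qed

lemma coeff_class_power: "a \<in> laurent \<epsilon> \<Longrightarrow> coeff_class l \<epsilon> (a ^ n) = coeff_class l \<epsilon> a [^]\<^bsub>coeff_ring l \<epsilon>\<^esub> n"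
proof (induction n)
  case (Suc n)
  then show ?case
    using coeff_class_mult[OF Suc.prems laurent_power[OF Suc.prems, of n]]
      comm_monoid.m_comm[OF cring.axioms(2)[OF cring_coeff_ring] coeff_class_closed[OF Suc.prems]
        coeff_class_closed[OF laurent_power[OF Suc.prems, of n]]]
    by simp
qed (simp add: coeff_class_one)

text \<open>Counts enter the algebra as multiples of the unit; seen as residue classes of integers
  they can be compared modulo the ideal.\<close>

lemma coeff_class_of_nat: "[(n :: nat)] \<cdot>\<^bsub>coeff_ring l \<epsilon>\<^esub> \<one>\<^bsub>coeff_ring l \<epsilon>\<^esub> = coeff_class l \<epsilon> (of_nat n)"
proof -
  interpret A: cring "coeff_ring l \<epsilon>" by (rule cring_coeff_ring)
  show ?thesis
  proof (induction n)
    case 0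
    have "coeff_class l \<epsilon> 0 = coeff_class l \<epsilon> 0 \<oplus>\<^bsub>coeff_ring l \<epsilon>\<^esub> coeff_class l \<epsilon> 0"
      using coeff_class_add[OF laurent_0 laurent_0] by simp
    then have "coeff_class l \<epsilon> 0 = \<zero>\<^bsub>coeff_ring l \<epsilon>\<^esub>"
      using A.add.r_cancel_one'[OF coeff_class_closed[OF laurent_0] coeff_class_closed[OF laurent_0]] by blast
    then show ?case by simp
  next
    case (Suc n)
    have "coeff_class l \<epsilon> (of_nat n + 1) = coeff_class l \<epsilon> (of_nat n) \<oplus>\<^bsub>coeff_ring l \<epsilon>\<^esub> \<one>\<^bsub>coeff_ring l \<epsilon>\<^esub>"
      using coeff_class_add[OF laurent_of_nat laurent_1] by (simp add: coeff_class_one)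
    then show ?case using Suc.IH by (simp add: add.commute)
  qed
qed

lemma coeff_class_unit:
  assumes "\<epsilon> \<noteq> 0"
  shows "coeff_class l \<epsilon> \<epsilon> \<in> Units (coeff_ring l \<epsilon>)"
proof -
  interpret A: cring "coeff_ring l \<epsilon>" by (rule cring_coeff_ring)
  note g = laurent_gen[of \<epsilon>]
  have "coeff_class l \<epsilon> (inverse \<epsilon>) \<otimes>\<^bsub>coeff_ring l \<epsilon>\<^esub> coeff_class l \<epsilon> \<epsilon> = \<one>\<^bsub>coeff_ring l \<epsilon>\<^esub>"
    using coeff_class_mult[OF g(2,1)] assms by (simp add: coeff_class_one)
  then show ?thesis
    using A.m_comm[OF coeff_class_closed[OF g(1)] coeff_class_closed[OF g(2)]]
      coeff_class_closed[OF g(1)] coeff_class_closed[OF g(2)] by (auto simp: Units_def)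
qed

text \<open>In the coefficient ring \<open>\<epsilon>^l = -1\<close>, so both sides equal \<open>(-1)^l\<close>.\<close>

lemma coeff_class_twist:
  "coeff_class l \<epsilon> ((-1) ^ (l + 1) * \<epsilon> ^ l) = coeff_class l \<epsilon> \<epsilon> [^]\<^bsub>coeff_ring l \<epsilon>\<^esub> (l * l)"
proof -
  note g = laurent_gen(1)[of \<epsilon>]
  define x where "x = \<epsilon> ^ l"
  have x: "x \<in> laurent \<epsilon>" unfolding x_def by (rule laurent_power[OF g])
  have m1: "- 1 \<in> laurent \<epsilon>" by (rule laurent_uminus[OF laurent_1])
  obtain r where r: "r \<in> laurent \<epsilon>" "x + 1 = poly (cyclotomic_poly (2 * l)) \<epsilon> * r"
    unfolding x_def by (rule power_plus_1_cyclotomic[OF l])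
  \<comment> \<open>The cofactor of x + 1 in x^l - (-1)^l. As x + 1 lies in the ideal, so do its
    multiples by elements of the ring.\<close>
  define s where "s = (\<Sum>i<l. (- 1) ^ (l - Suc i) * x ^ i)"
  have s: "s \<in> laurent \<epsilon>"
    unfolding s_def by (intro laurent_sum laurent_mult laurent_power x m1)
  have "x ^ l - (- 1) ^ l = (x + 1) * s"
    unfolding s_def using power_diff_sumr2[of x l "- 1"] by simp
  \<comment> \<open>Here (-1)^{l+1} x = (-1)^{l+1} (x + 1) + (-1)^l, so subtracting x^l leaves a
    multiple of x + 1.\<close>
  then have "(- 1) ^ (l + 1) * x - x ^ l = (x + 1) * ((- 1) ^ (l + 1) - s)"
    by (simp add: algebra_simps)
  also have "\<dots> = poly (cyclotomic_poly (2 * l)) \<epsilon> * (r * ((- 1) ^ (l + 1) - s))"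
    unfolding r(2) by (simp add: mult.assoc)
  finally have "(- 1) ^ (l + 1) * x - x ^ l \<in> coeff_ideal l \<epsilon>"
    unfolding coeff_ideal_eq
    using laurent_mult[OF r(1) laurent_add[OF laurent_power[OF m1, of "l + 1"] laurent_uminus[OF s]]] by auto
  then have "coeff_class l \<epsilon> ((- 1) ^ (l + 1) * x) = coeff_class l \<epsilon> (x ^ l)"
    by (intro coeff_class_eqI laurent_mult laurent_power m1 x)
  also have "x ^ l = \<epsilon> ^ (l * l)" by (simp add: x_def power_mult)
  finally show ?thesis using coeff_class_power[OF g, of "l * l"] by (simp add: x_def)
qed

end

theorem theorem5p5:
  fixes D :: "('i, 'a) quiver" and p q l n :: nat and \<epsilon> :: complex
    and F Fsharp :: "(complex set, ('i, 'a, 'k::alg_closed_field, complex set) hall) module"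
  assumes "quiver_datum D"
    and "l > 0" and "\<forall>i\<in>vertices D. coprime l (vdeg D i)"
    and "prime p" and "\<not> p dvd l"
    and "is_closure_of_prime_field TYPE('k) p"
    and "n > 0" and "q = p ^ n"
    and "\<epsilon> ^ 2 = of_nat q"
  defines "F \<equiv> composition_algebra D q (coeff_ring l \<epsilon>) (coeff_class l \<epsilon> \<epsilon>)"
    and "Fsharp \<equiv> composition_algebra D (q ^ l) (coeff_ring l \<epsilon>)
                     (coeff_class l \<epsilon> ((-1) ^ (l + 1) * \<epsilon> ^ l))"
  shows "Q_map D q l ` carrier F \<subseteq> carrier Fsharp
    \<and> Q_map D q l \<in> ring_hom F Fsharp
    \<and> (\<forall>a\<in>carrier (coeff_ring l \<epsilon>). \<forall>f\<in>carrier F.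
         Q_map D q l (a \<odot>\<^bsub>F\<^esub> f) = a \<odot>\<^bsub>Fsharp\<^esub> Q_map D q l f)"
proof -
  let ?A = "coeff_ring l \<epsilon>" and ?e = "coeff_class l \<epsilon> \<epsilon>"
  note l = assms(2)
  have char: "char_power TYPE('k) q"
    using assms(6-8) by (auto simp: char_power_def is_closure_of_prime_field_def)
  have q1: "q > 1" by (rule char_power_gt_1[OF char])
  have "\<epsilon> \<noteq> 0" using assms(9) q1 by auto
  interpret A: cring ?A by (rule cring_coeff_ring[OF l])
  \<comment> \<open>The abstract set \<open>J\<close> becomes the ideal generated by
    Phi_{2l}(\<epsilon>), and \<open>e'\<close> the class of the chosen square root of q^l.\<close>
  have hall_restriction: "hall_restriction D q (TYPE('k)) l ?A ?e
      (coeff_class l \<epsilon> ((-1) ^ (l + 1) * \<epsilon> ^ l)) (coeff_ideal l \<epsilon>)"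
  proof (intro hall_restriction.intro hall_restriction_axioms.intro quiver_rep_ext.intro
      quiver_rep_ext_axioms.intro quiver_rep.intro)
    show "?e \<in> Units ?A" by (rule coeff_class_unit[OF l \<open>\<epsilon> \<noteq> 0\<close>])
    show "coeff_class l \<epsilon> ((-1) ^ (l + 1) * \<epsilon> ^ l) = ?e [^]\<^bsub>?A\<^esub> (l * l)"
      by (rule coeff_class_twist[OF l])
    show "0 \<in> coeff_ideal l \<epsilon>" using laurent_0 by (force simp: coeff_ideal_eq)
    show "a + b \<in> coeff_ideal l \<epsilon>" if "a \<in> coeff_ideal l \<epsilon>" "b \<in> coeff_ideal l \<epsilon>" for a b
      using that laurent_add by (auto simp: coeff_ideal_eq simp flip: distrib_left)
    show "a * of_nat m \<in> coeff_ideal l \<epsilon>" if "a \<in> coeff_ideal l \<epsilon>" for a m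
      using that laurent_mult[OF _ laurent_of_nat] by (auto simp: coeff_ideal_eq mult.assoc)
    show "of_nat m \<in> coeff_ideal l \<epsilon>"
      if "f dvd l" "0 < f" "f < l" "m * (q ^ f - 1) = q ^ l - 1" for f m
      by (rule orbit_size_cyclotomic[OF that(1-3) assms(9) q1 that(4)]) (auto simp: coeff_ideal_eq)
    show "[a] \<cdot>\<^bsub>?A\<^esub> \<one>\<^bsub>?A\<^esub> = [b] \<cdot>\<^bsub>?A\<^esub> \<one>\<^bsub>?A\<^esub>" if "of_nat a - of_nat b \<in> coeff_ideal l \<epsilon>" for a b :: nat
      unfolding coeff_class_of_nat[OF l] by (rule coeff_class_eqI[OF l laurent_of_nat laurent_of_nat that])
  qed (use assms(1-3) char A.is_cring in simp_all)
  interpret hall_restriction D q "TYPE('k)" l ?A ?e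
      "coeff_class l \<epsilon> ((-1) ^ (l + 1) * \<epsilon> ^ l)" "coeff_ideal l \<epsilon>"
    by (rule hall_restriction)
  have hom: "Q_map D q l \<in> ring_hom F Fsharp" unfolding F_def Fsharp_def by (rule Qm_ring_hom)
  moreover have "Q_map D q l ` carrier F \<subseteq> carrier Fsharp" using ring_hom_closed[OF hom] by blast
  ultimately show ?thesis using Qm_smult_comp by (simp add: F_def Fsharp_def)
qed

end
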